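(* Let $q\in(1,\infty)$. For each $i\in\mathbb N=\{0,1,2,\dots\}$ let $Y_1^i\hookrightarrow Y_0^i$ be a continuously and densely injected complex Banach couple such that, with continuous and dense injections, $$Y_0^{i+1}\hookrightarrow Y_0^i,\qquad Y_1^{i+1}\hookrightarrow Y_1^i,\qquad Y_1^i\hookrightarrow(Y_1^{i+1},Y_0^{i+1})_{\frac1q,q}.$$ Consider the problem $$u'(t)+A(u(t))u(t)=F(u(t),t),\quad t>0,\qquad u(0)=u_0, \tag{P}$$ where $u_0\in Z$ and $Z$ is a subset of $(Y_1^0,Y_0^0)_{\frac1q,q}$. Assume: (i) There exist a $T>0$ and a unique $$u\in W^{1,q}(0,T;Y_0^0)\cap L^q(0,T;Y_1^0)\hookrightarrow C([0,T];(Y_1^0,Y_0^0)_{\frac1q,q})$$ solving (P) on $(0,T)$, such that $u(t)\in Z$ for all $t\in[0,T]$. Moreover, $A(u(t)):Y_1^0\to Y_0^0$ has maximal $L^q$-regularity for each $t\in[0,T]$ and $A(u(\cdot))\in C([0,T];\mathcal L(Y_1^0,Y_0^0))$. (ii) For each $i\in\mathbb N$ and each $v\in Z\cap(Y_1^i,Y_0^i)_{\frac1q,q}$, $A(v):Y_1^{i+1}\to Y_0^{i+1}$ has maximal $L^q$-regularity. Furthermore, $A(v(\cdot))\in C([0,T];\mathcal L(Y_1^{i+1},Y_0^{i+1}))$ for each $v\in C([0,T];Z\cap(Y_1^i,Y_0^i)_{\frac1q,q})$. (iii) For all $i\in\mathbb N$, $t\mapsto F(v(t),t)$ belongs to $L^q(0,T;Y_0^{i+1})$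 for all $v\in C([0,T];Z\cap(Y_1^i,Y_0^i)_{\frac1q,q})$. Then, for each $\varepsilon\in(0,T)$, $$u\in\bigcap_{i\in\mathbb N}W^{1,q}(\varepsilon,T;Y_0^i)\cap L^q(\varepsilon,T;Y_1^i).$$
   Context: $(X_1,X_0)_{\frac1q,q}$ denotes the real interpolation space, equal to $(X_0,X_1)_{1-\frac1q,q}$. Maximal $L^q$-regularity: for a densely injected Banach couple $X_1\hookrightarrow X_0$ and $A\in\mathcal L(X_1,X_0)$ such that $-A$ (with domain $X_1$) generates an analytic semigroup on $X_0$, $A$ has maximal $L^q$-regularity if for ($T>0$ and) every $f\in L^q(0,T;X_0)$ there is a unique $u\in W^{1,q}(0,T;X_0)\cap L^q(0,T;X_1)$ with $u'(t)+Au(t)=f(t)$ for a.e. $t\in(0,T)$ and $u(0)=0$. For $v\in Z$, $A(v)$ is a linear operator from $Y_1^0$ to $Y_0^0$; statements about $A(v):Y_1^{i+1}\to Y_0^{i+1}$ refer to its restriction to $Y_1^{i+1}$. $C([0,T];Z\cap(Y_1^i,Y_0^i)_{\frac1q,q})$ denotes continuous functions on $[0,T]$ with values in $(Y_1^i,Y_0^i)_{\frac1q,q}$ whose values lie in $Z$. *)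

theory Defs
  imports "HOL-Analysis.Analysis"
begin

text \<open>
  A Banach scale is a family of spaces whose number is infinite, so the spaces cannot each have a
  type of their own.  Since every injection of the scale eventually leads into the largest space,
  all spaces are realised as linear subspaces of one complex vector space \<open>'a\<close> (for instance
  the largest space itself), each with its own norm; the injections are then inclusions.
\<close>

class complex_vector = real_vector +
  fixes scaleC :: "complex \<Rightarrow> 'a \<Rightarrow> 'a" (infixr "*\<^sub>C" 75)
  assumes scaleC_add_right: "c *\<^sub>C (x + y) = c *\<^sub>C x + c *\<^sub>C y"
    and scaleC_add_left: "(c + d) *\<^sub>C x = c *\<^sub>C x + d *\<^sub>C x"
    and scaleC_scaleC: "c *\<^sub>C (d *\<^sub>C x) = (c * d) *\<^sub>C x"
    and scaleC_one: "1 *\<^sub>C x = x"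
    and scaleR_scaleC: "r *\<^sub>R x = complex_of_real r *\<^sub>C x"

instantiation complex :: complex_vector
begin
definition scaleC_complex :: "complex \<Rightarrow> complex \<Rightarrow> complex"
  where "scaleC_complex c x = c * x"
instance
  by standard (auto simp: scaleC_complex_def algebra_simps scaleR_conv_of_real)
end

text \<open>The values of \<open>nrm X\<close> outside \<open>carr X\<close> are irrelevant.\<close>

record 'a nspace =
  carr :: "'a set"
  nrm :: "'a \<Rightarrow> real"

text \<open>The locale \<open>Metric_space\<close> asks for symmetry and nonnegativity on the whole type,
  hence the value 0 outside the carrier.\<close>

definition ndist :: "'a::complex_vector nspace \<Rightarrow> 'a \<Rightarrow> 'a \<Rightarrow> real" where
  "ndist X x y = (if x \<in> carr X \<and> y \<in> carr X then nrm X (x - y) else 0)"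

definition ntop :: "'a::complex_vector nspace \<Rightarrow> 'a topology" where
  "ntop X = Metric_space.mtopology (carr X) (ndist X)"

definition complex_banach :: "'a::complex_vector nspace \<Rightarrow> bool" where
  "complex_banach X \<longleftrightarrow>
     0 \<in> carr X \<and>
     (\<forall>x\<in>carr X. \<forall>y\<in>carr X. x + y \<in> carr X) \<and>
     (\<forall>c. \<forall>x\<in>carr X. c *\<^sub>C x \<in> carr X) \<and>
     (\<forall>x\<in>carr X. 0 \<le> nrm X x \<and> (nrm X x = 0 \<longleftrightarrow> x = 0)) \<and>
     (\<forall>c. \<forall>x\<in>carr X. nrm X (c *\<^sub>C x) = cmod c * nrm X x) \<and>
     (\<forall>x\<in>carr X. \<forall>y\<in>carr X. nrm X (x + y) \<le> nrm X x + nrm X y) \<and>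
     Metric_space.mcomplete (carr X) (ndist X)"

definition dense_inj :: "'a::complex_vector nspace \<Rightarrow> 'a nspace \<Rightarrow> bool" where
  "dense_inj X Y \<longleftrightarrow>
     carr X \<subseteq> carr Y \<and>
     (\<exists>C. \<forall>x\<in>carr X. nrm Y x \<le> C * nrm X x) \<and>
     ntop Y closure_of carr X = carr Y"


subsection \<open>Operators\<close>

definition linear_op :: "'a::complex_vector nspace \<Rightarrow> 'a nspace \<Rightarrow> ('a \<Rightarrow> 'a) \<Rightarrow> bool" where
  "linear_op X Y B \<longleftrightarrow>
     (\<forall>x\<in>carr X. B x \<in> carr Y) \<and>
     (\<forall>x\<in>carr X. \<forall>y\<in>carr X. B (x + y) = B x + B y) \<and>
     (\<forall>c. \<forall>x\<in>carr X. B (c *\<^sub>C x) = c *\<^sub>C B x)"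

definition bounded_op :: "'a::complex_vector nspace \<Rightarrow> 'a nspace \<Rightarrow> ('a \<Rightarrow> 'a) \<Rightarrow> bool" where
  "bounded_op X Y B \<longleftrightarrow>
     linear_op X Y B \<and> (\<exists>C. \<forall>x\<in>carr X. nrm Y (B x) \<le> C * nrm X x)"

definition opnorm :: "'a::complex_vector nspace \<Rightarrow> 'a nspace \<Rightarrow> ('a \<Rightarrow> 'a) \<Rightarrow> real" where
  "opnorm X Y B = Inf {C. 0 \<le> C \<and> (\<forall>x\<in>carr X. nrm Y (B x) \<le> C * nrm X x)}"

text \<open>Operators on \<open>X\<close> are represented by functions on the whole type, of which only the
  restriction to \<open>carr X\<close> matters; the next definition describes \<open>C([a,b]; L(X,Y))\<close>.\<close>

definition op_continuous_on ::
    "real \<Rightarrow> real \<Rightarrow> 'a::complex_vector nspace \<Rightarrow> 'a nspace \<Rightarrow> (real \<Rightarrow> 'a \<Rightarrow> 'a) \<Rightarrow> bool" where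
  "op_continuous_on a b X Y B \<longleftrightarrow>
     (\<forall>t\<in>{a..b}. bounded_op X Y (B t)) \<and>
     (\<forall>t\<in>{a..b}. ((\<lambda>s. opnorm X Y (\<lambda>x. B s x - B t x)) \<longlongrightarrow> 0) (at t within {a..b}))"

definition sector :: "real \<Rightarrow> complex set" where
  "sector \<delta> = {z. z \<noteq> 0 \<and> \<bar>Arg z\<bar> < \<delta>}"

definition generates_analytic_semigroup ::
    "'a::complex_vector nspace \<Rightarrow> 'a set \<Rightarrow> ('a \<Rightarrow> 'a) \<Rightarrow> bool" where
  "generates_analytic_semigroup X D G \<longleftrightarrow>
     (\<exists>\<delta> S. 0 < \<delta> \<and> \<delta> \<le> pi / 2 \<and>
       (\<forall>z\<in>insert 0 (sector \<delta>). bounded_op X X (S z)) \<and>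
       (\<forall>x\<in>carr X. S 0 x = x) \<and>
       (\<forall>z\<in>sector \<delta>. \<forall>w\<in>sector \<delta>. \<forall>x\<in>carr X. S (z + w) x = S z (S w x)) \<and>
       (\<forall>z\<in>sector \<delta>. \<exists>L. bounded_op X X L \<and>
          ((\<lambda>w. opnorm X X (\<lambda>x. (1 / (w - z)) *\<^sub>C (S w x - S z x) - L x)) \<longlongrightarrow> 0) (at z)) \<and>
       (\<forall>\<eta>. 0 < \<eta> \<and> \<eta> < \<delta> \<longrightarrow>
          (\<forall>x\<in>carr X. ((\<lambda>z. nrm X (S z x - x)) \<longlongrightarrow> 0) (at 0 within sector \<eta>))) \<and>
       D = {x\<in>carr X. \<exists>y\<in>carr X.
              ((\<lambda>t. nrm X ((1 / t) *\<^sub>R (S (complex_of_real t) x - x) - y)) \<longlongrightarrow> 0) (at_right 0)} \<and>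
       (\<forall>x\<in>D. G x \<in> carr X \<and>
          ((\<lambda>t. nrm X ((1 / t) *\<^sub>R (S (complex_of_real t) x - x) - G x)) \<longlongrightarrow> 0) (at_right 0)))"


subsection \<open>Real interpolation (K-method)\<close>

definition K_functional ::
    "'a::complex_vector nspace \<Rightarrow> 'a nspace \<Rightarrow> real \<Rightarrow> 'a \<Rightarrow> real" where
  "K_functional E0 E1 t x =
     Inf {nrm E0 a + t * nrm E1 b |a b. a \<in> carr E0 \<and> b \<in> carr E1 \<and> x = a + b}"

definition interp_integral ::
    "'a::complex_vector nspace \<Rightarrow> 'a nspace \<Rightarrow> real \<Rightarrow> real \<Rightarrow> 'a \<Rightarrow> ennreal" where
  "interp_integral E0 E1 \<theta> p x =
     (\<integral>\<^sup>+ t\<in>{0<..}. ennreal ((t powr (- \<theta>) * K_functional E0 E1 t x) powr p / t) \<partial>lborel)"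

definition real_interp ::
    "'a::complex_vector nspace \<Rightarrow> 'a nspace \<Rightarrow> real \<Rightarrow> real \<Rightarrow> 'a nspace" where
  "real_interp E0 E1 \<theta> p =
     \<lparr>carr = {a + b |a b. a \<in> carr E0 \<and> b \<in> carr E1} \<inter> {x. interp_integral E0 E1 \<theta> p x < \<infinity>},
      nrm = (\<lambda>x. enn2real (interp_integral E0 E1 \<theta> p x) powr (1 / p))\<rparr>"


text \<open>\<open>(X1, X0)\<close> with parameters \<open>1/q, q\<close>, which equals \<open>(X0, X1)\<close> with parameters
  \<open>1 - 1/q, q\<close>.\<close>

definition trace_space ::
    "real \<Rightarrow> 'a::complex_vector nspace \<Rightarrow> 'a nspace \<Rightarrow> 'a nspace" where
  "trace_space q X1 X0 = real_interp X1 X0 (1 / q) q"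


subsection \<open>Bochner-Lebesgue and Bochner-Sobolev spaces\<close>

text \<open>The library's Bochner integral uses the norm of the type, whereas here measurability and
  integrals refer to the norm of a subspace; strong measurability is approximability almost
  everywhere by simple functions.  Elements of the function spaces are functions of which only the
  almost-everywhere class on the interval matters.\<close>

definition simple_fun :: "'a::complex_vector nspace \<Rightarrow> real set \<Rightarrow> (real \<Rightarrow> 'a) \<Rightarrow> bool" where
  "simple_fun X I s \<longleftrightarrow> Bochner_Integration.simple_bochner_integrable (lebesgue_on I) s \<and> s ` I \<subseteq> carr X"

definition strongly_measurable ::
    "'a::complex_vector nspace \<Rightarrow> real set \<Rightarrow> (real \<Rightarrow> 'a) \<Rightarrow> bool" where
  "strongly_measurable X I f \<longleftrightarrow>
     (\<exists>s. (\<forall>n. simple_fun X I (s n)) \<and>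
          (AE t in lebesgue_on I. f t \<in> carr X \<and> (\<lambda>n. nrm X (s n t - f t)) \<longlonglongrightarrow> 0))"

definition has_bochner_integral_in ::
    "'a::complex_vector nspace \<Rightarrow> real set \<Rightarrow> (real \<Rightarrow> 'a) \<Rightarrow> 'a \<Rightarrow> bool" where
  "has_bochner_integral_in X I f x \<longleftrightarrow>
     strongly_measurable X I f \<and>
     (\<exists>s. (\<forall>n. simple_fun X I (s n)) \<and>
          (\<lambda>n. \<integral>\<^sup>+ t. ennreal (nrm X (s n t - f t)) \<partial>lebesgue_on I) \<longlonglongrightarrow> 0 \<and>
          limitin (ntop X) (\<lambda>n. Bochner_Integration.simple_bochner_integral (lebesgue_on I) (s n)) x sequentially)"

definition Lq :: "real \<Rightarrow> real \<Rightarrow> real \<Rightarrow> 'a::complex_vector nspace \<Rightarrow> (real \<Rightarrow> 'a) set" where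
  "Lq q a b X = {f. strongly_measurable X {a<..<b} f \<and>
     (\<integral>\<^sup>+ t. ennreal (nrm X (f t) powr q) \<partial>lebesgue_on {a<..<b}) < \<infinity>}"

definition test_function :: "real \<Rightarrow> real \<Rightarrow> (real \<Rightarrow> real) \<Rightarrow> bool" where
  "test_function a b \<phi> \<longleftrightarrow>
     (\<forall>n t. ((deriv ^^ n) \<phi>) field_differentiable (at t)) \<and>
     (\<exists>c d. a < c \<and> d < b \<and> (\<forall>t. t \<notin> {c..d} \<longrightarrow> \<phi> t = 0))"

definition weak_deriv ::
    "real \<Rightarrow> real \<Rightarrow> 'a::complex_vector nspace \<Rightarrow> (real \<Rightarrow> 'a) \<Rightarrow> (real \<Rightarrow> 'a) \<Rightarrow> bool" where
  "weak_deriv a b X u u' \<longleftrightarrow>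
     (\<forall>\<phi>. test_function a b \<phi> \<longrightarrow>
       (\<exists>x. has_bochner_integral_in X {a<..<b} (\<lambda>t. deriv \<phi> t *\<^sub>R u t) x \<and>
            has_bochner_integral_in X {a<..<b} (\<lambda>t. \<phi> t *\<^sub>R u' t) (- x)))"

definition W1q :: "real \<Rightarrow> real \<Rightarrow> real \<Rightarrow> 'a::complex_vector nspace \<Rightarrow> (real \<Rightarrow> 'a) set" where
  "W1q q a b X = {u \<in> Lq q a b X. \<exists>u'\<in>Lq q a b X. weak_deriv a b X u u'}"


subsection \<open>Abstract Cauchy problems and maximal regularity\<close>

text \<open>\<open>u\<close> solves \<open>u' + B(t) u = f\<close> on \<open>(0,T)\<close>, \<open>u(0) = u0\<close>.  So that pointwise values make
  sense, \<open>u\<close> is required to be the continuous representative on \<open>[0,T]\<close> of its class in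
  \<open>W\<^sup>1\<^sup>,\<^sup>q(0,T;X0)\<close>.\<close>

definition strong_solution ::
    "real \<Rightarrow> real \<Rightarrow> 'a::complex_vector nspace \<Rightarrow> 'a nspace \<Rightarrow>
     (real \<Rightarrow> 'a \<Rightarrow> 'a) \<Rightarrow> (real \<Rightarrow> 'a) \<Rightarrow> 'a \<Rightarrow> (real \<Rightarrow> 'a) \<Rightarrow> bool" where
  "strong_solution q T X1 X0 B f u0 u \<longleftrightarrow>
     u \<in> W1q q 0 T X0 \<inter> Lq q 0 T X1 \<and>
     continuous_map (top_of_set {0..T}) (ntop X0) u \<and>
     (\<exists>u'\<in>Lq q 0 T X0. weak_deriv 0 T X0 u u' \<and>
        (AE t in lebesgue_on {0<..<T}. u' t + B t (u t) = f t)) \<and>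
     u 0 = u0"

text \<open>Under the generation hypothesis the property does not depend on the length \<open>\<tau>\<close> of the
  interval; it is stated for some \<open>\<tau>\<close>, which is formally the weakest form.\<close>

definition maximal_regularity ::
    "real \<Rightarrow> 'a::complex_vector nspace \<Rightarrow> 'a nspace \<Rightarrow> ('a \<Rightarrow> 'a) \<Rightarrow> bool" where
  "maximal_regularity q X1 X0 A \<longleftrightarrow>
     bounded_op X1 X0 A \<and>
     generates_analytic_semigroup X0 (carr X1) (\<lambda>x. - A x) \<and>
     (\<exists>\<tau>>0. \<forall>f\<in>Lq q 0 \<tau> X0.
        (\<exists>u. strong_solution q \<tau> X1 X0 (\<lambda>_. A) f 0 u) \<and>
        (\<forall>u v. strong_solution q \<tau> X1 X0 (\<lambda>_. A) f 0 u \<longrightarrow>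
               strong_solution q \<tau> X1 X0 (\<lambda>_. A) f 0 v \<longrightarrow> (\<forall>t\<in>{0..\<tau>}. u t = v t)))"

text \<open>Continuous functions on \<open>[a,b]\<close> with values in \<open>X\<close> that lie in \<open>Z\<close>.\<close>

definition cont_into :: "real \<Rightarrow> real \<Rightarrow> 'a set \<Rightarrow> 'a::complex_vector nspace \<Rightarrow> (real \<Rightarrow> 'a) set" where
  "cont_into a b Z X = {v. continuous_map (top_of_set {a..b}) (ntop X) v \<and> v ` {a..b} \<subseteq> Z}"

end

theory Submission
  imports Defs
begin

text \<open>
  Let \<open>v\<close> be the derivative of \<open>u\<close>.  By induction on \<open>i\<close>, \<open>u\<close> and \<open>v\<close> lie in \<open>L\<^sup>q(\<epsilon>,T)\<close> with
  values in \<open>Y1 i\<close> and \<open>Y0 i\<close>.  Given this on \<open>(\<epsilon>/2,T)\<close>, the trace embedding makes \<open>u\<close> continuous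
  on \<open>[\<epsilon>/2,T]\<close> into the trace space of level \<open>i\<close>, so (ii) and (iii) apply to \<open>u(max t (\<epsilon>/2))\<close>.
  Near a time \<open>s\<close> the function \<open>w(t) = (t - c) u(t)\<close> solves \<open>w' + A(u(t)) w = (t - c) F + u\<close>,
  \<open>w(c) = 0\<close>, whose right-hand side has values in \<open>Y0 (i + 1)\<close>.  Freezing the operator at \<open>s\<close> and
  perturbing, the problem is solvable at level \<open>i + 1\<close> and uniquely solvable at level 0; hence \<open>w\<close>,
  and with it \<open>u\<close> away from \<open>c\<close>, gains a level.

  The bound on the solution operator that the perturbation needs follows from bare existence by
  Baire's theorem.  The trace embedding is Hardy's inequality, applied to the decomposition of
  \<open>u(t)\<close> into its mean over an interval of length \<open>h\<close> ending or starting at \<open>t\<close> and a remainder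
  controlled by the integral of \<open>v\<close>.
\<close>

subsection \<open>Strong measurability and integrals of powers of the norm\<close>

text \<open>The members of the scale are subsets with norms of their own, while limits, series and
  gauge integrals live on types. Hence the analysis is done in types, and each Banach space of the
  scale sits isometrically, as a complemented piece, in the one Banach type \<open>bsum\<close>. L^q
  is never formed as a normed space: functions stand for their classes, and \<open>qint\<close> is
  the q-th power of the norm, an extended real. Triangle inequalities then cost a factor
  \<open>2 powr q\<close>; the rate \<open>4 powr - q\<close> in the solvability arguments makes
  series converge in spite of it. Solutions in the sense of \<open>solves\<close> start at time 0
  with value 0, so they can be preceded by zeros: one interval length then serves both couples, and
  short intervals near \<open>s\<close> can be moved into it. The comparison is always with level 0,
  where assumption (i) gives continuity and maximal regularity along \<open>u\<close>; (ii) serves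
  the new level. The summand \<open>u\<close> of the right-hand side, produced by differentiating
  the factor, has values at the new level because \<open>Y1 i\<close> embeds into the trace space of
  level i + 1 and that one into \<open>Y0 (Suc i)\<close>.\<close>

definition smeas :: "'x measure \<Rightarrow> ('x \<Rightarrow> 'b::real_normed_vector) \<Rightarrow> bool" where
  "smeas M f \<longleftrightarrow> (\<exists>s. (\<forall>n. simple_function M (s n)) \<and> (AE x in M. (\<lambda>n. s n x) \<longlonglongrightarrow> f x))"

text \<open>The q-th power of the L^q norm, without the root: values may be infinite, and constants
  enter as q-th powers.\<close>

definition qint :: "'x measure \<Rightarrow> real \<Rightarrow> ('x \<Rightarrow> 'b::real_normed_vector) \<Rightarrow> ennreal" where
  "qint M q f = (\<integral>\<^sup>+ x. ennreal (norm (f x) powr q) \<partial>M)"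

lemma smeas_simple: "simple_function M f \<Longrightarrow> smeas M f"
  unfolding smeas_def by (rule exI[of _ "\<lambda>_. f"]) auto

lemma smeas_const: "smeas M (\<lambda>_. c)"
  by (rule smeas_simple) simp

lemma smeas_cong_AE: "smeas M f \<Longrightarrow> AE x in M. f x = g x \<Longrightarrow> smeas M g"
proof -
  assume "smeas M f" and ae: "AE x in M. f x = g x"
  then obtain s where s: "\<And>n. simple_function M (s n)" "AE x in M. (\<lambda>n. s n x) \<longlonglongrightarrow> f x"
    unfolding smeas_def by blast
  have "AE x in M. (\<lambda>n. s n x) \<longlonglongrightarrow> g x"
    using s(2) ae by eventually_elim simp
  with s(1) show ?thesis unfolding smeas_def by blast
qed

lemma smeas_compose:
  assumes "smeas M f" "continuous_on UNIV h"
  shows "smeas M (\<lambda>x. h (f x))"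
proof -
  obtain s where s: "\<And>n. simple_function M (s n)" "AE x in M. (\<lambda>n. s n x) \<longlonglongrightarrow> f x"
    using assms(1) unfolding smeas_def by blast
  have "AE x in M. (\<lambda>n. h (s n x)) \<longlonglongrightarrow> h (f x)"
    using s(2)
  proof eventually_elim
    fix x assume "(\<lambda>n. s n x) \<longlonglongrightarrow> f x"
    moreover have "isCont h (f x)" using assms(2) by (simp add: continuous_on_eq_continuous_at)
    ultimately show "(\<lambda>n. h (s n x)) \<longlonglongrightarrow> h (f x)" by (rule isCont_tendsto_compose[rotated])
  qed
  with s(1) show ?thesis unfolding smeas_def
    by (intro exI[of _ "\<lambda>n x. h (s n x)"]) (auto intro: simple_function_compose1)
qed

lemma smeas_compose2:
  assumes "smeas M f" "smeas M g" "continuous_on UNIV (\<lambda>p. h (fst p) (snd p))"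
  shows "smeas M (\<lambda>x. h (f x) (g x))"
proof -
  obtain s where s: "\<And>n. simple_function M (s n)" "AE x in M. (\<lambda>n. s n x) \<longlonglongrightarrow> f x"
    using assms(1) unfolding smeas_def by blast
  obtain r where r: "\<And>n. simple_function M (r n)" "AE x in M. (\<lambda>n. r n x) \<longlonglongrightarrow> g x"
    using assms(2) unfolding smeas_def by blast
  have "AE x in M. (\<lambda>n. h (s n x) (r n x)) \<longlonglongrightarrow> h (f x) (g x)"
    using s(2) r(2)
  proof eventually_elim
    fix x assume "(\<lambda>n. s n x) \<longlonglongrightarrow> f x" "(\<lambda>n. r n x) \<longlonglongrightarrow> g x"
    then have "(\<lambda>n. (s n x, r n x)) \<longlonglongrightarrow> (f x, g x)" by (rule tendsto_Pair)
    moreover have "isCont (\<lambda>p. h (fst p) (snd p)) (f x, g x)"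
      using assms(3) by (simp add: continuous_on_eq_continuous_at)
    ultimately show "(\<lambda>n. h (s n x) (r n x)) \<longlonglongrightarrow> h (f x) (g x)"
      by (auto dest: isCont_tendsto_compose)
  qed
  with s(1) r(1) show ?thesis unfolding smeas_def
    by (intro exI[of _ "\<lambda>n x. h (s n x) (r n x)"]) (auto intro: simple_function_compose2)
qed

lemma smeas_add: "smeas M f \<Longrightarrow> smeas M g \<Longrightarrow> smeas M (\<lambda>x. f x + g x)"
  by (rule smeas_compose2) (auto intro!: continuous_intros)

lemma smeas_diff: "smeas M f \<Longrightarrow> smeas M g \<Longrightarrow> smeas M (\<lambda>x. f x - g x)"
  by (rule smeas_compose2) (auto intro!: continuous_intros)

lemma smeas_Pair: "smeas M f \<Longrightarrow> smeas M g \<Longrightarrow> smeas M (\<lambda>x. (f x, g x))"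
  by (rule smeas_compose2) (auto intro!: continuous_intros)

lemma smeas_sum: "(\<And>i. i \<in> I \<Longrightarrow> smeas M (f i)) \<Longrightarrow> smeas M (\<lambda>x. \<Sum>i\<in>I. f i x)"
  by (induction I rule: infinite_finite_induct) (auto intro: smeas_const smeas_add)

lemma smeas_bounded_linear: "bounded_linear h \<Longrightarrow> smeas M f \<Longrightarrow> smeas M (\<lambda>x. h (f x))"
  by (rule smeas_compose) (auto intro: bounded_linear.continuous_on)

lemma smeas_real: "f \<in> borel_measurable M \<Longrightarrow> smeas M (f :: _ \<Rightarrow> real)"
proof -
  assume "f \<in> borel_measurable M"
  from borel_measurable_implies_sequence_metric[OF this, of 0]
  obtain F where F: "\<And>i. simple_function M (F i)" "\<And>x. x \<in> space M \<Longrightarrow> (\<lambda>i. F i x) \<longlonglongrightarrow> f x" by blast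
  then have "AE x in M. (\<lambda>i. F i x) \<longlonglongrightarrow> f x" by (intro AE_I2)
  with F(1) show ?thesis unfolding smeas_def by blast
qed

lemma smeas_scaleR: "f \<in> borel_measurable M \<Longrightarrow> smeas M g \<Longrightarrow> smeas M (\<lambda>x. f x *\<^sub>R g x)"
  by (rule smeas_compose2[OF smeas_real]) (auto intro!: continuous_intros)

text \<open>By completeness a set that agrees almost everywhere with a measurable one is measurable;
  this is why the limits below may be taken merely almost everywhere.\<close>

lemma (in complete_measure) borel_measurable_cong_AE:
  assumes f: "f \<in> borel_measurable M" and ae: "AE x in M. f x = (g x :: real)"
  shows "g \<in> borel_measurable M"
proof (rule measurableI)
  fix A :: "real set" assume A: "A \<in> sets borel"
  show "g -` A \<inter> space M \<in> sets M"
  proof (rule in_sets_AE)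
    show "AE x in M. (x \<in> f -` A \<inter> space M) = (x \<in> g -` A \<inter> space M)"
      using ae by eventually_elim auto
  qed (use f A in \<open>auto intro: measurable_sets\<close>)
qed auto

lemma (in complete_measure) borel_measurable_LIMSEQ_AE:
  assumes f: "\<And>n. f n \<in> borel_measurable M" and ae: "AE x in M. (\<lambda>n. f n x :: real) \<longlonglongrightarrow> g x"
  shows "g \<in> borel_measurable M"
proof (rule borel_measurable_cong_AE)
  show "(\<lambda>x. lim (\<lambda>n. f n x)) \<in> borel_measurable M"
    using f by (rule borel_measurable_lim_metric)
  show "AE x in M. lim (\<lambda>n. f n x) = g x"
    using ae by eventually_elim (rule limI)
qed

lemma (in complete_measure) smeas_norm_measurable:
  assumes "smeas M f"
  shows "(\<lambda>x. norm (f x)) \<in> borel_measurable M"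
proof -
  obtain s where s: "\<And>n. simple_function M (s n)" "AE x in M. (\<lambda>n. s n x) \<longlonglongrightarrow> f x"
    using assms(1) unfolding smeas_def by blast
  show ?thesis
  proof (rule borel_measurable_LIMSEQ_AE)
    show "(\<lambda>x. norm (s n x)) \<in> borel_measurable M" for n
      by (rule borel_measurable_simple_function) (auto intro: simple_function_compose1 s)
    show "AE x in M. (\<lambda>n. norm (s n x)) \<longlonglongrightarrow> norm (f x)"
      using s(2) by eventually_elim (auto intro: tendsto_intros)
  qed
qed

lemma (in complete_measure) smeas_qint_measurable:
  assumes "smeas M f"
  shows "(\<lambda>x. ennreal (norm (f x) powr q)) \<in> borel_measurable M"
  using smeas_norm_measurable[OF assms] by measurable

text \<open>The nontrivial half of Pettis' theorem: running nearest-point selections in the countable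
  set \<open>D\<close> are simple and converge.\<close>

lemma smeasI_separable:
  assumes D: "countable D" and cl: "AE x in M. f x \<in> closure D"
    and meas: "\<And>d. d \<in> D \<Longrightarrow> (\<lambda>x. norm (f x - d)) \<in> borel_measurable M"
  shows "smeas M f"
proof (cases "D = {}")
  case True
  then have "AE x in M. 0 = f x" using cl by auto
  then show ?thesis by (rule smeas_cong_AE[OF smeas_const])
next
  case False
  define d where "d = from_nat_into D"
  have d: "d n \<in> D" for n unfolding d_def using False by (rule from_nat_into)
  have d_onto: "\<exists>n. y = d n" if "y \<in> D" for y
    unfolding d_def using from_nat_into_surj[OF D that] by metis
  define s where "s = rec_nat (\<lambda>x. d 0)
     (\<lambda>n r x. if norm (f x - d (Suc n)) < norm (f x - r x) then d (Suc n) else r x)"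
  have s0: "s 0 = (\<lambda>x. d 0)" unfolding s_def by simp
  have sS: "s (Suc n) = (\<lambda>x. if norm (f x - d (Suc n)) < norm (f x - s n x) then d (Suc n) else s n x)" for n
    unfolding s_def by simp
  have "simple_function M (s n) \<and> (\<lambda>x. norm (f x - s n x)) \<in> borel_measurable M" for n
  proof (induction n)
    case 0
    then show ?case by (simp add: s0 meas d)
  next
    case (Suc n)
    then have [measurable]: "(\<lambda>x. norm (f x - s n x)) \<in> borel_measurable M" by simp
    have [measurable]: "(\<lambda>x. norm (f x - d (Suc n))) \<in> borel_measurable M" by (simp add: meas d)
    have "(\<lambda>x. norm (f x - s (Suc n) x)) = (\<lambda>x. min (norm (f x - d (Suc n))) (norm (f x - s n x)))"
      by (auto simp: sS)
    moreover have "simple_function M (s (Suc n))"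
      unfolding sS by (rule simple_function_If) (use Suc in auto)
    ultimately show ?case by simp
  qed
  moreover have le: "norm (f x - s n x) \<le> norm (f x - d k)" if "k \<le> n" for n k x
    using that by (induction n) (auto simp: s0 sS le_Suc_eq)
  moreover have "AE x in M. (\<lambda>n. s n x) \<longlonglongrightarrow> f x"
    using cl
  proof eventually_elim
    fix x assume x: "f x \<in> closure D"
    show "(\<lambda>n. s n x) \<longlonglongrightarrow> f x"
    proof (rule LIMSEQ_I)
      fix e :: real assume "0 < e"
      then obtain y where "y \<in> D" "dist y (f x) < e"
        using x unfolding closure_approachable by blast
      then obtain k where "norm (f x - d k) < e"
        using d_onto by (metis dist_norm norm_minus_commute)
      then show "\<exists>n0. \<forall>n\<ge>n0. norm (s n x - f x) < e"
        using le by (metis norm_minus_commute order_le_less_trans)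
    qed
  qed
  ultimately show ?thesis unfolding smeas_def by blast
qed

text \<open>No diagonal sequence is extracted. The values of all approximating simple functions form
  a countable set whose closure contains almost every value of \<open>g\<close>, so the separability
  criterion \<open>smeasI_separable\<close> applies.\<close>

lemma (in complete_measure) smeas_LIMSEQ:
  assumes f: "\<And>n. smeas M (f n)" and lim: "AE x in M. (\<lambda>n. f n x) \<longlonglongrightarrow> g x"
  shows "smeas M g"
proof -
  obtain s where s: "\<And>n k. simple_function M (s n k)" "\<And>n. AE x in M. (\<lambda>k. s n k x) \<longlonglongrightarrow> f n x"
    using f unfolding smeas_def by metis
  define D where "D = (\<Union>n k. s n k ` space M)"
  show ?thesis
  proof (rule smeasI_separable)
    show "countable D"
      unfolding D_def using s(1) by (auto simp: simple_function_def intro!: countable_UN intro: countable_finite)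
    have "AE x in M. \<forall>n. (\<lambda>k. s n k x) \<longlonglongrightarrow> f n x"
      using s(2) by (simp add: AE_all_countable)
    with lim AE_space show "AE x in M. g x \<in> closure D"
    proof eventually_elim
      fix x assume x: "x \<in> space M" "(\<lambda>n. f n x) \<longlonglongrightarrow> g x" "\<forall>n. (\<lambda>k. s n k x) \<longlonglongrightarrow> f n x"
      have "f n x \<in> closure D" for n
        by (rule closed_sequentially[OF closed_closure _ x(3)[rule_format, of n]])
           (rule subsetD[OF closure_subset], use x(1) in \<open>auto simp: D_def\<close>)
      then show "g x \<in> closure D"
        by (intro closed_sequentially[OF closed_closure _ x(2)]) auto
    qed
    show "(\<lambda>x. norm (g x - d)) \<in> borel_measurable M" for d
    proof (rule borel_measurable_LIMSEQ_AE)
      show "(\<lambda>x. norm (f n x - d)) \<in> borel_measurable M" for n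
        by (intro smeas_norm_measurable smeas_diff f smeas_const)
      show "AE x in M. (\<lambda>n. norm (f n x - d)) \<longlonglongrightarrow> norm (g x - d)"
        using lim by eventually_elim (intro tendsto_norm tendsto_diff tendsto_const)
    qed
  qed
qed

section \<open>Quasi-norm estimates and convergence of series in L^q\<close>

lemma powr_add_le: "(a + b) powr q \<le> 2 powr q * (a powr q + b powr q)"
  if "0 \<le> a" "0 \<le> b" "0 \<le> q" for a b q :: real
proof -
  have "(a + b) powr q \<le> (2 * max a b) powr q" using that by (intro powr_mono2) auto
  also have "\<dots> = 2 powr q * max a b powr q" using that by (simp add: powr_mult)
  also have "\<dots> \<le> 2 powr q * (a powr q + b powr q)"
    by (intro mult_left_mono) (auto simp: max_def)
  finally show ?thesis .
qed

lemma (in complete_measure) qint_add: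
  assumes "smeas M f" "smeas M g" "0 \<le> q"
  shows "qint M q (\<lambda>x. f x + g x) \<le> ennreal (2 powr q) * (qint M q f + qint M q g)"
proof -
  note [measurable] = smeas_norm_measurable[OF assms(1)] smeas_norm_measurable[OF assms(2)]
  have "norm (f x + g x) powr q \<le> 2 powr q * (norm (f x) powr q + norm (g x) powr q)" for x
    by (rule order_trans[OF powr_mono2 powr_add_le]) (auto simp: norm_triangle_ineq assms)
  then have "qint M q (\<lambda>x. f x + g x)
      \<le> (\<integral>\<^sup>+ x. ennreal (2 powr q) * (ennreal (norm (f x) powr q) + ennreal (norm (g x) powr q)) \<partial>M)"
    unfolding qint_def by (intro nn_integral_mono) (simp add: ennreal_mult[symmetric] flip: ennreal_plus)
  also have "\<dots> = ennreal (2 powr q) * (qint M q f + qint M q g)"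
    unfolding qint_def by (simp add: nn_integral_cmult nn_integral_add distrib_left)
  finally show ?thesis .
qed

lemma qint_minus: "qint M q (\<lambda>x. - f x) = qint M q f"
  unfolding qint_def by simp

lemma qint_minus_commute: "qint M q (\<lambda>x. f x - g x) = qint M q (\<lambda>x. g x - f x)"
  unfolding qint_def by (simp add: norm_minus_commute)

lemma (in complete_measure) qint_diff:
  assumes "smeas M f" "smeas M g" "0 \<le> q"
  shows "qint M q (\<lambda>x. f x - g x) \<le> ennreal (2 powr q) * (qint M q f + qint M q g)"
  using qint_add[OF assms(1) smeas_bounded_linear[OF bounded_linear_minus[OF bounded_linear_ident] assms(2)] assms(3)]
  by (simp add: qint_minus)

lemma (in complete_measure) qint_triangle:
  assumes "smeas M f" "smeas M g" "smeas M h" "0 \<le> q"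
  shows "qint M q (\<lambda>x. f x - h x) \<le> ennreal (2 powr q) * (qint M q (\<lambda>x. f x - g x) + qint M q (\<lambda>x. g x - h x))"
  using qint_add[OF smeas_diff[OF assms(1,2)] smeas_diff[OF assms(2,3)] assms(4)] by simp

lemma (in complete_measure) qint_bound:
  assumes "smeas M g" "AE x in M. norm (f x) \<le> K * norm (g x)" "0 \<le> K" "0 \<le> q"
  shows "qint M q f \<le> ennreal (K powr q) * qint M q g"
proof -
  note [measurable] = smeas_norm_measurable[OF assms(1)]
  have "qint M q f \<le> (\<integral>\<^sup>+ x. ennreal (K powr q) * ennreal (norm (g x) powr q) \<partial>M)"
    unfolding qint_def
  proof (rule nn_integral_mono_AE, use assms(2) in eventually_elim)
    fix x assume "norm (f x) \<le> K * norm (g x)"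
    then have "norm (f x) powr q \<le> (K * norm (g x)) powr q"
      using assms by (intro powr_mono2) auto
    then show "ennreal (norm (f x) powr q) \<le> ennreal (K powr q) * ennreal (norm (g x) powr q)"
      using assms by (simp add: powr_mult ennreal_mult[symmetric])
  qed
  then show ?thesis unfolding qint_def by (simp add: nn_integral_cmult)
qed

lemma (in complete_measure) qint_scaleR:
  assumes "smeas M f" "0 < q"
  shows "qint M q (\<lambda>x. c *\<^sub>R f x) = ennreal (\<bar>c\<bar> powr q) * qint M q f"
proof -
  note [measurable] = smeas_norm_measurable[OF assms(1)]
  show ?thesis unfolding qint_def
    by (simp add: nn_integral_cmult[symmetric] powr_mult ennreal_mult)
qed

lemma (in complete_measure) qint_eq_0_AE:
  assumes "smeas M f" "qint M q f = 0"
  shows "AE x in M. f x = 0"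
proof -
  note [measurable] = smeas_norm_measurable[OF assms(1)]
  have "AE x in M. ennreal (norm (f x) powr q) = 0"
    using assms(2) unfolding qint_def by (simp add: nn_integral_0_iff_AE)
  then show ?thesis by eventually_elim simp
qed

lemma qint_cong_AE: "AE x in M. f x = g x \<Longrightarrow> qint M q f = qint M q g"
  unfolding qint_def by (rule nn_integral_cong_AE) (auto elim: eventually_mono)

lemma ennreal_le_suminf: "f k \<le> suminf f" for f :: "nat \<Rightarrow> ennreal"
  using sum_le_suminf[OF summableI, of "{k}" f] by simp

text \<open>Each single term of the weighted sum is at most \<open>r\<close>, so \<open>a k\<close>
  is at most \<open>R * (1 / 2) ^ k\<close> with \<open>R\<close> the q-th root of \<open>r\<close>;
  the geometric series contributes the factor 2. The weights \<open>2 ^ k\<close> stand in for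
  Minkowski's inequality.\<close>

lemma summable_of_weighted_powers:
  fixes a :: "nat \<Rightarrow> real"
  assumes a: "\<And>k. 0 \<le> a k" and q: "0 < q" and r: "0 \<le> r"
    and le: "(\<Sum>k. ennreal ((2 ^ k * a k) powr q)) \<le> ennreal r"
  shows "summable a" "(\<Sum>k. a k) powr q \<le> 2 powr q * r"
proof -
  define R where "R = r powr (1 / q)"
  have b: "a k \<le> R * (1 / 2) ^ k" for k
  proof -
    have "ennreal ((2 ^ k * a k) powr q) \<le> (\<Sum>k. ennreal ((2 ^ k * a k) powr q))"
      by (rule ennreal_le_suminf)
    then have "ennreal ((2 ^ k * a k) powr q) \<le> ennreal r" using le by (rule order_trans)
    then have "(2 ^ k * a k) powr q \<le> r" using r by simp
    then have "((2 ^ k * a k) powr q) powr (1 / q) \<le> R"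
      unfolding R_def using q by (intro powr_mono2) auto
    then have "2 ^ k * a k \<le> R" using q a[of k] by (simp add: powr_powr)
    then have "a k \<le> R / 2 ^ k" by (simp add: pos_le_divide_eq mult.commute)
    then show ?thesis by (simp add: power_divide)
  qed
  have sg: "summable (\<lambda>k. R * (1 / 2) ^ k)" by (intro summable_mult summable_geometric) simp
  show sa: "summable a"
    by (rule summable_comparison_test'[OF sg, of 0]) (use a b in auto)
  have "(\<Sum>k. a k) \<le> (\<Sum>k. R * (1 / 2) ^ k)" by (rule suminf_le[OF b sa sg])
  also have "\<dots> = 2 * R" by (subst suminf_mult) (auto simp: suminf_geometric)
  finally have "(\<Sum>k. a k) powr q \<le> (2 * R) powr q"
    using q by (intro powr_mono2 suminf_nonneg sa a) auto
  also have "\<dots> = 2 powr q * r" using q r by (simp add: R_def powr_mult powr_powr)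
  finally show "(\<Sum>k. a k) powr q \<le> 2 powr q * r" .
qed

text \<open>The weighted sum \<open>R\<close> of \<open>summable_of_weighted_powers\<close> is
  integrable, hence finite almost everywhere, and it dominates the q-th power of the series
  pointwise.\<close>

lemma (in complete_measure) Lq_suminf:
  fixes f :: "nat \<Rightarrow> 'a \<Rightarrow> 'b::banach"
  assumes q: "1 \<le> q" and f: "\<And>k. smeas M (f k)" and c: "0 \<le> c"
    and b: "\<And>k. qint M q (f k) \<le> ennreal (c * (4 powr - q) ^ k)"
  shows "AE x in M. summable (\<lambda>k. f k x)"
    and "qint M q (\<lambda>x. \<Sum>k. f k x) \<le> ennreal (2 powr q * 2 * c)"
proof -
  define R where "R = (\<lambda>x. \<Sum>k. ennreal ((2 ^ k * norm (f k x)) powr q))"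
  have [measurable]: "\<And>k. (\<lambda>x. norm (f k x)) \<in> borel_measurable M"
    using f by (rule smeas_norm_measurable)
  have Rm[measurable]: "R \<in> borel_measurable M" unfolding R_def by measurable
  \<comment> \<open>The product is \<open>2 powr - (q * k)\<close>: the rate
    \<open>4 powr - q\<close> pays for the weights \<open>2 ^ k\<close> and still leaves a geometric
    series.\<close>
  have p4: "(2 ^ k) powr q * (4 powr - q) ^ k \<le> (1 / 2) ^ k" for k :: nat
  proof -
    have 4: "(4::real) = 2 powr 2" by simp
    have "(2 ^ k) powr q * (4 powr - q) ^ k = 2 powr (real k * q) * (2 powr (2 * - q)) powr real k"
      unfolding 4 powr_powr by (simp add: powr_powr flip: powr_realpow)
    also have "\<dots> = 2 powr - (q * real k)"
      by (simp add: powr_powr mult.commute flip: powr_add)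
    also have "\<dots> \<le> 2 powr - (1 * real k)"
      using q mult_right_mono[OF q, of "real k"] by (intro powr_mono) auto
    also have "\<dots> = (1 / 2) ^ k" by (simp add: powr_minus_divide powr_realpow power_one_over)
    finally show ?thesis .
  qed
  have "(\<integral>\<^sup>+ x. R x \<partial>M) = (\<Sum>k. \<integral>\<^sup>+ x. ennreal ((2 ^ k * norm (f k x)) powr q) \<partial>M)"
    unfolding R_def by (rule nn_integral_suminf) measurable
  also have "\<dots> = (\<Sum>k. ennreal ((2 ^ k) powr q) * qint M q (f k))"
    unfolding qint_def by (simp add: powr_mult ennreal_mult nn_integral_cmult)
  also have "\<dots> \<le> (\<Sum>k. ennreal (c * (1 / 2) ^ k))"
  proof (rule suminf_le)
    show "ennreal ((2 ^ k) powr q) * qint M q (f k) \<le> ennreal (c * (1 / 2) ^ k)" for k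
    proof -
      have "ennreal ((2 ^ k) powr q) * qint M q (f k)
          \<le> ennreal ((2 ^ k) powr q) * ennreal (c * (4 powr - q) ^ k)"
        by (rule mult_left_mono[OF b]) simp
      also have "\<dots> = ennreal (c * ((2 ^ k) powr q * (4 powr - q) ^ k))"
        using c by (simp add: ennreal_mult[symmetric] mult_ac)
      also have "\<dots> \<le> ennreal (c * (1 / 2) ^ k)"
        using c p4[of k] by (intro ennreal_leI mult_left_mono)
      finally show ?thesis .
    qed
  qed auto
  also have "\<dots> = ennreal (2 * c)"
    using c by (subst suminf_ennreal2) (auto simp: suminf_mult suminf_geometric mult.commute)
  finally have intR: "(\<integral>\<^sup>+ x. R x \<partial>M) \<le> ennreal (2 * c)" .
  then have fin: "AE x in M. R x \<noteq> \<infinity>"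
    by (intro nn_integral_noteq_infinite) (auto simp: top_unique)
  have key: "summable (\<lambda>k. f k x) \<and> ennreal (norm (\<Sum>k. f k x) powr q) \<le> ennreal (2 powr q) * R x"
    if "R x \<noteq> \<infinity>" for x
  proof -
    from that obtain r where r: "0 \<le> r" "R x = ennreal r" by (cases "R x") auto
    have le: "(\<Sum>k. ennreal ((2 ^ k * norm (f k x)) powr q)) \<le> ennreal r"
      using r(2) unfolding R_def by simp
    have q0: "0 < q" using q by simp
    note 1 = summable_of_weighted_powers[OF norm_ge_zero q0 r(1) le]
    have "norm (\<Sum>k. f k x) powr q \<le> (\<Sum>k. norm (f k x)) powr q"
      using q by (intro powr_mono2 summable_norm 1) auto
    also note 1(2)
    finally have "ennreal (norm (\<Sum>k. f k x) powr q) \<le> ennreal (2 powr q) * R x"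
      unfolding r(2) using r(1) by (simp add: ennreal_mult[symmetric])
    with summable_norm_cancel[OF 1(1)] show ?thesis by blast
  qed
  show "AE x in M. summable (\<lambda>k. f k x)" using fin by eventually_elim (use key in auto)
  have "qint M q (\<lambda>x. \<Sum>k. f k x) \<le> (\<integral>\<^sup>+ x. ennreal (2 powr q) * R x \<partial>M)"
    unfolding qint_def by (rule nn_integral_mono_AE, use fin in eventually_elim) (use key in auto)
  also have "\<dots> = ennreal (2 powr q) * (\<integral>\<^sup>+ x. R x \<partial>M)" by (rule nn_integral_cmult) simp
  also have "\<dots> \<le> ennreal (2 powr q) * ennreal (2 * c)" by (rule mult_left_mono[OF intR]) simp
  finally show "qint M q (\<lambda>x. \<Sum>k. f k x) \<le> ennreal (2 powr q * 2 * c)"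
    using c by (simp add: ennreal_mult[symmetric] mult_ac)
qed

text \<open>Completeness of L^q in the form used below. The tail estimate has a constant
  \<open>c'\<close> of its own, because the tail from \<open>n\<close> on is itself a geometrically
  bounded series with a smaller constant.\<close>

lemma (in complete_measure) Lq_series:
  fixes f :: "nat \<Rightarrow> 'a \<Rightarrow> 'b::banach"
  assumes q: "1 \<le> q" and f: "\<And>k. smeas M (f k)" and c: "0 \<le> c"
    and b: "\<And>k. qint M q (f k) \<le> ennreal (c * (4 powr - q) ^ k)"
  obtains F where "smeas M F" "AE x in M. (\<lambda>k. f k x) sums F x"
    and "\<And>n c'. 0 \<le> c' \<Longrightarrow> (\<And>k. qint M q (f (n + k)) \<le> ennreal (c' * (4 powr - q) ^ k)) \<Longrightarrow>
      qint M q (\<lambda>x. F x - (\<Sum>k<n. f k x)) \<le> ennreal (2 powr q * 2 * c')"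
proof
  let ?F = "\<lambda>x. \<Sum>k. f k x"
  note sm = Lq_suminf(1)[OF q f c b]
  show sums: "AE x in M. (\<lambda>k. f k x) sums ?F x"
    using sm by eventually_elim (rule summable_sums)
  show "smeas M ?F"
    by (rule smeas_LIMSEQ[of "\<lambda>n x. \<Sum>k<n. f k x"])
       (use sums in \<open>auto intro: smeas_sum f simp: sums_def\<close>)
  show "qint M q (\<lambda>x. ?F x - (\<Sum>k<n. f k x)) \<le> ennreal (2 powr q * 2 * c')"
    if "0 \<le> c'" "\<And>k. qint M q (f (n + k)) \<le> ennreal (c' * (4 powr - q) ^ k)" for n c'
  proof -
    have "qint M q (\<lambda>x. ?F x - (\<Sum>k<n. f k x)) = qint M q (\<lambda>x. \<Sum>k. f (n + k) x)"
      by (rule qint_cong_AE, use sm in eventually_elim)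
         (simp add: suminf_minus_initial_segment[symmetric] add.commute)
    also have "\<dots> \<le> ennreal (2 powr q * 2 * c')"
      by (rule Lq_suminf(2)[OF q f]) (use that in auto)
    finally show ?thesis .
  qed
qed

text \<open>A closed linear subspace of L^q, described by representatives. The data space and the
  graph space of maximal regularity are instances, so the solvability arguments need no
  quotient.\<close>

definition lq_closed :: "'x measure \<Rightarrow> real \<Rightarrow> ('x \<Rightarrow> 'b::real_normed_vector) set \<Rightarrow> bool" where
  "lq_closed M q G \<longleftrightarrow>
     (\<forall>z\<in>G. smeas M z \<and> qint M q z < \<infinity>) \<and> (\<lambda>_. 0) \<in> G \<and>
     (\<forall>z\<in>G. \<forall>w\<in>G. (\<lambda>x. z x + w x) \<in> G) \<and> (\<forall>c. \<forall>z\<in>G. (\<lambda>x. c *\<^sub>R z x) \<in> G) \<and>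
     (\<forall>Z z. (\<forall>n. Z n \<in> G) \<longrightarrow> smeas M z \<longrightarrow> (\<lambda>n. qint M q (\<lambda>x. z x - Z n x)) \<longlonglongrightarrow> 0 \<longrightarrow> z \<in> G)"

lemma lq_closedD:
  assumes "lq_closed M q G"
  shows "z \<in> G \<Longrightarrow> smeas M z" "z \<in> G \<Longrightarrow> qint M q z < \<infinity>" "(\<lambda>_. 0) \<in> G"
    "z \<in> G \<Longrightarrow> w \<in> G \<Longrightarrow> (\<lambda>x. z x + w x) \<in> G" "z \<in> G \<Longrightarrow> (\<lambda>x. c *\<^sub>R z x) \<in> G"
    "(\<And>n. Z n \<in> G) \<Longrightarrow> smeas M z \<Longrightarrow> (\<lambda>n. qint M q (\<lambda>x. z x - Z n x)) \<longlonglongrightarrow> 0 \<Longrightarrow> z \<in> G"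
  using assms unfolding lq_closed_def by blast+

lemma lq_closed_diff:
  assumes "lq_closed M q G" "z \<in> G" "w \<in> G"
  shows "(\<lambda>x. z x - w x) \<in> G"
  using lq_closedD(4)[OF assms(1,2) lq_closedD(5)[OF assms(1,3), of "-1"]] by simp

lemma lq_closed_sum:
  assumes "lq_closed M q G" "\<And>k. z k \<in> G"
  shows "(\<lambda>x. \<Sum>k<(n::nat). z k x) \<in> G"
  by (induction n) (auto intro: lq_closedD[OF assms(1)] assms(2))

lemma tendsto_ennreal_geometric_0:
  assumes "0 \<le> r" "r < 1" "0 \<le> (c::real)"
  shows "(\<lambda>n. ennreal (c * r ^ n)) \<longlonglongrightarrow> 0"
proof -
  have "(\<lambda>n. c * r ^ n) \<longlonglongrightarrow> c * 0"
    using assms by (intro tendsto_mult tendsto_const LIMSEQ_power_zero) auto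
  then show ?thesis
    using tendsto_ennrealI by fastforce
qed

text \<open>Successive approximation: the solution is the sum of approximate solutions for the residuals.\<close>

lemma (in complete_measure) approx_solve:
  fixes \<Lambda> :: "'a \<Rightarrow> 'c::banach \<Rightarrow> 'e::banach"
  assumes q: "1 \<le> q" and G: "lq_closed M q G" and L: "lq_closed M q L"
    and lin: "\<And>x. linear (\<Lambda> x)" and bd: "\<And>x y. norm (\<Lambda> x y) \<le> K * norm y" "0 \<le> K"
    and maps: "\<And>z. z \<in> G \<Longrightarrow> (\<lambda>x. \<Lambda> x (z x)) \<in> L"
    and approx: "\<And>f. f \<in> L \<Longrightarrow> \<exists>z\<in>G. qint M q z \<le> ennreal m * qint M q f \<and>
      qint M q (\<lambda>x. f x - \<Lambda> x (z x)) \<le> ennreal (4 powr - q) * qint M q f"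
    and m: "0 \<le> m" and f: "f \<in> L"
  shows "\<exists>z\<in>G. (AE x in M. \<Lambda> x (z x) = f x) \<and> qint M q z \<le> ennreal (2 powr q * 2 * m) * qint M q f"
proof -
  obtain S where S: "\<And>f. f \<in> L \<Longrightarrow> S f \<in> G" "\<And>f. f \<in> L \<Longrightarrow> qint M q (S f) \<le> ennreal m * qint M q f"
    "\<And>f. f \<in> L \<Longrightarrow> qint M q (\<lambda>x. f x - \<Lambda> x (S f x)) \<le> ennreal (4 powr - q) * qint M q f"
    using approx by metis
  \<comment> \<open>\<open>g n\<close> is the residual left after \<open>n\<close> rounds; round
    \<open>n\<close> solves approximately for it.\<close>
  define g where "g = rec_nat f (\<lambda>_ h x. h x - \<Lambda> x (S h x))"
  have g0: "g 0 = f" and gS: "g (Suc n) = (\<lambda>x. g n x - \<Lambda> x (S (g n) x))" for n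
    unfolding g_def by simp_all
  obtain e where e: "0 \<le> e" "qint M q f = ennreal e"
    using lq_closedD(2)[OF L f] by (cases "qint M q f") auto
  define r where "r = (4::real) powr - q"
  have "(4::real) powr - q < 4 powr 0" using q by (intro powr_less_mono) auto
  then have r: "0 \<le> r" "r < 1" by (auto simp: r_def)
  have gL: "g n \<in> L" for n
    by (induction n) (auto simp: g0 gS intro!: f lq_closed_diff[OF L] maps S)
  have gb: "qint M q (g n) \<le> ennreal (e * r ^ n)" for n
  proof (induction n)
    case (Suc n)
    have "qint M q (g (Suc n)) \<le> ennreal r * qint M q (g n)" unfolding gS r_def by (rule S(3)[OF gL])
    also have "\<dots> \<le> ennreal r * ennreal (e * r ^ n)" by (rule mult_left_mono[OF Suc]) simp
    finally show ?case using e r by (simp add: ennreal_mult[symmetric] mult_ac)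
  qed (simp add: g0 e)
  define z where "z n = S (g n)" for n
  have zG: "z n \<in> G" for n unfolding z_def by (rule S(1)[OF gL])
  have zb: "qint M q (z n) \<le> ennreal (m * e * r ^ n)" for n
  proof -
    have "qint M q (z n) \<le> ennreal m * qint M q (g n)" unfolding z_def by (rule S(2)[OF gL])
    also have "\<dots> \<le> ennreal m * ennreal (e * r ^ n)" by (rule mult_left_mono[OF gb]) simp
    finally show ?thesis using e r m by (simp add: ennreal_mult[symmetric] mult_ac)
  qed
  have me: "0 \<le> m * e" using m e by simp
  obtain F where F: "smeas M F" "\<And>n c'. 0 \<le> c' \<Longrightarrow> (\<And>k. qint M q (z (n + k)) \<le> ennreal (c' * r ^ k)) \<Longrightarrow>
      qint M q (\<lambda>x. F x - (\<Sum>k<n. z k x)) \<le> ennreal (2 powr q * 2 * c')"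
    using Lq_series[OF q lq_closedD(1)[OF G zG] me zb[unfolded r_def]] unfolding r_def by blast
  define Z where "Z n = (\<lambda>x. \<Sum>k<n. z k x)" for n
  have ZG: "Z n \<in> G" for n unfolding Z_def by (rule lq_closed_sum[OF G zG])
  have FZ: "qint M q (\<lambda>x. F x - Z n x) \<le> ennreal (2 powr q * 2 * (m * e) * r ^ n)" for n
    unfolding Z_def mult.assoc[of _ "m * e"] mult.assoc[of _ _ "(m * e) * r ^ n", symmetric]
    by (rule F(2)) (use me m e r in \<open>auto intro!: order_trans[OF zb] simp: power_add mult_ac\<close>)
  have FZ0: "(\<lambda>n. qint M q (\<lambda>x. F x - Z n x)) \<longlonglongrightarrow> 0"
    by (rule tendsto_sandwich[OF _ _ tendsto_const])
       (use FZ tendsto_ennreal_geometric_0[OF r, of "2 powr q * 2 * (m * e)"] me in auto)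
  have FG: "F \<in> G" by (rule lq_closedD(6)[OF G ZG F(1) FZ0])
  \<comment> \<open>Linearity telescopes the residuals: what is left after \<open>n\<close> rounds
    is the defect of the partial sum \<open>Z n\<close>.\<close>
  have gZ: "g n x = f x - \<Lambda> x (Z n x)" for n x
  proof (induction n)
    case 0 show ?case by (simp add: g0 Z_def linear_0[OF lin])
  next
    case (Suc n)
    have "\<Lambda> x (Z (Suc n) x) = \<Lambda> x (Z n x) + \<Lambda> x (z n x)" by (simp add: Z_def linear_add[OF lin])
    then show ?case using Suc by (simp add: gS z_def)
  qed
  have LF: "(\<lambda>x. \<Lambda> x (F x)) \<in> L" by (rule maps[OF FG])
  have LZ: "(\<lambda>x. \<Lambda> x (Z n x)) \<in> L" for n by (rule maps[OF ZG])
  \<comment> \<open>The defect of the limit is compared with that of \<open>Z n\<close>. The uniform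
    bound \<open>K\<close> on the maps turns convergence of the \<open>Z n\<close> into convergence
    of their images.\<close>
  have le: "qint M q (\<lambda>x. f x - \<Lambda> x (F x))
     \<le> ennreal (2 powr q) * (qint M q (g n) + ennreal (K powr q) * qint M q (\<lambda>x. F x - Z n x))" for n
  proof -
    have "qint M q (\<lambda>x. f x - \<Lambda> x (F x)) \<le>
       ennreal (2 powr q) * (qint M q (\<lambda>x. f x - \<Lambda> x (Z n x)) + qint M q (\<lambda>x. \<Lambda> x (Z n x) - \<Lambda> x (F x)))"
      using q by (intro qint_triangle lq_closedD(1)[OF L] f LF LZ) auto
    also have "qint M q (\<lambda>x. \<Lambda> x (Z n x) - \<Lambda> x (F x)) \<le> ennreal (K powr q) * qint M q (\<lambda>x. F x - Z n x)"
      by (rule qint_bound)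
         (use q bd in \<open>auto intro: lq_closedD(1)[OF G] lq_closed_diff[OF G] FG ZG
            simp flip: linear_diff[OF lin] simp: norm_minus_commute[of "F _"]\<close>)
    finally show ?thesis unfolding gZ[symmetric] by (simp add: add_left_mono mult_left_mono)
  qed
  have "(\<lambda>n. ennreal (2 powr q) * (qint M q (g n) + ennreal (K powr q) * qint M q (\<lambda>x. F x - Z n x)))
     \<longlonglongrightarrow> ennreal (2 powr q) * (0 + ennreal (K powr q) * 0)"
  proof (intro ennreal_tendsto_cmult tendsto_add FZ0)
    show "(\<lambda>n. qint M q (g n)) \<longlonglongrightarrow> 0"
      by (rule tendsto_sandwich[OF _ _ tendsto_const])
         (use gb tendsto_ennreal_geometric_0[OF r e(1)] in auto)
  qed auto
  then have "qint M q (\<lambda>x. f x - \<Lambda> x (F x)) \<le> 0"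
    by (intro LIMSEQ_le_const) (use le in auto)
  then have "AE x in M. f x - \<Lambda> x (F x) = 0"
    by (intro qint_eq_0_AE[of _ q] lq_closedD(1)[OF L] lq_closed_diff[OF L] f LF) simp
  then have "AE x in M. \<Lambda> x (F x) = f x" by eventually_elim simp
  moreover have "qint M q F \<le> ennreal (2 powr q * 2 * m) * qint M q f"
    using FZ[of 0] m e by (simp add: Z_def ennreal_mult[symmetric] mult_ac)
  ultimately show ?thesis using FG by blast
qed

text \<open>Baire's argument, by nested balls in the quasi-norm \<open>qint\<close>.\<close>

lemma (in complete_measure) Baire_solve:
  fixes \<Lambda> :: "'a \<Rightarrow> 'c::banach \<Rightarrow> 'e::banach"
  assumes q: "1 \<le> q" and G: "lq_closed M q G" and L: "lq_closed M q L"
    and maps: "\<And>z. z \<in> G \<Longrightarrow> (\<lambda>x. \<Lambda> x (z x)) \<in> L"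
    and solve: "\<And>f. f \<in> L \<Longrightarrow> \<exists>z\<in>G. AE x in M. \<Lambda> x (z x) = f x"
  shows "\<exists>(n::nat) f0 r. f0 \<in> L \<and> 0 < r \<and> (\<forall>f\<in>L. qint M q (\<lambda>x. f x - f0 x) \<le> ennreal r \<longrightarrow>
    (\<forall>e>0. \<exists>z\<in>G. qint M q z \<le> of_nat n \<and> qint M q (\<lambda>x. f x - \<Lambda> x (z x)) < ennreal e))"
proof (rule ccontr)
  \<comment> \<open>\<open>\<not> P n f e\<close> says that the \<open>e\<close>-ball about
    \<open>f\<close> misses the image of the ball of size \<open>n\<close>. The negated claim finds
    such a ball arbitrarily close to every point.\<close>
  define P where "P n f e \<longleftrightarrow> (\<exists>z\<in>G. qint M q z \<le> of_nat n \<and> qint M q (\<lambda>x. f x - \<Lambda> x (z x)) < ennreal e)"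
    for n :: nat and f e
  assume "\<not> ?thesis"
  then have no: "\<exists>f' e. f' \<in> L \<and> 0 < e \<and> qint M q (\<lambda>x. f' x - f x) \<le> ennreal r \<and> \<not> P n f' e"
    if "f \<in> L" "0 < r" for n f r
    using that unfolding P_def by blast
  define Q where "Q n f r f' e \<longleftrightarrow> f' \<in> L \<and> (0::real) < e \<and> qint M q (\<lambda>x. f' x - f x) \<le> ennreal r \<and> \<not> P n f' e"
    for n f r f' e
  have "\<forall>n f r. \<exists>f' e. f \<in> L \<and> 0 < r \<longrightarrow> Q n f r f' e"
    using no unfolding Q_def by blast
  then obtain N E where "\<forall>n f r. f \<in> L \<and> 0 < r \<longrightarrow> Q n f r (N n f r) (E n f r)"
    unfolding choice_iff by blast
  then have NE: "\<And>n f r. f \<in> L \<Longrightarrow> 0 < r \<Longrightarrow> N n f r \<in> L"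
    "\<And>n f r. f \<in> L \<Longrightarrow> 0 < r \<Longrightarrow> (0::real) < E n f r"
    "\<And>n f r. f \<in> L \<Longrightarrow> 0 < r \<Longrightarrow> qint M q (\<lambda>x. N n f r x - f x) \<le> ennreal r"
    "\<And>n f r. f \<in> L \<Longrightarrow> 0 < r \<Longrightarrow> \<not> P n (N n f r) (E n f r)"
    unfolding Q_def by blast+
  define a where "a = (4::real) powr - q"
  have a: "0 < a" by (simp add: a_def)
  \<comment> \<open>The limit is within \<open>2 powr q * 2 * \<rho> (Suc n)\<close> of the centre
    \<open>h (Suc n)\<close>; this factor makes that at most half of the radius of the missed
    ball.\<close>
  define \<kappa> where "\<kappa> = 1 / (4 * 2 powr q)"
  have \<kappa>: "0 < \<kappa>" by (simp add: \<kappa>_def)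
  \<comment> \<open>Pairs of centre and radius. The radii shrink by at least the factor
    \<open>a\<close>, the rate that \<open>Lq_series\<close> asks for, and stay below
    \<open>\<kappa>\<close> times the radius of the ball that was missed.\<close>
  define s where "s = rec_nat ((\<lambda>_. 0) :: 'a \<Rightarrow> 'e, 1::real)
    (\<lambda>n p. (N n (fst p) (snd p), min (snd p * a) (E n (fst p) (snd p) * \<kappa>)))"
  define h where "h n = fst (s n)" for n
  define \<rho> where "\<rho> n = snd (s n)" for n
  have h0: "h 0 = (\<lambda>_. 0)" and \<rho>0: "\<rho> 0 = 1" by (simp_all add: h_def \<rho>_def s_def)
  have hS: "h (Suc n) = N n (h n) (\<rho> n)" and \<rho>S: "\<rho> (Suc n) = min (\<rho> n * a) (E n (h n) (\<rho> n) * \<kappa>)" for n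
    by (simp_all add: h_def \<rho>_def s_def)
  have inv: "h n \<in> L \<and> 0 < \<rho> n" for n
  proof (induction n)
    case 0 then show ?case using lq_closedD(3)[OF L] by (simp add: h0 \<rho>0)
  next
    case (Suc n)
    then show ?case using NE(1,2)[of "h n" "\<rho> n" n] a \<kappa> by (simp add: hS \<rho>S)
  qed
  then have hL: "h n \<in> L" and \<rho>: "0 < \<rho> n" for n by auto
  have \<rho>le: "\<rho> (n + k) \<le> \<rho> n * a ^ k" for n k
  proof (induction k)
    case (Suc k)
    have "\<rho> (n + Suc k) \<le> \<rho> (n + k) * a" by (simp add: \<rho>S)
    also have "\<dots> \<le> \<rho> n * a ^ k * a" using Suc a by (intro mult_right_mono) auto
    finally show ?case by (simp add: mult_ac)
  qed simp
  define f where "f k = (\<lambda>x. h (Suc k) x - h k x)" for k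
  have fL: "f k \<in> L" for k unfolding f_def by (intro lq_closed_diff[OF L] hL)
  have fb: "qint M q (f (n + k)) \<le> ennreal (\<rho> n * a ^ k)" for n k
  proof -
    have "qint M q (f (n + k)) \<le> ennreal (\<rho> (n + k))"
      unfolding f_def hS by (rule NE(3)[OF hL \<rho>])
    then show ?thesis by (rule order_trans[OF _ ennreal_leI[OF \<rho>le]])
  qed
  have hsum: "h n x = (\<Sum>k<n. f k x)" for n x
    by (induction n) (simp_all add: h0 f_def)
  obtain F where F: "smeas M F" "\<And>n c'. 0 \<le> c' \<Longrightarrow> (\<And>k. qint M q (f (n + k)) \<le> ennreal (c' * a ^ k)) \<Longrightarrow>
      qint M q (\<lambda>x. F x - (\<Sum>k<n. f k x)) \<le> ennreal (2 powr q * 2 * c')"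
  proof (rule Lq_series[OF q lq_closedD(1)[OF L fL], of 1])
    show "qint M q (f k) \<le> ennreal (1 * (4 powr - q) ^ k)" for k
      using fb[of 0 k] by (simp add: \<rho>0 a_def)
  qed (use that in \<open>auto simp: a_def\<close>)
  have Fh: "qint M q (\<lambda>x. F x - h n x) \<le> ennreal (2 powr q * 2 * \<rho> n)" for n
    unfolding hsum by (rule F(2)) (use fb \<rho>[of n] in auto)
  have a1: "a < 1"
  proof -
    have "(4::real) powr - q < 4 powr 0" using q by (intro powr_less_mono) auto
    then show ?thesis by (simp add: a_def)
  qed
  have Fh0: "(\<lambda>n. qint M q (\<lambda>x. F x - h n x)) \<longlonglongrightarrow> 0"
  proof (rule tendsto_sandwich[OF _ _ tendsto_const])
    show "\<forall>\<^sub>F n in sequentially. qint M q (\<lambda>x. F x - h n x) \<le> ennreal (2 powr q * 2 * a ^ n)"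
    proof (intro always_eventually allI)
      fix n
      have "2 powr q * 2 * \<rho> n \<le> 2 powr q * 2 * a ^ n"
        using \<rho>le[of 0 n] by (simp add: \<rho>0)
      with Fh[of n] show "qint M q (\<lambda>x. F x - h n x) \<le> ennreal (2 powr q * 2 * a ^ n)"
        by (meson ennreal_leI order_trans)
    qed
    show "(\<lambda>n. ennreal (2 powr q * 2 * a ^ n)) \<longlonglongrightarrow> 0"
      using a a1 by (intro tendsto_ennreal_geometric_0) auto
  qed simp
  have FL: "F \<in> L" by (rule lq_closedD(6)[OF L hL F(1) Fh0])
  \<comment> \<open>The common point \<open>F\<close> of the balls has an exact solution, whose size
    is below some \<open>n\<close>; yet \<open>F\<close> lies in the ball missed at stage
    \<open>n\<close>.\<close>
  then obtain z where z: "z \<in> G" "AE x in M. \<Lambda> x (z x) = F x" using solve by blast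
  obtain w where "0 \<le> w" "qint M q z = ennreal w"
    using lq_closedD(2)[OF G z(1)] by (cases "qint M q z") auto
  moreover obtain n :: nat where "w \<le> n" using real_arch_simple by blast
  ultimately have n: "qint M q z \<le> of_nat n"
    by (metis ennreal_leI ennreal_of_nat_eq_real_of_nat)
  have "qint M q (\<lambda>x. h (Suc n) x - \<Lambda> x (z x)) = qint M q (\<lambda>x. F x - h (Suc n) x)"
    unfolding qint_minus_commute[of M q F] by (rule qint_cong_AE, use z(2) in eventually_elim) simp
  also have "\<dots> \<le> ennreal (2 powr q * 2 * \<rho> (Suc n))" by (rule Fh)
  also have "\<dots> \<le> ennreal (E n (h n) (\<rho> n) / 2)"
  proof (rule ennreal_leI)
    have "\<rho> (Suc n) \<le> E n (h n) (\<rho> n) * \<kappa>" by (simp add: \<rho>S)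
    then have "2 powr q * 2 * \<rho> (Suc n) \<le> 2 powr q * 2 * (E n (h n) (\<rho> n) * \<kappa>)"
      by (intro mult_left_mono) auto
    then show "2 powr q * 2 * \<rho> (Suc n) \<le> E n (h n) (\<rho> n) / 2" by (simp add: \<kappa>_def)
  qed
  also have "\<dots> < ennreal (E n (h n) (\<rho> n))"
    using NE(2)[OF hL \<rho>] by (intro ennreal_lessI) auto
  finally have "P n (h (Suc n)) (E n (h n) (\<rho> n))" unfolding P_def using n z(1) by blast
  then show False using NE(4)[OF hL \<rho>] unfolding hS by blast
qed

text \<open>The open mapping theorem. \<open>Baire_solve\<close> gives approximate solutions of
  bounded size near some \<open>f0\<close>; those for \<open>f0 + s f\<close> and for
  \<open>f0\<close>, subtracted and divided by \<open>s\<close>, solve approximately for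
  \<open>f\<close>, and \<open>approx_solve\<close> removes the error.\<close>

lemma (in complete_measure) bounded_solve:
  fixes \<Lambda> :: "'a \<Rightarrow> 'c::banach \<Rightarrow> 'e::banach"
  assumes q: "1 \<le> q" and G: "lq_closed M q G" and L: "lq_closed M q L"
    and lin: "\<And>x. linear (\<Lambda> x)" and bd: "\<And>x y. norm (\<Lambda> x y) \<le> K * norm y" "0 \<le> K"
    and maps: "\<And>z. z \<in> G \<Longrightarrow> (\<lambda>x. \<Lambda> x (z x)) \<in> L"
    and solve: "\<And>f. f \<in> L \<Longrightarrow> \<exists>z\<in>G. AE x in M. \<Lambda> x (z x) = f x"
  shows "\<exists>m\<ge>0. \<forall>f\<in>L. \<exists>z\<in>G. (AE x in M. \<Lambda> x (z x) = f x) \<and> qint M q z \<le> ennreal m * qint M q f"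
proof -
  obtain n :: nat and f0 r where f0: "f0 \<in> L" and r: "0 < r" and
    P: "\<And>f e. f \<in> L \<Longrightarrow> qint M q (\<lambda>x. f x - f0 x) \<le> ennreal r \<Longrightarrow> 0 < e \<Longrightarrow>
      \<exists>z\<in>G. qint M q z \<le> of_nat n \<and> qint M q (\<lambda>x. f x - \<Lambda> x (z x)) < ennreal e"
    using Baire_solve[OF q G L maps solve] by blast
  \<comment> \<open>Two solutions of size \<open>n\<close> have a difference of size at most
    \<open>2 powr q * (2 * n)\<close>; rescaling multiplies by \<open>a / r\<close>, where
    \<open>a\<close> is the size of \<open>f\<close>.\<close>
  define m where "m = 2 powr q * (2 * real n) / r"
  have m: "0 \<le> m" using r by (simp add: m_def)
  \<comment> \<open>Calibrated so that two errors \<open>e\<close>, the factor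
    \<open>2 powr q\<close> and the rescaling by \<open>a / r\<close> leave exactly
    \<open>4 powr - q * a\<close>.\<close>
  define e where "e = r * 4 powr - q / (2 powr q * 2)"
  have e: "0 < e" using r by (simp add: e_def)
  have approx: "\<exists>z\<in>G. qint M q z \<le> ennreal m * qint M q f \<and>
      qint M q (\<lambda>x. f x - \<Lambda> x (z x)) \<le> ennreal (4 powr - q) * qint M q f" if f: "f \<in> L" for f
  proof -
    obtain a where a: "0 \<le> a" "qint M q f = ennreal a"
      using lq_closedD(2)[OF L f] by (cases "qint M q f") auto
    show ?thesis
    proof (cases "a = 0")
      \<comment> \<open>A null function cannot be scaled up to the radius \<open>r\<close>; here the
        zero solution serves.\<close>
      case True
      show ?thesis
        by (rule bexI[OF _ lq_closedD(3)[OF G]]) (use a True q in \<open>simp add: linear_0[OF lin] qint_def\<close>)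
    next
      case False
      with a have a0: "0 < a" by simp
      \<comment> \<open>This scaling places \<open>f0 + s f\<close> at distance exactly
        \<open>r\<close> from \<open>f0\<close>, measured by \<open>qint\<close>.\<close>
      define s where "s = (r / a) powr (1 / q)"
      have s: "0 < s" "s powr q = r / a" using q r a0 by (simp_all add: s_def powr_powr)
      have inv_s: "\<bar>1 / s\<bar> powr q = a / r" using s r a0 by (simp add: powr_divide)
      define g where "g = (\<lambda>x. f0 x + s *\<^sub>R f x)"
      have gL: "g \<in> L" unfolding g_def by (intro lq_closedD(4,5)[OF L] f0 f)
      have "qint M q (\<lambda>x. g x - f0 x) = ennreal (s powr q) * qint M q f"
        using qint_scaleR[OF lq_closedD(1)[OF L f], of q s] q s by (simp add: g_def)
      also have "\<dots> = ennreal r" using s a a0 r by (simp add: ennreal_mult[symmetric])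
      finally have "qint M q (\<lambda>x. g x - f0 x) \<le> ennreal r" by simp
      from P[OF gL this e] obtain z1 where z1: "z1 \<in> G" "qint M q z1 \<le> of_nat n"
        "qint M q (\<lambda>x. g x - \<Lambda> x (z1 x)) < ennreal e" by blast
      have "qint M q (\<lambda>x. f0 x - f0 x) \<le> ennreal r" using q by (simp add: qint_def)
      from P[OF f0 this e] obtain z2 where z2: "z2 \<in> G" "qint M q z2 \<le> of_nat n"
        "qint M q (\<lambda>x. f0 x - \<Lambda> x (z2 x)) < ennreal e" by blast
      define z where "z = (\<lambda>x. (1 / s) *\<^sub>R (z1 x - z2 x))"
      have dG: "(\<lambda>x. z1 x - z2 x) \<in> G" by (intro lq_closed_diff[OF G] z1 z2)
      have zG: "z \<in> G" unfolding z_def by (rule lq_closedD(5)[OF G dG])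
      have "qint M q z1 + qint M q z2 \<le> ennreal (2 * real n)"
        using add_mono[OF z1(2) z2(2)] by (simp add: ennreal_of_nat_eq_real_of_nat flip: ennreal_plus)
      then have "qint M q (\<lambda>x. z1 x - z2 x) \<le> ennreal (2 powr q) * ennreal (2 * real n)"
        using q by (intro order_trans[OF qint_diff mult_left_mono] lq_closedD(1)[OF G] z1 z2) auto
      then have "ennreal (a / r) * qint M q (\<lambda>x. z1 x - z2 x) \<le>
          ennreal (a / r) * (ennreal (2 powr q) * ennreal (2 * real n))"
        by (rule mult_left_mono) simp
      also have "\<dots> = ennreal m * qint M q f"
        using r a by (simp add: m_def ennreal_mult[symmetric] mult_ac)
      finally have 1: "qint M q z \<le> ennreal m * qint M q f"
        unfolding z_def using qint_scaleR[OF lq_closedD(1)[OF G dG], of q "1 / s"] q by (simp only: inv_s)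
      define w1 where "w1 = (\<lambda>x. g x - \<Lambda> x (z1 x))"
      define w2 where "w2 = (\<lambda>x. f0 x - \<Lambda> x (z2 x))"
      have wL: "w1 \<in> L" "w2 \<in> L" unfolding w1_def w2_def by (intro lq_closed_diff[OF L] gL f0 maps z1 z2)+
      have wd: "(\<lambda>x. w1 x - w2 x) \<in> L" by (rule lq_closed_diff[OF L wL])
      have "(\<lambda>x. f x - \<Lambda> x (z x)) = (\<lambda>x. (1 / s) *\<^sub>R (w1 x - w2 x))"
        using s by (auto simp: w1_def w2_def z_def g_def linear_cmul[OF lin] linear_diff[OF lin] algebra_simps)
      then have eq: "qint M q (\<lambda>x. f x - \<Lambda> x (z x)) = ennreal (a / r) * qint M q (\<lambda>x. w1 x - w2 x)"
        using qint_scaleR[OF lq_closedD(1)[OF L wd], of q "1 / s"] q by (simp only: inv_s)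
      have "qint M q w1 + qint M q w2 \<le> ennreal e + ennreal e"
        using z1(3) z2(3) unfolding w1_def w2_def by (intro add_mono) auto
      then have "qint M q (\<lambda>x. w1 x - w2 x) \<le> ennreal (2 powr q) * (ennreal e + ennreal e)"
        using q by (intro order_trans[OF qint_diff mult_left_mono] lq_closedD(1)[OF L] wL) auto
      then have "ennreal (a / r) * qint M q (\<lambda>x. w1 x - w2 x) \<le>
          ennreal (a / r) * (ennreal (2 powr q) * (ennreal e + ennreal e))"
        by (rule mult_left_mono) simp
      also have "\<dots> = ennreal (4 powr - q) * qint M q f"
        using a r e by (simp add: e_def ennreal_mult[symmetric] flip: ennreal_plus)
      finally have 2: "qint M q (\<lambda>x. f x - \<Lambda> x (z x)) \<le> ennreal (4 powr - q) * qint M q f"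
        unfolding eq .
      show ?thesis using zG 1 2 by blast
    qed
  qed
  show ?thesis
    by (rule exI[of _ "2 powr q * 2 * m"])
       (use m in \<open>auto intro!: approx_solve[OF q G L lin bd maps approx m]\<close>)
qed

text \<open>A Neumann series in disguise: the exact solution for \<open>\<Lambda>\<close> solves for
  \<open>\<Lambda>'\<close> up to the factor \<open>\<kappa> powr q * m\<close>, and this is the
  contraction rate that \<open>approx_solve\<close> tolerates.\<close>

lemma (in complete_measure) perturb_solve:
  fixes \<Lambda> \<Lambda>' :: "'a \<Rightarrow> 'c::banach \<Rightarrow> 'e::banach"
  assumes q: "1 \<le> q" and G: "lq_closed M q G" and L: "lq_closed M q L"
    and lin: "\<And>x. linear (\<Lambda>' x)" and bd: "\<And>x y. norm (\<Lambda>' x y) \<le> K * norm y" "0 \<le> K"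
    and maps: "\<And>z. z \<in> G \<Longrightarrow> (\<lambda>x. \<Lambda>' x (z x)) \<in> L"
    and solve: "\<And>f. f \<in> L \<Longrightarrow> \<exists>z\<in>G. (AE x in M. \<Lambda> x (z x) = f x) \<and> qint M q z \<le> ennreal m * qint M q f"
    and m: "0 \<le> m" and close: "\<And>x y. norm (\<Lambda> x y - \<Lambda>' x y) \<le> \<kappa> * norm y" "0 \<le> \<kappa>" "\<kappa> powr q * m \<le> 4 powr - q"
    and f: "f \<in> L"
  shows "\<exists>z\<in>G. AE x in M. \<Lambda>' x (z x) = f x"
proof -
  have "\<exists>z\<in>G. qint M q z \<le> ennreal m * qint M q f \<and>
      qint M q (\<lambda>x. f x - \<Lambda>' x (z x)) \<le> ennreal (4 powr - q) * qint M q f" if "f \<in> L" for f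
  proof -
    from solve[OF that] obtain z where z: "z \<in> G" "AE x in M. \<Lambda> x (z x) = f x"
      "qint M q z \<le> ennreal m * qint M q f" by blast
    have "qint M q (\<lambda>x. f x - \<Lambda>' x (z x)) \<le> ennreal (\<kappa> powr q) * qint M q z"
    proof (rule qint_bound)
      show "AE x in M. norm (f x - \<Lambda>' x (z x)) \<le> \<kappa> * norm (z x)"
        using z(2) by eventually_elim (metis close(1))
    qed (use q close lq_closedD(1)[OF G z(1)] in auto)
    also have "\<dots> \<le> ennreal (\<kappa> powr q) * (ennreal m * qint M q f)" by (rule mult_left_mono[OF z(3)]) simp
    also have "\<dots> = ennreal (\<kappa> powr q * m) * qint M q f" using m by (simp add: ennreal_mult mult.assoc)
    also have "\<dots> \<le> ennreal (4 powr - q) * qint M q f" by (intro mult_right_mono ennreal_leI close) simp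
    finally show ?thesis using z by blast
  qed
  from approx_solve[OF q G L lin bd maps this m f] show ?thesis by blast
qed

section \<open>Spaces given by a carrier and a norm, and their common Banach type\<close>

lemma scaleC_zero_left [simp]: "0 *\<^sub>C x = (0 :: 'a::complex_vector)"
  using scaleR_scaleC[of 0 x] by simp

context
  fixes X :: "'a::complex_vector nspace"
  assumes X: "complex_banach X"
begin

lemma banach_zero: "0 \<in> carr X"
  and banach_add: "x \<in> carr X \<Longrightarrow> y \<in> carr X \<Longrightarrow> x + y \<in> carr X"
  and banach_scaleR: "x \<in> carr X \<Longrightarrow> r *\<^sub>R x \<in> carr X"
  and nrm_nonneg: "x \<in> carr X \<Longrightarrow> 0 \<le> nrm X x"
  and nrm_eq_0: "x \<in> carr X \<Longrightarrow> nrm X x = 0 \<longleftrightarrow> x = 0"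
  and nrm_scaleR: "x \<in> carr X \<Longrightarrow> nrm X (r *\<^sub>R x) = \<bar>r\<bar> * nrm X x"
  and nrm_triangle: "x \<in> carr X \<Longrightarrow> y \<in> carr X \<Longrightarrow> nrm X (x + y) \<le> nrm X x + nrm X y"
  and banach_mcomplete: "Metric_space.mcomplete (carr X) (ndist X)"
  using X unfolding complex_banach_def by (auto simp: scaleR_scaleC)

lemma nrm_zero: "nrm X 0 = 0"
  using nrm_eq_0[OF banach_zero] by simp

lemma banach_minus: "x \<in> carr X \<Longrightarrow> - x \<in> carr X"
  using banach_scaleR[of x "-1"] by simp

lemma banach_diff: "x \<in> carr X \<Longrightarrow> y \<in> carr X \<Longrightarrow> x - y \<in> carr X"
  using banach_add[of x "- y"] banach_minus[of y] by simp

lemma nrm_minus: "x \<in> carr X \<Longrightarrow> nrm X (- x) = nrm X x"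
  using nrm_scaleR[of x "-1"] by simp

lemma nrm_diff_commute: "x \<in> carr X \<Longrightarrow> y \<in> carr X \<Longrightarrow> nrm X (x - y) = nrm X (y - x)"
  using nrm_minus[OF banach_diff, of x y] by simp

lemma banach_Metric_space: "Metric_space (carr X) (ndist X)"
proof
  show "0 \<le> ndist X x y" for x y by (auto simp: ndist_def nrm_nonneg banach_diff)
  show "ndist X x y = ndist X y x" for x y by (auto simp: ndist_def nrm_diff_commute)
  show "ndist X x y = 0 \<longleftrightarrow> x = y" if "x \<in> carr X" "y \<in> carr X" for x y
    using that by (simp add: ndist_def nrm_eq_0 banach_diff)
  show "ndist X x z \<le> ndist X x y + ndist X y z" if "x \<in> carr X" "y \<in> carr X" "z \<in> carr X" for x y z
    using that nrm_triangle[OF banach_diff banach_diff, of x y y z] by (simp add: ndist_def)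
qed

lemma banach_complete:
  assumes s: "\<And>n. s n \<in> carr X"
    and C: "\<And>e. 0 < e \<Longrightarrow> \<exists>N. \<forall>m\<ge>N. \<forall>n\<ge>N. nrm X (s m - s n) < e"
  shows "\<exists>x\<in>carr X. (\<lambda>n. nrm X (s n - x)) \<longlonglongrightarrow> 0"
proof -
  interpret Metric_space "carr X" "ndist X" by (rule banach_Metric_space)
  have "MCauchy s"
    unfolding MCauchy_def using s C by (auto simp: ndist_def)
  then obtain x where "limitin mtopology s x sequentially"
    using banach_mcomplete unfolding mcomplete_def by blast
  then have "x \<in> carr X" "(\<lambda>n. ndist X (s n) x) \<longlonglongrightarrow> 0"
    by (simp_all add: limitin_metric_dist_null)
  then show ?thesis using s by (auto simp: ndist_def)
qed

end

text \<open>The \<open>\<ell>\<^sup>\<infinity>\<close>-sum of all Banach spaces carried by subspaces of \<open>'a\<close>: one Banach space, as a type,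
  into which each of them embeds isometrically as a complemented subspace.\<close>

typedef (overloaded) ('a::complex_vector) bsum =
  "{f :: 'a nspace \<Rightarrow> 'a. (\<forall>X. if complex_banach X then f X \<in> carr X else f X = 0) \<and>
      (\<exists>C. \<forall>X. complex_banach X \<longrightarrow> nrm X (f X) \<le> C)}"
  morphisms bproj Abs_bsum
  by (rule exI[of _ "\<lambda>_. 0"]) (auto simp: banach_zero nrm_zero)

lemma bproj_carr: "complex_banach X \<Longrightarrow> bproj f X \<in> carr X"
  and bproj_outside: "\<not> complex_banach X \<Longrightarrow> bproj f X = 0"
  and bproj_bounded: "\<exists>C. \<forall>X. complex_banach X \<longrightarrow> nrm X (bproj f X) \<le> C"
  using bproj[of f] by (auto split: if_splits)

lemma bsum_eqI: "(\<And>X. complex_banach X \<Longrightarrow> bproj f X = bproj g X) \<Longrightarrow> f = g"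
  by (metis bproj_inject bproj_outside ext)

lemma Abs_bsum_inverse':
  assumes "\<And>X. complex_banach X \<Longrightarrow> f X \<in> carr X" "\<And>X. \<not> complex_banach X \<Longrightarrow> f X = 0"
    and "\<And>X. complex_banach X \<Longrightarrow> nrm X (f X) \<le> C"
  shows "bproj (Abs_bsum f) = f"
  by (rule Abs_bsum_inverse) (use assms in auto)

instantiation bsum :: (complex_vector) real_vector
begin

definition "0 = Abs_bsum (\<lambda>_. 0 :: 'a)"
definition "f + g = Abs_bsum (\<lambda>X. bproj f X + bproj g X :: 'a)"
definition "r *\<^sub>R f = Abs_bsum (\<lambda>X. r *\<^sub>R bproj f X :: 'a)"
definition "- f = Abs_bsum (\<lambda>X. - bproj f X :: 'a)"
definition "f - g = Abs_bsum (\<lambda>X. bproj f X - bproj g X :: 'a)"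

lemma bproj_zero: "bproj 0 X = 0"
  unfolding zero_bsum_def by (subst Abs_bsum_inverse'[of _ 0]) (auto simp: banach_zero nrm_zero)

lemma bproj_add: "bproj (f + g) X = bproj f X + bproj g X"
proof -
  obtain C D where "\<And>X. complex_banach X \<Longrightarrow> nrm X (bproj f X) \<le> C"
    "\<And>X. complex_banach X \<Longrightarrow> nrm X (bproj g X) \<le> D" using bproj_bounded by metis
  then show ?thesis unfolding plus_bsum_def
    by (subst Abs_bsum_inverse'[of _ "C + D"])
       (auto simp: banach_add bproj_carr bproj_outside intro: order_trans[OF nrm_triangle add_mono])
qed

lemma bproj_scaleR: "bproj (r *\<^sub>R f) X = r *\<^sub>R bproj f X"
proof -
  obtain C where "\<And>X. complex_banach X \<Longrightarrow> nrm X (bproj f X) \<le> C" using bproj_bounded by metis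
  then show ?thesis unfolding scaleR_bsum_def
    by (subst Abs_bsum_inverse'[of _ "\<bar>r\<bar> * C"])
       (auto simp: banach_scaleR bproj_carr bproj_outside nrm_scaleR intro: mult_left_mono)
qed

lemma bproj_minus: "bproj (- f) X = - bproj f X"
proof -
  have "- f = (-1) *\<^sub>R f" unfolding uminus_bsum_def scaleR_bsum_def by simp
  then show ?thesis by (simp add: bproj_scaleR)
qed

lemma bproj_diff: "bproj (f - g) X = bproj f X - bproj g X"
proof -
  have "f - g = f + (- g)" unfolding minus_bsum_def plus_bsum_def bproj_minus by simp
  then show ?thesis by (simp add: bproj_add bproj_minus)
qed

instance
  by standard (auto intro!: bsum_eqI simp: bproj_zero bproj_add bproj_scaleR bproj_minus bproj_diff
      algebra_simps)

end

lemmas bproj_simps = bproj_zero bproj_add bproj_scaleR bproj_minus bproj_diff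

instantiation bsum :: (complex_vector) real_normed_vector
begin

definition "norm f = (SUP X. if complex_banach X then nrm X (bproj f X :: 'a) else 0)"
definition "dist f g = norm (f - g :: 'a bsum)"
definition "sgn f = inverse (norm f) *\<^sub>R (f :: 'a bsum)"
definition [code del]: "uniformity = (INF e\<in>{0 <..}. principal {(f, g :: 'a bsum). dist f g < e})"
definition [code del]: "open U = (\<forall>x\<in>U. \<forall>\<^sub>F (x', y) in uniformity. x' = x \<longrightarrow> y \<in> (U :: 'a bsum set))"

lemma bsum_bdd: "bdd_above (range (\<lambda>X. if complex_banach X then nrm X (bproj f X) else 0))"
proof -
  obtain C where "\<And>X. complex_banach X \<Longrightarrow> nrm X (bproj f X) \<le> C" using bproj_bounded by metis
  then show ?thesis by (intro bdd_aboveI[of _ "max C 0"]) (auto split: if_splits simp: le_max_iff_disj)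
qed

lemma nrm_bproj_le: "complex_banach X \<Longrightarrow> nrm X (bproj f X) \<le> norm f"
  unfolding norm_bsum_def using cSUP_upper[OF UNIV_I bsum_bdd[of f], of X] by simp

lemma norm_bsum_leI:
  assumes "0 \<le> C" "\<And>X. complex_banach X \<Longrightarrow> nrm X (bproj f X) \<le> C"
  shows "norm f \<le> C"
  unfolding norm_bsum_def by (rule cSUP_least) (use assms in auto)

lemma norm_bsum_nonneg: "0 \<le> norm (f :: 'a bsum)"
proof -
  define X where "X = (undefined :: 'a nspace)"
  have "(if complex_banach X then nrm X (bproj f X) else 0) \<le> norm f"
    unfolding norm_bsum_def by (rule cSUP_upper[OF UNIV_I bsum_bdd])
  then show ?thesis
    by (auto split: if_splits dest: order_trans[OF nrm_nonneg[OF _ bproj_carr]])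
qed

instance
proof
  fix f g :: "'a bsum" and r :: real
  show "norm f = 0 \<longleftrightarrow> f = 0"
  proof
    assume "norm f = 0"
    then have "complex_banach X \<Longrightarrow> nrm X (bproj f X) = 0" for X
      using nrm_bproj_le[of X f] nrm_nonneg[OF _ bproj_carr, of X f] by fastforce
    then show "f = 0" by (auto intro!: bsum_eqI simp: nrm_eq_0 bproj_carr bproj_zero)
  next
    assume "f = 0"
    then have "norm f \<le> 0" by (intro norm_bsum_leI) (auto simp: bproj_zero nrm_zero)
    then show "norm f = 0" using norm_bsum_nonneg[of f] by simp
  qed
  show "norm (f + g) \<le> norm f + norm g"
    by (rule norm_bsum_leI)
       (auto simp: bproj_add norm_bsum_nonneg bproj_carr nrm_bproj_le
         intro: order_trans[OF nrm_triangle add_mono])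
  have le: "norm (r *\<^sub>R f) \<le> \<bar>r\<bar> * norm f" for r and f :: "'a bsum"
    by (rule norm_bsum_leI)
       (auto simp: bproj_scaleR norm_bsum_nonneg bproj_carr nrm_bproj_le nrm_scaleR intro: mult_left_mono)
  show "norm (r *\<^sub>R f) = \<bar>r\<bar> * norm f"
  proof (cases "r = 0")
    case True
    then show ?thesis using le[of r f] norm_bsum_nonneg[of "r *\<^sub>R f"] by simp
  next
    case False
    have "\<bar>r\<bar> * norm ((1 / r) *\<^sub>R (r *\<^sub>R f)) \<le> \<bar>r\<bar> * (\<bar>1 / r\<bar> * norm (r *\<^sub>R f))"
      by (rule mult_left_mono[OF le]) simp
    then have "\<bar>r\<bar> * norm f \<le> norm (r *\<^sub>R f)" using False by (simp add: abs_mult[symmetric])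
    with le[of r f] show ?thesis by simp
  qed
qed (rule dist_bsum_def sgn_bsum_def uniformity_bsum_def open_bsum_def)+

end

text \<open>Limits are taken in each component; the Cauchy bound, uniform over the components, makes
  the family of limits bounded and the convergence uniform.\<close>

instance bsum :: (complex_vector) banach
proof
  fix s :: "nat \<Rightarrow> 'a bsum" assume "Cauchy s"
  then have C: "\<exists>N. \<forall>m\<ge>N. \<forall>n\<ge>N. norm (s m - s n) < e" if "0 < e" for e
    using that unfolding Cauchy_iff by blast
  have "\<exists>x\<in>carr X. (\<lambda>n. nrm X (bproj (s n) X - x)) \<longlonglongrightarrow> 0" if X: "complex_banach X" for X
  proof (rule banach_complete[OF X])
    fix e :: real assume "0 < e"
    from C[OF this] obtain N where N: "\<And>m n. m \<ge> N \<Longrightarrow> n \<ge> N \<Longrightarrow> norm (s m - s n) < e" by blast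
    show "\<exists>N. \<forall>m\<ge>N. \<forall>n\<ge>N. nrm X (bproj (s m) X - bproj (s n) X) < e"
      by (rule exI[of _ N])
         (auto simp: bproj_diff[symmetric] intro!: order_le_less_trans[OF nrm_bproj_le[OF X]] N)
  qed (rule bproj_carr[OF X])
  then obtain l where l: "\<And>X. complex_banach X \<Longrightarrow> l X \<in> carr X"
    "\<And>X. complex_banach X \<Longrightarrow> (\<lambda>n. nrm X (bproj (s n) X - l X)) \<longlonglongrightarrow> 0" by metis
  \<comment> \<open>The Cauchy estimate with its second index sent to infinity; the bound
    \<open>e\<close> does not depend on the component.\<close>
  have lim: "nrm X (bproj (s m) X - l X) \<le> e"
    if X: "complex_banach X" and N: "\<And>m n. m \<ge> N \<Longrightarrow> n \<ge> N \<Longrightarrow> norm (s m - s n) < e" and m: "m \<ge> N"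
    for X N m e
  proof (rule LIMSEQ_le_const)
    show "(\<lambda>n. e + nrm X (bproj (s n) X - l X)) \<longlonglongrightarrow> e"
      using tendsto_add[OF tendsto_const l(2)[OF X], of e] by simp
    have "nrm X (bproj (s m) X - l X) \<le> e + nrm X (bproj (s n) X - l X)" if "n \<ge> N" for n
    proof -
      have "nrm X (bproj (s m) X - l X)
          \<le> nrm X (bproj (s m) X - bproj (s n) X) + nrm X (bproj (s n) X - l X)"
        using nrm_triangle[OF X banach_diff[OF X] banach_diff[OF X],
            of "bproj (s m) X" "bproj (s n) X" "bproj (s n) X" "l X"] X l(1) by (simp add: bproj_carr)
      also have "nrm X (bproj (s m) X - bproj (s n) X) \<le> norm (s m - s n)"
        unfolding bproj_diff[symmetric] by (rule nrm_bproj_le[OF X])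
      also have "\<dots> \<le> e" using N[OF m that] by simp
      finally show ?thesis by simp
    qed
    then show "\<exists>N. \<forall>n\<ge>N. nrm X (bproj (s m) X - l X) \<le> e + nrm X (bproj (s n) X - l X)" by blast
  qed
  define L where "L = Abs_bsum (\<lambda>X. if complex_banach X then l X else 0)"
  obtain N where N: "\<And>m n. m \<ge> N \<Longrightarrow> n \<ge> N \<Longrightarrow> norm (s m - s n) < 1" using C[of 1] by auto
  have L: "bproj L = (\<lambda>X. if complex_banach X then l X else 0)"
    unfolding L_def
  proof (rule Abs_bsum_inverse'[of _ "1 + norm (s N)"])
    fix X :: "'a nspace" assume X: "complex_banach X"
    have "nrm X (l X) \<le> nrm X (l X - bproj (s N) X) + nrm X (bproj (s N) X)"
      using nrm_triangle[OF X banach_diff[OF X], of "l X" "bproj (s N) X" "bproj (s N) X"]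
        X l(1) by (simp add: bproj_carr)
    also have "nrm X (l X - bproj (s N) X) \<le> 1"
      using lim[OF X N order_refl] nrm_diff_commute[OF X, of "l X" "bproj (s N) X"] l(1)[OF X] bproj_carr[OF X]
      by simp
    also have "nrm X (bproj (s N) X) \<le> norm (s N)" by (rule nrm_bproj_le[OF X])
    finally show "nrm X (if complex_banach X then l X else 0) \<le> 1 + norm (s N)" using X by simp
  qed (use l in auto)
  have "s \<longlonglongrightarrow> L"
  proof (rule LIMSEQ_I)
    fix e :: real assume e: "0 < e"
    from C[of "e / 2"] e obtain N where N: "\<And>m n. m \<ge> N \<Longrightarrow> n \<ge> N \<Longrightarrow> norm (s m - s n) < e / 2" by auto
    have "norm (s n - L) \<le> e / 2" if "n \<ge> N" for n
      by (rule norm_bsum_leI) (use e lim[OF _ N that] in \<open>auto simp: bproj_diff L\<close>)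
    then show "\<exists>N. \<forall>n\<ge>N. norm (s n - L) < e" using e by (intro exI[of _ N]) fastforce
  qed
  then show "convergent s" unfolding convergent_def by blast
qed

text \<open>The value 0 outside the carrier makes the embedding total with range in one component,
  so functions that leave the carrier on a null set cause no trouble.\<close>

definition binj :: "'a::complex_vector nspace \<Rightarrow> 'a \<Rightarrow> 'a bsum" where
  "binj X x = (if complex_banach X \<and> x \<in> carr X then Abs_bsum (\<lambda>Y. if Y = X then x else 0) else 0)"

context
  fixes X :: "'a::complex_vector nspace"
  assumes X: "complex_banach X"
begin

lemma bproj_binj_gen: "x \<in> carr X \<Longrightarrow> bproj (binj X x) Y = (if Y = X then x else 0)"
proof -
  assume x: "x \<in> carr X"
  have "bproj (Abs_bsum (\<lambda>Y. if Y = X then x else 0)) = (\<lambda>Y. if Y = X then x else 0)"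
    by (rule Abs_bsum_inverse'[of _ "nrm X x"])
       (use x X in \<open>auto simp: banach_zero nrm_zero nrm_nonneg\<close>)
  then show ?thesis using x X by (simp add: binj_def)
qed

lemma bproj_binj: "x \<in> carr X \<Longrightarrow> bproj (binj X x) X = x"
  by (simp add: bproj_binj_gen)

lemma norm_binj: "x \<in> carr X \<Longrightarrow> norm (binj X x) = nrm X x"
  using nrm_bproj_le[OF X, of "binj X x"]
  by (intro antisym norm_bsum_leI) (auto simp: bproj_binj_gen X nrm_nonneg nrm_zero)

lemma binj_add: "x \<in> carr X \<Longrightarrow> y \<in> carr X \<Longrightarrow> binj X (x + y) = binj X x + binj X y"
  by (rule bsum_eqI) (simp add: bproj_binj_gen bproj_add banach_add X)

lemma binj_diff: "x \<in> carr X \<Longrightarrow> y \<in> carr X \<Longrightarrow> binj X (x - y) = binj X x - binj X y"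
  by (rule bsum_eqI) (simp add: bproj_binj_gen bproj_diff banach_diff X)

lemma binj_scaleR: "x \<in> carr X \<Longrightarrow> binj X (r *\<^sub>R x) = r *\<^sub>R binj X x"
  by (rule bsum_eqI) (simp add: bproj_binj_gen bproj_scaleR banach_scaleR X)

lemma binj_zero: "binj X 0 = 0"
  by (rule bsum_eqI) (simp add: bproj_binj_gen bproj_zero banach_zero X)

lemma binj_inject: "x \<in> carr X \<Longrightarrow> y \<in> carr X \<Longrightarrow> binj X x = binj X y \<longleftrightarrow> x = y"
  by (metis bproj_binj)

end

section \<open>Lebesgue measure on intervals and gauge integrals\<close>

abbreviation leb_Ioo :: "real \<Rightarrow> real \<Rightarrow> real measure" where
  "leb_Ioo a b \<equiv> lebesgue_on {a<..<b}"

lemma complete_measure_lebesgue_on: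
  assumes "S \<in> sets lebesgue"
  shows "complete_measure (lebesgue_on S)"
proof
  fix A B :: "'a set" assume "B \<subseteq> A" "A \<in> null_sets (lebesgue_on S)"
  then have "A \<in> null_sets lebesgue" "A \<subseteq> S"
    using assms by (auto simp: null_sets_restrict_space)
  with \<open>B \<subseteq> A\<close> have "B \<in> sets lebesgue" "B \<subseteq> S"
    using complete_measure.complete[OF completion.complete_measure_axioms] by auto
  then show "B \<in> sets (lebesgue_on S)"
    using assms by (auto simp: sets_restrict_space_iff)
qed

lemma complete_leb_Ioo: "complete_measure (leb_Ioo a b)"
  by (rule complete_measure_lebesgue_on) simp

lemma finite_leb_Ioo: "finite_measure (leb_Ioo a b)"
  by (rule finite_measure_lebesgue_on) (simp add: lmeasurable_interval)

lemma emeasure_leb_Ioo_finite: "emeasure (leb_Ioo a b) A \<noteq> \<infinity>"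
  using finite_measure.emeasure_finite[OF finite_leb_Ioo] by (simp add: infinity_ennreal_def)

lemma qint_1: "qint M 1 f = (\<integral>\<^sup>+ x. ennreal (norm (f x)) \<partial>M)"
  unfolding qint_def by simp

text \<open>A substitute for Young's and Hoelder's inequalities: if \<open>x\<close> exceeds
  \<open>e\<close>, then \<open>x = x powr (1 - q) * x powr q\<close>, and the first factor
  decreases in \<open>x\<close>. It yields that L^q lies in L^1 on bounded intervals, and later
  Hardy's inequality.\<close>

lemma le_power_weighted:
  fixes x e q :: real
  assumes "0 \<le> x" "0 < e" "1 \<le> q"
  shows "x \<le> e + e powr (1 - q) * x powr q"
proof (cases "x \<le> e")
  case False
  then have x: "0 < x" "e \<le> x" using assms by auto
  have "x powr 1 = x powr (1 - q) * x powr q" by (simp add: powr_add[symmetric])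
  also have "\<dots> \<le> e powr (1 - q) * x powr q"
    using x assms by (intro mult_right_mono powr_mono2') auto
  finally show ?thesis using x assms by simp
qed (simp add: add_increasing2)

lemma (in complete_measure) qint_1_le:
  assumes q: "1 \<le> q" and f: "smeas M f" and e: "0 < e"
  shows "qint M 1 f \<le> ennreal e * emeasure M (space M) + ennreal (e powr (1 - q)) * qint M q f"
proof -
  note [measurable] = smeas_norm_measurable[OF f]
  have "qint M 1 f \<le> (\<integral>\<^sup>+ x. ennreal e + ennreal (e powr (1 - q)) * ennreal (norm (f x) powr q) \<partial>M)"
    unfolding qint_1 using e
    by (intro nn_integral_mono) (use q in \<open>simp add: le_power_weighted ennreal_mult[symmetric] ennreal_leI flip: ennreal_plus\<close>)
  also have "\<dots> = ennreal e * emeasure M (space M) + ennreal (e powr (1 - q)) * qint M q f"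
    unfolding qint_def by (simp add: nn_integral_add nn_integral_cmult)
  finally show ?thesis .
qed

lemma qint_1_finite:
  assumes "1 \<le> q" "smeas (leb_Ioo a b) f" "qint (leb_Ioo a b) q f < \<infinity>"
  shows "qint (leb_Ioo a b) 1 f < \<infinity>"
proof -
  interpret complete_measure "leb_Ioo a b" by (rule complete_leb_Ioo)
  have "qint (leb_Ioo a b) 1 f \<le> emeasure (leb_Ioo a b) (space (leb_Ioo a b)) + qint (leb_Ioo a b) q f"
    using qint_1_le[OF assms(1,2), of 1] by simp
  also have "\<dots> < \<infinity>"
    using assms(3) emeasure_leb_Ioo_finite[of a b] by (simp add: less_top)
  finally show ?thesis .
qed

text \<open>Approximants are truncated so that dominated convergence applies.\<close>

lemma (in complete_measure) smeas_L1_approx: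
  fixes f :: "'a \<Rightarrow> 'b::real_normed_vector"
  assumes f: "smeas M f" and fin: "qint M 1 f < \<infinity>"
  obtains s where "\<And>n. simple_function M (s n)" "(\<lambda>n. qint M 1 (\<lambda>x. f x - s n x)) \<longlonglongrightarrow> 0"
proof -
  obtain r where r: "\<And>n. simple_function M (r n)" "AE x in M. (\<lambda>n. r n x) \<longlonglongrightarrow> f x"
    using f unfolding smeas_def by blast
  \<comment> \<open>Truncation at \<open>2 * norm (f x)\<close> gives the integrable bound
    \<open>3 * norm (f x)\<close> for the error. It is eventually inactive where
    \<open>f x \<noteq> 0\<close>, and gives the exact value 0 where \<open>f x = 0\<close>.\<close>
  define s where "s n x = (if norm (r n x) \<le> 2 * norm (f x) then r n x else 0)" for n x
  note [measurable] = smeas_norm_measurable[OF f]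
  have s: "simple_function M (s n)" for n
  proof -
    have [measurable]: "(\<lambda>x. norm (r n x)) \<in> borel_measurable M"
      by (rule borel_measurable_simple_function) (rule simple_function_compose1[OF r(1)])
    show ?thesis unfolding s_def by (intro simple_function_If r) auto
  qed
  have [measurable]: "(\<lambda>x. norm (f x - s n x)) \<in> borel_measurable M" for n
    by (intro smeas_norm_measurable smeas_diff f smeas_simple s)
  have "(\<lambda>n. \<integral>\<^sup>+ x. ennreal (norm (f x - s n x)) \<partial>M) \<longlonglongrightarrow> (\<integral>\<^sup>+ x. 0 \<partial>M)"
  proof (rule nn_integral_dominated_convergence[where w = "\<lambda>x. 3 * ennreal (norm (f x))"])
    have "norm (f x - s n x) \<le> 3 * norm (f x)" for n x
      using norm_triangle_ineq4[of "f x" "s n x"] by (auto simp: s_def)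
    then have "ennreal (norm (f x - s n x)) \<le> ennreal (3 * norm (f x))" for n x
      by (rule ennreal_leI)
    then show "AE x in M. ennreal (norm (f x - s j x)) \<le> 3 * ennreal (norm (f x))" for j
      by (simp add: ennreal_mult)
    show "(\<integral>\<^sup>+ x. 3 * ennreal (norm (f x)) \<partial>M) < \<infinity>"
      using fin by (simp add: qint_1 nn_integral_cmult ennreal_mult_less_top)
    show "AE x in M. (\<lambda>n. ennreal (norm (f x - s n x))) \<longlonglongrightarrow> 0"
      using r(2)
    proof eventually_elim
      fix x assume x: "(\<lambda>n. r n x) \<longlonglongrightarrow> f x"
      have "(\<lambda>n. norm (f x - s n x)) \<longlonglongrightarrow> 0"
      proof (cases "f x = 0")
        case True
        then have "s n x = 0" for n by (auto simp: s_def)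
        then show ?thesis using True by simp
      next
        case False
        have "(\<lambda>n. norm (r n x)) \<longlonglongrightarrow> norm (f x)" using x by (rule tendsto_norm)
        then have "\<forall>\<^sub>F n in sequentially. norm (r n x) < 2 * norm (f x)"
          by (rule order_tendstoD) (use False in simp)
        then have "\<forall>\<^sub>F n in sequentially. norm (f x - r n x) = norm (f x - s n x)"
          by eventually_elim (simp add: s_def)
        moreover have "(\<lambda>n. norm (f x - r n x)) \<longlonglongrightarrow> 0"
          using tendsto_norm[OF tendsto_diff[OF tendsto_const x, of "f x"]] by simp
        ultimately show ?thesis by (rule Lim_transform_eventually[rotated])
      qed
      then have "(\<lambda>n. ennreal (norm (f x - s n x))) \<longlonglongrightarrow> ennreal 0" by (rule tendsto_ennrealI)
      then show "(\<lambda>n. ennreal (norm (f x - s n x))) \<longlonglongrightarrow> 0" by simp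
    qed
  qed auto
  then have "(\<lambda>n. qint M 1 (\<lambda>x. f x - s n x)) \<longlonglongrightarrow> 0" unfolding qint_1 by simp
  with s show ?thesis by (rule that)
qed

text \<open>\<open>bsum\<close> need not be separable, so its integrals are gauge integrals. Riemann
  sums of \<open>f\<close> and \<open>g\<close> over the same division differ by at most the Riemann
  sum of the real function \<open>k\<close>, which is close to its small integral; Cauchy's
  criterion passes from \<open>g\<close> to \<open>f\<close>.\<close>

lemma integrable_on_approx:
  fixes f :: "real \<Rightarrow> 'b::banach"
  assumes approx: "\<And>e. 0 < e \<Longrightarrow> \<exists>g k. g integrable_on {a..b} \<and> k integrable_on {a..b} \<and>
      (\<forall>x\<in>{a..b}. norm (f x - g x) \<le> k x) \<and> integral {a..b} k < e"
  shows "f integrable_on {a..b}"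
  unfolding cbox_interval[symmetric] integrable_Cauchy
proof (intro allI impI)
  fix e :: real assume e: "0 < e"
  \<comment> \<open>A Riemann sum of \<open>k\<close> is below e/8 + e/8, so each of the two
    divisions costs e/4; the two sums of \<open>g\<close> differ by less than e/2.\<close>
  from approx[of "e / 8"] e obtain g k where g: "g integrable_on cbox a b" and k: "k integrable_on cbox a b"
    and le: "\<And>x. x \<in> cbox a b \<Longrightarrow> norm (f x - g x) \<le> k x" and ik: "integral (cbox a b) k < e / 8"
    by auto
  have "0 < e / 2" using e by simp
  with g obtain \<gamma>1 where \<gamma>1: "gauge \<gamma>1" "\<And>D1 D2. D1 tagged_division_of cbox a b \<Longrightarrow> \<gamma>1 fine D1 \<Longrightarrow>
      D2 tagged_division_of cbox a b \<Longrightarrow> \<gamma>1 fine D2 \<Longrightarrow>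
      norm ((\<Sum>(x, K)\<in>D1. Henstock_Kurzweil_Integration.content K *\<^sub>R g x) - (\<Sum>(x, K)\<in>D2. Henstock_Kurzweil_Integration.content K *\<^sub>R g x)) < e / 2"
    unfolding integrable_Cauchy by meson
  have "(k has_integral integral (cbox a b) k) (cbox a b)" using k by (rule integrable_integral)
  moreover have "0 < e / 8" using e by simp
  ultimately obtain \<gamma>2 where \<gamma>2: "gauge \<gamma>2" "\<And>D. D tagged_division_of cbox a b \<Longrightarrow> \<gamma>2 fine D \<Longrightarrow>
      norm ((\<Sum>(x, K)\<in>D. Henstock_Kurzweil_Integration.content K *\<^sub>R k x) - integral (cbox a b) k) < e / 8"
    unfolding has_integral by meson
  have close: "norm ((\<Sum>(x, K)\<in>D. Henstock_Kurzweil_Integration.content K *\<^sub>R f x) - (\<Sum>(x, K)\<in>D. Henstock_Kurzweil_Integration.content K *\<^sub>R g x)) < e / 4"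
    if D: "D tagged_division_of cbox a b" "\<gamma>2 fine D" for D
  proof -
    have "norm ((\<Sum>(x, K)\<in>D. Henstock_Kurzweil_Integration.content K *\<^sub>R f x) - (\<Sum>(x, K)\<in>D. Henstock_Kurzweil_Integration.content K *\<^sub>R g x))
        = norm (\<Sum>(x, K)\<in>D. Henstock_Kurzweil_Integration.content K *\<^sub>R (f x - g x))"
      by (simp add: sum_subtractf[symmetric] case_prod_unfold scaleR_diff_right)
    also have "\<dots> \<le> (\<Sum>(x, K)\<in>D. Henstock_Kurzweil_Integration.content K *\<^sub>R k x)"
    proof (rule sum_norm_le, clarify)
      fix x K assume K: "(x, K) \<in> D"
      have "x \<in> cbox a b"
        using tagged_division_ofD(2,3)[OF D(1) K] by blast
      then have "Henstock_Kurzweil_Integration.content K * norm (f x - g x) \<le> Henstock_Kurzweil_Integration.content K * k x"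
        by (intro mult_left_mono le content_pos_le)
      then show "norm (Henstock_Kurzweil_Integration.content K *\<^sub>R (f x - g x)) \<le> Henstock_Kurzweil_Integration.content K *\<^sub>R k x"
        by (simp only: norm_scaleR real_scaleR_def abs_of_nonneg content_pos_le)
    qed
    also have "\<dots> < e / 4" using order_le_less_trans[OF abs_ge_self \<gamma>2(2)[OF D, unfolded real_norm_def]] ik by linarith
    finally show ?thesis .
  qed
  show "\<exists>\<gamma>. gauge \<gamma> \<and> (\<forall>D1 D2. D1 tagged_division_of cbox a b \<and> \<gamma> fine D1 \<and>
      D2 tagged_division_of cbox a b \<and> \<gamma> fine D2 \<longrightarrow>
      norm ((\<Sum>(x, K)\<in>D1. Henstock_Kurzweil_Integration.content K *\<^sub>R f x) - (\<Sum>(x, K)\<in>D2. Henstock_Kurzweil_Integration.content K *\<^sub>R f x)) < e)"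
  proof (intro exI[of _ "\<lambda>x. \<gamma>1 x \<inter> \<gamma>2 x"] conjI allI impI)
    show "gauge (\<lambda>x. \<gamma>1 x \<inter> \<gamma>2 x)" using \<gamma>1(1) \<gamma>2(1) by (rule gauge_Int)
    fix D1 D2 assume "D1 tagged_division_of cbox a b \<and> (\<lambda>x. \<gamma>1 x \<inter> \<gamma>2 x) fine D1 \<and>
      D2 tagged_division_of cbox a b \<and> (\<lambda>x. \<gamma>1 x \<inter> \<gamma>2 x) fine D2"
    then have D: "D1 tagged_division_of cbox a b" "\<gamma>1 fine D1" "\<gamma>2 fine D1"
      "D2 tagged_division_of cbox a b" "\<gamma>1 fine D2" "\<gamma>2 fine D2"
      by (auto simp: fine_Int)
    define Sf where "Sf D = (\<Sum>(x, K)\<in>D. Henstock_Kurzweil_Integration.content K *\<^sub>R f x)" for D :: "(real \<times> real set) set"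
    define Sg where "Sg D = (\<Sum>(x, K)\<in>D. Henstock_Kurzweil_Integration.content K *\<^sub>R g x)" for D :: "(real \<times> real set) set"
    have c: "norm (Sf D1 - Sg D1) < e / 4" "norm (Sf D2 - Sg D2) < e / 4" "norm (Sg D1 - Sg D2) < e / 2"
      unfolding Sf_def Sg_def
      by (rule close[OF D(1,3)] close[OF D(4,6)] \<gamma>1(2)[OF D(1,2,4,5)])+
    have "Sf D1 - Sf D2 = (Sf D1 - Sg D1) - (Sf D2 - Sg D2) + (Sg D1 - Sg D2)" by simp
    also have "norm \<dots> \<le> norm (Sf D1 - Sg D1) + norm (Sf D2 - Sg D2) + norm (Sg D1 - Sg D2)"
      by (intro order_trans[OF norm_triangle_ineq] add_right_mono norm_triangle_ineq4)
    also have "\<dots> < e" using c by linarith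
    finally have "norm (Sf D1 - Sf D2) < e" .
    then show "norm ((\<Sum>(x, K)\<in>D1. Henstock_Kurzweil_Integration.content K *\<^sub>R f x) -
        (\<Sum>(x, K)\<in>D2. Henstock_Kurzweil_Integration.content K *\<^sub>R f x)) < e"
      unfolding Sf_def .
  qed
qed

lemma has_integral_Ioo_iff:
  fixes f :: "real \<Rightarrow> 'b::banach"
  shows "(f has_integral i) {a<..<b} \<longleftrightarrow> (f has_integral i) {a..b}"
  by (rule has_integral_spike_set_eq) (rule negligible_subset[of "{a, b}"], auto)+

lemma simple_function_has_integral:
  fixes s :: "real \<Rightarrow> 'b::banach"
  assumes s: "simple_function (leb_Ioo a b) s"
  shows "(s has_integral Bochner_Integration.simple_bochner_integral (leb_Ioo a b) s) {a..b}"
proof -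
  let ?M = "leb_Ioo a b"
  have fin: "finite (s ` {a<..<b})" using s by (simp add: simple_function_def)
  have pre: "{x \<in> space ?M. s x = y} \<in> sets ?M" for y
  proof -
    have "s -` {y} \<inter> space ?M \<in> sets ?M" using s by (rule simple_functionD)
    then show ?thesis by (simp add: vimage_def Int_def conj_commute)
  qed
  have "((\<lambda>x. \<Sum>y\<in>s ` {a<..<b}. indicator {x \<in> space ?M. s x = y} x *\<^sub>R y) has_integral
      (\<Sum>y\<in>s ` {a<..<b}. measure ?M {x \<in> space ?M. s x = y} *\<^sub>R y)) {a<..<b}"
  proof (intro has_integral_sum fin has_integral_linear[OF _ bounded_linear_scaleR_left, unfolded o_def])
    fix y
    have "integrable ?M (indicator {x \<in> space ?M. s x = y} :: real \<Rightarrow> real)"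
      using pre emeasure_leb_Ioo_finite by (simp add: less_top)
    from has_integral_integral_lebesgue_on[OF this]
    show "(indicator {x \<in> space ?M. s x = y} has_integral measure ?M {x \<in> space ?M. s x = y}) {a<..<b}"
      using pre[of y, THEN sets.sets_into_space] by (simp add: Int_absorb2)
  qed
  moreover have "(\<Sum>y\<in>s ` {a<..<b}. indicator {x \<in> space ?M. s x = y} x *\<^sub>R y) = s x" if "x \<in> {a<..<b}" for x
  proof -
    have "(\<Sum>y\<in>s ` {a<..<b}. indicator {x \<in> space ?M. s x = y} x *\<^sub>R y)
        = (\<Sum>y\<in>{s x}. indicator {x \<in> space ?M. s x = y} x *\<^sub>R y)"
      by (rule sum.mono_neutral_right) (use fin that in \<open>auto simp: indicator_def\<close>)
    also have "\<dots> = s x" using that by simp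
    finally show ?thesis .
  qed
  ultimately have "(s has_integral (\<Sum>y\<in>s ` {a<..<b}. measure ?M {x \<in> space ?M. s x = y} *\<^sub>R y)) {a<..<b}"
    by (rule has_integral_eq[rotated])
  then show ?thesis by (simp add: Bochner_Integration.simple_bochner_integral_def has_integral_Ioo_iff)
qed

lemma L1_norm_has_integral:
  fixes f :: "real \<Rightarrow> 'b::banach"
  assumes f: "smeas (leb_Ioo a b) f" and fin: "qint (leb_Ioo a b) 1 f < \<infinity>"
  shows "((\<lambda>x. norm (f x)) has_integral enn2real (qint (leb_Ioo a b) 1 f)) {a..b}"
proof -
  interpret complete_measure "leb_Ioo a b" by (rule complete_leb_Ioo)
  have "integrable (leb_Ioo a b) (\<lambda>x. norm (f x))"
    using smeas_norm_measurable[OF f] fin unfolding qint_1 by (intro integrableI_bounded) auto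
  from has_integral_integral_lebesgue_on[OF this]
  have "((\<lambda>x. norm (f x)) has_integral (LINT x|leb_Ioo a b. norm (f x))) {a<..<b}" by simp
  moreover have "(LINT x|leb_Ioo a b. norm (f x)) = enn2real (qint (leb_Ioo a b) 1 f)"
    unfolding qint_1 by (rule integral_eq_nn_integral) (use smeas_norm_measurable[OF f] in auto)
  ultimately show ?thesis by (simp add: has_integral_Ioo_iff)
qed

text \<open>A simple approximation in the mean serves as \<open>g\<close>, and the norm of the
  error, a real function of small integral, as \<open>k\<close>.\<close>

lemma L1_integrable_on:
  fixes f :: "real \<Rightarrow> 'b::banach"
  assumes f: "smeas (leb_Ioo a b) f" and fin: "qint (leb_Ioo a b) 1 f < \<infinity>"
  shows "f integrable_on {a..b}"
proof (rule integrable_on_approx)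
  interpret complete_measure "leb_Ioo a b" by (rule complete_leb_Ioo)
  fix e :: real assume e: "0 < e"
  obtain s where s: "\<And>n. simple_function (leb_Ioo a b) (s n)"
    "(\<lambda>n. qint (leb_Ioo a b) 1 (\<lambda>x. f x - s n x)) \<longlonglongrightarrow> 0"
    using smeas_L1_approx[OF f fin] by blast
  have "\<forall>\<^sub>F n in sequentially. qint (leb_Ioo a b) 1 (\<lambda>x. f x - s n x) < ennreal e"
    using s(2) by (rule order_tendstoD) (use e in simp)
  then obtain n where n: "qint (leb_Ioo a b) 1 (\<lambda>x. f x - s n x) < ennreal e"
    unfolding eventually_sequentially by blast
  have d: "smeas (leb_Ioo a b) (\<lambda>x. f x - s n x)" by (intro smeas_diff f smeas_simple s)
  have "qint (leb_Ioo a b) 1 (\<lambda>x. f x - s n x) < \<infinity>" using order_less_trans[OF n ennreal_less_top] by simp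
  from L1_norm_has_integral[OF d this]
  have "(\<lambda>x. norm (f x - s n x)) integrable_on {a..b}"
    "integral {a..b} (\<lambda>x. norm (f x - s n x)) = enn2real (qint (leb_Ioo a b) 1 (\<lambda>x. f x - s n x))"
    by (auto intro: integral_unique)
  moreover have "ennreal (enn2real (qint (leb_Ioo a b) 1 (\<lambda>x. f x - s n x))) < ennreal e"
    by (subst ennreal_enn2real) (use n order_less_trans[OF n ennreal_less_top] in simp_all)
  then have "enn2real (qint (leb_Ioo a b) 1 (\<lambda>x. f x - s n x)) < e" using e by (simp add: ennreal_less_iff)
  moreover have "s n integrable_on {a..b}" using simple_function_has_integral[OF s(1)] by blast
  ultimately show "\<exists>g k. g integrable_on {a..b} \<and> k integrable_on {a..b} \<and>
      (\<forall>x\<in>{a..b}. norm (f x - g x) \<le> k x) \<and> integral {a..b} k < e"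
    by (intro exI[of _ "s n"] exI[of _ "\<lambda>x. norm (f x - s n x)"]) auto
qed

lemma L1_norm_integral_le:
  fixes f :: "real \<Rightarrow> 'b::banach"
  assumes f: "smeas (leb_Ioo a b) f" and fin: "qint (leb_Ioo a b) 1 f < \<infinity>"
    and st: "{s..t} \<subseteq> {a..b}"
  shows "ennreal (norm (integral {s..t} f)) \<le> qint (leb_Ioo a b) 1 f"
proof -
  note n = L1_norm_has_integral[OF f fin]
  have "norm (integral {s..t} f) \<le> integral {s..t} (\<lambda>x. norm (f x))"
    using integrable_on_subinterval[OF L1_integrable_on[OF f fin] st]
      integrable_on_subinterval[OF has_integral_integrable[OF n] st]
    by (intro integral_norm_bound_integral) auto
  also have "\<dots> \<le> integral {a..b} (\<lambda>x. norm (f x))"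
    using has_integral_integrable[OF n] integrable_on_subinterval[OF has_integral_integrable[OF n] st]
    by (intro integral_subset_le st) auto
  also have "\<dots> = enn2real (qint (leb_Ioo a b) 1 f)" using n by (rule integral_unique)
  finally have "ennreal (norm (integral {s..t} f)) \<le> ennreal (enn2real (qint (leb_Ioo a b) 1 f))"
    by (rule ennreal_leI)
  also have "\<dots> = qint (leb_Ioo a b) 1 f" by (rule ennreal_enn2real) (use fin in simp)
  finally show ?thesis .
qed

subsection \<open>Change of interval\<close>

text \<open>Extension by zero to the whole line: restricting, joining and shifting intervals become
  computations with indicator functions.\<close>

lemma smeas_leb_Ioo_iff:
  "smeas (leb_Ioo a b) f \<longleftrightarrow> smeas lebesgue (\<lambda>t. indicator {a<..<b} t *\<^sub>R f t)"
proof
  have \<Omega>: "{a<..<b} \<inter> space lebesgue \<in> sets lebesgue" by simp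
  {
    assume "smeas (leb_Ioo a b) f"
    then obtain s where s: "\<And>n. simple_function (leb_Ioo a b) (s n)"
      "AE t in leb_Ioo a b. (\<lambda>n. s n t) \<longlonglongrightarrow> f t"
      unfolding smeas_def by blast
    have "AE t in lebesgue. (\<lambda>n. indicator {a<..<b} t *\<^sub>R s n t) \<longlonglongrightarrow> indicator {a<..<b} t *\<^sub>R f t"
      using s(2) unfolding AE_restrict_space_iff[OF \<Omega>] by eventually_elim (auto simp: indicator_def)
    with s(1) show "smeas lebesgue (\<lambda>t. indicator {a<..<b} t *\<^sub>R f t)"
      unfolding smeas_def simple_function_restrict_space[OF \<Omega>]
      by (intro exI[of _ "\<lambda>n t. indicator {a<..<b} t *\<^sub>R s n t"]) auto
  next
    assume "smeas lebesgue (\<lambda>t. indicator {a<..<b} t *\<^sub>R f t)"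
    then obtain s where s: "\<And>n. simple_function lebesgue (s n)"
      "AE t in lebesgue. (\<lambda>n. s n t) \<longlonglongrightarrow> indicator {a<..<b} t *\<^sub>R f t"
      unfolding smeas_def by blast
    have "simple_function (leb_Ioo a b) (s n)" for n
      unfolding simple_function_restrict_space[OF \<Omega>]
      by (rule simple_function_compose2[where h = "(*\<^sub>R)", OF simple_function_indicator s(1)]) simp
    moreover have "AE t in leb_Ioo a b. (\<lambda>n. s n t) \<longlonglongrightarrow> f t"
      using s(2) unfolding AE_restrict_space_iff[OF \<Omega>] by eventually_elim (auto simp: indicator_def)
    ultimately show "smeas (leb_Ioo a b) f" unfolding smeas_def by (intro exI[of _ s] conjI allI)
  }
qed

lemma qint_leb_Ioo_eq:
  "qint (leb_Ioo a b) q f = qint lebesgue q (\<lambda>t. indicator {a<..<b} t *\<^sub>R f t)"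
proof -
  have "qint (leb_Ioo a b) q f = (\<integral>\<^sup>+ t. ennreal (norm (f t) powr q) * indicator {a<..<b} t \<partial>lebesgue)"
    unfolding qint_def by (rule nn_integral_restrict_space) simp
  also have "\<dots> = qint lebesgue q (\<lambda>t. indicator {a<..<b} t *\<^sub>R f t)"
    unfolding qint_def by (intro nn_integral_cong) (auto simp: indicator_def)
  finally show ?thesis .
qed

lemma AE_leb_Ioo: "(AE t in leb_Ioo a b. P t) \<longleftrightarrow> (AE t in lebesgue. t \<in> {a<..<b} \<longrightarrow> P t)"
  by (rule AE_restrict_space_iff) simp

lemma AE_leb_Ioo_I: "(\<And>t. a < t \<Longrightarrow> t < b \<Longrightarrow> P t) \<Longrightarrow> AE t in leb_Ioo a b. P t"
  by (rule AE_I2) simp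

lemma AE_leb_Ioo_subset:
  "AE t in leb_Ioo a b. P t \<Longrightarrow> a \<le> c \<Longrightarrow> d \<le> b \<Longrightarrow> AE t in leb_Ioo c d. P t"
  unfolding AE_leb_Ioo by (erule eventually_mono) auto

lemma smeas_leb_Ioo_subset:
  assumes "smeas (leb_Ioo a b) f" "a \<le> c" "d \<le> b"
  shows "smeas (leb_Ioo c d) f"
proof -
  have "smeas lebesgue (\<lambda>t. indicator {c<..<d} t *\<^sub>R (indicator {a<..<b} t *\<^sub>R f t))"
    by (rule smeas_scaleR[OF borel_measurable_indicator]) (use assms(1) in \<open>simp_all add: smeas_leb_Ioo_iff\<close>)
  moreover have "(\<lambda>t. indicator {c<..<d} t *\<^sub>R (indicator {a<..<b} t *\<^sub>R f t)) = (\<lambda>t. indicator {c<..<d} t *\<^sub>R f t)"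
    using assms by (auto simp: indicator_def)
  ultimately show ?thesis by (simp add: smeas_leb_Ioo_iff)
qed

lemma qint_leb_Ioo_subset:
  assumes "a \<le> c" "d \<le> b"
  shows "qint (leb_Ioo c d) q f \<le> qint (leb_Ioo a b) q f"
  unfolding qint_leb_Ioo_eq unfolding qint_def
  by (rule nn_integral_mono) (use assms in \<open>auto simp: indicator_def\<close>)

lemma smeas_leb_Ioo_join:
  assumes "smeas (leb_Ioo a b) f" "smeas (leb_Ioo b c) f" "a \<le> b" "b \<le> c"
  shows "smeas (leb_Ioo a c) f"
proof -
  have "smeas lebesgue (\<lambda>t. indicator {a<..<b} t *\<^sub>R f t + indicator {b<..<c} t *\<^sub>R f t)"
    by (intro smeas_add) (use assms in \<open>simp_all add: smeas_leb_Ioo_iff\<close>)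
  moreover have "AE t in lebesgue. t \<noteq> b"
    using AE_lborel_singleton[of b] by (rule AE_completion)
  then have "AE t in lebesgue. indicator {a<..<b} t *\<^sub>R f t + indicator {b<..<c} t *\<^sub>R f t
      = indicator {a<..<c} t *\<^sub>R f t"
    by eventually_elim (use assms in \<open>auto simp: indicator_def\<close>)
  ultimately show ?thesis unfolding smeas_leb_Ioo_iff by (rule smeas_cong_AE)
qed

lemma AE_leb_Ioo_join:
  assumes "AE t in leb_Ioo a b. P t" "AE t in leb_Ioo b c. P t"
  shows "AE t in leb_Ioo a c. P t"
proof -
  have "AE t in lebesgue. t \<noteq> b"
    using AE_lborel_singleton[of b] by (rule AE_completion)
  then show ?thesis using assms unfolding AE_leb_Ioo by eventually_elim auto
qed

lemma qint_leb_Ioo_join: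
  assumes s: "smeas (leb_Ioo a b) f" "smeas (leb_Ioo b c) f" and q: "0 < q" and abc: "a \<le> b" "b \<le> c"
    and fin: "qint (leb_Ioo a b) q f < \<infinity>" "qint (leb_Ioo b c) q f < \<infinity>"
  shows "qint (leb_Ioo a c) q f < \<infinity>"
proof -
  have "AE t in lebesgue. t \<noteq> b"
    using AE_lborel_singleton[of b] by (rule AE_completion)
  then have "qint lebesgue q (\<lambda>t. indicator {a<..<c} t *\<^sub>R f t)
      = qint lebesgue q (\<lambda>t. indicator {a<..<b} t *\<^sub>R f t + indicator {b<..<c} t *\<^sub>R f t)"
    by (intro qint_cong_AE, eventually_elim) (use abc in \<open>auto simp: indicator_def\<close>)
  also have "\<dots> \<le> ennreal (2 powr q) * (qint lebesgue q (\<lambda>t. indicator {a<..<b} t *\<^sub>R f t)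
      + qint lebesgue q (\<lambda>t. indicator {b<..<c} t *\<^sub>R f t))"
    by (rule complete_measure.qint_add[OF completion.complete_measure_axioms])
       (use s q in \<open>simp_all add: smeas_leb_Ioo_iff\<close>)
  also have "\<dots> < \<infinity>"
    using fin unfolding qint_leb_Ioo_eq by (simp add: ennreal_mult_less_top less_top)
  finally show ?thesis unfolding qint_leb_Ioo_eq .
qed

lemma lebesgue_shift: "(\<lambda>t. h + t) \<in> lebesgue \<rightarrow>\<^sub>M lebesgue" "distr lebesgue lebesgue (\<lambda>t. h + t) = (lebesgue :: real measure)"
proof -
  show "(\<lambda>t. h + t) \<in> lebesgue \<rightarrow>\<^sub>M (lebesgue :: real measure)"
    using lebesgue_affine_measurable[of "\<lambda>_. 1" h] by simp
  show "distr lebesgue lebesgue (\<lambda>t. h + t) = (lebesgue :: real measure)"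
    using lebesgue_real_affine[of 1 h] by (simp add: density_1)
qed

lemma AE_lebesgue_shift: "AE t in lebesgue. P (h + t)" if "AE t in lebesgue. P t" for h :: real
proof (rule AE_distrD[OF lebesgue_shift(1)])
  show "AE t in distr lebesgue lebesgue (\<lambda>t. h + t). P t" unfolding lebesgue_shift(2) by (rule that)
qed

lemma smeas_shift:
  assumes "smeas (leb_Ioo a b) f"
  shows "smeas (leb_Ioo (a - h) (b - h)) (\<lambda>t. f (h + t))"
proof -
  obtain s where s: "\<And>n. simple_function lebesgue (s n)"
    "AE t in lebesgue. (\<lambda>n. s n t) \<longlonglongrightarrow> indicator {a<..<b} t *\<^sub>R f t"
    using assms unfolding smeas_leb_Ioo_iff unfolding smeas_def by (elim exE conjE) auto
  have "simple_function lebesgue (\<lambda>t. s n (h + t))" for n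
    by (rule simple_function_comp[OF lebesgue_shift(1) s(1)])
  moreover have "AE t in lebesgue. (\<lambda>n. s n (h + t)) \<longlonglongrightarrow> indicator {a<..<b} (h + t) *\<^sub>R f (h + t)"
    using s(2) by (rule AE_lebesgue_shift)
  moreover have "indicator {a<..<b} (h + t) *\<^sub>R f (h + t) = indicator {a - h<..<b - h} t *\<^sub>R f (h + t)" for t
    by (auto simp: indicator_def)
  ultimately show ?thesis
    unfolding smeas_leb_Ioo_iff unfolding smeas_def by (intro exI[of _ "\<lambda>n t. s n (h + t)"]) simp
qed

lemma qint_shift:
  assumes "smeas (leb_Ioo a b) f"
  shows "qint (leb_Ioo (a - h) (b - h)) q (\<lambda>t. f (h + t)) = qint (leb_Ioo a b) q f"
proof -
  let ?g = "\<lambda>t. ennreal (norm (indicator {a<..<b} t *\<^sub>R f t) powr q)"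
  have "?g \<in> borel_measurable lebesgue"
    using assms unfolding smeas_leb_Ioo_iff
    by (rule complete_measure.smeas_qint_measurable[OF completion.complete_measure_axioms])
  from nn_integral_real_affine_lebesgue[OF this, of 1 h]
  have "(\<integral>\<^sup>+ t. ?g t \<partial>lebesgue) = (\<integral>\<^sup>+ t. ?g (h + t) \<partial>lebesgue)" by simp
  also have "\<dots> = qint (leb_Ioo (a - h) (b - h)) q (\<lambda>t. f (h + t))"
    unfolding qint_leb_Ioo_eq unfolding qint_def
    by (rule nn_integral_cong) (auto simp: indicator_def)
  finally show ?thesis unfolding qint_leb_Ioo_eq unfolding qint_def ..
qed

text \<open>The values at rational points are dense in the range, and distances to a fixed point are
  continuous real functions, so the separability criterion applies.\<close>

lemma smeas_continuous_on:
  fixes g :: "real \<Rightarrow> 'b::real_normed_vector"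
  assumes g: "continuous_on {a..b} g"
  shows "smeas (leb_Ioo a b) g"
proof (rule smeasI_separable)
  show "countable (g ` (\<rat> \<inter> {a..b}))" by (intro countable_image countable_Int1 countable_rat)
  show "AE t in leb_Ioo a b. g t \<in> closure (g ` (\<rat> \<inter> {a..b}))"
  proof (rule AE_leb_Ioo_I)
    fix t assume t: "a < t" "t < b"
    show "g t \<in> closure (g ` (\<rat> \<inter> {a..b}))"
      unfolding closure_approachable
    proof (intro allI impI)
      fix e :: real assume "0 < e"
      then obtain d where d: "0 < d" "\<And>s. s \<in> {a..b} \<Longrightarrow> dist s t < d \<Longrightarrow> dist (g s) (g t) < e"
        using g t unfolding continuous_on_iff by (metis atLeastAtMost_iff less_imp_le)
      have "t < min (t + d) b" using d t by simp
      from Rats_dense_in_real[OF this] obtain r where "r \<in> \<rat>" "t < r" "r < min (t + d) b" by blast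
      with t d(2)[of r] show "\<exists>y\<in>g ` (\<rat> \<inter> {a..b}). dist y (g t) < e"
        by (intro bexI[of _ "g r"]) (auto simp: dist_real_def)
    qed
  qed
  show "(\<lambda>t. norm (g t - d)) \<in> borel_measurable (leb_Ioo a b)" for d
    by (rule continuous_imp_measurable_on_sets_lebesgue)
       (auto intro!: continuous_intros continuous_on_subset[OF g])
qed

subsection \<open>Function spaces with values in a Banach space\<close>

text \<open>Real scalars are enough because \<open>bsum\<close> is used as a real Banach space; the
  constant is a parameter so that it can be passed on to the lifted operators.\<close>

definition bnd_lin :: "'a::complex_vector nspace \<Rightarrow> 'a nspace \<Rightarrow> real \<Rightarrow> ('a \<Rightarrow> 'a) \<Rightarrow> bool" where
  "bnd_lin X Y C B \<longleftrightarrow> (\<forall>x\<in>carr X. B x \<in> carr Y \<and> nrm Y (B x) \<le> C * nrm X x) \<and>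
     (\<forall>x\<in>carr X. \<forall>y\<in>carr X. B (x + y) = B x + B y) \<and> (\<forall>r. \<forall>x\<in>carr X. B (r *\<^sub>R x) = r *\<^sub>R B x)"

text \<open>Composition with the projection onto the component \<open>X\<close> makes the operator
  total on \<open>bsum\<close>, with the same bound; it vanishes on the other components.\<close>

definition lift_op :: "'a::complex_vector nspace \<Rightarrow> 'a nspace \<Rightarrow> ('a \<Rightarrow> 'a) \<Rightarrow> 'a bsum \<Rightarrow> 'a bsum" where
  "lift_op X Y B y = binj Y (B (bproj y X))"

lemma lift_op_binj: "complex_banach X \<Longrightarrow> x \<in> carr X \<Longrightarrow> lift_op X Y B (binj X x) = binj Y (B x)"
  by (simp add: lift_op_def bproj_binj)

lemma lift_op_bounded:
  assumes "complex_banach X" "complex_banach Y" "bnd_lin X Y C B" "0 \<le> C"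
  shows "linear (lift_op X Y B)" "norm (lift_op X Y B y) \<le> C * norm y" "bounded_linear (lift_op X Y B)"
proof -
  show 1: "norm (lift_op X Y B y) \<le> C * norm y" for y
  proof -
    have "norm (lift_op X Y B y) \<le> C * nrm X (bproj y X)"
      using assms by (simp add: lift_op_def bnd_lin_def norm_binj bproj_carr)
    also have "\<dots> \<le> C * norm y" using assms by (intro mult_left_mono nrm_bproj_le)
    finally show ?thesis .
  qed
  show 2: "linear (lift_op X Y B)"
    using assms by (intro linearI)
      (simp_all add: lift_op_def bnd_lin_def bproj_carr bproj_add bproj_scaleR binj_add binj_scaleR)
  show "bounded_linear (lift_op X Y B)"
    by (rule bounded_linear_intro[of _ C])
       (use 1 2 in \<open>auto simp: linear_add linear_cmul mult.commute\<close>)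
qed

lemma bnd_linD:
  assumes "bnd_lin X Y C B" "x \<in> carr X"
  shows "B x \<in> carr Y" "nrm Y (B x) \<le> C * nrm X x"
  using assms unfolding bnd_lin_def by auto

lemma bounded_op_bnd_lin:
  assumes "complex_banach X" "bounded_op X Y B"
  shows "\<exists>C\<ge>0. bnd_lin X Y C B"
proof -
  obtain C where C: "linear_op X Y B" "\<And>x. x \<in> carr X \<Longrightarrow> nrm Y (B x) \<le> C * nrm X x"
    using assms unfolding bounded_op_def by blast
  have "C * nrm X x \<le> max C 0 * nrm X x" if "x \<in> carr X" for x
    using nrm_nonneg[OF assms(1) that] by (intro mult_right_mono) auto
  with C show ?thesis
    by (intro exI[of _ "max C 0"]) (fastforce simp: bnd_lin_def linear_op_def scaleR_scaleC)
qed

lemma dense_inj_bnd_lin: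
  assumes "complex_banach X" "dense_inj X Y"
  shows "\<exists>C\<ge>0. bnd_lin X Y C (\<lambda>x. x)"
proof -
  obtain C where C: "carr X \<subseteq> carr Y" "\<And>x. x \<in> carr X \<Longrightarrow> nrm Y x \<le> C * nrm X x"
    using assms unfolding dense_inj_def by blast
  have "C * nrm X x \<le> max C 0 * nrm X x" if "x \<in> carr X" for x
    using nrm_nonneg[OF assms(1) that] by (intro mult_right_mono) auto
  with C show ?thesis
    by (intro exI[of _ "max C 0"]) (fastforce simp: bnd_lin_def)
qed

text \<open>Conversely, the approximants in \<open>bsum\<close> may leave the component of
  \<open>X\<close>; projecting them back by \<open>bproj\<close> keeps them simple and does not
  increase the error.\<close>

lemma strongly_measurable_iff:
  assumes X: "complex_banach X"
  shows "strongly_measurable X {a<..<b} f \<longleftrightarrow>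
    (AE t in leb_Ioo a b. f t \<in> carr X) \<and> smeas (leb_Ioo a b) (\<lambda>t. binj X (f t))"
proof
  assume "strongly_measurable X {a<..<b} f"
  then obtain s where s: "\<And>n. simple_fun X {a<..<b} (s n)"
    and ae: "AE t in leb_Ioo a b. f t \<in> carr X \<and> (\<lambda>n. nrm X (s n t - f t)) \<longlonglongrightarrow> 0"
    unfolding strongly_measurable_def by blast
  have "simple_function (leb_Ioo a b) (\<lambda>t. binj X (s n t))" for n
  proof -
    have "simple_function (leb_Ioo a b) (s n)"
      using s[of n] unfolding simple_fun_def
      by (auto elim: Bochner_Integration.simple_bochner_integrable.cases)
    from simple_function_compose1[OF this, of "binj X"] show ?thesis .
  qed
  moreover have "AE t in leb_Ioo a b. (\<lambda>n. binj X (s n t)) \<longlonglongrightarrow> binj X (f t)"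
    using ae AE_space
  proof eventually_elim
    fix t assume t: "f t \<in> carr X \<and> (\<lambda>n. nrm X (s n t - f t)) \<longlonglongrightarrow> 0" "t \<in> space (leb_Ioo a b)"
    have "s n t \<in> carr X" for n using s[of n] t(2) unfolding simple_fun_def by auto
    then have "norm (binj X (s n t) - binj X (f t)) = nrm X (s n t - f t)" for n
      using X t by (simp add: binj_diff[symmetric] norm_binj banach_diff)
    then have "(\<lambda>n. norm (binj X (s n t) - binj X (f t))) \<longlonglongrightarrow> 0" using t(1) by simp
    then show "(\<lambda>n. binj X (s n t)) \<longlonglongrightarrow> binj X (f t)"
      by (rule LIM_zero_cancel[OF tendsto_norm_zero_cancel])
  qed
  ultimately show "(AE t in leb_Ioo a b. f t \<in> carr X) \<and> smeas (leb_Ioo a b) (\<lambda>t. binj X (f t))"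
    using ae unfolding smeas_def
    by (intro conjI exI[of _ "\<lambda>n t. binj X (s n t)"] allI) (auto elim: eventually_mono)
next
  assume f: "(AE t in leb_Ioo a b. f t \<in> carr X) \<and> smeas (leb_Ioo a b) (\<lambda>t. binj X (f t))"
  then obtain r where r: "\<And>n. simple_function (leb_Ioo a b) (r n)"
    "AE t in leb_Ioo a b. (\<lambda>n. r n t) \<longlonglongrightarrow> binj X (f t)"
    unfolding smeas_def by blast
  define s where "s n t = bproj (r n t) X" for n t
  have "simple_fun X {a<..<b} (s n)" for n
    unfolding simple_fun_def s_def
    by (intro conjI Bochner_Integration.simple_bochner_integrable.intros emeasure_leb_Ioo_finite
        simple_function_compose1[OF r(1)]) (auto intro: bproj_carr X)
  moreover have "AE t in leb_Ioo a b. f t \<in> carr X \<and> (\<lambda>n. nrm X (s n t - f t)) \<longlonglongrightarrow> 0"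
    using r(2) conjunct1[OF f]
  proof eventually_elim
    fix t assume t: "(\<lambda>n. r n t) \<longlonglongrightarrow> binj X (f t)" "f t \<in> carr X"
    have z: "(\<lambda>n. norm (r n t - binj X (f t))) \<longlonglongrightarrow> 0"
      using tendsto_norm[OF tendsto_diff[OF t(1) tendsto_const, of "binj X (f t)"]] by simp
    have le: "\<forall>n. nrm X (s n t - f t) \<le> norm (r n t - binj X (f t))"
    proof
      fix n show "nrm X (s n t - f t) \<le> norm (r n t - binj X (f t))"
        using nrm_bproj_le[OF X, of "r n t - binj X (f t)"] X t(2) by (simp add: s_def bproj_diff bproj_binj)
    qed
    have ge: "\<forall>n. 0 \<le> nrm X (s n t - f t)"
      using X t(2) by (simp add: s_def nrm_nonneg banach_diff bproj_carr)
    have "(\<lambda>n. nrm X (s n t - f t)) \<longlonglongrightarrow> 0"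
      by (rule tendsto_sandwich[OF always_eventually[OF ge] always_eventually[OF le] tendsto_const z])
    with t show "f t \<in> carr X \<and> (\<lambda>n. nrm X (s n t - f t)) \<longlonglongrightarrow> 0" by simp
  qed
  ultimately show "strongly_measurable X {a<..<b} f" unfolding strongly_measurable_def by blast
qed

lemma Lq_iff:
  assumes X: "complex_banach X"
  shows "f \<in> Lq q a b X \<longleftrightarrow> (AE t in leb_Ioo a b. f t \<in> carr X) \<and>
    smeas (leb_Ioo a b) (\<lambda>t. binj X (f t)) \<and> qint (leb_Ioo a b) q (\<lambda>t. binj X (f t)) < \<infinity>"
proof -
  have "(\<integral>\<^sup>+ t. ennreal (nrm X (f t) powr q) \<partial>leb_Ioo a b) = qint (leb_Ioo a b) q (\<lambda>t. binj X (f t))"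
    if "AE t in leb_Ioo a b. f t \<in> carr X"
    unfolding qint_def by (rule nn_integral_cong_AE, use that in eventually_elim) (simp add: X norm_binj)
  then show ?thesis unfolding Lq_def strongly_measurable_iff[OF X] by auto
qed

lemma atin_within_euclidean: "atin_within euclidean a S = at a within S"
  by (rule filter_eqI) (auto simp: eventually_atin_within eventually_at_topological)

lemma continuous_map_ntop_iff:
  assumes X: "complex_banach X"
  shows "continuous_map (top_of_set S) (ntop X) u \<longleftrightarrow>
    (\<forall>t\<in>S. u t \<in> carr X) \<and> continuous_on S (\<lambda>t. binj X (u t))"
proof -
  interpret N: Metric_space "carr X" "ndist X" by (rule banach_Metric_space[OF X])
  have "continuous_map (top_of_set S) (ntop X) u \<longleftrightarrow>
      (\<forall>t\<in>S. u t \<in> carr X) \<and> (\<forall>t\<in>S. limitin N.mtopology u (u t) (at t within S))"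
    unfolding ntop_def continuous_map_atin
    by (auto simp: limitin_def atin_subtopology_within atin_within_euclidean)
  also have "\<dots> \<longleftrightarrow> (\<forall>t\<in>S. u t \<in> carr X) \<and> (\<forall>t\<in>S. ((\<lambda>t. binj X (u t)) \<longlongrightarrow> binj X (u t)) (at t within S))"
  proof (intro conj_cong refl ball_cong)
    fix t assume u: "\<forall>t\<in>S. u t \<in> carr X" and t: "t \<in> S"
    have d: "ndist X (u s) (u t) = dist (binj X (u s)) (binj X (u t))" if "s \<in> S" for s
      using u t that X by (simp add: ndist_def dist_norm binj_diff[symmetric] norm_binj banach_diff)
    have S: "\<forall>\<^sub>F s in at t within S. s \<in> S" by (simp add: eventually_at_filter)
    then have Sc: "\<forall>\<^sub>F s in at t within S. u s \<in> carr X" by (rule eventually_mono) (use u in auto)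
    have "limitin N.mtopology u (u t) (at t within S) \<longleftrightarrow> (\<forall>e>0. \<forall>\<^sub>F s in at t within S. ndist X (u s) (u t) < e)"
      unfolding N.limitin_metric using u t by (simp add: eventually_conj_iff Sc)
    also have "\<dots> \<longleftrightarrow> (\<forall>e>0. \<forall>\<^sub>F s in at t within S. dist (binj X (u s)) (binj X (u t)) < e)"
      by (intro all_cong1 imp_cong refl eventually_subst eventually_mono[OF S]) (simp add: d)
    finally show "limitin N.mtopology u (u t) (at t within S) \<longleftrightarrow>
        ((\<lambda>t. binj X (u t)) \<longlongrightarrow> binj X (u t)) (at t within S)"
      by (simp add: tendsto_iff)
  qed
  finally show ?thesis by (simp add: continuous_on_def)
qed

lemma simple_function_qint_1_finite:
  assumes s: "simple_function (leb_Ioo a b) s"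
  shows "qint (leb_Ioo a b) 1 s < \<infinity>"
proof -
  have "finite (s ` space (leb_Ioo a b))" using s by (simp add: simple_function_def)
  then obtain K where K: "\<And>t. t \<in> space (leb_Ioo a b) \<Longrightarrow> norm (s t) \<le> K"
    using finite_imp_bounded[THEN bounded_iff[THEN iffD1]] by (metis image_eqI)
  have "qint (leb_Ioo a b) 1 s \<le> (\<integral>\<^sup>+ t. ennreal K \<partial>leb_Ioo a b)"
    unfolding qint_1 by (intro nn_integral_mono ennreal_leI K)
  also have "\<dots> < \<infinity>"
    using emeasure_leb_Ioo_finite[of a b] by (simp add: ennreal_mult_less_top less_top)
  finally show ?thesis .
qed

lemma simple_bochner_integral_cong:
  assumes "\<And>x. x \<in> space M \<Longrightarrow> f x = g x"
  shows "Bochner_Integration.simple_bochner_integral M f = Bochner_Integration.simple_bochner_integral M g"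
proof -
  have "f ` space M = g ` space M" using assms by (rule image_cong[OF refl])
  moreover have "{x \<in> space M. f x = y} = {x \<in> space M. g x = y}" for y using assms by auto
  ultimately show ?thesis unfolding Bochner_Integration.simple_bochner_integral_def by simp
qed

lemma simple_bochner_integrable_leb_Ioo:
  "simple_function (leb_Ioo a b) s \<Longrightarrow> Bochner_Integration.simple_bochner_integrable (leb_Ioo a b) s"
  by (intro Bochner_Integration.simple_bochner_integrable.intros emeasure_leb_Ioo_finite)

lemma linear_bproj: "linear (\<lambda>y. bproj y X)"
  by (rule linearI) (simp_all add: bproj_simps)

text \<open>The lift of the identity of \<open>X\<close> is the projection onto the component of
  \<open>X\<close>. It fixes the integrand, hence also the integral, which therefore lies in that
  component.\<close>

lemma simple_bochner_integral_binj:
  assumes X: "complex_banach X" and s: "simple_function (leb_Ioo a b) s"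
    and c: "\<And>t. a < t \<Longrightarrow> t < b \<Longrightarrow> s t \<in> carr X"
  shows "Bochner_Integration.simple_bochner_integral (leb_Ioo a b) s \<in> carr X"
    and "Bochner_Integration.simple_bochner_integral (leb_Ioo a b) (\<lambda>t. binj X (s t)) =
      binj X (Bochner_Integration.simple_bochner_integral (leb_Ioo a b) s)"
proof -
  let ?I = "Bochner_Integration.simple_bochner_integral (leb_Ioo a b)"
  let ?g = "\<lambda>t. binj X (s t)"
  have g: "Bochner_Integration.simple_bochner_integrable (leb_Ioo a b) ?g"
    by (rule simple_bochner_integrable_leb_Ioo[OF simple_function_compose1[OF s, of "binj X"]])
  have "bnd_lin X X 1 (\<lambda>x. x)" by (simp add: bnd_lin_def)
  from lift_op_bounded(1)[OF X X this] have lin: "linear (lift_op X X (\<lambda>x. x))" by simp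
  have 1: "?I s = bproj (?I ?g) X"
    using Bochner_Integration.simple_bochner_integral_linear[OF linear_bproj g, of X]
    by (subst simple_bochner_integral_cong[of _ s "\<lambda>t. bproj (?g t) X"]) (simp_all add: X c bproj_binj)
  then show "?I s \<in> carr X" by (simp add: X bproj_carr)
  have "?I ?g = ?I (\<lambda>t. lift_op X X (\<lambda>x. x) (?g t))"
    by (rule simple_bochner_integral_cong) (simp add: X c lift_op_binj)
  also have "\<dots> = lift_op X X (\<lambda>x. x) (?I ?g)"
    by (rule Bochner_Integration.simple_bochner_integral_linear[OF lin g])
  finally show "?I ?g = binj X (?I s)" unfolding 1 lift_op_def .
qed

lemma qint_1_binj_diff:
  assumes X: "complex_banach X" and f: "AE t in leb_Ioo a b. f t \<in> carr X"
    and s: "\<And>t. a < t \<Longrightarrow> t < b \<Longrightarrow> s t \<in> carr X"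
  shows "(\<integral>\<^sup>+ t. ennreal (nrm X (s t - f t)) \<partial>leb_Ioo a b) =
    qint (leb_Ioo a b) 1 (\<lambda>t. binj X (f t) - binj X (s t))"
  unfolding qint_1
proof (rule nn_integral_cong_AE, use f AE_space in eventually_elim)
  fix t assume "f t \<in> carr X" "t \<in> space (leb_Ioo a b)"
  with s[of t] show "ennreal (nrm X (s t - f t)) = ennreal (norm (binj X (f t) - binj X (s t)))"
    by (simp add: X binj_diff[symmetric] norm_binj banach_diff nrm_diff_commute[OF X, of "f t" "s t"])
qed

lemma L1_integral_diff_le:
  fixes f g :: "real \<Rightarrow> 'b::banach"
  assumes f: "smeas (leb_Ioo a b) f" "qint (leb_Ioo a b) 1 f < \<infinity>"
    and g: "smeas (leb_Ioo a b) g" "qint (leb_Ioo a b) 1 g < \<infinity>" and st: "{s..t} \<subseteq> {a..b}"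
  shows "ennreal (norm (integral {s..t} f - integral {s..t} g)) \<le> qint (leb_Ioo a b) 1 (\<lambda>t. f t - g t)"
proof -
  interpret complete_measure "leb_Ioo a b" by (rule complete_leb_Ioo)
  have "qint (leb_Ioo a b) 1 (\<lambda>t. f t - g t) \<le> ennreal (2 powr 1) * (qint (leb_Ioo a b) 1 f + qint (leb_Ioo a b) 1 g)"
    by (rule qint_diff) (use f g in auto)
  also have "\<dots> < \<infinity>" using f g by (simp add: ennreal_mult_less_top less_top)
  finally have "ennreal (norm (integral {s..t} (\<lambda>t. f t - g t))) \<le> qint (leb_Ioo a b) 1 (\<lambda>t. f t - g t)"
    by (intro L1_norm_integral_le smeas_diff f g st)
  moreover have "integral {s..t} (\<lambda>t. f t - g t) = integral {s..t} f - integral {s..t} g"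
    by (intro integral_diff integrable_on_subinterval[OF L1_integrable_on st] f g)
  ultimately show ?thesis by simp
qed

text \<open>The integral depends continuously on the integrand in the mean, and for simple functions
  both notions agree. So every admissible sequence of simple functions has the gauge integral as
  limit, and one such sequence exists by \<open>smeas_L1_approx\<close>.\<close>

lemma has_bochner_integral_in_iff:
  assumes X: "complex_banach X" and ab: "a \<le> b"
  shows "has_bochner_integral_in X {a<..<b} f x \<longleftrightarrow> (AE t in leb_Ioo a b. f t \<in> carr X) \<and>
    smeas (leb_Ioo a b) (\<lambda>t. binj X (f t)) \<and> qint (leb_Ioo a b) 1 (\<lambda>t. binj X (f t)) < \<infinity> \<and>
    x \<in> carr X \<and> ((\<lambda>t. binj X (f t)) has_integral binj X x) {a..b}"
proof -
  interpret complete_measure "leb_Ioo a b" by (rule complete_leb_Ioo)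
  interpret N: Metric_space "carr X" "ndist X" by (rule banach_Metric_space[OF X])
  let ?M = "leb_Ioo a b"
  let ?I = "Bochner_Integration.simple_bochner_integral ?M"
  let ?f = "\<lambda>t. binj X (f t)"
  show ?thesis
  proof (intro iffI)
    assume "has_bochner_integral_in X {a<..<b} f x"
    then obtain s where f: "AE t in ?M. f t \<in> carr X" "smeas ?M ?f"
      and s: "\<And>n. simple_fun X {a<..<b} (s n)"
      and lim: "(\<lambda>n. \<integral>\<^sup>+ t. ennreal (nrm X (s n t - f t)) \<partial>?M) \<longlonglongrightarrow> 0"
      and x: "limitin (ntop X) (\<lambda>n. ?I (s n)) x sequentially"
      unfolding has_bochner_integral_in_def strongly_measurable_iff[OF X] by blast
    define g where "g n t = binj X (s n t)" for n t
    have sc: "s n t \<in> carr X" if "a < t" "t < b" for n t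
      using s[of n] that unfolding simple_fun_def by auto
    have ss: "simple_function ?M (s n)" for n
      using s[of n] unfolding simple_fun_def
      by (auto elim: Bochner_Integration.simple_bochner_integrable.cases)
    have gs: "simple_function ?M (g n)" for n unfolding g_def by (rule simple_function_compose1[OF ss])
    have "(\<integral>\<^sup>+ t. ennreal (nrm X (s n t - f t)) \<partial>?M) = qint ?M 1 (\<lambda>t. ?f t - g n t)" for n
      unfolding g_def by (rule qint_1_binj_diff[OF X f(1)]) (rule sc)
    note lim = lim[unfolded this]
    have bI: "?I (s n) \<in> carr X" "?I (\<lambda>t. binj X (s n t)) = binj X (?I (s n))" for n
      using simple_bochner_integral_binj[of X a b "s n"] X ss sc by blast+
    from lim have "\<forall>\<^sub>F n in sequentially. qint ?M 1 (\<lambda>t. ?f t - g n t) < \<infinity>"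
      by (rule order_tendstoD) simp
    then obtain n0 where n0: "qint ?M 1 (\<lambda>t. ?f t - g n0 t) < \<infinity>"
      unfolding eventually_sequentially by blast
    have "qint ?M 1 ?f \<le> ennreal (2 powr 1) * (qint ?M 1 (\<lambda>t. ?f t - g n0 t) + qint ?M 1 (g n0))"
      using qint_add[OF smeas_diff[OF f(2) smeas_simple[OF gs]] smeas_simple[OF gs], of 1 n0 n0] by simp
    also have "\<dots> < \<infinity>"
      using n0 simple_function_qint_1_finite[OF gs, of n0] by (simp add: ennreal_mult_less_top less_top)
    finally have fin: "qint ?M 1 ?f < \<infinity>" .
    have gi: "integral {a..b} (g n) = binj X (?I (s n))" for n
      using simple_function_has_integral[OF gs, of n] bI(2)[of n]
      unfolding g_def by (simp add: integral_unique)
    have x': "x \<in> carr X" "(\<lambda>n. ndist X (?I (s n)) x) \<longlonglongrightarrow> 0"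
      using x unfolding ntop_def N.limitin_metric_dist_null by auto
    have "ndist X (?I (s n)) x = norm (binj X (?I (s n)) - binj X x)" for n
      using bI(1)[of n] x'(1)
      by (simp add: ndist_def X binj_diff[symmetric] norm_binj banach_diff)
    then have "(\<lambda>n. norm (integral {a..b} (g n) - binj X x)) \<longlonglongrightarrow> 0"
      using x'(2) unfolding gi by simp
    then have l1: "(\<lambda>n. integral {a..b} (g n)) \<longlonglongrightarrow> binj X x"
      by (rule LIM_zero_cancel[OF tendsto_norm_zero_cancel])
    have "(\<lambda>n. ennreal (norm (integral {a..b} ?f - integral {a..b} (g n)))) \<longlonglongrightarrow> 0"
      by (rule tendsto_sandwich[OF always_eventually always_eventually tendsto_const lim])
         (simp, intro allI L1_integral_diff_le f fin smeas_simple gs simple_function_qint_1_finite order_refl)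
    then have "(\<lambda>n. norm (integral {a..b} ?f - integral {a..b} (g n))) \<longlonglongrightarrow> 0"
      by (simp flip: ennreal_0)
    then have "(\<lambda>n. norm (integral {a..b} (g n) - integral {a..b} ?f)) \<longlonglongrightarrow> 0"
      by (simp only: norm_minus_commute)
    then have "(\<lambda>n. integral {a..b} (g n)) \<longlonglongrightarrow> integral {a..b} ?f"
      by (rule LIM_zero_cancel[OF tendsto_norm_zero_cancel])
    with l1 have "integral {a..b} ?f = binj X x" by (rule LIMSEQ_unique[rotated])
    with L1_integrable_on[OF f(2) fin] have "(?f has_integral binj X x) {a..b}"
      by (metis integrable_integral)
    with f fin x' show "(AE t in ?M. f t \<in> carr X) \<and> smeas ?M ?f \<and> qint ?M 1 ?f < \<infinity> \<and>
      x \<in> carr X \<and> (?f has_integral binj X x) {a..b}" by blast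
  next
    assume "(AE t in ?M. f t \<in> carr X) \<and> smeas ?M ?f \<and> qint ?M 1 ?f < \<infinity> \<and>
      x \<in> carr X \<and> (?f has_integral binj X x) {a..b}"
    then have f: "AE t in ?M. f t \<in> carr X" "smeas ?M ?f" "qint ?M 1 ?f < \<infinity>" "x \<in> carr X"
      "(?f has_integral binj X x) {a..b}" by auto
    obtain r where r: "\<And>n. simple_function ?M (r n)" "(\<lambda>n. qint ?M 1 (\<lambda>t. ?f t - r n t)) \<longlonglongrightarrow> 0"
      using smeas_L1_approx[OF f(2,3)] by blast
    \<comment> \<open>The approximants of the embedded function are projected back into
      \<open>X\<close>, without increase of the error.\<close>
    define s where "s n t = bproj (r n t) X" for n t
    have ss: "simple_function ?M (s n)" for n unfolding s_def by (rule simple_function_compose1[OF r(1)])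
    have sc: "s n t \<in> carr X" for n t by (simp add: s_def X bproj_carr)
    have "(\<lambda>n. \<integral>\<^sup>+ t. ennreal (nrm X (s n t - f t)) \<partial>?M) \<longlonglongrightarrow> 0"
    proof (rule tendsto_sandwich[OF _ _ tendsto_const r(2)])
      show "\<forall>\<^sub>F n in sequentially. (\<integral>\<^sup>+ t. ennreal (nrm X (s n t - f t)) \<partial>?M) \<le> qint ?M 1 (\<lambda>t. ?f t - r n t)"
      proof (intro always_eventually allI)
        fix n
        show "(\<integral>\<^sup>+ t. ennreal (nrm X (s n t - f t)) \<partial>?M) \<le> qint ?M 1 (\<lambda>t. ?f t - r n t)"
          unfolding qint_1
        proof (rule nn_integral_mono_AE, use f(1) in eventually_elim)
          fix t assume "f t \<in> carr X"
          then have "nrm X (s n t - f t) = nrm X (bproj (r n t - ?f t) X)"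
            by (simp add: s_def bproj_diff bproj_binj X)
          also have "\<dots> \<le> norm (?f t - r n t)"
            using nrm_bproj_le[OF X] by (subst norm_minus_commute)
          finally show "ennreal (nrm X (s n t - f t)) \<le> ennreal (norm (?f t - r n t))" by (rule ennreal_leI)
        qed
      qed
    qed simp
    moreover have "simple_fun X {a<..<b} (s n)" for n
      unfolding simple_fun_def using sc by (auto intro: simple_bochner_integrable_leb_Ioo ss)
    moreover have "limitin (ntop X) (\<lambda>n. ?I (s n)) x sequentially"
    proof -
      have Is: "?I (s n) = bproj (integral {a..b} (r n)) X" for n
        using Bochner_Integration.simple_bochner_integral_linear[OF linear_bproj
            simple_bochner_integrable_leb_Ioo[OF r(1)], of n X]
          integral_unique[OF simple_function_has_integral[OF r(1)]]
        by (simp add: s_def[abs_def])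
      have le: "ndist X (?I (s n)) x \<le> norm (integral {a..b} ?f - integral {a..b} (r n))" for n
      proof -
        have "ndist X (?I (s n)) x = nrm X (bproj (integral {a..b} (r n) - binj X x) X)"
          unfolding Is using f(4) X by (simp add: ndist_def bproj_carr bproj_diff bproj_binj)
        also have "\<dots> \<le> norm (integral {a..b} (r n) - binj X x)" by (rule nrm_bproj_le[OF X])
        finally show ?thesis by (simp add: integral_unique[OF f(5)] norm_minus_commute)
      qed
      have "(\<lambda>n. ennreal (norm (integral {a..b} ?f - integral {a..b} (r n)))) \<longlonglongrightarrow> 0"
        by (rule tendsto_sandwich[OF always_eventually always_eventually tendsto_const r(2)])
           (simp, intro allI L1_integral_diff_le f smeas_simple r simple_function_qint_1_finite order_refl)
      then have z: "(\<lambda>n. norm (integral {a..b} ?f - integral {a..b} (r n))) \<longlonglongrightarrow> 0"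
        by (simp flip: ennreal_0)
      have "(\<lambda>n. ndist X (?I (s n)) x) \<longlonglongrightarrow> 0"
        by (rule tendsto_sandwich[OF always_eventually always_eventually tendsto_const z]) (use le in simp_all)
      then show ?thesis
        unfolding ntop_def N.limitin_metric_dist_null using f(4) by (simp add: Is bproj_carr X)
    qed
    ultimately show "has_bochner_integral_in X {a<..<b} f x"
      unfolding has_bochner_integral_in_def strongly_measurable_iff[OF X] using f by blast
  qed
qed

context
  fixes X :: "'a::complex_vector nspace"
  assumes X: "complex_banach X"
begin

lemma Lq_subinterval: "f \<in> Lq q a b X \<Longrightarrow> a \<le> c \<Longrightarrow> d \<le> b \<Longrightarrow> f \<in> Lq q c d X"
  unfolding Lq_iff[OF X]
  by (auto intro: AE_leb_Ioo_subset smeas_leb_Ioo_subset order_le_less_trans[OF qint_leb_Ioo_subset])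

lemma Lq_join:
  "f \<in> Lq q a b X \<Longrightarrow> f \<in> Lq q b c X \<Longrightarrow> 0 < q \<Longrightarrow> a \<le> b \<Longrightarrow> b \<le> c \<Longrightarrow> f \<in> Lq q a c X"
  unfolding Lq_iff[OF X]
  using AE_leb_Ioo_join[where P = "\<lambda>t. f t \<in> carr X" and a = a and b = b and c = c] smeas_leb_Ioo_join[of a b "\<lambda>t. binj X (f t)" c]
    qint_leb_Ioo_join[of a b "\<lambda>t. binj X (f t)" c q] by blast

lemma Lq_cong_AE:
  assumes f: "f \<in> Lq q a b X" and ae: "AE t in leb_Ioo a b. f t = g t"
  shows "g \<in> Lq q a b X"
proof -
  have ae': "AE t in leb_Ioo a b. binj X (f t) = binj X (g t)" using ae by eventually_elim simp
  have "AE t in leb_Ioo a b. f t \<in> carr X" using f by (simp add: Lq_iff[OF X])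
  with ae have "AE t in leb_Ioo a b. g t \<in> carr X" by eventually_elim simp
  with f show ?thesis
    unfolding Lq_iff[OF X] using smeas_cong_AE[OF _ ae'] qint_cong_AE[OF ae', of q] by auto
qed

lemma Lq_shift: "f \<in> Lq q a b X \<Longrightarrow> (\<lambda>t. f (h + t)) \<in> Lq q (a - h) (b - h) X"
proof -
  assume f: "f \<in> Lq q a b X"
  then have "AE t in lebesgue. t \<in> {a<..<b} \<longrightarrow> f t \<in> carr X" by (simp add: Lq_iff[OF X] AE_leb_Ioo)
  from AE_lebesgue_shift[OF this, of h] have "AE t in leb_Ioo (a - h) (b - h). f (h + t) \<in> carr X"
    unfolding AE_leb_Ioo by eventually_elim auto
  with f show ?thesis
    using smeas_shift[of a b "\<lambda>t. binj X (f t)" h] qint_shift[of a b "\<lambda>t. binj X (f t)" h q]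
    by (simp add: Lq_iff[OF X])
qed

lemma Lq_map:
  assumes f: "f \<in> Lq q a b X" and Y: "complex_banach Y" and q: "0 \<le> q" and C: "0 \<le> C"
    and g: "AE t in leb_Ioo a b. g t \<in> carr Y \<and> nrm Y (g t) \<le> C * nrm X (f t)"
    and m: "smeas (leb_Ioo a b) (\<lambda>t. binj Y (g t))"
  shows "g \<in> Lq q a b Y"
proof -
  interpret complete_measure "leb_Ioo a b" by (rule complete_leb_Ioo)
  have "AE t in leb_Ioo a b. f t \<in> carr X" using f by (simp add: Lq_iff[OF X])
  with g have "AE t in leb_Ioo a b. norm (binj Y (g t)) \<le> C * norm (binj X (f t))"
    by eventually_elim (simp add: norm_binj X Y)
  then have "qint (leb_Ioo a b) q (\<lambda>t. binj Y (g t)) \<le> ennreal (C powr q) * qint (leb_Ioo a b) q (\<lambda>t. binj X (f t))"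
    using f q C by (intro qint_bound) (auto simp: Lq_iff[OF X])
  also have "\<dots> < \<infinity>" using f by (simp add: Lq_iff[OF X] ennreal_mult_less_top)
  finally show ?thesis using g m by (auto simp: Lq_iff[OF Y] elim: eventually_mono)
qed

lemma Lq_scaleR:
  assumes f: "f \<in> Lq q a b X" and q: "0 \<le> q" and \<phi>: "continuous_on {a..b} \<phi>"
  shows "(\<lambda>t. \<phi> t *\<^sub>R f t) \<in> Lq q a b X"
proof -
  have "bounded (\<phi> ` {a..b})" by (intro compact_imp_bounded compact_continuous_image \<phi>) simp
  then obtain K where K: "0 < K" "\<And>t. t \<in> {a..b} \<Longrightarrow> \<bar>\<phi> t\<bar> \<le> K"
    unfolding bounded_pos by auto
  have fc: "AE t in leb_Ioo a b. f t \<in> carr X" using f by (simp add: Lq_iff[OF X])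
  show ?thesis
  proof (rule Lq_map[OF f X q])
    show "0 \<le> K" using K by simp
    show "AE t in leb_Ioo a b. \<phi> t *\<^sub>R f t \<in> carr X \<and> nrm X (\<phi> t *\<^sub>R f t) \<le> K * nrm X (f t)"
      using fc AE_space
      by eventually_elim (use K in \<open>auto simp: nrm_scaleR nrm_nonneg banach_scaleR X intro!: mult_right_mono\<close>)
    have "\<phi> \<in> borel_measurable (leb_Ioo a b)"
      by (rule continuous_imp_measurable_on_sets_lebesgue) (auto intro: continuous_on_subset[OF \<phi>])
    then have "smeas (leb_Ioo a b) (\<lambda>t. \<phi> t *\<^sub>R binj X (f t))"
      by (rule smeas_scaleR) (use f in \<open>simp add: Lq_iff[OF X]\<close>)
    then show "smeas (leb_Ioo a b) (\<lambda>t. binj X (\<phi> t *\<^sub>R f t))"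
      by (rule smeas_cong_AE, use fc in eventually_elim) (simp add: binj_scaleR X)
  qed
qed

lemma Lq_add:
  assumes f: "f \<in> Lq q a b X" and g: "g \<in> Lq q a b X" and q: "0 \<le> q"
  shows "(\<lambda>t. f t + g t) \<in> Lq q a b X"
proof -
  interpret complete_measure "leb_Ioo a b" by (rule complete_leb_Ioo)
  have c: "AE t in leb_Ioo a b. f t \<in> carr X" "AE t in leb_Ioo a b. g t \<in> carr X"
    using f g by (simp_all add: Lq_iff[OF X])
  then have e: "AE t in leb_Ioo a b. binj X (f t) + binj X (g t) = binj X (f t + g t)"
    by eventually_elim (simp add: binj_add X)
  have s: "smeas (leb_Ioo a b) (\<lambda>t. binj X (f t))" "smeas (leb_Ioo a b) (\<lambda>t. binj X (g t))"
    using f g by (simp_all add: Lq_iff[OF X])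
  have "qint (leb_Ioo a b) q (\<lambda>t. binj X (f t) + binj X (g t)) < \<infinity>"
    by (rule order_le_less_trans[OF qint_add[OF s q]])
       (use f g in \<open>simp add: Lq_iff[OF X] ennreal_mult_less_top less_top\<close>)
  then have "qint (leb_Ioo a b) q (\<lambda>t. binj X (f t + g t)) < \<infinity>" unfolding qint_cong_AE[OF e] .
  moreover have "AE t in leb_Ioo a b. f t + g t \<in> carr X" using c by eventually_elim (simp add: banach_add X)
  ultimately show ?thesis using smeas_cong_AE[OF smeas_add[OF s] e] by (simp add: Lq_iff[OF X])
qed

lemma Lq_diff:
  assumes f: "f \<in> Lq q a b X" and g: "g \<in> Lq q a b X" and q: "0 \<le> q"
  shows "(\<lambda>t. f t - g t) \<in> Lq q a b X"
  using Lq_add[OF f Lq_scaleR[OF g q, of "\<lambda>_. -1"] q] by simp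

lemma Lq_zero: "(\<lambda>_. 0) \<in> Lq q a b X"
  by (simp add: Lq_iff[OF X] banach_zero X binj_zero smeas_const qint_def)

lemma Lq_bnd_lin:
  assumes f: "f \<in> Lq q a b X" and Y: "complex_banach Y" and q: "0 \<le> q" and B: "bnd_lin X Y C B" "0 \<le> C"
  shows "(\<lambda>t. B (f t)) \<in> Lq q a b Y"
proof -
  have fc: "AE t in leb_Ioo a b. f t \<in> carr X" using f by (simp add: Lq_iff[OF X])
  show ?thesis
  proof (rule Lq_map[OF f Y q B(2)])
    show "AE t in leb_Ioo a b. B (f t) \<in> carr Y \<and> nrm Y (B (f t)) \<le> C * nrm X (f t)"
      using fc by eventually_elim (use B in \<open>auto simp: bnd_lin_def\<close>)
    have "smeas (leb_Ioo a b) (\<lambda>t. lift_op X Y B (binj X (f t)))"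
      by (rule smeas_bounded_linear[OF lift_op_bounded(3)[OF X Y B]]) (use f in \<open>simp add: Lq_iff[OF X]\<close>)
    then show "smeas (leb_Ioo a b) (\<lambda>t. binj Y (B (f t)))"
      by (rule smeas_cong_AE, use fc in eventually_elim) (simp add: lift_op_binj X)
  qed
qed

lemma Lq_integrable_on:
  assumes f: "f \<in> Lq q a b X" and q: "1 \<le> q"
  shows "smeas (leb_Ioo a b) (\<lambda>t. binj X (f t))" "qint (leb_Ioo a b) 1 (\<lambda>t. binj X (f t)) < \<infinity>"
    "(\<lambda>t. binj X (f t)) integrable_on {a..b}" "(\<lambda>t. norm (binj X (f t))) integrable_on {a..b}"
proof -
  show s: "smeas (leb_Ioo a b) (\<lambda>t. binj X (f t))" using f by (simp add: Lq_iff[OF X])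
  show fin: "qint (leb_Ioo a b) 1 (\<lambda>t. binj X (f t)) < \<infinity>"
    using qint_1_finite[OF q s] f by (simp add: Lq_iff[OF X])
  show "(\<lambda>t. binj X (f t)) integrable_on {a..b}" by (rule L1_integrable_on[OF s fin])
  show "(\<lambda>t. norm (binj X (f t))) integrable_on {a..b}"
    by (rule has_integral_integrable[OF L1_norm_has_integral[OF s fin]])
qed

text \<open>The projection onto the component of \<open>X\<close> fixes every
  \<open>binj X y\<close>, also for \<open>y\<close> outside the carrier, where this is 0. Being
  bounded and linear, it commutes with the integral.\<close>

lemma integral_in_carr:
  assumes "(\<lambda>t. binj X (v t)) integrable_on {s..t}"
  obtains x where "x \<in> carr X" "((\<lambda>t. binj X (v t)) has_integral binj X x) {s..t}"
proof -
  have "bnd_lin X X 1 (\<lambda>x. x)" by (simp add: bnd_lin_def)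
  from lift_op_bounded(3)[OF X X this] have bl: "bounded_linear (lift_op X X (\<lambda>x. x))" by simp
  let ?I = "integral {s..t} (\<lambda>t. binj X (v t))"
  have p: "lift_op X X (\<lambda>x. x) (binj X y) = binj X y" for y
  proof (cases "y \<in> carr X")
    case False
    then show ?thesis using bl by (simp add: binj_def bounded_linear.linear linear_0)
  qed (simp add: lift_op_binj X)
  have "((\<lambda>t. binj X (v t)) has_integral ?I) {s..t}" using assms by (rule integrable_integral)
  from has_integral_linear[OF this bl]
  have "((\<lambda>t. binj X (v t)) has_integral lift_op X X (\<lambda>x. x) ?I) {s..t}" by (simp add: o_def p)
  then show ?thesis unfolding lift_op_def by (intro that[of "bproj ?I X"] bproj_carr X)
qed

end

section \<open>Primitives of integrable functions\<close>

lemma has_integral_cong_AE: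
  fixes f g :: "real \<Rightarrow> 'b::banach"
  assumes f: "(f has_integral y) {a..b}" and ae: "AE t in leb_Ioo a b. f t = g t"
  shows "(g has_integral y) {a..b}"
proof -
  define N where "N = {t. \<not> (t \<in> {a<..<b} \<longrightarrow> f t = g t)}"
  have "N \<in> null_sets lebesgue"
    using ae unfolding AE_leb_Ioo N_def
    by (subst (asm) complete_measure.AE_iff_null_sets[OF completion.complete_measure_axioms]) simp
  then have "negligible (N \<union> {a, b})" by (auto simp: negligible_iff_null_sets[symmetric])
  then show ?thesis
    by (rule has_integral_spike[OF _ _ f]) (auto simp: N_def)
qed

text \<open>The working form of \<open>weak_deriv\<close>: \<open>u\<close> is the continuous
  representative and its increments are integrals of \<open>v\<close>. No test functions occur, so
  the relation passes easily between the spaces of the scale.\<close>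

definition primitive :: "'a::complex_vector nspace \<Rightarrow> real \<Rightarrow> real \<Rightarrow> (real \<Rightarrow> 'a) \<Rightarrow> (real \<Rightarrow> 'a) \<Rightarrow> bool" where
  "primitive X a b u v \<longleftrightarrow> (\<forall>t\<in>{a..b}. u t \<in> carr X \<and>
     ((\<lambda>r. binj X (v r)) has_integral binj X (u t) - binj X (u a)) {a..t})"

lemma primitive_carr: "primitive X a b u v \<Longrightarrow> t \<in> {a..b} \<Longrightarrow> u t \<in> carr X"
  unfolding primitive_def by blast

lemma primitive_has_integral:
  assumes "primitive X a b u v" "a \<le> s" "s \<le> t" "t \<le> b"
  shows "((\<lambda>r. binj X (v r)) has_integral binj X (u t) - binj X (u s)) {s..t}"
proof -
  have s: "((\<lambda>r. binj X (v r)) has_integral binj X (u s) - binj X (u a)) {a..s}"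
    and t: "((\<lambda>r. binj X (v r)) has_integral binj X (u t) - binj X (u a)) {a..t}"
    using assms unfolding primitive_def by auto
  have "(\<lambda>r. binj X (v r)) integrable_on {s..t}"
    by (rule integrable_on_subinterval[OF has_integral_integrable[OF t]]) (use assms in auto)
  then obtain y where y: "((\<lambda>r. binj X (v r)) has_integral y) {s..t}" by blast
  have "binj X (u s) - binj X (u a) + y = binj X (u t) - binj X (u a)"
    using has_integral_combine[OF assms(2,3) s y] t by (rule has_integral_unique)
  then have "y = binj X (u t) - binj X (u s)" by (simp add: algebra_simps)
  with y show ?thesis by simp
qed

lemma primitive_subinterval:
  "primitive X a b u v \<Longrightarrow> a \<le> c \<Longrightarrow> d \<le> b \<Longrightarrow> primitive X c d u v"
  using primitive_has_integral[of X a b u v c] primitive_carr[of X a b u v]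
  unfolding primitive_def[of X c d] by auto

lemma primitive_continuous_on:
  assumes "primitive X a b u v"
  shows "continuous_on {a..b} (\<lambda>t. binj X (u t))"
proof (cases "a \<le> b")
  case True
  have "(\<lambda>r. binj X (v r)) integrable_on {a..b}"
    using primitive_has_integral[OF assms order_refl True] by blast
  then have "continuous_on {a..b} (\<lambda>t. integral {a..t} (\<lambda>r. binj X (v r)))"
    by (rule indefinite_integral_continuous_1)
  then have "continuous_on {a..b} (\<lambda>t. integral {a..t} (\<lambda>r. binj X (v r)) + binj X (u a))"
    by (intro continuous_intros)
  moreover have "integral {a..t} (\<lambda>r. binj X (v r)) + binj X (u a) = binj X (u t)" if "t \<in> {a..b}" for t
    using integral_unique[OF primitive_has_integral[OF assms, of a t]] that by simp
  ultimately show ?thesis by (rule continuous_on_eq)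
qed simp

lemma primitive_continuous_map:
  "complex_banach X \<Longrightarrow> primitive X a b u v \<Longrightarrow> continuous_map (top_of_set {a..b}) (ntop X) u"
  by (simp add: continuous_map_ntop_iff primitive_carr primitive_continuous_on)

lemma primitive_bnd_lin:
  assumes X: "complex_banach X" and Y: "complex_banach Y" and B: "bnd_lin X Y C (\<lambda>x. x)" "0 \<le> C"
    and p: "primitive X a b u v" and v: "AE t in leb_Ioo a b. v t \<in> carr X"
  shows "primitive Y a b u v"
  unfolding primitive_def
proof (intro ballI conjI)
  fix t assume t: "t \<in> {a..b}"
  have u: "u t \<in> carr X" "u a \<in> carr X" using primitive_carr[OF p] t by auto
  then show "u t \<in> carr Y" using bnd_linD(1)[OF B(1)] by auto
  note bl = lift_op_bounded(3)[OF X Y B]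
  have "((\<lambda>r. lift_op X Y (\<lambda>x. x) (binj X (v r))) has_integral
      lift_op X Y (\<lambda>x. x) (binj X (u t) - binj X (u a))) {a..t}"
    using has_integral_linear[OF _ bl, of "\<lambda>r. binj X (v r)"] p t unfolding primitive_def o_def by blast
  moreover have "lift_op X Y (\<lambda>x. x) (binj X (u t) - binj X (u a)) = binj Y (u t) - binj Y (u a)"
    using u X by (simp add: bounded_linear.linear[OF bl, THEN linear_diff] lift_op_binj)
  ultimately have 1: "((\<lambda>r. lift_op X Y (\<lambda>x. x) (binj X (v r))) has_integral binj Y (u t) - binj Y (u a)) {a..t}"
    by simp
  have "AE r in leb_Ioo a t. v r \<in> carr X" using AE_leb_Ioo_subset[OF v, of a t] t by simp
  then have "AE r in leb_Ioo a t. lift_op X Y (\<lambda>x. x) (binj X (v r)) = binj Y (v r)"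
    by eventually_elim (simp add: lift_op_binj X)
  with 1 show "((\<lambda>r. binj Y (v r)) has_integral binj Y (u t) - binj Y (u a)) {a..t}"
    by (rule has_integral_cong_AE)
qed

text \<open>The inequality adds up over adjacent intervals, so bisection carries it from short
  intervals to the whole one.\<close>

lemma increment_le_of_local:
  fixes G :: "real \<Rightarrow> 'b::real_normed_vector" and H :: "real \<Rightarrow> real"
  assumes "a \<le> b" and d: "0 < d"
    and le: "\<And>s t. a \<le> s \<Longrightarrow> s \<le> t \<Longrightarrow> t \<le> b \<Longrightarrow> t - s < d \<Longrightarrow> norm (G t - G s) \<le> H t - H s"
  shows "norm (G b - G a) \<le> H b - H a"
proof -
  have "a \<le> a \<and> b \<le> b \<longrightarrow> norm (G b - G a) \<le> H b - H a"
    using \<open>a \<le> b\<close>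
  proof (induction rule: Bolzano[where P = "\<lambda>s t. a \<le> s \<and> t \<le> b \<longrightarrow> norm (G t - G s) \<le> H t - H s"])
    case (trans x y z)
    show ?case
    proof
      assume "a \<le> x \<and> z \<le> b"
      with trans have "norm (G y - G x) \<le> H y - H x" "norm (G z - G y) \<le> H z - H y" by auto
      then show "norm (G z - G x) \<le> H z - H x"
        using norm_triangle_ineq[of "G z - G y" "G y - G x"] by simp
    qed
  next
    case (local x)
    show ?case by (rule exI[of _ d]) (use d le in auto)
  qed
  then show ?thesis by simp
qed

text \<open>\<open>V\<close> is merely integrable, so \<open>U\<close> cannot be differentiated
  pointwise everywhere. Instead the defect \<open>G\<close> of the formula is shown to have
  increments at most \<open>e\<close> times length plus integral of \<open>norm V\<close> on short
  intervals; \<open>e\<close> is arbitrary.\<close>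

lemma product_rule_has_integral:
  fixes U V :: "real \<Rightarrow> 'b::banach" and \<phi> \<phi>' :: "real \<Rightarrow> real"
  assumes ab: "a \<le> b"
    and U: "\<And>s t. a \<le> s \<Longrightarrow> s \<le> t \<Longrightarrow> t \<le> b \<Longrightarrow> (V has_integral U t - U s) {s..t}"
    and cU: "continuous_on {a..b} U" and nV: "(\<lambda>r. norm (V r)) integrable_on {a..b}"
    and \<phi>: "\<And>t. t \<in> {a..b} \<Longrightarrow> (\<phi> has_real_derivative \<phi>' t) (at t within {a..b})"
    and c\<phi>': "continuous_on {a..b} \<phi>'"
    and \<phi>V: "(\<lambda>r. \<phi> r *\<^sub>R V r) integrable_on {a..b}"
  shows "((\<lambda>r. \<phi>' r *\<^sub>R U r + \<phi> r *\<^sub>R V r) has_integral (\<phi> b *\<^sub>R U b - \<phi> a *\<^sub>R U a)) {a..b}"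
proof -
  have c\<phi>: "continuous_on {a..b} \<phi>"
    using \<phi> by (rule DERIV_continuous_on)
  define J where "J r = \<phi>' r *\<^sub>R U r + \<phi> r *\<^sub>R V r" for r
  have J: "J integrable_on {a..b}" unfolding J_def
    by (intro integrable_add \<phi>V integrable_continuous_real continuous_intros cU c\<phi>')
  define G where "G t = \<phi> t *\<^sub>R U t - integral {a..t} J" for t
  define N where "N t = integral {a..t} (\<lambda>r. norm (V r))" for t
  have Nst: "N t - N s = integral {s..t} (\<lambda>r. norm (V r))" if "a \<le> s" "s \<le> t" "t \<le> b" for s t
    using Henstock_Kurzweil_Integration.integral_combine[OF that(1,2) integrable_on_subinterval[OF nV]] that
    unfolding N_def by (simp add: algebra_simps)
  have Jst: "integral {a..t} J - integral {a..s} J = integral {s..t} J" if "a \<le> s" "s \<le> t" "t \<le> b" for s t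
    using Henstock_Kurzweil_Integration.integral_combine[OF that(1,2) integrable_on_subinterval[OF J]] that
    by (simp add: algebra_simps)
  have "bounded (\<phi>' ` {a..b})" by (intro compact_imp_bounded compact_continuous_image c\<phi>') simp
  then obtain K where K: "0 < K" "\<And>t. t \<in> {a..b} \<Longrightarrow> \<bar>\<phi>' t\<bar> \<le> K"
    unfolding bounded_pos by auto
  have est: "norm (G b - G a) \<le> e * (b - a + N b)" if e: "0 < e" for e
  proof -
    have "uniformly_continuous_on {a..b} U"
      using cU by (intro compact_uniformly_continuous) auto
    moreover have "0 < e / K" using e K(1) by simp
    ultimately obtain d1 where d1: "0 < d1"
      "\<And>s t. s \<in> {a..b} \<Longrightarrow> t \<in> {a..b} \<Longrightarrow> dist t s < d1 \<Longrightarrow> dist (U t) (U s) < e / K"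
      unfolding uniformly_continuous_on_def by blast
    have "uniformly_continuous_on {a..b} \<phi>"
      using c\<phi> by (intro compact_uniformly_continuous) auto
    with e obtain d2 where d2: "0 < d2"
      "\<And>s t. s \<in> {a..b} \<Longrightarrow> t \<in> {a..b} \<Longrightarrow> dist t s < d2 \<Longrightarrow> dist (\<phi> t) (\<phi> s) < e"
      unfolding uniformly_continuous_on_def by blast
    note d = d1(1) d2(1) d1(2) d2(2)
    have "norm (G b - G a) \<le> e * (b + N b) - e * (a + N a)"
    proof (rule increment_le_of_local[OF ab, where d = "min d1 d2"])
      show "0 < min d1 d2" using d by simp
      fix s t assume st: "a \<le> s" "s \<le> t" "t \<le> b" "t - s < min d1 d2"
      have "(\<phi>' has_integral \<phi> t - \<phi> s) {s..t}"
        by (rule fundamental_theorem_of_calculus[OF st(2)])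
           (use st in \<open>auto simp: has_real_derivative_iff_has_vector_derivative[symmetric]
              intro!: DERIV_subset[OF \<phi>]\<close>)
      from has_integral_linear[OF this bounded_linear_scaleR_left, of "U t"]
      have h1: "((\<lambda>r. \<phi>' r *\<^sub>R U t) has_integral (\<phi> t - \<phi> s) *\<^sub>R U t) {s..t}" by (simp add: o_def)
      have h2: "((\<lambda>r. \<phi> s *\<^sub>R V r) has_integral \<phi> s *\<^sub>R (U t - U s)) {s..t}"
        by (rule has_integral_cmul[OF U]) (use st in auto)
      have h3: "(J has_integral integral {s..t} J) {s..t}"
        by (intro integrable_integral integrable_on_subinterval[OF J]) (use st in auto)
      \<comment> \<open>The integral of
        \<open>\<phi>' r *\<^sub>R U t + \<phi> s *\<^sub>R V r\<close> over \<open>{s..t}\<close>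
        is exactly \<open>\<phi> t *\<^sub>R U t - \<phi> s *\<^sub>R U s\<close>, and the integrand
        differs from \<open>J\<close> only by oscillations of \<open>U\<close> and
        \<open>\<phi>\<close>.\<close>
      have h: "((\<lambda>r. \<phi>' r *\<^sub>R U t + \<phi> s *\<^sub>R V r - J r) has_integral G t - G s) {s..t}"
        using has_integral_diff[OF has_integral_add[OF h1 h2] h3] Jst[OF st(1-3)]
        by (simp add: G_def algebra_simps)
      have n: "(\<lambda>r. e + e * norm (V r)) integrable_on {s..t}"
        using integrable_on_subinterval[OF nV, of s t] st
        by (intro integrable_add integrable_const_ivl integrable_on_mult_right) auto
      have "norm (integral {s..t} (\<lambda>r. \<phi>' r *\<^sub>R U t + \<phi> s *\<^sub>R V r - J r)) \<le> integral {s..t} (\<lambda>r. e + e * norm (V r))"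
      proof (rule integral_norm_bound_integral[OF has_integral_integrable[OF h] n])
        fix r assume r: "r \<in> {s..t}"
        have "norm (\<phi>' r *\<^sub>R (U t - U r)) \<le> K * (e / K)"
          unfolding norm_scaleR
          by (rule mult_mono) (use K r st d(3)[of r t] in \<open>auto simp: dist_norm dist_real_def\<close>)
        moreover have "norm ((\<phi> s - \<phi> r) *\<^sub>R V r) \<le> e * norm (V r)"
          unfolding norm_scaleR
          by (rule mult_right_mono) (use r st d(4)[of r s] in \<open>auto simp: dist_real_def\<close>)
        moreover have "\<phi>' r *\<^sub>R U t + \<phi> s *\<^sub>R V r - J r = \<phi>' r *\<^sub>R (U t - U r) + (\<phi> s - \<phi> r) *\<^sub>R V r"
          by (simp add: J_def algebra_simps)
        ultimately show "norm (\<phi>' r *\<^sub>R U t + \<phi> s *\<^sub>R V r - J r) \<le> e + e * norm (V r)"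
          using K(1) norm_triangle_ineq[of "\<phi>' r *\<^sub>R (U t - U r)" "(\<phi> s - \<phi> r) *\<^sub>R V r"] by simp
      qed
      also have "integral {s..t} (\<lambda>r. e + e * norm (V r)) = e * (t - s) + e * integral {s..t} (\<lambda>r. norm (V r))"
        using integrable_on_subinterval[OF nV, of s t] st
        by (subst Henstock_Kurzweil_Integration.integral_add) (auto intro!: integrable_on_mult_right)
      finally have "norm (G t - G s) \<le> e * (t - s) + e * (N t - N s)"
        unfolding integral_unique[OF h] Nst[OF st(1-3)] .
      then show "norm (G t - G s) \<le> e * (t + N t) - e * (s + N s)"
        by (simp add: algebra_simps)
    qed
    then show ?thesis by (simp add: N_def algebra_simps)
  qed
  have "0 \<le> N b" unfolding N_def by (rule integral_nonneg[OF nV]) simp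
  have "norm (G b - G a) \<le> 0"
  proof (rule field_le_epsilon)
    fix e :: real assume e: "0 < e"
    \<comment> \<open>The summand 1 keeps the divisor positive when \<open>a = b\<close> and
      \<open>V\<close> has integral zero.\<close>
    have D: "0 < b - a + N b + 1" using ab \<open>0 \<le> N b\<close> by simp
    have "norm (G b - G a) \<le> (e / (b - a + N b + 1)) * (b - a + N b)"
      by (rule est) (use e D in simp)
    also have "\<dots> \<le> e" using e D by (simp add: field_simps)
    finally show "norm (G b - G a) \<le> 0 + e" by simp
  qed
  then have "G b = G a" by simp
  then have "integral {a..b} J = \<phi> b *\<^sub>R U b - \<phi> a *\<^sub>R U a" by (simp add: G_def algebra_simps)
  with J show ?thesis unfolding J_def[symmetric] by (metis has_integral_integral)
qed

lemma primitive_scaleR: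
  assumes X: "complex_banach X" and q: "1 \<le> q" and p: "primitive X a b u v" and v: "v \<in> Lq q a b X"
    and \<phi>: "\<And>t. t \<in> {a..b} \<Longrightarrow> (\<phi> has_real_derivative \<phi>' t) (at t within {a..b})"
    and c\<phi>': "continuous_on {a..b} \<phi>'"
  shows "primitive X a b (\<lambda>t. \<phi> t *\<^sub>R u t) (\<lambda>t. \<phi>' t *\<^sub>R u t + \<phi> t *\<^sub>R v t)"
  unfolding primitive_def
proof (intro ballI conjI)
  fix t assume t: "t \<in> {a..b}"
  have uc: "u r \<in> carr X" if "r \<in> {a..b}" for r by (rule primitive_carr[OF p that])
  show "\<phi> t *\<^sub>R u t \<in> carr X" using uc[OF t] by (rule banach_scaleR[OF X])
  have c\<phi>: "continuous_on {a..b} \<phi>"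
    using \<phi> by (rule DERIV_continuous_on)
  have vc: "AE r in leb_Ioo a b. v r \<in> carr X" using v by (simp add: Lq_iff[OF X])
  have sub: "{a..t} \<subseteq> {a..b}" using t by auto
  have "(\<lambda>r. binj X (\<phi> r *\<^sub>R v r)) integrable_on {a..b}"
    using q by (intro Lq_integrable_on(3)[OF X _ q] Lq_scaleR[OF X v] c\<phi>) auto
  moreover have "AE r in leb_Ioo a b. binj X (\<phi> r *\<^sub>R v r) = \<phi> r *\<^sub>R binj X (v r)"
    using vc by eventually_elim (simp add: binj_scaleR X)
  ultimately have "(\<lambda>r. \<phi> r *\<^sub>R binj X (v r)) integrable_on {a..b}"
    unfolding integrable_on_def by (blast intro: has_integral_cong_AE)
  then have "((\<lambda>r. \<phi>' r *\<^sub>R binj X (u r) + \<phi> r *\<^sub>R binj X (v r)) has_integral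
      (\<phi> t *\<^sub>R binj X (u t) - \<phi> a *\<^sub>R binj X (u a))) {a..t}"
    using t sub Lq_integrable_on(4)[OF X v q]
    by (intro product_rule_has_integral primitive_has_integral[OF p] DERIV_subset[OF \<phi>])
       (auto intro: continuous_on_subset[OF primitive_continuous_on[OF p]] continuous_on_subset[OF c\<phi>']
         integrable_on_subinterval)
  moreover have "AE r in leb_Ioo a t. v r \<in> carr X" using AE_leb_Ioo_subset[OF vc, of a t] t by simp
  then have "AE r in leb_Ioo a t. \<phi>' r *\<^sub>R binj X (u r) + \<phi> r *\<^sub>R binj X (v r) = binj X (\<phi>' r *\<^sub>R u r + \<phi> r *\<^sub>R v r)"
    using AE_space by eventually_elim (use t uc in \<open>simp add: binj_scaleR binj_add banach_scaleR X\<close>)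
  ultimately have "((\<lambda>r. binj X (\<phi>' r *\<^sub>R u r + \<phi> r *\<^sub>R v r)) has_integral
      (\<phi> t *\<^sub>R binj X (u t) - \<phi> a *\<^sub>R binj X (u a))) {a..t}"
    by (rule has_integral_cong_AE)
  then show "((\<lambda>r. binj X (\<phi>' r *\<^sub>R u r + \<phi> r *\<^sub>R v r)) has_integral
      binj X (\<phi> t *\<^sub>R u t) - binj X (\<phi> a *\<^sub>R u a)) {a..t}"
    using t uc by (simp add: binj_scaleR X)
qed

lemma AE_leb_Ioo_ex:
  assumes "a < b" "AE t in leb_Ioo a b. P t"
  shows "\<exists>t. a < t \<and> t < b \<and> P t"
proof (rule ccontr)
  assume no: "\<not> ?thesis"
  from assms(2) AE_space[of "leb_Ioo a b"] have "AE t in leb_Ioo a b. False"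
    by eventually_elim (use no in auto)
  then have "space (leb_Ioo a b) \<in> null_sets (leb_Ioo a b)"
    by (subst AE_iff_null_sets) (auto elim: eventually_mono)
  then have "emeasure (leb_Ioo a b) (space (leb_Ioo a b)) = 0" by blast
  moreover have "emeasure (leb_Ioo a b) (space (leb_Ioo a b)) = ennreal (b - a)"
    using assms(1) by (simp add: emeasure_restrict_space)
  ultimately show False using assms(1) by simp
qed

text \<open>Integrals in the smaller space are integrals in the larger one, so a primitive that starts
  at one point of the smaller space never leaves it.\<close>

lemma primitive_upgrade:
  assumes X: "complex_banach X" and Y: "complex_banach Y" and B: "bnd_lin X Y C (\<lambda>x. x)" "0 \<le> C"
    and q: "1 \<le> q" and ab: "a < b" and p: "primitive Y a b u v" and v: "v \<in> Lq q a b X"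
    and u: "AE t in leb_Ioo a b. u t \<in> carr X"
  shows "primitive X a b u v"
proof -
  obtain t0 where t0: "a < t0" "t0 < b" "u t0 \<in> carr X" using AE_leb_Ioo_ex[OF ab u] by blast
  note bl = lift_op_bounded(3)[OF X Y B]
  have vc: "AE r in leb_Ioo a b. v r \<in> carr X" using v by (simp add: Lq_iff[OF X])
  have step: "\<exists>x\<in>carr X. ((\<lambda>r. binj X (v r)) has_integral binj X x) {s..t} \<and> u t - u s = x"
    if st: "a \<le> s" "s \<le> t" "t \<le> b" for s t
  proof -
    have "(\<lambda>r. binj X (v r)) integrable_on {s..t}"
      by (rule integrable_on_subinterval[OF Lq_integrable_on(3)[OF X v q]]) (use st in auto)
    then obtain x where x: "x \<in> carr X" "((\<lambda>r. binj X (v r)) has_integral binj X x) {s..t}"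
      using integral_in_carr[OF X] by blast
    have "((\<lambda>r. lift_op X Y (\<lambda>x. x) (binj X (v r))) has_integral binj Y x) {s..t}"
      using has_integral_linear[OF x(2) bl] x(1) by (simp add: o_def lift_op_binj X)
    moreover have "AE r in leb_Ioo s t. v r \<in> carr X" using AE_leb_Ioo_subset[OF vc] st by blast
    then have "AE r in leb_Ioo s t. lift_op X Y (\<lambda>x. x) (binj X (v r)) = binj Y (v r)"
      by eventually_elim (simp add: lift_op_binj X)
    ultimately have "((\<lambda>r. binj Y (v r)) has_integral binj Y x) {s..t}" by (rule has_integral_cong_AE)
    then have "binj Y x = binj Y (u t) - binj Y (u s)"
      using primitive_has_integral[OF p st] by (rule has_integral_unique)
    then have "binj Y x = binj Y (u t - u s)"
      using primitive_carr[OF p] st by (simp add: binj_diff Y)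
    moreover have "x \<in> carr Y" using bnd_linD(1)[OF B(1) x(1)] .
    moreover have "u t - u s \<in> carr Y"
      by (intro banach_diff[OF Y] primitive_carr[OF p]) (use st in auto)
    ultimately have "u t - u s = x" using binj_inject[OF Y] by metis
    with x show ?thesis by blast
  qed
  have uc: "u t \<in> carr X" if t: "a \<le> t" "t \<le> b" for t
  proof (cases "t0 \<le> t")
    case True
    then have "u t - u t0 \<in> carr X" using step[of t0 t] t t0 by auto
    from banach_add[OF X this t0(3)] show ?thesis by simp
  next
    case False
    then have "u t0 - u t \<in> carr X" using step[of t t0] t t0 by auto
    from banach_diff[OF X t0(3) this] show ?thesis by simp
  qed
  show ?thesis
    unfolding primitive_def
  proof (intro ballI conjI)
    fix t assume t: "t \<in> {a..b}"
    then show "u t \<in> carr X" using uc by auto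
    show "((\<lambda>r. binj X (v r)) has_integral binj X (u t) - binj X (u a)) {a..t}"
      using step[of a t] t uc[of a] uc[of t] ab by (auto simp: binj_diff[OF X, symmetric])
  qed
qed

subsection \<open>Test functions\<close>

text \<open>Counting the order makes closure under sums, products and affine substitution provable
  by induction; a test function is one for which every order is available.\<close>

definition diff_times :: "nat \<Rightarrow> (real \<Rightarrow> real) \<Rightarrow> bool" where
  "diff_times k f \<longleftrightarrow> (\<forall>n<k. \<forall>t. ((deriv ^^ n) f) field_differentiable (at t))"

lemma diff_times_0 [simp]: "diff_times 0 f"
  by (simp add: diff_times_def)

lemma diff_times_Suc:
  "diff_times (Suc k) f \<longleftrightarrow> (\<forall>t. f field_differentiable (at t)) \<and> diff_times k (deriv f)"
  unfolding diff_times_def All_less_Suc2 funpow_Suc_right by simp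

lemma diff_times_mono: "diff_times k f \<Longrightarrow> j \<le> k \<Longrightarrow> diff_times j f"
  unfolding diff_times_def by auto

lemma diff_times_add: "diff_times k f \<Longrightarrow> diff_times k g \<Longrightarrow> diff_times k (\<lambda>x. f x + g x)"
proof (induction k arbitrary: f g)
  case (Suc k)
  then have "deriv (\<lambda>x. f x + g x) = (\<lambda>x. deriv f x + deriv g x)"
    by (intro ext deriv_add) (auto simp: diff_times_Suc)
  with Suc show ?case by (auto simp: diff_times_Suc intro!: field_differentiable_add)
qed simp

lemma diff_times_mult: "diff_times k f \<Longrightarrow> diff_times k g \<Longrightarrow> diff_times k (\<lambda>x. f x * g x)"
proof (induction k arbitrary: f g)
  case (Suc k)
  then have "deriv (\<lambda>x. f x * g x) = (\<lambda>x. f x * deriv g x + deriv f x * g x)"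
    by (intro ext deriv_mult) (auto simp: diff_times_Suc)
  moreover have "diff_times k f" "diff_times k g" using Suc.prems by (auto intro: diff_times_mono)
  ultimately show ?case using Suc
    by (auto simp: diff_times_Suc intro!: field_differentiable_mult diff_times_add)
qed simp

lemma diff_times_const: "diff_times k (\<lambda>_. c)"
  by (induction k arbitrary: c) (auto simp: diff_times_Suc)

lemma diff_times_affine: "diff_times k f \<Longrightarrow> diff_times k (\<lambda>x. f (c * x + d))"
proof (induction k arbitrary: f)
  case (Suc k)
  have D: "((\<lambda>x. f (c * x + d)) has_field_derivative deriv f (c * x + d) * c) (at x)" for x
    by (rule DERIV_chain2[where g = "\<lambda>x. c * x + d"])
       (use Suc.prems in \<open>auto intro!: derivative_eq_intros simp: diff_times_Suc field_differentiable_derivI\<close>)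
  then have "deriv (\<lambda>x. f (c * x + d)) = (\<lambda>x. deriv f (c * x + d) * c)"
    by (intro ext DERIV_imp_deriv)
  with Suc D show ?case
    by (auto simp: diff_times_Suc field_differentiable_def intro!: diff_times_mult diff_times_const)
qed simp

text \<open>The classical flat function, with a polynomial in \<open>inverse x\<close> as a
  parameter so that the class is closed under differentiation.\<close>

definition flat :: "real poly \<Rightarrow> real \<Rightarrow> real" where
  "flat p x = (if 0 < x then poly p (inverse x) * exp (- inverse x) else 0)"

lemma tendsto_poly_exp_0: "((\<lambda>z. z ^ k * poly p z * exp (- z)) \<longlongrightarrow> (0::real)) at_top"
proof (induction p arbitrary: k)
  case (pCons a p)
  have "((\<lambda>z. a * (z ^ k / exp z) + z ^ Suc k * poly p z * exp (- z)) \<longlongrightarrow> a * 0 + 0) at_top"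
    by (intro tendsto_intros tendsto_power_div_exp_0 pCons)
  then show ?case by (simp add: exp_minus field_simps)
qed simp

text \<open>Differentiating \<open>p (1/x) exp (-1/x)\<close> gives
  \<open>(1/x)^2 (p - p') (1/x) exp (-1/x)\<close>; the polynomial \<open>[:0, 0, 1:]\<close> is the
  square. At 0 exponential decay beats every power.\<close>

lemma flat_has_derivative:
  "(flat p has_field_derivative flat ([:0, 0, 1:] * (p - pderiv p)) x) (at x)"
proof -
  consider "0 < x" | "x < 0" | "x = 0" by linarith
  then show ?thesis
  proof cases
    case 1
    then have D: "(inverse has_field_derivative - (inverse x ^ Suc (Suc 0))) (at x)"
      by (intro DERIV_inverse) simp
    have "((\<lambda>x. poly p (inverse x) * exp (- inverse x)) has_field_derivative
        flat ([:0, 0, 1:] * (p - pderiv p)) x) (at x)"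
      using DERIV_mult[OF DERIV_chain2[OF poly_DERIV D] DERIV_chain2[OF DERIV_exp DERIV_minus[OF D]], of p] 1
      by (simp add: flat_def algebra_simps)
    then show ?thesis
      by (rule has_field_derivative_transform_within_open[of _ _ _ "{0<..}"]) (use 1 in \<open>auto simp: flat_def\<close>)
  next
    case 2
    have "((\<lambda>_. 0) has_field_derivative flat ([:0, 0, 1:] * (p - pderiv p)) x) (at x)"
      using 2 by (simp add: flat_def)
    then show ?thesis
      by (rule has_field_derivative_transform_within_open[of _ _ _ "{..<0}"]) (use 2 in \<open>auto simp: flat_def\<close>)
  next
    case 3
    have "((\<lambda>h. (flat p (0 + h) - flat p 0) / h) \<longlongrightarrow> 0) (at 0)"
      unfolding filterlim_at_split
    proof
      show "((\<lambda>h. (flat p (0 + h) - flat p 0) / h) \<longlongrightarrow> 0) (at_left 0)"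
        by (rule tendsto_eventually) (auto simp: eventually_at_filter flat_def)
      have "((\<lambda>h. inverse h ^ 1 * poly p (inverse h) * exp (- inverse h)) \<longlongrightarrow> (0::real)) (at_right 0)"
        by (rule filterlim_compose[OF tendsto_poly_exp_0 filterlim_inverse_at_top_right])
      then show "((\<lambda>h. (flat p (0 + h) - flat p 0) / h) \<longlongrightarrow> 0) (at_right 0)"
        by (rule Lim_transform_eventually) (auto simp: eventually_at_filter flat_def divide_inverse)
    qed
    then show ?thesis using 3 by (simp add: DERIV_def flat_def)
  qed
qed

lemma diff_times_flat: "diff_times k (flat p)"
proof (induction k arbitrary: p)
  case (Suc k)
  have "deriv (flat p) = flat ([:0, 0, 1:] * (p - pderiv p))"
    by (intro ext DERIV_imp_deriv flat_has_derivative)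
  with Suc show ?case unfolding diff_times_Suc field_differentiable_def
    using flat_has_derivative by metis
qed simp

definition bump :: "real \<Rightarrow> real" where
  "bump x = flat 1 (1 * x + 1) * flat 1 ((-1) * x + 1)"

text \<open>A smooth step, constant outside \<open>(-1, 1)\<close>. The lower limit lies strictly to
  the left of the support of \<open>bump\<close>; the total height \<open>bump_step 1\<close> is
  left unnormalised.\<close>

definition bump_step :: "real \<Rightarrow> real" where
  "bump_step x = integral {-2..x} bump"

lemma diff_times_bump: "diff_times k bump"
  unfolding bump_def[abs_def] by (intro diff_times_mult diff_times_affine diff_times_flat)

lemma bump_continuous: "continuous_on S bump"
proof -
  have "bump field_differentiable (at x)" for x
    using diff_times_bump[of "Suc 0"] by (simp add: diff_times_Suc)
  then show ?thesis
    by (meson continuous_at_imp_continuous_on field_differentiable_imp_continuous_at)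
qed

lemma bump_nonneg: "0 \<le> bump x"
  by (auto simp: bump_def flat_def)

lemma bump_eq_0: "1 \<le> \<bar>x\<bar> \<Longrightarrow> bump x = 0"
  by (auto simp: bump_def flat_def)

lemma bump_step_deriv: "(bump_step has_field_derivative bump x) (at x)"
proof (cases "x < -1")
  case True
  have z: "bump_step y = 0" if "y < -1" for y
  proof -
    have "integral {-2..y} bump = integral {-2..y} (\<lambda>_. 0)"
      by (rule Henstock_Kurzweil_Integration.integral_cong) (use that in \<open>auto intro: bump_eq_0\<close>)
    then show ?thesis by (simp add: bump_step_def)
  qed
  have "((\<lambda>_. 0) has_field_derivative bump x) (at x)" using True by (simp add: bump_eq_0)
  then show ?thesis
    by (rule has_field_derivative_transform_within_open[of _ _ _ "{..<-1}"]) (use True z in auto)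
next
  case False
  have "((\<lambda>x. integral {-2..x} bump) has_real_derivative bump x) (at x within {-2..x + 1})"
    by (rule integral_has_real_derivative[OF bump_continuous]) (use False in auto)
  moreover have "at x within {-2..x + 1} = at x"
    by (rule at_within_interior) (use False in auto)
  ultimately show ?thesis by (simp add: bump_step_def[abs_def])
qed

lemma bump_step_left: "x \<le> -1 \<Longrightarrow> bump_step x = 0"
proof -
  assume x: "x \<le> -1"
  have "integral {-2..x} bump = integral {-2..x} (\<lambda>_. 0)"
    by (rule Henstock_Kurzweil_Integration.integral_cong) (use x in \<open>auto intro: bump_eq_0\<close>)
  then show ?thesis by (simp add: bump_step_def)
qed

lemma bump_step_right:
  assumes x: "1 \<le> x"
  shows "bump_step x = bump_step 1"
proof -
  have "integral {-2..1} bump + integral {1..x} bump = integral {-2..x} bump"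
    by (rule Henstock_Kurzweil_Integration.integral_combine)
       (use x in \<open>auto intro!: integrable_continuous_real bump_continuous\<close>)
  moreover have "integral {1..x} bump = integral {1..x} (\<lambda>_. 0)"
    by (rule Henstock_Kurzweil_Integration.integral_cong) (auto intro: bump_eq_0)
  ultimately show ?thesis by (simp add: bump_step_def)
qed

lemma bump_step_pos: "0 < bump_step 1"
proof -
  have "0 \<le> bump_step 1"
    unfolding bump_step_def
    by (intro integral_nonneg integrable_continuous_real bump_continuous bump_nonneg)
  moreover have "bump_step 1 \<noteq> 0"
  proof
    assume "bump_step 1 = 0"
    then have "(bump has_integral 0) (cbox (-2) 1)"
      unfolding bump_step_def
      using integrable_integral[OF integrable_continuous_real[OF bump_continuous, of "-2" 1]] by simp
    then have "bump 0 = 0"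
      by (rule has_integral_0_cbox_imp_0[OF bump_continuous bump_nonneg]) auto
    then show False by (simp add: bump_def flat_def)
  qed
  ultimately show ?thesis by simp
qed

lemma diff_times_bump_step: "diff_times k bump_step"
proof (cases k)
  case (Suc j)
  have "deriv bump_step = bump" by (intro ext DERIV_imp_deriv bump_step_deriv)
  then show ?thesis unfolding Suc diff_times_Suc field_differentiable_def
    using bump_step_deriv diff_times_bump by metis
qed simp

lemma test_functionI:
  assumes "\<And>k. diff_times k \<phi>" "a < c" "d < b" "\<And>t. t < c \<or> d < t \<Longrightarrow> \<phi> t = 0"
  shows "test_function a b \<phi>"
  using assms unfolding test_function_def diff_times_def by (metis atLeastAtMost_iff lessI linorder_not_le)

lemma test_function_deriv:
  assumes "test_function a b \<phi>"
  shows "(\<phi> has_real_derivative deriv \<phi> t) (at t)" "continuous_on S (deriv \<phi>)" "\<phi> a = 0" "\<phi> b = 0"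
proof -
  have d: "((deriv ^^ n) \<phi>) field_differentiable (at t)" for n t
    using assms unfolding test_function_def by blast
  from d[of 0 t] show "(\<phi> has_real_derivative deriv \<phi> t) (at t)"
    by (simp add: field_differentiable_derivI)
  from d[of 1] show "continuous_on S (deriv \<phi>)"
    by (auto intro!: continuous_at_imp_continuous_on field_differentiable_imp_continuous_at)
  show "\<phi> a = 0" "\<phi> b = 0" using assms unfolding test_function_def by force+
qed

text \<open>The lemma of du Bois-Reymond: the difference of two narrow steps at \<open>s\<close> and
  at \<open>t\<close> is a test function whose derivative is a difference of two approximate point
  masses. Testing with it compares \<open>g s\<close> with \<open>g t\<close>.\<close>

lemma continuous_const_of_weak_deriv_0:
  fixes g :: "real \<Rightarrow> 'b::banach"
  assumes ab: "a < b" and g: "continuous_on {a..b} g"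
    and z: "\<And>\<phi>. test_function a b \<phi> \<Longrightarrow> ((\<lambda>t. deriv \<phi> t *\<^sub>R g t) has_integral 0) {a..b}"
    and st: "a < s" "s < t" "t < b"
  shows "g s = g t"
proof -
  let ?c = "bump_step 1"
  \<comment> \<open>Approximate point mass at \<open>p\<close> of width \<open>d\<close> and total
    mass \<open>?c\<close>; \<open>kd\<close> exhibits the rescaled step as its primitive.\<close>
  define k where "k d p r = bump ((r - p) / d) / d" for d p r :: real
  have kd: "((\<lambda>r. bump_step ((r - p) / d)) has_real_derivative k d p r) (at r)" if "0 < d" for d p r
  proof -
    have "((\<lambda>r. (r - p) / d) has_real_derivative 1 / d) (at r)"
      using that by (auto intro!: derivative_eq_intros)
    from DERIV_chain2[OF bump_step_deriv this] show ?thesis by (simp add: k_def)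
  qed
  have kc: "continuous_on S (k d p)" if "0 < d" for S d p
    unfolding k_def[abs_def] using that
    by (intro continuous_intros continuous_on_compose2[OF bump_continuous]) auto
  have main: "norm (?c *\<^sub>R (g s - g t)) \<le> ?c * e" if e: "0 < e" for e
  proof -
    have "\<exists>d>0. \<forall>r\<in>{a..b}. dist r p < d \<longrightarrow> dist (g r) (g p) < e / 2" if "p \<in> {a..b}" for p
      using g that half_gt_zero[OF e] unfolding continuous_on_iff by blast
    note near = this
    obtain d1 where d1: "0 < d1" "\<And>r. r \<in> {a..b} \<Longrightarrow> dist r s < d1 \<Longrightarrow> dist (g r) (g s) < e / 2"
      using near[of s] st by auto
    obtain d2 where d2: "0 < d2" "\<And>r. r \<in> {a..b} \<Longrightarrow> dist r t < d2 \<Longrightarrow> dist (g r) (g t) < e / 2"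
      using near[of t] st by auto
    note d12 = d1(1) d2(1) d1(2) d2(2)
    \<comment> \<open>Small enough for both smoothing intervals to stay inside
      \<open>(a, b)\<close>, and for \<open>g\<close> to differ there by less than
      \<open>e / 2\<close> from its value at the centre.\<close>
    define d where "d = min (min d1 d2) (min (s - a) (b - t)) / 2"
    have d: "0 < d" "d < d1" "d < d2" "d < s - a" "d < b - t"
      using d12(1,2) st by (auto simp: d_def min_def)
    have one: "\<exists>I. ((\<lambda>r. k d p r *\<^sub>R g r) has_integral I) {a..b} \<and> norm (I - ?c *\<^sub>R g p) \<le> ?c * (e / 2)"
      if p: "a + d < p" "p < b - d" and close: "\<And>r. r \<in> {a..b} \<Longrightarrow> dist r p < d \<Longrightarrow> dist (g r) (g p) < e / 2" for p
    proof -
      have "(k d p has_integral bump_step ((b - p) / d) - bump_step ((a - p) / d)) {a..b}"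
        by (rule fundamental_theorem_of_calculus)
           (use ab d in \<open>auto simp: has_real_derivative_iff_has_vector_derivative[symmetric]
              intro!: has_field_derivative_at_within kd\<close>)
      moreover have "bump_step ((b - p) / d) = ?c" by (rule bump_step_right) (use p d in \<open>simp add: field_simps\<close>)
      moreover have "bump_step ((a - p) / d) = 0" by (rule bump_step_left) (use p d in \<open>simp add: field_simps\<close>)
      ultimately have hk: "(k d p has_integral ?c) {a..b}" by simp
      have "(\<lambda>r. k d p r *\<^sub>R g r) integrable_on {a..b}"
        by (intro integrable_continuous_real continuous_intros kc d g)
      then obtain I where I: "((\<lambda>r. k d p r *\<^sub>R g r) has_integral I) {a..b}" by blast
      from has_integral_linear[OF hk bounded_linear_scaleR_left, of "g p"]
      have "((\<lambda>r. k d p r *\<^sub>R g p) has_integral ?c *\<^sub>R g p) {a..b}" by (simp add: o_def)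
      from has_integral_diff[OF I this]
      have D: "((\<lambda>r. k d p r *\<^sub>R (g r - g p)) has_integral I - ?c *\<^sub>R g p) {a..b}"
        by (simp add: scaleR_diff_right)
      have ke: "((\<lambda>r. k d p r * (e / 2)) has_integral ?c * (e / 2)) {a..b}"
        by (rule has_integral_mult_left[OF hk])
      have "norm (integral {a..b} (\<lambda>r. k d p r *\<^sub>R (g r - g p))) \<le> integral {a..b} (\<lambda>r. k d p r * (e / 2))"
      proof (rule integral_norm_bound_integral[OF has_integral_integrable[OF D] has_integral_integrable[OF ke]])
        fix r assume r: "r \<in> {a..b}"
        have k0: "0 \<le> k d p r" unfolding k_def using d bump_nonneg by simp
        show "norm (k d p r *\<^sub>R (g r - g p)) \<le> k d p r * (e / 2)"
        proof (cases "dist r p < d")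
          case True
          then have "norm (g r - g p) \<le> e / 2" using close[OF r] by (simp add: dist_norm)
          from mult_left_mono[OF this k0] show ?thesis using k0 by (simp only: norm_scaleR abs_of_nonneg)
        next
          case False
          then have "1 \<le> \<bar>(r - p) / d\<bar>" using d by (simp add: dist_real_def field_simps)
          then show ?thesis by (simp add: k_def bump_eq_0)
        qed
      qed
      then have "norm (I - ?c *\<^sub>R g p) \<le> ?c * (e / 2)"
        unfolding integral_unique[OF D] integral_unique[OF ke] .
      with I show ?thesis by blast
    qed
    obtain I where I: "((\<lambda>r. k d s r *\<^sub>R g r) has_integral I) {a..b}" "norm (I - ?c *\<^sub>R g s) \<le> ?c * (e / 2)"
      using one[of s] d st d12(3) by force
    obtain J where J: "((\<lambda>r. k d t r *\<^sub>R g r) has_integral J) {a..b}" "norm (J - ?c *\<^sub>R g t) \<le> ?c * (e / 2)"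
      using one[of t] d st d12(4) by force
    \<comment> \<open>The step up at \<open>s\<close> is cancelled by the step down at
      \<open>t\<close>, hence compact support; the affine form matches
      \<open>diff_times_affine\<close>.\<close>
    define \<phi> where "\<phi> r = bump_step ((1 / d) * r + (- s / d)) + (-1) * bump_step ((1 / d) * r + (- t / d))" for r
    have \<phi>': "\<phi> r = bump_step ((r - s) / d) - bump_step ((r - t) / d)" for r
      by (simp add: \<phi>_def diff_divide_distrib)
    have "test_function a b \<phi>"
    proof (rule test_functionI[of _ _ "s - d" "t + d"])
      show "diff_times k \<phi>" for k
        unfolding \<phi>_def[abs_def]
        by (intro diff_times_add diff_times_mult diff_times_const diff_times_affine diff_times_bump_step)
      show "\<phi> r = 0" if "r < s - d \<or> t + d < r" for r
        using that
      proof
        assume "r < s - d"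
        then have "(r - s) / d \<le> -1" "(r - t) / d \<le> -1" using d st by (simp_all add: field_simps)
        then show ?thesis by (simp add: \<phi>' bump_step_left)
      next
        assume "t + d < r"
        then have "1 \<le> (r - s) / d" "1 \<le> (r - t) / d" using d st by (simp_all add: field_simps)
        then show ?thesis
          unfolding \<phi>' using bump_step_right[of "(r - s) / d"] bump_step_right[of "(r - t) / d"] by linarith
      qed
    qed (use d in auto)
    from z[OF this] have "((\<lambda>r. deriv \<phi> r *\<^sub>R g r) has_integral 0) {a..b}" .
    moreover have "deriv \<phi> r = k d s r - k d t r" for r
      unfolding \<phi>'[abs_def] by (intro DERIV_imp_deriv DERIV_diff kd d)
    ultimately have "((\<lambda>r. k d s r *\<^sub>R g r - k d t r *\<^sub>R g r) has_integral 0) {a..b}"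
      by (simp add: scaleR_diff_left)
    with has_integral_diff[OF I(1) J(1)] have "I - J = 0" by (rule has_integral_unique)
    then have "?c *\<^sub>R (g s - g t) = (J - ?c *\<^sub>R g t) - (I - ?c *\<^sub>R g s)" by (simp add: algebra_simps)
    then have "norm (?c *\<^sub>R (g s - g t)) \<le> norm (J - ?c *\<^sub>R g t) + norm (I - ?c *\<^sub>R g s)"
      by (simp add: norm_triangle_ineq4)
    with I(2) J(2) show ?thesis by (simp add: field_simps)
  qed
  have "norm (g s - g t) \<le> 0"
  proof (rule field_le_epsilon)
    fix e :: real assume "0 < e"
    from main[OF this] show "norm (g s - g t) \<le> 0 + e" using bump_step_pos by simp
  qed
  then show ?thesis by simp
qed

subsection \<open>Weak derivatives and strong solutions\<close>

lemma Lq_of_continuous: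
  assumes X: "complex_banach X" and u: "\<And>t. t \<in> {a..b} \<Longrightarrow> u t \<in> carr X"
    and c: "continuous_on {a..b} (\<lambda>t. binj X (u t))" and q: "0 \<le> q"
  shows "u \<in> Lq q a b X"
proof -
  have "bounded ((\<lambda>t. binj X (u t)) ` {a..b})" by (intro compact_imp_bounded compact_continuous_image c) simp
  then have "\<exists>K. \<forall>t\<in>{a..b}. norm (binj X (u t)) \<le> K" unfolding bounded_iff by auto
  then obtain K where K: "\<And>t. t \<in> {a..b} \<Longrightarrow> norm (binj X (u t)) \<le> K" by blast
  have "qint (leb_Ioo a b) q (\<lambda>t. binj X (u t)) \<le> (\<integral>\<^sup>+ t. ennreal (K powr q) \<partial>leb_Ioo a b)"
    unfolding qint_def
  proof (rule nn_integral_mono)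
    fix t assume "t \<in> space (leb_Ioo a b)"
    then have "norm (binj X (u t)) \<le> K" by (intro K) auto
    then show "ennreal (norm (binj X (u t)) powr q) \<le> ennreal (K powr q)"
      by (intro ennreal_leI powr_mono2 q) auto
  qed
  also have "\<dots> < \<infinity>"
    using emeasure_leb_Ioo_finite[of a b] by (simp add: ennreal_mult_less_top less_top)
  finally show ?thesis
    unfolding Lq_iff[OF X] using smeas_continuous_on[OF c] u by (auto intro!: AE_leb_Ioo_I)
qed

lemma primitive_Lq: "complex_banach X \<Longrightarrow> primitive X a b u v \<Longrightarrow> 0 \<le> q \<Longrightarrow> u \<in> Lq q a b X"
  by (rule Lq_of_continuous) (auto intro: primitive_carr primitive_continuous_on)

text \<open>By the product rule the indefinite integral \<open>I\<close> of \<open>v\<close> has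
  \<open>v\<close> as weak derivative. So the continuous function \<open>u\<close> minus
  \<open>I\<close> has weak derivative 0 and is constant.\<close>

lemma weak_deriv_primitive:
  assumes X: "complex_banach X" and ab: "a < b" and q: "1 \<le> q"
    and u: "continuous_map (top_of_set {a..b}) (ntop X) u" and v: "v \<in> Lq q a b X"
    and w: "weak_deriv a b X u v"
  shows "primitive X a b u v"
proof -
  have uc: "\<And>t. t \<in> {a..b} \<Longrightarrow> u t \<in> carr X" and cu: "continuous_on {a..b} (\<lambda>t. binj X (u t))"
    using u by (simp_all add: continuous_map_ntop_iff[OF X])
  have vc: "AE t in leb_Ioo a b. v t \<in> carr X" using v by (simp add: Lq_iff[OF X])
  define V where "V t = binj X (v t)" for t
  define I where "I t = integral {a..t} V" for t
  have Vi: "V integrable_on {a..b}" and nV: "(\<lambda>t. norm (V t)) integrable_on {a..b}"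
    using Lq_integrable_on[OF X v q] by (simp_all add: V_def[abs_def])
  have cI: "continuous_on {a..b} I" unfolding I_def by (rule indefinite_integral_continuous_1[OF Vi])
  have It: "(V has_integral I t - I s) {s..t}" if "a \<le> s" "s \<le> t" "t \<le> b" for s t
  proof -
    have "I s + integral {s..t} V = I t"
      unfolding I_def
      by (rule Henstock_Kurzweil_Integration.integral_combine[OF that(1,2) integrable_on_subinterval[OF Vi]])
         (use that in auto)
    then have "I t - I s = integral {s..t} V" by (simp add: algebra_simps)
    moreover have "V integrable_on {s..t}" by (rule integrable_on_subinterval[OF Vi]) (use that in auto)
    ultimately show ?thesis by (simp add: integrable_integral)
  qed
  define g where "g t = binj X (u t) - I t" for t
  have cg: "continuous_on {a..b} g" unfolding g_def by (intro continuous_intros cu cI)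
  have "((\<lambda>t. deriv \<phi> t *\<^sub>R g t) has_integral 0) {a..b}" if \<phi>: "test_function a b \<phi>" for \<phi>
  proof -
    note d = test_function_deriv[OF \<phi>]
    have c\<phi>: "continuous_on {a..b} \<phi>" by (rule DERIV_continuous_on[OF has_field_derivative_at_within[OF d(1)]])
    obtain x where x: "has_bochner_integral_in X {a<..<b} (\<lambda>t. deriv \<phi> t *\<^sub>R u t) x"
      "has_bochner_integral_in X {a<..<b} (\<lambda>t. \<phi> t *\<^sub>R v t) (- x)"
      using w \<phi> unfolding weak_deriv_def by blast
    have xc: "x \<in> carr X" and x1: "((\<lambda>t. binj X (deriv \<phi> t *\<^sub>R u t)) has_integral binj X x) {a..b}"
      and x2: "((\<lambda>t. binj X (\<phi> t *\<^sub>R v t)) has_integral binj X (- x)) {a..b}"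
      using x ab unfolding has_bochner_integral_in_iff[OF X less_imp_le[OF ab]] by auto
    have "((\<lambda>t. deriv \<phi> t *\<^sub>R binj X (u t)) has_integral binj X x) {a..b}"
      by (rule has_integral_eq[OF _ x1]) (use uc in \<open>simp add: binj_scaleR X\<close>)
    moreover have "AE t in leb_Ioo a b. binj X (\<phi> t *\<^sub>R v t) = \<phi> t *\<^sub>R V t"
      using vc by eventually_elim (simp add: V_def binj_scaleR X)
    with x2 have y2: "((\<lambda>t. \<phi> t *\<^sub>R V t) has_integral binj X (- x)) {a..b}"
      by (rule has_integral_cong_AE)
    have "((\<lambda>r. deriv \<phi> r *\<^sub>R I r + \<phi> r *\<^sub>R V r) has_integral (\<phi> b *\<^sub>R I b - \<phi> a *\<^sub>R I a)) {a..b}"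
      using ab by (intro product_rule_has_integral It cI nV has_field_derivative_at_within[OF d(1)] d(2)
          has_integral_integrable[OF y2]) auto
    from has_integral_diff[OF this y2]
    have "((\<lambda>r. deriv \<phi> r *\<^sub>R I r) has_integral - binj X (- x)) {a..b}" by (simp add: d)
    moreover have "binj X (- x) = - binj X x"
      using binj_scaleR[OF X xc, of "-1"] by simp
    ultimately show ?thesis
      using has_integral_diff[of "\<lambda>t. deriv \<phi> t *\<^sub>R binj X (u t)" "binj X x" "{a..b}"
          "\<lambda>r. deriv \<phi> r *\<^sub>R I r" "binj X x"] by (simp add: g_def scaleR_diff_right)
  qed
  note const = continuous_const_of_weak_deriv_0[OF ab cg this]
  define m where "m = (a + b) / 2"
  have m: "a < m" "m < b" using ab by (simp_all add: m_def)
  have mid: "g t = g m" if "a < t" "t < b" for t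
  proof (cases t m rule: linorder_cases)
    case less
    then show ?thesis using const[of t m] that m by blast
  next
    case greater
    then show ?thesis using const[of m t] that m by simp
  qed simp
  \<comment> \<open>Test functions see only the open interval; continuity carries constancy to the
    end points.\<close>
  have "g t = g m" if t: "t \<in> {a..b}" for t
  proof -
    have "continuous_on (closure {a<..<b}) g" using cg ab by simp
    moreover have "g constant_on {a<..<b}" unfolding constant_on_def using mid by auto
    ultimately have "g constant_on (closure {a<..<b})"
      by (intro constant_on_closureI)
    then show ?thesis using t m ab unfolding constant_on_def by auto
  qed
  then have g: "g t = g a" if "t \<in> {a..b}" for t using that ab by (metis atLeastAtMost_iff less_imp_le order_refl)
  show ?thesis
    unfolding primitive_def
  proof (intro ballI conjI uc)
    fix t assume t: "t \<in> {a..b}"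
    have "I t - I a = binj X (u t) - binj X (u a)" using g[OF t] by (simp add: g_def algebra_simps)
    moreover have "(V has_integral I t - I a) {a..t}" using It[of a t] t by simp
    ultimately show "((\<lambda>r. binj X (v r)) has_integral binj X (u t) - binj X (u a)) {a..t}"
      by (simp add: V_def[abs_def])
  qed
qed

text \<open>The product rule over the whole interval: the boundary terms vanish with the test
  function.\<close>

lemma primitive_weak_deriv:
  assumes X: "complex_banach X" and ab: "a < b" and q: "1 \<le> q"
    and p: "primitive X a b u v" and v: "v \<in> Lq q a b X"
  shows "weak_deriv a b X u v"
  unfolding weak_deriv_def
proof (intro allI impI)
  fix \<phi> assume \<phi>: "test_function a b \<phi>"
  have q0: "0 \<le> q" using q by simp
  note d = test_function_deriv[OF \<phi>]
  have c\<phi>: "continuous_on {a..b} \<phi>" by (rule DERIV_continuous_on[OF has_field_derivative_at_within[OF d(1)]])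
  have L1: "(\<lambda>t. deriv \<phi> t *\<^sub>R u t) \<in> Lq q a b X"
    by (intro Lq_scaleR[OF X] primitive_Lq[OF X p] q0 d(2))
  have L2: "(\<lambda>t. \<phi> t *\<^sub>R v t) \<in> Lq q a b X"
    by (intro Lq_scaleR[OF X] v q0 c\<phi>)
  have "primitive X a b (\<lambda>t. \<phi> t *\<^sub>R u t) (\<lambda>t. deriv \<phi> t *\<^sub>R u t + \<phi> t *\<^sub>R v t)"
    by (rule primitive_scaleR[OF X q p v has_field_derivative_at_within[OF d(1)] d(2)])
  from primitive_has_integral[OF this order_refl less_imp_le[OF ab] order_refl]
  have s: "((\<lambda>t. binj X (deriv \<phi> t *\<^sub>R u t + \<phi> t *\<^sub>R v t)) has_integral 0) {a..b}"
    by (simp add: d)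
  have "AE t in leb_Ioo a b. v t \<in> carr X" using v by (simp add: Lq_iff[OF X])
  then have "AE t in leb_Ioo a b. binj X (deriv \<phi> t *\<^sub>R u t + \<phi> t *\<^sub>R v t) =
      binj X (deriv \<phi> t *\<^sub>R u t) + binj X (\<phi> t *\<^sub>R v t)"
    using AE_space by eventually_elim (use primitive_carr[OF p] in \<open>simp add: binj_add banach_scaleR X\<close>)
  with s have s': "((\<lambda>t. binj X (deriv \<phi> t *\<^sub>R u t) + binj X (\<phi> t *\<^sub>R v t)) has_integral 0) {a..b}"
    by (rule has_integral_cong_AE)
  obtain x where x: "x \<in> carr X" "((\<lambda>t. binj X (deriv \<phi> t *\<^sub>R u t)) has_integral binj X x) {a..b}"
    using integral_in_carr[OF X Lq_integrable_on(3)[OF X L1 q]] by blast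
  have "((\<lambda>t. binj X (\<phi> t *\<^sub>R v t)) has_integral - binj X x) {a..b}"
    using has_integral_diff[OF s' x(2)] by simp
  moreover have "binj X (- x) = - binj X x"
    using binj_scaleR[OF X x(1), of "-1"] by simp
  ultimately have "((\<lambda>t. binj X (\<phi> t *\<^sub>R v t)) has_integral binj X (- x)) {a..b}" by simp
  moreover have a1: "AE t in leb_Ioo a b. deriv \<phi> t *\<^sub>R u t \<in> carr X"
    and a2: "AE t in leb_Ioo a b. \<phi> t *\<^sub>R v t \<in> carr X"
    using L1 L2 by (simp_all add: Lq_iff[OF X])
  ultimately show "\<exists>x. has_bochner_integral_in X {a<..<b} (\<lambda>t. deriv \<phi> t *\<^sub>R u t) x \<and>
      has_bochner_integral_in X {a<..<b} (\<lambda>t. \<phi> t *\<^sub>R v t) (- x)"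
    unfolding has_bochner_integral_in_iff[OF X less_imp_le[OF ab]]
    using x a1 a2 Lq_integrable_on(1,2)[OF X L1 q] Lq_integrable_on(1,2)[OF X L2 q] banach_minus[OF X x(1)]
    by blast
qed

section \<open>Problems with zero initial value on an interval of fixed length\<close>

definition solves :: "real \<Rightarrow> real \<Rightarrow> 'a::complex_vector nspace \<Rightarrow> 'a nspace \<Rightarrow>
    (real \<Rightarrow> 'a \<Rightarrow> 'a) \<Rightarrow> (real \<Rightarrow> 'a) \<Rightarrow> (real \<Rightarrow> 'a) \<Rightarrow> (real \<Rightarrow> 'a) \<Rightarrow> bool" where
  "solves q \<tau> X1 X0 B f w v \<longleftrightarrow> w \<in> Lq q 0 \<tau> X1 \<and> v \<in> Lq q 0 \<tau> X0 \<and> primitive X0 0 \<tau> w v \<and> w 0 = 0 \<and>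
     (AE t in leb_Ioo 0 \<tau>. v t + B t (w t) = f t)"

lemma strong_solution_0_iff:
  assumes X0: "complex_banach X0" and q: "1 \<le> q" and \<tau>: "0 < \<tau>"
  shows "strong_solution q \<tau> X1 X0 B f 0 w \<longleftrightarrow> (\<exists>v. solves q \<tau> X1 X0 B f w v)"
proof
  assume "strong_solution q \<tau> X1 X0 B f 0 w"
  then obtain v where w: "w \<in> Lq q 0 \<tau> X1" "continuous_map (top_of_set {0..\<tau>}) (ntop X0) w"
    and v: "v \<in> Lq q 0 \<tau> X0" "weak_deriv 0 \<tau> X0 w v" "AE t in leb_Ioo 0 \<tau>. v t + B t (w t) = f t" and "w 0 = 0"
    unfolding strong_solution_def by blast
  then have "solves q \<tau> X1 X0 B f w v"
    unfolding solves_def using weak_deriv_primitive[OF X0 \<tau> q w(2) v(1,2)] by simp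
  then show "\<exists>v. solves q \<tau> X1 X0 B f w v" by (rule exI[where x = v])
next
  assume "\<exists>v. solves q \<tau> X1 X0 B f w v"
  then obtain v where v: "w \<in> Lq q 0 \<tau> X1" "v \<in> Lq q 0 \<tau> X0" "primitive X0 0 \<tau> w v" "w 0 = 0"
     "AE t in leb_Ioo 0 \<tau>. v t + B t (w t) = f t" unfolding solves_def by blast
  have "w \<in> Lq q 0 \<tau> X0" using primitive_Lq[OF X0 v(3)] q by simp
  then show "strong_solution q \<tau> X1 X0 B f 0 w"
    unfolding strong_solution_def W1q_def
    using v primitive_continuous_map[OF X0 v(3)] primitive_weak_deriv[OF X0 \<tau> q v(3,2)] by blast
qed

text \<open>The part of maximal regularity that enters the perturbation argument, for a given
  length. By linearity uniqueness need only be recorded for zero data.\<close>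

definition max_reg_on :: "real \<Rightarrow> real \<Rightarrow> 'a::complex_vector nspace \<Rightarrow> 'a nspace \<Rightarrow> ('a \<Rightarrow> 'a) \<Rightarrow> bool" where
  "max_reg_on q \<tau> X1 X0 A \<longleftrightarrow> (\<forall>f\<in>Lq q 0 \<tau> X0. \<exists>w v. solves q \<tau> X1 X0 (\<lambda>_. A) f w v) \<and>
     (\<forall>w v. solves q \<tau> X1 X0 (\<lambda>_. A) (\<lambda>_. 0) w v \<longrightarrow> (\<forall>t\<in>{0..\<tau>}. w t = 0))"

lemma max_reg_onD:
  assumes "max_reg_on q \<tau> X1 X0 A"
  shows "f \<in> Lq q 0 \<tau> X0 \<Longrightarrow> \<exists>w v. solves q \<tau> X1 X0 (\<lambda>_. A) f w v"
    and "solves q \<tau> X1 X0 (\<lambda>_. A) (\<lambda>_. 0) w v \<Longrightarrow> t \<in> {0..\<tau>} \<Longrightarrow> w t = 0"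
proof -
  note 1 = conjunct1[OF assms[unfolded max_reg_on_def]] and 2 = conjunct2[OF assms[unfolded max_reg_on_def]]
  show "f \<in> Lq q 0 \<tau> X0 \<Longrightarrow> \<exists>w v. solves q \<tau> X1 X0 (\<lambda>_. A) f w v" by (rule 1[rule_format])
  show "solves q \<tau> X1 X0 (\<lambda>_. A) (\<lambda>_. 0) w v \<Longrightarrow> t \<in> {0..\<tau>} \<Longrightarrow> w t = 0" by (rule 2[rule_format])
qed

lemma linear_op_0: "complex_banach X \<Longrightarrow> linear_op X Y A \<Longrightarrow> A 0 = 0"
  unfolding linear_op_def using banach_zero[of X] scaleC_zero_left by metis

lemma primitive_zero: "complex_banach X \<Longrightarrow> primitive X a b (\<lambda>_. 0) (\<lambda>_. 0)"
  by (auto simp: primitive_def banach_zero binj_zero)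

lemma maximal_regularity_max_reg_on:
  assumes X: "complex_banach X0" "complex_banach X1" and q: "1 \<le> q" and A: "maximal_regularity q X1 X0 A"
  shows "\<exists>\<tau>>0. max_reg_on q \<tau> X1 X0 A"
proof -
  obtain \<tau> where \<tau>: "0 < \<tau>" and ex: "\<And>f. f \<in> Lq q 0 \<tau> X0 \<Longrightarrow> \<exists>u. strong_solution q \<tau> X1 X0 (\<lambda>_. A) f 0 u"
    and un: "\<And>f u v t. f \<in> Lq q 0 \<tau> X0 \<Longrightarrow> strong_solution q \<tau> X1 X0 (\<lambda>_. A) f 0 u \<Longrightarrow>
      strong_solution q \<tau> X1 X0 (\<lambda>_. A) f 0 v \<Longrightarrow> t \<in> {0..\<tau>} \<Longrightarrow> u t = v t"
    using A unfolding maximal_regularity_def by blast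
  have "A 0 = 0" using A X(2) linear_op_0 unfolding maximal_regularity_def bounded_op_def by blast
  then have "solves q \<tau> X1 X0 (\<lambda>_. A) (\<lambda>_. 0) (\<lambda>_. 0) (\<lambda>_. 0)"
    by (simp add: solves_def Lq_zero X primitive_zero)
  then have z: "strong_solution q \<tau> X1 X0 (\<lambda>_. A) (\<lambda>_. 0) 0 (\<lambda>_. 0)"
    unfolding strong_solution_0_iff[OF X(1) q \<tau>] by blast
  have "max_reg_on q \<tau> X1 X0 A"
    unfolding max_reg_on_def
  proof (intro conjI ballI allI impI)
    show "\<exists>w v. solves q \<tau> X1 X0 (\<lambda>_. A) f w v" if "f \<in> Lq q 0 \<tau> X0" for f
      using ex[OF that] unfolding strong_solution_0_iff[OF X(1) q \<tau>] .
    show "w t = 0" if "solves q \<tau> X1 X0 (\<lambda>_. A) (\<lambda>_. 0) w v" "t \<in> {0..\<tau>}" for w v t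
      using un[OF Lq_zero[OF X(1)] _ z that(2)] that(1) unfolding strong_solution_0_iff[OF X(1) q \<tau>] by blast
  qed
  with \<tau> show ?thesis by blast
qed

text \<open>A function on \<open>(c, d)\<close> is moved to start at time \<open>h\<close> and
  preceded by zeros. A solution that vanishes at \<open>c\<close> stays a solution, since zero
  solves the homogeneous problem before \<open>h\<close>.\<close>

definition delay :: "real \<Rightarrow> real \<Rightarrow> (real \<Rightarrow> 'a::zero) \<Rightarrow> real \<Rightarrow> 'a" where
  "delay h c f t = (if t \<le> h then 0 else f (c - h + t))"

text \<open>The predicate sees the new time: the old time \<open>t\<close> becomes
  \<open>t + h - c\<close>.\<close>

lemma AE_delay:
  assumes "AE t in leb_Ioo c d. P (t + h - c) (f t)" "\<And>t. 0 < t \<Longrightarrow> t \<le> h \<Longrightarrow> P t 0"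
  shows "AE t in leb_Ioo 0 (h + d - c). P t (delay h c f t)"
proof -
  from AE_lebesgue_shift[OF assms(1)[unfolded AE_leb_Ioo], of "c - h"]
  show ?thesis unfolding AE_leb_Ioo
    by eventually_elim (use assms(2) in \<open>auto simp: delay_def algebra_simps\<close>)
qed

lemma Lq_delay:
  assumes X: "complex_banach X" and f: "f \<in> Lq q c d X" and h: "0 \<le> h" and cd: "c \<le> d" and q: "0 < q"
  shows "delay h c f \<in> Lq q 0 (h + d - c) X"
proof (rule Lq_join[OF X, of _ _ _ h])
  show "delay h c f \<in> Lq q 0 h X"
    by (rule Lq_cong_AE[OF X Lq_zero[OF X]], rule AE_leb_Ioo_I) (simp add: delay_def)
  have "(\<lambda>t. f (c - h + t)) \<in> Lq q (c - (c - h)) (d - (c - h)) X" by (rule Lq_shift[OF X f])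
  then have "(\<lambda>t. f (c - h + t)) \<in> Lq q h (h + d - c) X" by (simp add: algebra_simps)
  then show "delay h c f \<in> Lq q h (h + d - c) X"
    by (rule Lq_cong_AE[OF X], intro AE_leb_Ioo_I) (simp add: delay_def)
qed (use h cd q in auto)

lemma primitive_delay:
  assumes X: "complex_banach X" and p: "primitive X c d w v" and h: "0 \<le> h" and w: "w c = 0" and cd: "c \<le> d"
  shows "primitive X 0 (h + d - c) (delay h c w) (delay h c v)"
  unfolding primitive_def
proof (intro ballI conjI)
  fix t assume t: "t \<in> {0..h + d - c}"
  show "delay h c w t \<in> carr X"
    using t primitive_carr[OF p, of "c - h + t"] by (auto simp: delay_def banach_zero X)
  have d0: "delay h c w 0 = 0" using h by (simp add: delay_def)
  have z: "((\<lambda>r. binj X (delay h c v r)) has_integral 0) {0..s}" if "s \<le> h" for s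
    by (rule has_integral_is_0) (use that in \<open>auto simp: delay_def binj_zero X\<close>)
  show "((\<lambda>r. binj X (delay h c v r)) has_integral binj X (delay h c w t) - binj X (delay h c w 0)) {0..t}"
  proof (cases "t \<le> h")
    case True
    with z[OF True] show ?thesis unfolding d0 by (simp add: delay_def binj_zero X)
  next
    case False
    have "((\<lambda>r. binj X (v r)) has_integral binj X (w (c - h + t)) - binj X (w c)) {c..c - h + t}"
      by (rule primitive_has_integral[OF p]) (use False t in auto)
    then have "((\<lambda>r. binj X (v r)) has_integral binj X (delay h c w t)) {h + (c - h)..t + (c - h)}"
      using False by (simp add: w binj_zero X delay_def add.commute)
    then have "((\<lambda>r. binj X (v (c - h + r))) has_integral binj X (delay h c w t)) {h..t}"
      unfolding has_integral_shift_Icc_real[symmetric] by (simp add: o_def)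
    then have "((\<lambda>r. binj X (delay h c v r)) has_integral binj X (delay h c w t)) {h..t}"
      by (rule has_integral_cong_AE) (auto intro!: AE_leb_Ioo_I simp: delay_def)
    from has_integral_combine[OF h _ z[OF order_refl] this] False show ?thesis
      unfolding d0 by (simp add: binj_zero X)
  qed
qed

text \<open>For existence the data are continued by zero to the right and the solution is
  restricted. For uniqueness a homogeneous solution is not continued beyond its interval but
  delayed, so that it ends where the longer interval ends.\<close>

lemma max_reg_on_shrink:
  assumes X: "complex_banach X0" "complex_banach X1" and q: "1 \<le> q" and A: "linear_op X1 X0 A"
    and mr: "max_reg_on q \<tau> X1 X0 A" and \<tau>: "0 < \<tau>'" "\<tau>' \<le> \<tau>"
  shows "max_reg_on q \<tau>' X1 X0 A"
  unfolding max_reg_on_def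
proof (intro conjI ballI allI impI)
  fix f assume f: "f \<in> Lq q 0 \<tau>' X0"
  define g where "g t = (if t < \<tau>' then f t else 0)" for t
  have "g \<in> Lq q 0 \<tau> X0"
  proof (rule Lq_join[OF X(1), of _ _ _ \<tau>'])
    show "g \<in> Lq q 0 \<tau>' X0"
      by (rule Lq_cong_AE[OF X(1) f], rule AE_leb_Ioo_I) (simp add: g_def)
    show "g \<in> Lq q \<tau>' \<tau> X0"
      by (rule Lq_cong_AE[OF X(1) Lq_zero[OF X(1)]], rule AE_leb_Ioo_I) (simp add: g_def)
  qed (use \<tau> q in auto)
  from max_reg_onD(1)[OF mr this] obtain w v where s: "solves q \<tau> X1 X0 (\<lambda>_. A) g w v" by (elim exE)
  have "AE t in leb_Ioo 0 \<tau>'. v t + A (w t) = g t"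
    using s \<tau> unfolding solves_def by (elim conjE) (rule AE_leb_Ioo_subset[where a = 0 and b = \<tau>], auto)
  moreover have "AE t in leb_Ioo 0 \<tau>'. g t = f t" by (rule AE_leb_Ioo_I) (simp add: g_def)
  ultimately have "AE t in leb_Ioo 0 \<tau>'. v t + A (w t) = f t" by eventually_elim simp
  then have "solves q \<tau>' X1 X0 (\<lambda>_. A) f w v"
    using s \<tau> Lq_subinterval[OF X(1), of v q 0 \<tau> 0 \<tau>'] Lq_subinterval[OF X(2), of w q 0 \<tau> 0 \<tau>']
      primitive_subinterval[of X0 0 \<tau> w v 0 \<tau>'] unfolding solves_def by simp
  then show "\<exists>w v. solves q \<tau>' X1 X0 (\<lambda>_. A) f w v" by auto
next
  fix w v t assume s: "solves q \<tau>' X1 X0 (\<lambda>_. A) (\<lambda>_. 0) w v" and t: "t \<in> {0..\<tau>'}"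
  define h where "h = \<tau> - \<tau>'"
  have h: "0 \<le> h" "h + \<tau>' - 0 = \<tau>" using \<tau> by (simp_all add: h_def)
  have q0: "0 < q" using q by simp
  have A0: "A 0 = 0" by (rule linear_op_0[OF X(2) A])
  have "AE t in leb_Ioo 0 \<tau>'. v t + A (w t) = 0" using s by (simp add: solves_def)
  then have "AE t in leb_Ioo 0 (h + \<tau>' - 0). delay h 0 (\<lambda>t. v t + A (w t)) t = 0"
    by (intro AE_delay[where P = "\<lambda>t y. y = 0"]) auto
  then have "AE t in leb_Ioo 0 \<tau>. delay h 0 v t + A (delay h 0 w t) = 0"
    unfolding h by eventually_elim (auto simp: delay_def A0 split: if_splits)
  then have "solves q \<tau> X1 X0 (\<lambda>_. A) (\<lambda>_. 0) (delay h 0 w) (delay h 0 v)"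
    using s Lq_delay[OF X(2), of w q 0 \<tau>' h] Lq_delay[OF X(1), of v q 0 \<tau>' h]
      primitive_delay[OF X(1), of 0 \<tau>' w v h] h \<tau> q0 unfolding solves_def by (simp add: delay_def)
  from max_reg_onD(2)[OF mr this, of "h + t"] have "delay h 0 w (h + t) = 0" using t h by simp
  moreover have "w 0 = 0" using s by (simp add: solves_def)
  ultimately show "w t = 0" using t by (cases "t = 0") (auto simp: delay_def)
qed

subsection \<open>Maximal regularity for operators depending continuously on time\<close>

lemma bnd_lin_diff:
  assumes Y: "complex_banach Y" and "bnd_lin X Y C A" "bnd_lin X Y D B"
  shows "bnd_lin X Y (C + D) (\<lambda>x. A x - B x)"
proof -
  have "nrm Y (A x - B x) \<le> (C + D) * nrm X x" if x: "x \<in> carr X" for x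
  proof -
    have c: "A x \<in> carr Y" "B x \<in> carr Y" using assms x by (auto simp: bnd_lin_def)
    have "nrm Y (A x - B x) \<le> nrm Y (A x) + nrm Y (B x)"
      using nrm_triangle[OF Y c(1) banach_minus[OF Y c(2)]] nrm_minus[OF Y c(2)] by simp
    also have "\<dots> \<le> C * nrm X x + D * nrm X x" using assms x by (intro add_mono) (auto simp: bnd_lin_def)
    finally show ?thesis by (simp add: distrib_right)
  qed
  then show ?thesis using assms by (auto simp: bnd_lin_def banach_diff Y algebra_simps)
qed

lemma opnorm_bound:
  assumes X: "complex_banach X" and Y: "complex_banach Y" and B: "bnd_lin X Y C B" "0 \<le> C" and x: "x \<in> carr X"
  shows "nrm Y (B x) \<le> opnorm X Y B * nrm X x"
proof (cases "nrm X x = 0")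
  case True
  then have "x = 0" using nrm_eq_0[OF X x] by simp
  moreover have "B 0 = 0" using B(1) banach_zero[OF X] unfolding bnd_lin_def by (metis scaleR_zero_left)
  ultimately show ?thesis by (simp add: nrm_zero X Y)
next
  case False
  then have p: "0 < nrm X x" using nrm_nonneg[OF X x] by simp
  have "nrm Y (B x) / nrm X x \<le> opnorm X Y B"
    unfolding opnorm_def
  proof (rule cInf_greatest)
    show "{C. 0 \<le> C \<and> (\<forall>x\<in>carr X. nrm Y (B x) \<le> C * nrm X x)} \<noteq> {}"
      using B unfolding bnd_lin_def by blast
  qed (use x p in \<open>auto simp: pos_divide_le_eq\<close>)
  then show ?thesis using p by (simp add: pos_divide_le_eq)
qed

lemma opnorm_nonneg:
  assumes "bnd_lin X Y C B" "0 \<le> C"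
  shows "0 \<le> opnorm X Y B"
  unfolding opnorm_def
  by (rule cInf_greatest) (use assms in \<open>auto simp: bnd_lin_def\<close>)

lemma op_continuous_bnd_lin:
  "complex_banach X \<Longrightarrow> op_continuous_on a b X Y B \<Longrightarrow> t \<in> {a..b} \<Longrightarrow> \<exists>C\<ge>0. bnd_lin X Y C (B t)"
  unfolding op_continuous_on_def using bounded_op_bnd_lin by blast

text \<open>As elements of a normed space of operators, the lifts make continuity in time ordinary
  continuity, which gives measurability of \<open>t \<mapsto> B t (w t)\<close>.\<close>

definition lift_bl :: "'a::complex_vector nspace \<Rightarrow> 'a nspace \<Rightarrow> ('a \<Rightarrow> 'a) \<Rightarrow> 'a bsum \<Rightarrow>\<^sub>L 'a bsum" where
  "lift_bl X Y B = Blinfun (lift_op X Y B)"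

lemma lift_bl_apply:
  assumes "complex_banach X" "complex_banach Y" "bnd_lin X Y C B" "0 \<le> C"
  shows "blinfun_apply (lift_bl X Y B) = lift_op X Y B"
  unfolding lift_bl_def by (rule bounded_linear_Blinfun_apply[OF lift_op_bounded(3)[OF assms]])

lemma lift_op_diff:
  assumes "complex_banach X" "complex_banach Y" "bnd_lin X Y C A" "bnd_lin X Y D B"
  shows "lift_op X Y (\<lambda>x. A x - B x) y = lift_op X Y A y - lift_op X Y B y"
  unfolding lift_op_def using assms by (intro binj_diff) (auto simp: bnd_lin_def bproj_carr)

lemma lift_bl_continuous:
  assumes X: "complex_banach X" and Y: "complex_banach Y" and B: "op_continuous_on a b X Y B"
  shows "continuous_on {a..b} (\<lambda>t. lift_bl X Y (B t))"
  unfolding continuous_on_def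
proof
  fix t assume t: "t \<in> {a..b}"
  obtain C where C: "0 \<le> C" "bnd_lin X Y C (B t)" using op_continuous_bnd_lin[OF X B t] by blast
  have le: "norm (lift_bl X Y (B s) - lift_bl X Y (B t)) \<le> opnorm X Y (\<lambda>x. B s x - B t x)" if s: "s \<in> {a..b}" for s
  proof -
    obtain D where D: "0 \<le> D" "bnd_lin X Y D (B s)" using op_continuous_bnd_lin[OF X B s] by blast
    have d: "bnd_lin X Y (D + C) (\<lambda>x. B s x - B t x)" by (rule bnd_lin_diff[OF Y D(2) C(2)])
    have dc: "0 \<le> D + C" using C D by simp
    let ?o = "opnorm X Y (\<lambda>x. B s x - B t x)"
    have o: "bnd_lin X Y ?o (\<lambda>x. B s x - B t x)"
      using d opnorm_bound[OF X Y d dc] unfolding bnd_lin_def by blast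
    show ?thesis
    proof (rule norm_blinfun_bound)
      show "0 \<le> ?o" by (rule opnorm_nonneg[OF d dc])
      then show "norm (blinfun_apply (lift_bl X Y (B s) - lift_bl X Y (B t)) y) \<le> ?o * norm y" for y
        using lift_op_bounded(2)[OF X Y o, of y]
        by (simp add: blinfun.diff_left lift_bl_apply[OF X Y C(2,1)] lift_bl_apply[OF X Y D(2,1)]
            lift_op_diff[OF X Y D(2) C(2)])
    qed
  qed
  have z: "((\<lambda>s. opnorm X Y (\<lambda>x. B s x - B t x)) \<longlongrightarrow> 0) (at t within {a..b})"
    using B t unfolding op_continuous_on_def by blast
  have "\<forall>\<^sub>F s in at t within {a..b}. norm (lift_bl X Y (B s) - lift_bl X Y (B t)) \<le> opnorm X Y (\<lambda>x. B s x - B t x)"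
    using le by (auto simp: eventually_at_filter)
  then have "((\<lambda>s. norm (lift_bl X Y (B s) - lift_bl X Y (B t))) \<longlongrightarrow> 0) (at t within {a..b})"
    by (intro tendsto_sandwich[OF _ _ tendsto_const z]) simp_all
  then show "((\<lambda>t. lift_bl X Y (B t)) \<longlongrightarrow> lift_bl X Y (B t)) (at t within {a..b})"
    by (rule LIM_zero_cancel[OF tendsto_norm_zero_cancel])
qed

section \<open>The closed graph space of pairs of derivative and function\<close>

definition brange :: "'a::complex_vector nspace \<Rightarrow> 'a bsum set" where
  "brange X = {y. binj X (bproj y X) = y}"

lemma brange_binj: "complex_banach X \<Longrightarrow> binj X x \<in> brange X"
proof (cases "x \<in> carr X")
  case False
  then have "binj X x = 0" by (simp add: binj_def)
  moreover assume "complex_banach X"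
  ultimately show ?thesis by (simp add: brange_def bproj_zero binj_zero)
qed (simp add: brange_def bproj_binj)

lemma bnd_lin_id: "bnd_lin X X 1 (\<lambda>x. x)"
  by (simp add: bnd_lin_def)

text \<open>The range of the embedding is the kernel of a bounded linear map; by
  \<open>AE_kernel_closed\<close> membership in it survives limits in L^q.\<close>

lemma brange_iff: "y \<in> brange X \<longleftrightarrow> lift_op X X (\<lambda>x. x) y - y = 0"
  by (simp add: brange_def lift_op_def)

text \<open>On this space of pairs (derivative, function), maximal regularity of \<open>A\<close> is bijectivity of
  \<open>(v, w) \<mapsto> v + A w\<close> onto \<open>mr_data\<close>.\<close>

definition mr_graph :: "real \<Rightarrow> real \<Rightarrow> 'a::complex_vector nspace \<Rightarrow> 'a nspace \<Rightarrow> (real \<Rightarrow> 'a bsum \<times> 'a bsum) set" where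
  "mr_graph q \<tau> X1 X0 = {z. smeas (leb_Ioo 0 \<tau>) z \<and> qint (leb_Ioo 0 \<tau>) q z < \<infinity> \<and>
     (AE t in leb_Ioo 0 \<tau>. fst (z t) \<in> brange X0 \<and> snd (z t) \<in> brange X1) \<and>
     (AE t in leb_Ioo 0 \<tau>. lift_op X1 X0 (\<lambda>x. x) (snd (z t)) = integral {0..t} (\<lambda>r. fst (z r)))}"

definition mr_data :: "real \<Rightarrow> real \<Rightarrow> 'a::complex_vector nspace \<Rightarrow> (real \<Rightarrow> 'a bsum) set" where
  "mr_data q \<tau> X0 = {f. smeas (leb_Ioo 0 \<tau>) f \<and> qint (leb_Ioo 0 \<tau>) q f < \<infinity> \<and>
     (AE t in leb_Ioo 0 \<tau>. f t \<in> brange X0)}"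

text \<open>Since \<open>h (Z n t) = 0\<close>, the norm of \<open>h (z t)\<close> is at most a
  constant times that of \<open>z t - Z n t\<close>.\<close>

lemma (in complete_measure) AE_kernel_closed:
  fixes h :: "'c::real_normed_vector \<Rightarrow> 'd::real_normed_vector"
  assumes q: "0 < q" and h: "bounded_linear h" and Z: "\<And>n. smeas M (Z n)" "\<And>n. AE t in M. h (Z n t) = 0"
    and z: "smeas M z" "(\<lambda>n. qint M q (\<lambda>x. z x - Z n x)) \<longlonglongrightarrow> 0"
  shows "AE t in M. h (z t) = 0"
proof -
  interpret h: bounded_linear h by fact
  obtain K where K: "0 < K" "\<And>x. norm (h x) \<le> norm x * K" using h.pos_bounded by blast
  have le: "qint M q (\<lambda>t. h (z t)) \<le> ennreal (K powr q) * qint M q (\<lambda>x. z x - Z n x)" for n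
  proof (rule qint_bound)
    show "AE t in M. norm (h (z t)) \<le> K * norm (z t - Z n t)"
      using Z(2)[of n]
    proof eventually_elim
      fix t assume "h (Z n t) = 0"
      then show "norm (h (z t)) \<le> K * norm (z t - Z n t)"
        using K(2)[of "z t - Z n t"] by (simp add: h.diff mult.commute)
    qed
  qed (use q K Z z in \<open>auto intro: smeas_diff\<close>)
  have "(\<lambda>n. ennreal (K powr q) * qint M q (\<lambda>x. z x - Z n x)) \<longlonglongrightarrow> ennreal (K powr q) * 0"
    by (rule ennreal_tendsto_cmult[OF _ z(2)]) simp
  then have "qint M q (\<lambda>t. h (z t)) \<le> ennreal (K powr q) * 0"
    by (rule LIMSEQ_le_const) (use le in blast)
  then show ?thesis
    by (intro qint_eq_0_AE[of _ q] smeas_bounded_linear[OF h] z) simp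
qed

lemma (in complete_measure) qint_finite_closed:
  assumes q: "0 \<le> q" and Z: "\<And>n. smeas M (Z n)" "\<And>n. qint M q (Z n) < \<infinity>"
    and z: "smeas M z" "(\<lambda>n. qint M q (\<lambda>x. z x - Z n x)) \<longlonglongrightarrow> 0"
  shows "qint M q z < \<infinity>"
proof -
  have "\<forall>\<^sub>F n in sequentially. qint M q (\<lambda>x. z x - Z n x) < \<infinity>"
    using z(2) by (rule order_tendstoD) simp
  then obtain n where n: "qint M q (\<lambda>x. z x - Z n x) < \<infinity>" unfolding eventually_sequentially by blast
  have "qint M q z \<le> ennreal (2 powr q) * (qint M q (\<lambda>x. z x - Z n x) + qint M q (Z n))"
    using qint_add[OF smeas_diff[OF z(1) Z(1)[of n]] Z(1)[of n] q] by simp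
  also have "\<dots> < \<infinity>" using n Z(2)[of n] by (simp add: ennreal_mult_less_top less_top)
  finally show ?thesis .
qed

text \<open>\<open>qint_1_le\<close> splits the integral into a part proportional to
  \<open>e\<close>, made small first, and a multiple of \<open>qint M q (f n)\<close> that tends to
  0 for this fixed \<open>e\<close>.\<close>

lemma (in complete_measure) qint_1_tendsto:
  assumes q: "1 \<le> q" and fin: "emeasure M (space M) < \<infinity>" and f: "\<And>n. smeas M (f n)"
    and lim: "(\<lambda>n. qint M q (f n)) \<longlonglongrightarrow> 0"
  shows "(\<lambda>n. qint M 1 (f n)) \<longlonglongrightarrow> 0"
proof -
  obtain m where m: "0 \<le> m" "emeasure M (space M) = ennreal m"
    using fin by (cases "emeasure M (space M)") auto
  show ?thesis
  proof (rule tendsto_zero_ennreal)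
    fix r :: real assume r: "0 < r"
    define e where "e = r / (4 * (m + 1))"
    have e: "0 < e" using r m by (simp add: e_def)
    have "(\<lambda>n. ennreal (e powr (1 - q)) * qint M q (f n)) \<longlonglongrightarrow> ennreal (e powr (1 - q)) * 0"
      by (rule ennreal_tendsto_cmult[OF _ lim]) simp
    then have "\<forall>\<^sub>F n in sequentially. ennreal (e powr (1 - q)) * qint M q (f n) < ennreal (r / 2)"
      by (rule order_tendstoD) (use r in simp)
    then show "\<forall>\<^sub>F n in sequentially. qint M 1 (f n) < ennreal r"
    proof eventually_elim
      fix n assume n: "ennreal (e powr (1 - q)) * qint M q (f n) < ennreal (r / 2)"
      have "e * m \<le> r / 4" using r m by (simp add: e_def field_simps)
      then have "ennreal e * emeasure M (space M) \<le> ennreal (r / 4)"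
        using e m by (simp add: ennreal_mult[symmetric] ennreal_leI)
      then have "ennreal e * emeasure M (space M) + ennreal (e powr (1 - q)) * qint M q (f n)
          \<le> ennreal (r / 4) + ennreal (r / 2)"
        using n by (intro add_mono) auto
      also have "\<dots> = ennreal (r / 4 + r / 2)" using r by (simp flip: ennreal_plus)
      also have "\<dots> < ennreal r" using r by (intro ennreal_lessI) auto
      finally show "qint M 1 (f n) < ennreal r" using qint_1_le[OF q f e, of n] by (rule order_le_less_trans[rotated])
    qed
  qed
qed

lemma mr_data_closed:
  assumes X: "complex_banach X0" and q: "1 \<le> q"
  shows "lq_closed (leb_Ioo 0 \<tau>) q (mr_data q \<tau> X0)"
proof -
  interpret complete_measure "leb_Ioo 0 \<tau>" by (rule complete_leb_Ioo)
  let ?M = "leb_Ioo 0 \<tau>"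
  have q0: "0 \<le> q" "0 < q" using q by auto
  have id: "bounded_linear (lift_op X0 X0 (\<lambda>x. x))" by (rule lift_op_bounded(3)[OF X X bnd_lin_id]) simp
  then have h: "bounded_linear (\<lambda>y. lift_op X0 X0 (\<lambda>x. x) y - y)"
    by (intro bounded_linear_sub bounded_linear_ident)
  interpret h: bounded_linear "\<lambda>y. lift_op X0 X0 (\<lambda>x. x) y - y" by (rule h)
  show ?thesis
    unfolding lq_closed_def
  proof (intro conjI ballI allI impI)
    fix f assume f: "f \<in> mr_data q \<tau> X0"
    then show "smeas ?M f" "qint ?M q f < \<infinity>" by (simp_all add: mr_data_def)
    fix c
    have "AE t in ?M. f t \<in> brange X0" using f by (simp add: mr_data_def)
    then have "AE t in ?M. c *\<^sub>R f t \<in> brange X0"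
      unfolding brange_iff by eventually_elim (simp only: h.scaleR scaleR_zero_right)
    then show "(\<lambda>x. c *\<^sub>R f x) \<in> mr_data q \<tau> X0"
      using f q0 by (auto simp: mr_data_def qint_scaleR ennreal_mult_less_top intro: smeas_scaleR)
  next
    show "(\<lambda>_. 0) \<in> mr_data q \<tau> X0"
      using q0 by (simp add: mr_data_def smeas_const qint_def brange_iff linear_0[OF bounded_linear.linear[OF id]])
  next
    fix f g assume f: "f \<in> mr_data q \<tau> X0" and g: "g \<in> mr_data q \<tau> X0"
    have "AE t in ?M. f t \<in> brange X0" "AE t in ?M. g t \<in> brange X0" using f g by (simp_all add: mr_data_def)
    then have "AE t in ?M. f t + g t \<in> brange X0"
      unfolding brange_iff by eventually_elim (simp only: h.add add_0)
    moreover have "qint ?M q (\<lambda>x. f x + g x) < \<infinity>"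
      by (rule order_le_less_trans[OF qint_add]) (use f g q0 in \<open>auto simp: mr_data_def ennreal_mult_less_top less_top\<close>)
    ultimately show "(\<lambda>x. f x + g x) \<in> mr_data q \<tau> X0"
      using f g by (auto simp: mr_data_def intro: smeas_add)
  next
    fix Z z assume Z: "\<forall>n. Z n \<in> mr_data q \<tau> X0" and z: "smeas ?M z" "(\<lambda>n. qint ?M q (\<lambda>x. z x - Z n x)) \<longlonglongrightarrow> 0"
    have Z': "\<And>n. smeas ?M (Z n)" "\<And>n. qint ?M q (Z n) < \<infinity>" "\<And>n. AE t in ?M. lift_op X0 X0 (\<lambda>x. x) (Z n t) - Z n t = 0"
      using Z by (simp_all add: mr_data_def brange_iff)
    show "z \<in> mr_data q \<tau> X0"
      using qint_finite_closed[OF q0(1) Z'(1,2) z] AE_kernel_closed[OF q0(2) h Z'(1,3) z] z(1)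
      by (simp add: mr_data_def brange_iff)
  qed
qed

lemma norm_fst_le': "norm (fst z) \<le> norm z" and norm_snd_le': "norm (snd z) \<le> norm z"
  using norm_fst_le[of "fst z" "snd z"] norm_snd_le[of "snd z" "fst z"] by simp_all

lemma qint_fst_le: "0 \<le> q \<Longrightarrow> qint M q (\<lambda>x. fst (z x)) \<le> qint M q z"
  and qint_snd_le: "0 \<le> q \<Longrightarrow> qint M q (\<lambda>x. snd (z x)) \<le> qint M q z"
  unfolding qint_def by (auto intro!: nn_integral_mono ennreal_leI powr_mono2 norm_fst_le' norm_snd_le')

lemma fst_integrable_on:
  assumes q: "1 \<le> q" and z: "smeas (leb_Ioo 0 \<tau>) z" "qint (leb_Ioo 0 \<tau>) q z < \<infinity>"
  shows "smeas (leb_Ioo 0 \<tau>) (\<lambda>r. fst (z r))" "qint (leb_Ioo 0 \<tau>) 1 (\<lambda>r. fst (z r)) < \<infinity>"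
    "(\<lambda>r. fst (z r :: 'b::banach \<times> 'c::banach)) integrable_on {0..\<tau>}"
proof -
  show s: "smeas (leb_Ioo 0 \<tau>) (\<lambda>r. fst (z r))" by (rule smeas_bounded_linear[OF bounded_linear_fst z(1)])
  show f: "qint (leb_Ioo 0 \<tau>) 1 (\<lambda>r. fst (z r)) < \<infinity>"
    by (rule qint_1_finite[OF q s order_le_less_trans[OF qint_fst_le z(2)]]) (use q in simp)
  show "(\<lambda>r. fst (z r)) integrable_on {0..\<tau>}" by (rule L1_integrable_on[OF s f])
qed

text \<open>Membership in the ranges is a kernel condition. For the integral relation the defect
  \<open>D\<close> of the limit is bounded in the mean: the embedding contributes at most
  \<open>C + 1\<close> times the L^1 distance to \<open>Z n\<close>, and the difference of integrals
  at most that distance uniformly in time, hence the factor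
  \<open>emeasure ?M (space ?M)\<close>.\<close>

lemma mr_graph_closed:
  assumes X: "complex_banach X0" "complex_banach X1" and q: "1 \<le> q"
    and \<iota>: "bnd_lin X1 X0 C (\<lambda>x. x)" "0 \<le> C"
  shows "lq_closed (leb_Ioo 0 \<tau>) q (mr_graph q \<tau> X1 X0)"
proof -
  interpret complete_measure "leb_Ioo 0 \<tau>" by (rule complete_leb_Ioo)
  let ?M = "leb_Ioo 0 \<tau>"
  let ?\<iota> = "lift_op X1 X0 (\<lambda>x. x)"
  let ?I = "\<lambda>z t. integral {0..t} (\<lambda>r. fst (z r :: 'a bsum \<times> 'a bsum))"
  have q0: "0 \<le> q" "0 < q" using q by auto
  have id0: "bounded_linear (lift_op X0 X0 (\<lambda>x. x))" by (rule lift_op_bounded(3)[OF X(1) X(1) bnd_lin_id]) simp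
  have id1: "bounded_linear (lift_op X1 X1 (\<lambda>x. x))" by (rule lift_op_bounded(3)[OF X(2) X(2) bnd_lin_id]) simp
  have bl: "bounded_linear ?\<iota>" by (rule lift_op_bounded(3)[OF X(2,1) \<iota>])
  interpret \<iota>: bounded_linear ?\<iota> by (rule bl)
  define h where "h y = (lift_op X0 X0 (\<lambda>x. x) (fst y) - fst y, lift_op X1 X1 (\<lambda>x. x) (snd y) - snd y)"
    for y :: "'a bsum \<times> 'a bsum"
  have h: "bounded_linear h" unfolding h_def[abs_def]
    by (intro bounded_linear_Pair bounded_linear_sub bounded_linear_fst bounded_linear_snd
        bounded_linear_compose[OF id0] bounded_linear_compose[OF id1])
  interpret h: bounded_linear h by (rule h)
  have G: "z \<in> mr_graph q \<tau> X1 X0 \<longleftrightarrow> smeas ?M z \<and> qint ?M q z < \<infinity> \<and> (AE t in ?M. h (z t) = 0) \<and>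
      (AE t in ?M. ?\<iota> (snd (z t)) = ?I z t)" for z
    by (simp add: mr_graph_def brange_iff h_def zero_prod_def)
  have int: "(\<lambda>r. fst (z r)) integrable_on {0..t}" if "smeas ?M z" "qint ?M q z < \<infinity>" "t < \<tau>"
    for z :: "real \<Rightarrow> 'a bsum \<times> 'a bsum" and t
    by (rule integrable_on_subinterval[OF fst_integrable_on(3)[OF q that(1,2)]]) (use that in auto)
  show ?thesis
    unfolding lq_closed_def
  proof (intro conjI ballI allI impI)
    fix z assume z: "z \<in> mr_graph q \<tau> X1 X0"
    then show s: "smeas ?M z" "qint ?M q z < \<infinity>" by (simp_all add: G)
    fix c
    have "AE t in ?M. h (z t) = 0" using z by (simp add: G)
    then have "AE t in ?M. h (c *\<^sub>R z t) = 0" by eventually_elim (simp add: h.scaleR)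
    moreover have "AE t in ?M. ?\<iota> (snd (z t)) = ?I z t" using z by (simp add: G)
    then have "AE t in ?M. ?\<iota> (snd (c *\<^sub>R z t)) = ?I (\<lambda>t. c *\<^sub>R z t) t"
      by eventually_elim (simp add: \<iota>.scaleR)
    ultimately show "(\<lambda>x. c *\<^sub>R z x) \<in> mr_graph q \<tau> X1 X0"
      using s q0 by (auto simp: G qint_scaleR ennreal_mult_less_top intro: smeas_scaleR)
  next
    show "(\<lambda>_. 0) \<in> mr_graph q \<tau> X1 X0"
      using q0 by (simp add: G smeas_const qint_def h.zero \<iota>.zero)
  next
    fix z w assume z: "z \<in> mr_graph q \<tau> X1 X0" and w: "w \<in> mr_graph q \<tau> X1 X0"
    have zs: "smeas ?M z" "qint ?M q z < \<infinity>" "AE t in ?M. h (z t) = 0" "AE t in ?M. ?\<iota> (snd (z t)) = ?I z t"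
      and ws: "smeas ?M w" "qint ?M q w < \<infinity>" "AE t in ?M. h (w t) = 0" "AE t in ?M. ?\<iota> (snd (w t)) = ?I w t"
      using z w by (simp_all add: G)
    have "AE t in ?M. h (z t + w t) = 0" using zs(3) ws(3) by eventually_elim (simp add: h.add)
    moreover have "AE t in ?M. ?\<iota> (snd (z t + w t)) = ?I (\<lambda>t. z t + w t) t"
      using zs(4) ws(4) AE_space
    proof eventually_elim
      fix t assume t: "?\<iota> (snd (z t)) = ?I z t" "?\<iota> (snd (w t)) = ?I w t" "t \<in> space ?M"
      then show "?\<iota> (snd (z t + w t)) = ?I (\<lambda>t. z t + w t) t"
        using Henstock_Kurzweil_Integration.integral_add[OF int[OF zs(1,2)] int[OF ws(1,2)], of t] by (simp add: \<iota>.add)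
    qed
    moreover have "qint ?M q (\<lambda>x. z x + w x) < \<infinity>"
      by (rule order_le_less_trans[OF qint_add]) (use zs ws q0 in \<open>auto simp: ennreal_mult_less_top less_top\<close>)
    ultimately show "(\<lambda>x. z x + w x) \<in> mr_graph q \<tau> X1 X0"
      using zs(1) ws(1) by (auto simp: G intro: smeas_add)
  next
    fix Z z assume Z: "\<forall>n. Z n \<in> mr_graph q \<tau> X1 X0" and z: "smeas ?M z" "(\<lambda>n. qint ?M q (\<lambda>x. z x - Z n x)) \<longlonglongrightarrow> 0"
    have Z': "\<And>n. smeas ?M (Z n)" "\<And>n. qint ?M q (Z n) < \<infinity>" "\<And>n. AE t in ?M. h (Z n t) = 0"
      "\<And>n. AE t in ?M. ?\<iota> (snd (Z n t)) = ?I (Z n) t"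
      using Z by (simp_all add: G)
    have zf: "qint ?M q z < \<infinity>" by (rule qint_finite_closed[OF q0(1) Z'(1,2) z])
    have fin: "emeasure ?M (space ?M) < \<infinity>" using emeasure_leb_Ioo_finite[of 0 \<tau>] by (simp add: less_top)
    have lim1: "(\<lambda>n. qint ?M 1 (\<lambda>x. z x - Z n x)) \<longlonglongrightarrow> 0"
      by (rule qint_1_tendsto[OF q fin _ z(2)]) (intro smeas_diff z Z')
    define D where "D t = ?\<iota> (snd (z t)) - ?I z t" for t
    have "continuous_on {0..\<tau>} (?I z)"
      by (rule indefinite_integral_continuous_1[OF fst_integrable_on(3)[OF q z(1) zf]])
    then have Ds: "smeas ?M D" unfolding D_def
      by (intro smeas_diff smeas_bounded_linear[OF bl] smeas_bounded_linear[OF bounded_linear_snd] z smeas_continuous_on)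
    have le: "qint ?M 1 D \<le> ennreal (C + 1) * qint ?M 1 (\<lambda>x. z x - Z n x) + qint ?M 1 (\<lambda>x. z x - Z n x) * emeasure ?M (space ?M)" for n
    proof -
      let ?d = "qint ?M 1 (\<lambda>x. z x - Z n x)"
      have ds: "smeas ?M (\<lambda>x. z x - Z n x)" by (intro smeas_diff z Z')
      note [measurable] = smeas_norm_measurable[OF ds]
      have "qint ?M 1 D \<le> (\<integral>\<^sup>+ t. ennreal (C + 1) * ennreal (norm (z t - Z n t)) + ?d \<partial>?M)"
        unfolding qint_1[of _ D]
      proof (rule nn_integral_mono_AE, use Z'(4)[of n] AE_space in eventually_elim)
        fix t assume t: "?\<iota> (snd (Z n t)) = ?I (Z n) t" "t \<in> space ?M"
        then have Dt: "D t = ?\<iota> (snd (z t - Z n t)) - (?I z t - ?I (Z n) t)" by (simp add: D_def \<iota>.diff)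
        have "norm (?\<iota> (snd (z t - Z n t))) \<le> C * norm (snd (z t - Z n t))"
          by (rule lift_op_bounded(2)[OF X(2,1) \<iota>])
        also have "\<dots> \<le> (C + 1) * norm (z t - Z n t)"
          using \<iota>(2) norm_snd_le'[of "z t - Z n t"] by (intro mult_mono) auto
        finally have 1: "norm (?\<iota> (snd (z t - Z n t))) \<le> (C + 1) * norm (z t - Z n t)" .
        have "ennreal (norm (?I z t - ?I (Z n) t)) \<le> qint ?M 1 (\<lambda>r. fst (z r) - fst (Z n r))"
          using t(2) by (intro L1_integral_diff_le fst_integrable_on[OF q] z zf Z') auto
        also have "\<dots> = qint ?M 1 (\<lambda>r. fst (z r - Z n r))" by simp
        also have "\<dots> \<le> ?d" by (rule qint_fst_le) simp
        finally have 2: "ennreal (norm (?I z t - ?I (Z n) t)) \<le> ?d" .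
        have "ennreal (norm (D t)) \<le> ennreal ((C + 1) * norm (z t - Z n t) + norm (?I z t - ?I (Z n) t))"
          unfolding Dt by (intro ennreal_leI order_trans[OF norm_triangle_ineq4] add_right_mono 1)
        also have "\<dots> = ennreal (C + 1) * ennreal (norm (z t - Z n t)) + ennreal (norm (?I z t - ?I (Z n) t))"
          using \<iota>(2) by (simp add: ennreal_mult)
        also have "\<dots> \<le> ennreal (C + 1) * ennreal (norm (z t - Z n t)) + ?d" using 2 by (rule add_left_mono)
        finally show "ennreal (norm (D t)) \<le> ennreal (C + 1) * ennreal (norm (z t - Z n t)) + ?d" .
      qed
      also have "\<dots> = ennreal (C + 1) * ?d + ?d * emeasure ?M (space ?M)"
        by (simp add: nn_integral_add nn_integral_cmult qint_1)
      finally show ?thesis .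
    qed
    obtain m where m: "0 \<le> m" "emeasure ?M (space ?M) = ennreal m"
      using fin by (cases "emeasure ?M (space ?M)") auto
    have "(\<lambda>n. ennreal (C + 1) * qint ?M 1 (\<lambda>x. z x - Z n x) + ennreal m * qint ?M 1 (\<lambda>x. z x - Z n x))
        \<longlonglongrightarrow> ennreal (C + 1) * 0 + ennreal m * 0"
      by (intro tendsto_add ennreal_tendsto_cmult lim1) auto
    then have "qint ?M 1 D \<le> ennreal (C + 1) * 0 + ennreal m * 0"
      by (rule LIMSEQ_le_const) (use le[unfolded m(2)] in \<open>auto simp: mult.commute\<close>)
    then have "AE t in ?M. D t = 0" by (intro qint_eq_0_AE[OF Ds, of 1]) simp
    then have "AE t in ?M. ?\<iota> (snd (z t)) = ?I z t" by eventually_elim (simp add: D_def)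
    with zf AE_kernel_closed[OF q0(2) h Z'(1,3) z] z(1) show "z \<in> mr_graph q \<tau> X1 X0"
      unfolding G by blast
  qed
qed

lemma nrm_bnd_lin_zero:
  assumes "complex_banach X" "bnd_lin X Y C A"
  shows "A 0 = 0"
  using assms(2) banach_zero[OF assms(1)] unfolding bnd_lin_def by (metis scaleR_zero_left)

lemma brange_add:
  assumes "complex_banach X" "a \<in> brange X" "b \<in> brange X"
  shows "a + b \<in> brange X"
  using assms by (simp add: brange_def bproj_add binj_add bproj_carr)

lemma mr_data_of_Lq:
  assumes X: "complex_banach X0" and f: "f \<in> Lq q 0 \<tau> X0"
  shows "(\<lambda>t. binj X0 (f t)) \<in> mr_data q \<tau> X0"
  using f by (simp add: mr_data_def Lq_iff[OF X] brange_binj X)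

lemma Lq_of_mr_data:
  assumes X: "complex_banach X0" and g: "g \<in> mr_data q \<tau> X0"
  shows "(\<lambda>t. bproj (g t) X0) \<in> Lq q 0 \<tau> X0" "AE t in leb_Ioo 0 \<tau>. binj X0 (bproj (g t) X0) = g t"
proof -
  have g': "smeas (leb_Ioo 0 \<tau>) g" "qint (leb_Ioo 0 \<tau>) q g < \<infinity>" "AE t in leb_Ioo 0 \<tau>. g t \<in> brange X0"
    using g by (simp_all add: mr_data_def)
  show 1: "AE t in leb_Ioo 0 \<tau>. binj X0 (bproj (g t) X0) = g t"
    using g'(3) by (simp add: brange_def)
  then have "AE t in leb_Ioo 0 \<tau>. g t = binj X0 (bproj (g t) X0)" by eventually_elim simp
  with g' 1 show "(\<lambda>t. bproj (g t) X0) \<in> Lq q 0 \<tau> X0"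
    unfolding Lq_iff[OF X] using smeas_cong_AE[OF g'(1)] qint_cong_AE[OF 1, of q] by (simp add: bproj_carr X)
qed

context
  fixes X1 X0 :: "'a::complex_vector nspace" and q C :: real
  assumes X: "complex_banach X0" "complex_banach X1" and q: "1 \<le> q"
    and \<iota>: "bnd_lin X1 X0 C (\<lambda>x. x)" "0 \<le> C"
begin

lemma solves_mr_graph:
  assumes s: "solves q \<tau> X1 X0 B f w v"
  shows "(\<lambda>t. (binj X0 (v t), binj X1 (w t))) \<in> mr_graph q \<tau> X1 X0"
    and "AE t in leb_Ioo 0 \<tau>. v t \<in> carr X0" "AE t in leb_Ioo 0 \<tau>. w t \<in> carr X1"
proof -
  let ?M = "leb_Ioo 0 \<tau>"
  interpret complete_measure ?M by (rule complete_leb_Ioo)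
  have w: "w \<in> Lq q 0 \<tau> X1" and v: "v \<in> Lq q 0 \<tau> X0" and p: "primitive X0 0 \<tau> w v" and w0: "w 0 = 0"
    using s by (simp_all add: solves_def)
  show vc: "AE t in ?M. v t \<in> carr X0" and wc: "AE t in ?M. w t \<in> carr X1"
    using v w by (simp_all add: Lq_iff X)
  have sv: "smeas ?M (\<lambda>t. binj X0 (v t))" and sw: "smeas ?M (\<lambda>t. binj X1 (w t))"
    using v w by (simp_all add: Lq_iff X)
  have "qint ?M q (\<lambda>t. (binj X0 (v t), binj X1 (w t)))
      = qint ?M q (\<lambda>t. (binj X0 (v t), 0 :: 'a bsum) + (0, binj X1 (w t)))" by simp
  also have "\<dots> \<le> ennreal (2 powr q) * (qint ?M q (\<lambda>t. (binj X0 (v t), 0 :: 'a bsum)) + qint ?M q (\<lambda>t. (0 :: 'a bsum, binj X1 (w t))))"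
    using q by (intro qint_add smeas_Pair sv sw smeas_const) auto
  also have "\<dots> = ennreal (2 powr q) * (qint ?M q (\<lambda>t. binj X0 (v t)) + qint ?M q (\<lambda>t. binj X1 (w t)))"
    by (simp add: qint_def norm_Pair)
  also have "\<dots> < \<infinity>" using v w by (simp add: Lq_iff X ennreal_mult_less_top less_top)
  finally have fin: "qint ?M q (\<lambda>t. (binj X0 (v t), binj X1 (w t))) < \<infinity>" .
  have "AE t in ?M. lift_op X1 X0 (\<lambda>x. x) (binj X1 (w t)) = integral {0..t} (\<lambda>r. binj X0 (v r))"
    using wc AE_space
  proof eventually_elim
    fix t assume t: "w t \<in> carr X1" "t \<in> space ?M"
    have "((\<lambda>r. binj X0 (v r)) has_integral binj X0 (w t) - binj X0 (w 0)) {0..t}"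
      by (rule primitive_has_integral[OF p]) (use t in auto)
    then show "lift_op X1 X0 (\<lambda>x. x) (binj X1 (w t)) = integral {0..t} (\<lambda>r. binj X0 (v r))"
      using t X by (simp add: w0 binj_zero lift_op_binj integral_unique)
  qed
  then show "(\<lambda>t. (binj X0 (v t), binj X1 (w t))) \<in> mr_graph q \<tau> X1 X0"
    using fin smeas_Pair[OF sv sw] by (simp add: mr_graph_def brange_binj X)
qed

lemma mr_graph_solves:
  assumes z: "z \<in> mr_graph q \<tau> X1 X0" and B: "\<And>t. t \<in> {0..\<tau>} \<Longrightarrow> \<exists>D\<ge>0. bnd_lin X1 X0 D (B t)"
    and \<tau>: "0 < \<tau>" and fc: "AE t in leb_Ioo 0 \<tau>. f t \<in> carr X0"
    and eq: "AE t in leb_Ioo 0 \<tau>. fst (z t) + lift_op X1 X0 (B t) (snd (z t)) = binj X0 (f t)"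
  obtains w v where "solves q \<tau> X1 X0 B f w v" "AE t in leb_Ioo 0 \<tau>. z t = (binj X0 (v t), binj X1 (w t))"
proof -
  let ?M = "leb_Ioo 0 \<tau>"
  interpret complete_measure ?M by (rule complete_leb_Ioo)
  have zs: "smeas ?M z" "qint ?M q z < \<infinity>" and r0: "AE t in ?M. fst (z t) \<in> brange X0 \<and> snd (z t) \<in> brange X1"
    and int: "AE t in ?M. lift_op X1 X0 (\<lambda>x. x) (snd (z t)) = integral {0..t} (\<lambda>r. fst (z r))"
    using z by (simp_all add: mr_graph_def)
  note fi = fst_integrable_on[OF q zs]
  define v where "v t = bproj (fst (z t)) X0" for t
  have "AE t in ?M. fst (z t) \<in> brange X0" using r0 by eventually_elim simp
  then have "(\<lambda>t. fst (z t)) \<in> mr_data q \<tau> X0"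
    using order_le_less_trans[OF qint_fst_le zs(2)] q by (simp add: mr_data_def fi)
  note vL = Lq_of_mr_data[OF X(1) this, folded v_def]
  have "AE t in ?M. snd (z t) \<in> brange X1" using r0 by eventually_elim simp
  then have "(\<lambda>t. snd (z t)) \<in> mr_data q \<tau> X1"
    using order_le_less_trans[OF qint_snd_le zs(2)] q
    by (simp add: mr_data_def smeas_bounded_linear[OF bounded_linear_snd zs(1)])
  note wL = Lq_of_mr_data[OF X(2) this]
  have vi: "((\<lambda>r. binj X0 (v r)) has_integral integral {0..t} (\<lambda>r. fst (z r))) {0..t}" if "t \<in> {0..\<tau>}" for t
  proof (rule has_integral_cong_AE)
    show "((\<lambda>r. fst (z r)) has_integral integral {0..t} (\<lambda>r. fst (z r))) {0..t}"
      by (rule integrable_integral[OF integrable_on_subinterval[OF fi(3)]]) (use that in auto)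
    have "AE t in ?M. fst (z t) = binj X0 (v t)" using vL(2) by eventually_elim simp
    then show "AE r in leb_Ioo 0 t. fst (z r) = binj X0 (v r)" by (rule AE_leb_Ioo_subset) (use that in auto)
  qed
  \<comment> \<open>Read off from the integral and not from the second component: this is the
    continuous representative, defined at every time and zero at time 0. The second component agrees
    with it almost everywhere.\<close>
  define w where "w t = bproj (integral {0..t} (\<lambda>r. fst (z r))) X0" for t
  have wi: "binj X0 (w t) = integral {0..t} (\<lambda>r. fst (z r))" if t: "t \<in> {0..\<tau>}" for t
  proof -
    obtain x where x: "x \<in> carr X0" "((\<lambda>r. binj X0 (v r)) has_integral binj X0 x) {0..t}"
      using integral_in_carr[OF X(1) has_integral_integrable[OF vi[OF t]]] by blast
    then have "integral {0..t} (\<lambda>r. fst (z r)) = binj X0 x" using has_integral_unique[OF vi[OF t]] by simp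
    then show ?thesis using x by (simp add: w_def bproj_binj X)
  qed
  have wc: "w t \<in> carr X0" for t by (simp add: w_def bproj_carr X)
  have w0: "w 0 = 0" by (simp add: w_def bproj_zero)
  have p: "primitive X0 0 \<tau> w v"
    unfolding primitive_def using vi wc by (simp add: wi w0 binj_zero X)
  have weq: "AE t in ?M. bproj (snd (z t)) X1 = w t"
    using int wL(2) AE_space
  proof eventually_elim
    fix t assume t: "lift_op X1 X0 (\<lambda>x. x) (snd (z t)) = integral {0..t} (\<lambda>r. fst (z r))"
      "binj X1 (bproj (snd (z t)) X1) = snd (z t)" "t \<in> space ?M"
    have c: "bproj (snd (z t)) X1 \<in> carr X0" using bnd_linD(1)[OF \<iota>(1) bproj_carr[OF X(2)]] .
    have "binj X0 (bproj (snd (z t)) X1) = binj X0 (w t)"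
      using t wi[of t] by (simp add: lift_op_def)
    then show "bproj (snd (z t)) X1 = w t" using binj_inject[OF X(1) c wc] by simp
  qed
  have zeq: "AE t in ?M. z t = (binj X0 (v t), binj X1 (w t))"
    using weq wL(2) vL(2) by eventually_elim (auto simp: prod_eq_iff)
  have wL': "w \<in> Lq q 0 \<tau> X1" by (rule Lq_cong_AE[OF X(2) wL(1) weq])
  have "AE t in ?M. v t + B t (w t) = f t"
    using eq zeq vL(1)[unfolded Lq_iff[OF X(1)], THEN conjunct1] wL'[unfolded Lq_iff[OF X(2)], THEN conjunct1] fc AE_space
  proof eventually_elim
    fix t assume t: "fst (z t) + lift_op X1 X0 (B t) (snd (z t)) = binj X0 (f t)"
      "z t = (binj X0 (v t), binj X1 (w t))" "v t \<in> carr X0" "w t \<in> carr X1" "f t \<in> carr X0" "t \<in> space ?M"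
    then have "t \<in> {0..\<tau>}" by auto
    from B[OF this] obtain D where "bnd_lin X1 X0 D (B t)" by blast
    then have Bw: "B t (w t) \<in> carr X0" using t(4) by (auto simp: bnd_lin_def)
    have "binj X0 (v t + B t (w t)) = binj X0 (f t)"
      using t Bw by (simp add: binj_add X lift_op_binj)
    then show "v t + B t (w t) = f t"
      using binj_inject[OF X(1) banach_add[OF X(1) t(3) Bw] t(5)] by simp
  qed
  then have "solves q \<tau> X1 X0 B f w v" unfolding solves_def using wL' vL(1) p w0 by simp
  with zeq show ?thesis using that by blast
qed

lemma mr_graph_image:
  assumes z: "z \<in> mr_graph q \<tau> X1 X0" and B: "\<And>t. t \<in> {0..\<tau>} \<Longrightarrow> \<exists>D\<ge>0. bnd_lin X1 X0 D (B t)"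
    and c: "continuous_on {0..\<tau>} (\<lambda>t. lift_bl X1 X0 (B t))"
  shows "(\<lambda>t. fst (z t) + lift_op X1 X0 (B t) (snd (z t))) \<in> mr_data q \<tau> X0"
proof -
  let ?M = "leb_Ioo 0 \<tau>"
  interpret complete_measure ?M by (rule complete_leb_Ioo)
  have zs: "smeas ?M z" "qint ?M q z < \<infinity>" and r0: "AE t in ?M. fst (z t) \<in> brange X0 \<and> snd (z t) \<in> brange X1"
    using z by (simp_all add: mr_graph_def)
  have ap: "blinfun_apply (lift_bl X1 X0 (B t)) = lift_op X1 X0 (B t)" if "t \<in> {0..\<tau>}" for t
    using B[OF that] lift_bl_apply[OF X(2,1)] by blast
  have "bounded ((\<lambda>t. lift_bl X1 X0 (B t)) ` {0..\<tau>})"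
    by (intro compact_imp_bounded compact_continuous_image c) simp
  then have "\<exists>K. \<forall>t\<in>{0..\<tau>}. norm (lift_bl X1 X0 (B t)) \<le> K" unfolding bounded_iff by auto
  then obtain K where K: "\<And>t. t \<in> {0..\<tau>} \<Longrightarrow> norm (lift_bl X1 X0 (B t)) \<le> K" by blast
  have s: "smeas ?M (\<lambda>t. fst (z t) + blinfun_apply (lift_bl X1 X0 (B t)) (snd (z t)))"
    by (intro smeas_add smeas_bounded_linear[OF bounded_linear_fst zs(1)]
        smeas_compose2[where h = blinfun_apply, OF smeas_continuous_on[OF c] smeas_bounded_linear[OF bounded_linear_snd zs(1)]]
        continuous_intros)
  have e: "AE t in ?M. fst (z t) + blinfun_apply (lift_bl X1 X0 (B t)) (snd (z t)) = fst (z t) + lift_op X1 X0 (B t) (snd (z t))"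
    by (rule AE_leb_Ioo_I) (simp add: ap)
  have "qint ?M q (\<lambda>t. fst (z t) + lift_op X1 X0 (B t) (snd (z t))) \<le> ennreal ((1 + max K 0) powr q) * qint ?M q z"
  proof (rule qint_bound[OF zs(1)])
    show "AE t in ?M. norm (fst (z t) + lift_op X1 X0 (B t) (snd (z t))) \<le> (1 + max K 0) * norm (z t)"
    proof (rule AE_leb_Ioo_I)
      fix t assume "0 < t" "t < \<tau>"
      then have t: "t \<in> {0..\<tau>}" by auto
      have "norm (lift_op X1 X0 (B t) (snd (z t))) \<le> norm (lift_bl X1 X0 (B t)) * norm (snd (z t))"
        unfolding ap[OF t, symmetric] by (rule norm_blinfun)
      also have "\<dots> \<le> max K 0 * norm (z t)" using K[OF t] norm_snd_le'[of "z t"] by (intro mult_mono) auto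
      finally show "norm (fst (z t) + lift_op X1 X0 (B t) (snd (z t))) \<le> (1 + max K 0) * norm (z t)"
        using norm_triangle_ineq[of "fst (z t)" "lift_op X1 X0 (B t) (snd (z t))"] norm_fst_le'[of "z t"]
        by (simp add: algebra_simps)
    qed
  qed (use q in auto)
  also have "\<dots> < \<infinity>" using zs(2) by (simp add: ennreal_mult_less_top)
  finally have fin: "qint ?M q (\<lambda>t. fst (z t) + lift_op X1 X0 (B t) (snd (z t))) < \<infinity>" .
  have "AE t in ?M. fst (z t) + lift_op X1 X0 (B t) (snd (z t)) \<in> brange X0"
    using r0 by eventually_elim (simp add: brange_add[OF X(1)] lift_op_def brange_binj[OF X(1)])
  with fin smeas_cong_AE[OF s e] show ?thesis by (simp add: mr_data_def)
qed

end

lemma solves_zero_v: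
  assumes X0: "complex_banach X0" and p: "primitive X0 0 \<tau> w v" and w0: "w 0 = 0"
    and v: "AE t in leb_Ioo 0 \<tau>. v t = 0" and t: "t \<in> {0..\<tau>}"
  shows "w t = 0"
proof -
  have "((\<lambda>r. binj X0 (v r)) has_integral binj X0 (w t) - binj X0 (w 0)) {0..t}"
    by (rule primitive_has_integral[OF p]) (use t in auto)
  moreover have "AE r in leb_Ioo 0 t. v r = 0" by (rule AE_leb_Ioo_subset[OF v]) (use t in auto)
  then have "AE r in leb_Ioo 0 t. binj X0 (v r) = 0" by eventually_elim (simp add: binj_zero X0)
  ultimately have "((\<lambda>r. 0 :: 'a bsum) has_integral binj X0 (w t) - binj X0 (w 0)) {0..t}"
    by (rule has_integral_cong_AE)
  then have "binj X0 (w t) - binj X0 (w 0) = 0" by (rule has_integral_unique) simp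
  then have "binj X0 (w t) = binj X0 0" by (simp add: w0)
  then show ?thesis using binj_inject[OF X0 primitive_carr[OF p t] banach_zero[OF X0]] by simp
qed

text \<open>Maximal regularity of \<open>A\<close> is unique solvability of a linear equation
  between two closed subspaces of L^q. \<open>bounded_solve\<close> provides a bound
  \<open>m\<close> for the solutions, and \<open>m\<close> determines how far \<open>B\<close> may
  deviate from \<open>A\<close>.\<close>

theorem max_reg_perturbation:
  fixes X1 X0 :: "'a::complex_vector nspace"
  assumes X: "complex_banach X0" "complex_banach X1" and q: "1 \<le> q"
    and \<iota>: "bnd_lin X1 X0 C (\<lambda>x. x)" "0 \<le> C" and \<tau>: "0 < \<tau>"
    and A: "bnd_lin X1 X0 CA A" "0 \<le> CA" and mr: "max_reg_on q \<tau> X1 X0 A"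
  obtains \<kappa> where "0 < \<kappa>"
    "\<And>B f. op_continuous_on 0 \<tau> X1 X0 B \<Longrightarrow>
      (\<And>t x. t \<in> {0..\<tau>} \<Longrightarrow> x \<in> carr X1 \<Longrightarrow> nrm X0 (A x - B t x) \<le> \<kappa> * nrm X1 x) \<Longrightarrow>
      f \<in> Lq q 0 \<tau> X0 \<Longrightarrow> \<exists>w v. solves q \<tau> X1 X0 B f w v"
    "\<And>B w v t. op_continuous_on 0 \<tau> X1 X0 B \<Longrightarrow>
      (\<And>t x. t \<in> {0..\<tau>} \<Longrightarrow> x \<in> carr X1 \<Longrightarrow> nrm X0 (A x - B t x) \<le> \<kappa> * nrm X1 x) \<Longrightarrow>
      solves q \<tau> X1 X0 B (\<lambda>_. 0) w v \<Longrightarrow> t \<in> {0..\<tau>} \<Longrightarrow> w t = 0"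
proof -
  let ?M = "leb_Ioo 0 \<tau>"
  let ?G = "mr_graph q \<tau> X1 X0"
  let ?L = "mr_data q \<tau> X0"
  interpret complete_measure ?M by (rule complete_leb_Ioo)
  note G = mr_graph_closed[OF X q \<iota>, of \<tau>] and L = mr_data_closed[OF X(1) q, of \<tau>]
  define \<Lambda> where "\<Lambda> B z = fst z + lift_op X1 X0 B (snd z)" for B :: "'a \<Rightarrow> 'a" and z :: "'a bsum \<times> 'a bsum"
  have lin: "linear (\<Lambda> B)" and bd: "norm (\<Lambda> B z) \<le> (1 + D) * norm z" if B: "bnd_lin X1 X0 D B" "0 \<le> D" for B D z
  proof -
    note l = lift_op_bounded[OF X(2,1) B]
    show "linear (\<Lambda> B)"
      by (rule linearI) (simp_all add: \<Lambda>_def linear_add[OF l(1)] linear_cmul[OF l(1)] scaleR_add_right)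
    have "norm (lift_op X1 X0 B (snd z)) \<le> D * norm z"
      using l(2)[of "snd z"] mult_left_mono[OF norm_snd_le'[of z] B(2)] by simp
    then show "norm (\<Lambda> B z) \<le> (1 + D) * norm z"
      unfolding \<Lambda>_def using norm_triangle_ineq[of "fst z" "lift_op X1 X0 B (snd z)"] norm_fst_le'[of z]
      by (simp add: algebra_simps)
  qed
  have exA: "\<exists>D\<ge>0. bnd_lin X1 X0 D A" using A by blast
  have mapsA: "(\<lambda>t. \<Lambda> A (z t)) \<in> ?L" if "z \<in> ?G" for z
    using mr_graph_image[OF X q \<iota> that, of "\<lambda>_. A"] exA unfolding \<Lambda>_def by simp
  have toG: "(\<lambda>t. (binj X0 (v t), binj X1 (w t))) \<in> ?G \<and>
      (AE t in ?M. \<Lambda> (B t) (binj X0 (v t), binj X1 (w t)) = binj X0 (f t))"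
    if s: "solves q \<tau> X1 X0 B f w v" and B: "\<And>t. t \<in> {0..\<tau>} \<Longrightarrow> \<exists>D\<ge>0. bnd_lin X1 X0 D (B t)" for B f w v
  proof
    note g = solves_mr_graph[OF X q \<iota> s]
    show "(\<lambda>t. (binj X0 (v t), binj X1 (w t))) \<in> ?G" by (rule g(1))
    have "AE t in ?M. v t + B t (w t) = f t" using s by (simp add: solves_def)
    then show "AE t in ?M. \<Lambda> (B t) (binj X0 (v t), binj X1 (w t)) = binj X0 (f t)"
      using g(2,3) AE_space
    proof eventually_elim
      fix t assume t: "v t + B t (w t) = f t" "v t \<in> carr X0" "w t \<in> carr X1" "t \<in> space ?M"
      then have "t \<in> {0..\<tau>}" by auto
      from B[OF this] obtain D where "bnd_lin X1 X0 D (B t)" by blast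
      with t show "\<Lambda> (B t) (binj X0 (v t), binj X1 (w t)) = binj X0 (f t)"
        by (simp add: \<Lambda>_def lift_op_binj X bnd_lin_def binj_add[symmetric])
    qed
  qed
  have solveA: "\<exists>z\<in>?G. AE t in ?M. \<Lambda> A (z t) = f t" if f: "f \<in> ?L" for f
  proof -
    note f' = Lq_of_mr_data[OF X(1) f]
    from max_reg_onD(1)[OF mr f'(1)] obtain w v where s: "solves q \<tau> X1 X0 (\<lambda>_. A) (\<lambda>t. bproj (f t) X0) w v"
      by (elim exE)
    from toG[OF s] exA have g: "(\<lambda>t. (binj X0 (v t), binj X1 (w t))) \<in> ?G"
      "AE t in ?M. \<Lambda> A (binj X0 (v t), binj X1 (w t)) = binj X0 (bproj (f t) X0)" by auto
    have "AE t in ?M. \<Lambda> A (binj X0 (v t), binj X1 (w t)) = f t"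
      using g(2) f'(2) by eventually_elim simp
    with g(1) show ?thesis
      by (intro bexI[where x = "\<lambda>t. (binj X0 (v t), binj X1 (w t))"])
  qed
  obtain m where m: "0 \<le> m" "\<And>f. f \<in> ?L \<Longrightarrow> \<exists>z\<in>?G. (AE t in ?M. \<Lambda> A (z t) = f t) \<and> qint ?M q z \<le> ennreal m * qint ?M q f"
    using bounded_solve[OF q G L, of "\<lambda>_. \<Lambda> A" "1 + CA"] lin[OF A] bd[OF A] A(2) mapsA solveA by auto
  \<comment> \<open>This makes \<open>\<kappa> powr q * (m + 1)\<close> equal to
    \<open>4 powr - q\<close>; the summand 1 avoids division by zero.\<close>
  define \<kappa> where "\<kappa> = (4 powr - q / (m + 1)) powr (1 / q)"
  have \<kappa>: "0 < \<kappa>" "\<kappa> powr q * m \<le> 4 powr - q"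
  proof -
    show "0 < \<kappa>" using m(1) by (simp add: \<kappa>_def)
    have "\<kappa> powr q = 4 powr - q / (m + 1)" using m(1) q by (simp add: \<kappa>_def powr_powr)
    then have "\<kappa> powr q * (m + 1) = 4 powr - q" using m(1) by simp
    moreover have "\<kappa> powr q * m \<le> \<kappa> powr q * (m + 1)" by (rule mult_left_mono) auto
    ultimately show "\<kappa> powr q * m \<le> 4 powr - q" by simp
  qed
  have r1: "(4::real) powr - q < 1"
  proof -
    have "(4::real) powr - q < 4 powr 0" using q by (intro powr_less_mono) auto
    then show ?thesis by simp
  qed
  show ?thesis
  proof (rule that[OF \<kappa>(1)])
    fix B assume B: "op_continuous_on 0 \<tau> X1 X0 B"
      and close: "\<And>t x. t \<in> {0..\<tau>} \<Longrightarrow> x \<in> carr X1 \<Longrightarrow> nrm X0 (A x - B t x) \<le> \<kappa> * nrm X1 x"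
    have Bb: "\<And>t. t \<in> {0..\<tau>} \<Longrightarrow> \<exists>D\<ge>0. bnd_lin X1 X0 D (B t)" by (rule op_continuous_bnd_lin[OF X(2) B])
    \<comment> \<open>The abstract lemmas want bounds at every point of the type, so times are
      clamped to the interval.\<close>
    define cl where "cl t = max 0 (min \<tau> t)" for t :: real
    have cl: "cl t \<in> {0..\<tau>}" for t using \<tau> by (auto simp: cl_def)
    have clid: "cl t = t" if "t \<in> {0..\<tau>}" for t using that by (auto simp: cl_def)
    have dif: "norm (\<Lambda> A z - \<Lambda> (B (cl t)) z) \<le> \<kappa> * norm z" for t z
    proof -
      obtain D where D: "0 \<le> D" "bnd_lin X1 X0 D (B (cl t))" using Bb[OF cl] by blast
      have d: "bnd_lin X1 X0 \<kappa> (\<lambda>x. A x - B (cl t) x)"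
        using bnd_lin_diff[OF X(1) A(1) D(2)] close[OF cl] unfolding bnd_lin_def by blast
      have "\<Lambda> A z - \<Lambda> (B (cl t)) z = lift_op X1 X0 (\<lambda>x. A x - B (cl t) x) (snd z)"
        by (simp add: \<Lambda>_def lift_op_diff[OF X(2,1) A(1) D(2)])
      also have "norm \<dots> \<le> \<kappa> * norm (snd z)" using \<kappa> by (intro lift_op_bounded(2)[OF X(2,1) d]) simp
      also have "\<dots> \<le> \<kappa> * norm z" using \<kappa> norm_snd_le'[of z] by (intro mult_left_mono) auto
      finally show ?thesis .
    qed
    have linB: "linear (\<Lambda> (B (cl t)))" for t using Bb[OF cl, of t] lin by blast
    have bdB: "norm (\<Lambda> (B (cl t)) z) \<le> (1 + CA + \<kappa>) * norm z" for t z
    proof -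
      have "norm (\<Lambda> (B (cl t)) z) \<le> norm (\<Lambda> A z) + norm (\<Lambda> A z - \<Lambda> (B (cl t)) z)"
        using norm_triangle_ineq4[of "\<Lambda> A z" "\<Lambda> A z - \<Lambda> (B (cl t)) z"] by simp
      also have "\<dots> \<le> (1 + CA) * norm z + \<kappa> * norm z" by (intro add_mono bd A dif)
      finally show ?thesis by (simp add: algebra_simps)
    qed
    have mapsB: "(\<lambda>t. \<Lambda> (B (cl t)) (z t)) \<in> ?L" if z: "z \<in> ?G" for z
    proof -
      have c: "continuous_on {0..\<tau>} (\<lambda>t. lift_bl X1 X0 (B (cl t)))"
        by (rule continuous_on_eq[OF lift_bl_continuous[OF X(2,1) B]]) (simp add: clid)
      show ?thesis unfolding \<Lambda>_def by (rule mr_graph_image[OF X q \<iota> z _ c]) (rule Bb[OF cl])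
    qed
    {
      fix f assume f: "f \<in> Lq q 0 \<tau> X0"
      have fc: "AE t in ?M. f t \<in> carr X0" using f by (simp add: Lq_iff[OF X(1)])
      have "\<exists>z\<in>?G. AE t in ?M. \<Lambda> (B (cl t)) (z t) = binj X0 (f t)"
      proof (rule perturb_solve[OF q G L linB bdB _ mapsB m(2) m(1) dif _ \<kappa>(2) mr_data_of_Lq[OF X(1) f]])
        show "0 \<le> 1 + CA + \<kappa>" using A(2) \<kappa> by simp
        show "0 \<le> \<kappa>" using \<kappa> by simp
      qed
      then obtain z where z: "z \<in> ?G" "AE t in ?M. \<Lambda> (B (cl t)) (z t) = binj X0 (f t)" by blast
      have "AE t in ?M. fst (z t) + lift_op X1 X0 (B t) (snd (z t)) = binj X0 (f t)"
        using z(2) AE_space by eventually_elim (simp add: \<Lambda>_def clid)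
      from mr_graph_solves[OF X q \<iota> z(1) Bb \<tau> fc this]
      show "\<exists>w v. solves q \<tau> X1 X0 B f w v" by metis
    next
      fix w v t assume s: "solves q \<tau> X1 X0 B (\<lambda>_. 0) w v" and t: "t \<in> {0..\<tau>}"
      define z where "z t = (binj X0 (v t), binj X1 (w t))" for t
      have zG: "z \<in> ?G" and z0: "AE t in ?M. \<Lambda> (B t) (z t) = 0"
        using toG[OF s Bb] by (simp_all add: z_def[abs_def] binj_zero X)
      have AL: "(\<lambda>t. \<Lambda> A (z t)) \<in> ?L" by (rule mapsA[OF zG])
      \<comment> \<open>Since \<open>\<Lambda> (B t) (z t) = 0\<close>, the image of
        \<open>z\<close> under \<open>\<Lambda> A\<close> is small, so \<open>y\<close> has at most
        \<open>4 powr - q\<close> times the size of \<open>z\<close>. Uniqueness for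
        \<open>A\<close> forces \<open>y = z\<close>, hence both vanish.\<close>
      obtain y where y: "y \<in> ?G" "AE t in ?M. \<Lambda> A (y t) = \<Lambda> A (z t)"
        "qint ?M q y \<le> ennreal m * qint ?M q (\<lambda>t. \<Lambda> A (z t))"
        using m(2)[OF AL] by blast
      have "qint ?M q (\<lambda>t. \<Lambda> A (z t)) \<le> ennreal (\<kappa> powr q) * qint ?M q z"
      proof (rule qint_bound[OF lq_closedD(1)[OF G zG]])
        show "AE t in ?M. norm (\<Lambda> A (z t)) \<le> \<kappa> * norm (z t)"
          using z0 AE_space
        proof eventually_elim
          fix t assume "\<Lambda> (B t) (z t) = 0" "t \<in> space ?M"
          then show "norm (\<Lambda> A (z t)) \<le> \<kappa> * norm (z t)" using dif[of "z t" t] by (simp add: clid)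
        qed
      qed (use \<kappa> q in auto)
      then have "qint ?M q y \<le> ennreal m * (ennreal (\<kappa> powr q) * qint ?M q z)"
        by (intro order_trans[OF y(3)] mult_left_mono) auto
      also have "\<dots> = ennreal (\<kappa> powr q * m) * qint ?M q z" using m(1) by (simp add: ennreal_mult mult_ac)
      also have "\<dots> \<le> ennreal (4 powr - q) * qint ?M q z" by (intro mult_right_mono ennreal_leI \<kappa>) simp
      finally have le: "qint ?M q y \<le> ennreal (4 powr - q) * qint ?M q z" .
      have dG: "(\<lambda>t. z t - y t) \<in> ?G" by (rule lq_closed_diff[OF G zG y(1)])
      have "AE t in ?M. fst (z t - y t) + lift_op X1 X0 A (snd (z t - y t)) = binj X0 0"
        using y(2)
      proof eventually_elim
        fix t assume "\<Lambda> A (y t) = \<Lambda> A (z t)"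
        then have "\<Lambda> A (z t - y t) = 0" by (simp add: linear_diff[OF lin[OF A]])
        then show "fst (z t - y t) + lift_op X1 X0 A (snd (z t - y t)) = binj X0 0"
          by (simp add: \<Lambda>_def binj_zero X)
      qed
      then obtain w' v' where s': "solves q \<tau> X1 X0 (\<lambda>_. A) (\<lambda>_. 0) w' v'"
        and e': "AE t in ?M. z t - y t = (binj X0 (v' t), binj X1 (w' t))"
        using mr_graph_solves[OF X q \<iota> dG, of "\<lambda>_. A" "\<lambda>_. 0"] exA \<tau> banach_zero[OF X(1)] by auto
      have A0: "A 0 = 0" by (rule nrm_bnd_lin_zero[OF X(2) A(1)])
      have "AE t in ?M. v' t + A (w' t) = 0" using s' by (simp add: solves_def)
      with e' AE_space have "AE t in ?M. y t = z t"
      proof eventually_elim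
        fix t assume t: "z t - y t = (binj X0 (v' t), binj X1 (w' t))" "t \<in> space ?M" "v' t + A (w' t) = 0"
        then have "w' t = 0" using max_reg_onD(2)[OF mr s', of t] by auto
        moreover from this have "v' t = 0" using t(3) A0 by simp
        ultimately show "y t = z t" using t(1) by (simp add: binj_zero X zero_prod_def[symmetric])
      qed
      then have "qint ?M q y = qint ?M q z" by (rule qint_cong_AE)
      moreover obtain a where a: "0 \<le> a" "qint ?M q z = ennreal a"
        using lq_closedD(2)[OF G zG] by (cases "qint ?M q z") auto
      ultimately have "a \<le> 4 powr - q * a" using le by (simp add: ennreal_mult[symmetric])
      moreover have "4 powr - q * a < a" if "0 < a" using mult_strict_right_mono[OF r1 that] by simp
      ultimately have "a = 0" using a(1) by fastforce
      then have "qint ?M q z = 0" using a by simp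
      then have "AE t in ?M. z t = 0" by (rule qint_eq_0_AE[OF lq_closedD(1)[OF G zG]])
      moreover have "AE t in ?M. v t \<in> carr X0" using solves_mr_graph(2)[OF X q \<iota> s] .
      ultimately have "AE t in ?M. v t = 0"
      proof eventually_elim
        fix t assume "z t = 0" "v t \<in> carr X0"
        then have "binj X0 (v t) = binj X0 0" "v t \<in> carr X0" by (simp_all add: z_def zero_prod_def binj_zero X)
        then show "v t = 0" using binj_inject[OF X(1) _ banach_zero[OF X(1)]] by blast
      qed
      then show "w t = 0"
        using s t solves_zero_v[OF X(1), of \<tau> w v t] unfolding solves_def by blast
    }
  qed
qed

subsection \<open>The trace space\<close>

text \<open>Minkowski's inequality for the trace norm results from taking for \<open>A\<close> and \<open>B\<close> (almost) the norms
  of the summands.\<close>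

lemma powr_add_weighted:
  fixes a b A B q :: real
  assumes "0 \<le> a" "0 \<le> b" "0 < A" "0 < B" "1 \<le> q"
  shows "(a + b) powr q \<le> (A + B) powr (q - 1) * (A powr (1 - q) * a powr q + B powr (1 - q) * b powr q)"
proof -
  \<comment> \<open>The case in which one summand is zero, where the powers of quotients are
    avoided.\<close>
  have le: "y powr q \<le> (D + E) powr (q - 1) * (E powr (1 - q) * y powr q)" if "0 \<le> y" "0 < D" "0 < E" for y D E :: real
  proof -
    have "1 = E powr (q - 1) * E powr (1 - q)" using that by (simp add: powr_add[symmetric])
    also have "\<dots> \<le> (D + E) powr (q - 1) * E powr (1 - q)"
      using that assms by (intro mult_right_mono powr_mono2) auto
    finally have "1 * y powr q \<le> (D + E) powr (q - 1) * E powr (1 - q) * y powr q"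
      by (intro mult_right_mono) auto
    then show ?thesis by (simp add: mult.assoc)
  qed
  consider "a = 0" | "b = 0" | "0 < a" "0 < b" using assms by linarith
  then show ?thesis
  proof cases
    case 1
    then show ?thesis using le[of b A B] assms by simp
  next
    case 2
    then show ?thesis using le[of a B A] assms by (simp add: add.commute)
  next
    case 3
    let ?t = "B / (A + B)"
    have t: "0 \<le> ?t" "?t \<le> 1" "1 - ?t = A / (A + B)" using assms by (auto simp: field_simps)
    have AB: "0 < A + B" using assms by simp
    \<comment> \<open>Convexity of the q-th power, with the weights A/(A+B) and B/(A+B).\<close>
    have "((1 - ?t) *\<^sub>R (a / A) + ?t *\<^sub>R (b / B)) powr q \<le> (1 - ?t) * (a / A) powr q + ?t * (b / B) powr q"
      by (rule convex_onD[OF powr_convex[OF assms(5)]]) (use t 3 assms in auto)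
    also have "(1 - ?t) *\<^sub>R (a / A) + ?t *\<^sub>R (b / B) = (a + b) / (A + B)"
      unfolding t(3) using assms AB by (simp add: add_divide_distrib)
    finally have "((a + b) / (A + B)) powr q \<le> A / (A + B) * (a / A) powr q + B / (A + B) * (b / B) powr q"
      unfolding t(3) .
    then have "(A + B) powr q * ((a + b) / (A + B)) powr q \<le>
        (A + B) powr q * (A / (A + B) * (a / A) powr q + B / (A + B) * (b / B) powr q)"
      by (rule mult_left_mono) simp
    moreover have "(A + B) powr q * ((a + b) / (A + B)) powr q = (a + b) powr q"
      using 3 AB by (simp add: powr_mult[symmetric])
    moreover have "(A + B) powr q * (A / (A + B) * (a / A) powr q + B / (A + B) * (b / B) powr q)
        = (A + B) powr (q - 1) * (A powr (1 - q) * a powr q + B powr (1 - q) * b powr q)"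
    proof -
      have "(A + B) powr q = (A + B) powr (q - 1) * (A + B)"
        using AB by (simp add: powr_diff)
      moreover have "A * (a / A) powr q = A powr (1 - q) * a powr q" "B * (b / B) powr q = B powr (1 - q) * b powr q"
        using assms 3 by (simp_all add: powr_divide powr_diff)
      ultimately show ?thesis using AB by (simp add: distrib_left[symmetric] add_divide_distrib[symmetric])
    qed
    ultimately show ?thesis by simp
  qed
qed

context
  fixes X1 X0 :: "'a::complex_vector nspace" and C :: real
  assumes X: "complex_banach X0" "complex_banach X1" and \<iota>: "bnd_lin X1 X0 C (\<lambda>x. x)" "0 \<le> C"
begin

abbreviation "Kf \<equiv> K_functional X1 X0"

lemma incl_carr: "x \<in> carr X1 \<Longrightarrow> x \<in> carr X0"
  using bnd_linD(1)[OF \<iota>(1)] .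

lemma K_bdd: "0 \<le> t \<Longrightarrow> bdd_below {nrm X1 a + t * nrm X0 b |a b. a \<in> carr X1 \<and> b \<in> carr X0 \<and> x = a + b}"
  by (rule bdd_belowI[of _ 0]) (auto intro!: add_nonneg_nonneg mult_nonneg_nonneg simp: nrm_nonneg X)

lemma K_le:
  assumes "0 \<le> t" "a \<in> carr X1" "b \<in> carr X0" "x = a + b"
  shows "Kf t x \<le> nrm X1 a + t * nrm X0 b"
  unfolding K_functional_def by (rule cInf_lower[OF _ K_bdd]) (use assms in auto)

lemma K_greatest:
  assumes "x \<in> carr X0"
    and "\<And>a b. a \<in> carr X1 \<Longrightarrow> b \<in> carr X0 \<Longrightarrow> x = a + b \<Longrightarrow> y \<le> nrm X1 a + t * nrm X0 b"
  shows "y \<le> Kf t x"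
  unfolding K_functional_def
proof (rule cInf_greatest)
  have "0 \<in> carr X1" "x = 0 + x" by (simp_all add: banach_zero X)
  then show "{nrm X1 a + t * nrm X0 b |a b. a \<in> carr X1 \<and> b \<in> carr X0 \<and> x = a + b} \<noteq> {}"
    using assms(1) by blast
qed (use assms(2) in auto)

lemma K_nonneg: "0 \<le> t \<Longrightarrow> x \<in> carr X0 \<Longrightarrow> 0 \<le> Kf t x"
  by (rule K_greatest) (auto intro!: add_nonneg_nonneg mult_nonneg_nonneg simp: nrm_nonneg X)

lemma K_le_X0: "0 \<le> t \<Longrightarrow> x \<in> carr X0 \<Longrightarrow> Kf t x \<le> t * nrm X0 x"
  using K_le[of t 0 x x] by (simp add: banach_zero nrm_zero X)

lemma K_mono: "0 \<le> s \<Longrightarrow> s \<le> t \<Longrightarrow> x \<in> carr X0 \<Longrightarrow> Kf s x \<le> Kf t x"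
  by (rule K_greatest, assumption, rule order_trans[OF K_le])
     (auto intro!: mult_right_mono simp: nrm_nonneg X)

lemma K_triangle:
  assumes t: "0 \<le> t" and x: "x \<in> carr X0" and y: "y \<in> carr X0"
  shows "Kf t (x + y) \<le> Kf t x + Kf t y"
proof -
  have "Kf t (x + y) - Kf t x \<le> Kf t y"
  proof (rule K_greatest[OF y])
    fix a b assume ab: "a \<in> carr X1" "b \<in> carr X0" "y = a + b"
    have "Kf t (x + y) - (nrm X1 a + t * nrm X0 b) \<le> Kf t x"
    proof (rule K_greatest[OF x])
      fix c d assume cd: "c \<in> carr X1" "d \<in> carr X0" "x = c + d"
      have "Kf t (x + y) \<le> nrm X1 (c + a) + t * nrm X0 (d + b)"
        by (rule K_le[OF t]) (use ab cd in \<open>auto simp: banach_add X algebra_simps\<close>)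
      also have "\<dots> \<le> (nrm X1 c + nrm X1 a) + t * (nrm X0 d + nrm X0 b)"
        using t ab cd by (intro add_mono mult_left_mono nrm_triangle X)
      finally show "Kf t (x + y) - (nrm X1 a + t * nrm X0 b) \<le> nrm X1 c + t * nrm X0 d"
        by (simp add: algebra_simps)
    qed
    then show "Kf t (x + y) - Kf t x \<le> nrm X1 a + t * nrm X0 b" by simp
  qed
  then show ?thesis by simp
qed

lemma K_minus_le: "0 \<le> t \<Longrightarrow> x \<in> carr X0 \<Longrightarrow> Kf t (- x) \<le> Kf t x"
proof (rule K_greatest)
  fix a b assume t: "0 \<le> t" and ab: "a \<in> carr X1" "b \<in> carr X0" "x = a + b"
  have "Kf t (- x) \<le> nrm X1 (- a) + t * nrm X0 (- b)"
    by (rule K_le[OF t]) (use ab in \<open>auto simp: banach_minus X\<close>)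
  then show "Kf t (- x) \<le> nrm X1 a + t * nrm X0 b" using ab by (simp add: nrm_minus X)
qed

lemma K_minus: "0 \<le> t \<Longrightarrow> x \<in> carr X0 \<Longrightarrow> Kf t (- x) = Kf t x"
  using K_minus_le[of t x] K_minus_le[of t "- x"] by (simp add: banach_minus X)

lemma nrm_le_K: "x \<in> carr X0 \<Longrightarrow> nrm X0 x \<le> (C + 1) * Kf 1 x"
proof -
  assume x: "x \<in> carr X0"
  have "nrm X0 x / (C + 1) \<le> Kf 1 x"
  proof (rule K_greatest[OF x])
    fix a b assume ab: "a \<in> carr X1" "b \<in> carr X0" "x = a + b"
    have "nrm X0 x \<le> nrm X0 a + nrm X0 b" using ab by (simp add: nrm_triangle X incl_carr)
    also have "\<dots> \<le> C * nrm X1 a + nrm X0 b" using bnd_linD(2)[OF \<iota>(1) ab(1)] by simp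
    also have "\<dots> \<le> (C + 1) * nrm X1 a + (C + 1) * nrm X0 b"
      using \<iota>(2) ab nrm_nonneg[OF X(2) ab(1)] nrm_nonneg[OF X(1) ab(2)] by (simp add: distrib_right)
    finally show "nrm X0 x / (C + 1) \<le> nrm X1 a + 1 * nrm X0 b"
      using \<iota>(2) by (simp add: pos_divide_le_eq algebra_simps)
  qed
  then show ?thesis using \<iota>(2) by (simp add: pos_divide_le_eq mult.commute)
qed

text \<open>The functional increases with \<open>t\<close>; setting it to 0 for nonpositive
  \<open>t\<close> keeps it monotone on the whole line.\<close>

lemma K_measurable: "x \<in> carr X0 \<Longrightarrow> (\<lambda>t. if 0 < t then Kf t x else 0) \<in> borel_measurable borel"
  by (rule borel_measurable_mono) (auto intro!: monoI simp: K_mono K_nonneg)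

text \<open>For the parameters \<open>1 / q, q\<close> the weights of the K-method combine to
  \<open>t powr (- 2)\<close>. The set \<open>S\<close> separates small \<open>t\<close>, governed
  by the norm of \<open>X0\<close>, from the tail.\<close>

definition trint :: "real \<Rightarrow> real set \<Rightarrow> 'a \<Rightarrow> ennreal" where
  "trint q S x = (\<integral>\<^sup>+ t. ennreal (t powr (- 2) * (if 0 < t then Kf t x else 0) powr q) * indicator S t \<partial>lborel)"

lemma interp_integral_eq:
  assumes x: "x \<in> carr X0" and q: "0 < q"
  shows "interp_integral X1 X0 (1 / q) q x = trint q {0<..} x"
  unfolding interp_integral_def trint_def
proof (rule nn_integral_cong)
  fix t :: real
  show "ennreal ((t powr - (1 / q) * K_functional X1 X0 t x) powr q / t) * indicator {0<..} t =
    ennreal (t powr - 2 * (if 0 < t then Kf t x else 0) powr q) * indicator {0<..} t"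
  proof (cases "0 < t")
    case True
    have "(t powr - (1 / q) * Kf t x) powr q / t = t powr - 1 * Kf t x powr q / t powr 1"
      using True x q by (simp add: powr_mult K_nonneg powr_powr)
    also have "\<dots> = t powr - 2 * Kf t x powr q"
      using True by (simp add: powr_minus field_simps power2_eq_square)
    finally show ?thesis using True by simp
  qed simp
qed

lemma trint_measurable [measurable]:
  assumes x: "x \<in> carr X0"
  shows "(\<lambda>t. ennreal (t powr (- 2) * (if 0 < t then Kf t x else 0) powr q)) \<in> borel_measurable borel"
  using K_measurable[OF x] by measurable

lemma trint_add:
  assumes x: "x \<in> carr X0" and y: "y \<in> carr X0" and q: "1 \<le> q" and AB: "0 < A" "0 < B" and S: "S \<in> sets borel"
  shows "trint q S (x + y) \<le> ennreal ((A + B) powr (q - 1)) *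
    (ennreal (A powr (1 - q)) * trint q S x + ennreal (B powr (1 - q)) * trint q S y)"
proof -
  note [measurable] = trint_measurable[OF x] trint_measurable[OF y] S
  have "trint q S (x + y) \<le> (\<integral>\<^sup>+ t. ennreal ((A + B) powr (q - 1)) *
     (ennreal (A powr (1 - q)) * (ennreal (t powr (- 2) * (if 0 < t then Kf t x else 0) powr q) * indicator S t) +
      ennreal (B powr (1 - q)) * (ennreal (t powr (- 2) * (if 0 < t then Kf t y else 0) powr q) * indicator S t)) \<partial>lborel)"
    unfolding trint_def
  proof (rule nn_integral_mono)
    fix t :: real
    show "ennreal (t powr - 2 * (if 0 < t then Kf t (x + y) else 0) powr q) * indicator S t \<le>
      ennreal ((A + B) powr (q - 1)) *
     (ennreal (A powr (1 - q)) * (ennreal (t powr (- 2) * (if 0 < t then Kf t x else 0) powr q) * indicator S t) +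
      ennreal (B powr (1 - q)) * (ennreal (t powr (- 2) * (if 0 < t then Kf t y else 0) powr q) * indicator S t))"
    proof (cases "0 < t \<and> t \<in> S")
      case True
      then have t: "0 < t" by simp
      have "Kf t (x + y) powr q \<le> (Kf t x + Kf t y) powr q"
        using t q x y by (intro powr_mono2 K_triangle K_nonneg) (auto simp: banach_add X)
      also have "\<dots> \<le> (A + B) powr (q - 1) * (A powr (1 - q) * Kf t x powr q + B powr (1 - q) * Kf t y powr q)"
        using t q x y AB by (intro powr_add_weighted K_nonneg) auto
      finally have "t powr - 2 * Kf t (x + y) powr q \<le> t powr - 2 *
         ((A + B) powr (q - 1) * (A powr (1 - q) * Kf t x powr q + B powr (1 - q) * Kf t y powr q))"
        by (rule mult_left_mono) simp
      also have "\<dots> = (A + B) powr (q - 1) * (A powr (1 - q) * (t powr - 2 * Kf t x powr q) + B powr (1 - q) * (t powr - 2 * Kf t y powr q))"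
        by (simp add: algebra_simps)
      finally show ?thesis using True by (simp add: ennreal_mult[symmetric] ennreal_leI flip: ennreal_plus)
    qed (auto simp: indicator_def)
  qed
  also have "\<dots> = ennreal ((A + B) powr (q - 1)) *
    (ennreal (A powr (1 - q)) * trint q S x + ennreal (B powr (1 - q)) * trint q S y)"
    unfolding trint_def by (simp add: nn_integral_cmult nn_integral_add)
  finally show ?thesis .
qed

lemma trint_minus: "x \<in> carr X0 \<Longrightarrow> trint q S (- x) = trint q S x"
  unfolding trint_def by (rule nn_integral_cong) (auto simp: K_minus)

text \<open>Only \<open>{1..2}\<close> is kept: there the weight is at least 1/4 and the functional
  at least its value at 1.\<close>

lemma trint_lower:
  assumes x: "x \<in> carr X0" and q: "0 < q"
  shows "ennreal (Kf 1 x powr q / 4) \<le> trint q {0<..} x"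
proof -
  have "ennreal (Kf 1 x powr q / 4) = (\<integral>\<^sup>+ t. ennreal (Kf 1 x powr q / 4) * indicator {1..2::real} t \<partial>lborel)"
    by (simp add: nn_integral_cmult_indicator)
  also have "\<dots> \<le> trint q {0<..} x"
    unfolding trint_def
  proof (rule nn_integral_mono)
    fix t :: real
    show "ennreal (Kf 1 x powr q / 4) * indicator {1..2} t
        \<le> ennreal (t powr - 2 * (if 0 < t then Kf t x else 0) powr q) * indicator {0<..} t"
    proof (cases "t \<in> {1..2}")
      case True
      then have "2 powr - 2 \<le> t powr - 2" by (intro powr_mono2') auto
      then have "1 / 4 \<le> t powr - 2" by (simp add: powr_minus)
      moreover have "Kf 1 x powr q \<le> Kf t x powr q" using True x q by (intro powr_mono2 K_mono K_nonneg) auto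
      ultimately have "1 / 4 * Kf 1 x powr q \<le> t powr - 2 * Kf t x powr q" by (intro mult_mono) auto
      then show ?thesis using True by (simp add: ennreal_leI)
    qed simp
  qed
  finally show ?thesis .
qed

context
  fixes q :: real
  assumes q: "1 < q"
begin

lemma trace_carr: "x \<in> carr (trace_space q X1 X0) \<longleftrightarrow> x \<in> carr X0 \<and> trint q {0<..} x < \<infinity>"
proof -
  have "x \<in> carr X0 \<longleftrightarrow> x \<in> {a + b |a b. a \<in> carr X1 \<and> b \<in> carr X0}"
  proof
    assume "x \<in> carr X0"
    moreover have "x = 0 + x" "0 \<in> carr X1" by (simp_all add: banach_zero X)
    ultimately show "x \<in> {a + b |a b. a \<in> carr X1 \<and> b \<in> carr X0}" by blast
  qed (auto simp: banach_add X incl_carr)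
  moreover have "x \<in> carr (trace_space q X1 X0) \<longleftrightarrow> x \<in> {a + b |a b. a \<in> carr X1 \<and> b \<in> carr X0} \<and>
      interp_integral X1 X0 (1 / q) q x < \<infinity>"
    unfolding trace_space_def real_interp_def by simp
  ultimately show ?thesis
    using interp_integral_eq[of x q] q by (cases "x \<in> carr X0") simp_all
qed

lemma trace_nrm: "x \<in> carr X0 \<Longrightarrow> nrm (trace_space q X1 X0) x = enn2real (trint q {0<..} x) powr (1 / q)"
  unfolding trace_space_def real_interp_def using interp_integral_eq[of x q] q by simp

lemma trint_eq_nrm:
  assumes "x \<in> carr (trace_space q X1 X0)"
  shows "trint q {0<..} x = ennreal (nrm (trace_space q X1 X0) x powr q)" "0 \<le> nrm (trace_space q X1 X0) x"
  using assms q unfolding trace_carr by (auto simp: trace_nrm powr_powr less_top)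

lemma trace_triangle:
  assumes x: "x \<in> carr (trace_space q X1 X0)" and y: "y \<in> carr (trace_space q X1 X0)"
  shows "x + y \<in> carr (trace_space q X1 X0)"
    "nrm (trace_space q X1 X0) (x + y) \<le> nrm (trace_space q X1 X0) x + nrm (trace_space q X1 X0) y"
proof -
  let ?N = "nrm (trace_space q X1 X0)"
  have x0: "x \<in> carr X0" and y0: "y \<in> carr X0" using x y by (simp_all add: trace_carr)
  \<comment> \<open>Strictly larger values \<open>A\<close>, \<open>B\<close> are positive even if a
    norm vanishes, as the weighted inequality requires.\<close>
  have main: "trint q {0<..} (x + y) \<le> ennreal ((A + B) powr q)" if A: "?N x < A" and B: "?N y < B" for A B
  proof -
    have AB: "0 < A" "0 < B" using A B trint_eq_nrm(2)[OF x] trint_eq_nrm(2)[OF y] by auto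
    have "trint q {0<..} (x + y) \<le> ennreal ((A + B) powr (q - 1)) *
        (ennreal (A powr (1 - q)) * trint q {0<..} x + ennreal (B powr (1 - q)) * trint q {0<..} y)"
      using q by (intro trint_add x0 y0 AB) auto
    also have "\<dots> = ennreal ((A + B) powr (q - 1) * (A powr (1 - q) * ?N x powr q + B powr (1 - q) * ?N y powr q))"
      unfolding trint_eq_nrm(1)[OF x] trint_eq_nrm(1)[OF y] by (simp add: ennreal_mult)
    also have "\<dots> \<le> ennreal ((A + B) powr (q - 1) * (A powr (1 - q) * A powr q + B powr (1 - q) * B powr q))"
      using A B q trint_eq_nrm(2)[OF x] trint_eq_nrm(2)[OF y]
      by (intro ennreal_leI mult_left_mono add_mono powr_mono2) auto
    also have "(A + B) powr (q - 1) * (A powr (1 - q) * A powr q + B powr (1 - q) * B powr q) = (A + B) powr q"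
      using AB by (simp add: powr_add[symmetric] powr_diff)
    finally show ?thesis .
  qed
  have "trint q {0<..} (x + y) < \<infinity>"
    using main[of "?N x + 1" "?N y + 1"] by (simp add: order_le_less_trans)
  then show c: "x + y \<in> carr (trace_space q X1 X0)" using x0 y0 by (simp add: trace_carr banach_add X)
  show "?N (x + y) \<le> ?N x + ?N y"
  proof (rule field_le_epsilon)
    fix e :: real assume e: "0 < e"
    have "ennreal (?N (x + y) powr q) \<le> ennreal (((?N x + e / 2) + (?N y + e / 2)) powr q)"
      unfolding trint_eq_nrm(1)[OF c, symmetric] by (rule main) (use e in auto)
    then have "?N (x + y) powr q \<le> (?N x + ?N y + e) powr q" by (simp add: algebra_simps)
    moreover have "0 \<le> ?N x + ?N y + e" using e trint_eq_nrm(2)[OF x] trint_eq_nrm(2)[OF y] by simp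
    ultimately show "?N (x + y) \<le> ?N x + ?N y + e"
      using powr_less_mono2[of q "?N x + ?N y + e" "?N (x + y)"] q by fastforce
  qed
qed

lemma trace_minus:
  assumes "x \<in> carr (trace_space q X1 X0)"
  shows "- x \<in> carr (trace_space q X1 X0)" "nrm (trace_space q X1 X0) (- x) = nrm (trace_space q X1 X0) x"
  using assms by (auto simp: trace_carr trace_nrm trint_minus banach_minus X)

lemma trace_diff:
  assumes "x \<in> carr (trace_space q X1 X0)" "y \<in> carr (trace_space q X1 X0)"
  shows "x - y \<in> carr (trace_space q X1 X0)"
  using trace_triangle(1)[OF assms(1) trace_minus(1)[OF assms(2)]] by simp

text \<open>The factor \<open>4 powr (1 / q)\<close> comes from the weight on \<open>{1..2}\<close>
  in \<open>trint_lower\<close>, the factor \<open>C + 1\<close> from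
  \<open>nrm_le_K\<close>.\<close>

lemma trace_lower:
  assumes x: "x \<in> carr (trace_space q X1 X0)"
  shows "nrm X0 x \<le> (C + 1) * 4 powr (1 / q) * nrm (trace_space q X1 X0) x"
proof -
  let ?N = "nrm (trace_space q X1 X0) x"
  have x0: "x \<in> carr X0" using x by (simp add: trace_carr)
  have "ennreal (Kf 1 x powr q / 4) \<le> ennreal (?N powr q)"
    using trint_lower[OF x0, of q] q unfolding trint_eq_nrm(1)[OF x] by simp
  then have "Kf 1 x powr q \<le> 4 * ?N powr q" by simp
  then have "(Kf 1 x powr q) powr (1 / q) \<le> (4 * ?N powr q) powr (1 / q)" using q by (intro powr_mono2) auto
  then have "Kf 1 x \<le> 4 powr (1 / q) * ?N"
    using q K_nonneg[OF _ x0, of 1] trint_eq_nrm(2)[OF x] by (simp add: powr_powr powr_mult)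
  then have "(C + 1) * Kf 1 x \<le> (C + 1) * (4 powr (1 / q) * ?N)" using \<iota>(2) by (intro mult_left_mono) auto
  then show ?thesis using nrm_le_K[OF x0] by (simp add: mult.assoc)
qed

lemma trace_zero: "0 \<in> carr (trace_space q X1 X0)" "nrm (trace_space q X1 X0) 0 = 0"
proof -
  have K0: "Kf t 0 = 0" if "0 < t" for t
    using K_le_X0[of t 0] K_nonneg[of t 0] that by (simp add: banach_zero nrm_zero X)
  have "trint q {0<..} 0 = (\<integral>\<^sup>+ t. 0 \<partial>(lborel :: real measure))"
    unfolding trint_def by (rule nn_integral_cong) (use K0 q in \<open>simp add: indicator_def\<close>)
  then have "trint q {0<..} 0 = 0" by simp
  then show "0 \<in> carr (trace_space q X1 X0)" "nrm (trace_space q X1 X0) 0 = 0"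
    using q by (simp_all add: trace_carr trace_nrm banach_zero X)
qed

text \<open>Needed before the topology \<open>ntop\<close> of the trace space can be expressed by
  distances; positivity of distances rests on \<open>trace_lower\<close>.\<close>

lemma trace_Metric_space: "Metric_space (carr (trace_space q X1 X0)) (ndist (trace_space q X1 X0))"
proof
  let ?T = "trace_space q X1 X0"
  show "0 \<le> ndist ?T x y" for x y by (auto simp: ndist_def trint_eq_nrm(2) trace_diff)
  show "ndist ?T x y = ndist ?T y x" for x y
    using trace_minus(2)[OF trace_diff, of x y] by (auto simp: ndist_def)
  show "ndist ?T x y = 0 \<longleftrightarrow> x = y" if "x \<in> carr ?T" "y \<in> carr ?T" for x y
  proof
    assume "ndist ?T x y = 0"
    then have "nrm X0 (x - y) \<le> 0" using trace_lower[OF trace_diff[OF that]] that by (simp add: ndist_def)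
    moreover have "x - y \<in> carr X0" using that by (simp add: trace_carr banach_diff X)
    ultimately show "x = y" using nrm_nonneg[OF X(1), of "x - y"] nrm_eq_0[OF X(1), of "x - y"] by simp
  qed (use that trace_zero in \<open>simp add: ndist_def\<close>)
  show "ndist ?T x z \<le> ndist ?T x y + ndist ?T y z" if "x \<in> carr ?T" "y \<in> carr ?T" "z \<in> carr ?T" for x y z
    using that trace_triangle(2)[OF trace_diff trace_diff, of x y y z] by (simp add: ndist_def)
qed

end

end

section \<open>Hardy's inequality and majorants\<close>

lemma nn_integral_powr_Ioo:
  fixes c e :: real
  assumes "-1 < e" "0 \<le> c"
  shows "(\<integral>\<^sup>+ x. ennreal (x powr e) * indicator {0<..<c} x \<partial>lborel) = ennreal (c powr (e + 1) / (e + 1))"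
proof -
  have "(\<integral>\<^sup>+ x. ennreal (x powr e) * indicator {0<..<c} x \<partial>lborel) = (\<integral>\<^sup>+ x. indicator {0..c} x * ennreal (x powr e) \<partial>lborel)"
  proof (rule nn_integral_cong_AE)
    show "AE x in lborel. ennreal (x powr e) * indicator {0<..<c} x = indicator {0..c} x * ennreal (x powr e)"
      using AE_lborel_singleton[of 0] AE_lborel_singleton[of c]
      by eventually_elim (auto simp: indicator_def)
  qed
  also have "\<dots> = ennreal (c powr (e + 1) / (e + 1))"
  proof -
    have "((\<lambda>x. if x \<in> {0..c} then x powr e else 0) has_integral (c powr (e + 1) / (e + 1))) UNIV"
      unfolding has_integral_restrict_UNIV by (rule has_integral_powr_from_0[OF assms])
    then have "(\<integral>\<^sup>+ x. ennreal (if x \<in> {0..c} then x powr e else 0) \<partial>lborel) = ennreal (c powr (e + 1) / (e + 1))"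
      by (rule nn_integral_has_integral_lborel[rotated 2]) auto
    moreover have "(\<lambda>x. indicator {0..c} x * ennreal (x powr e)) = (\<lambda>x. ennreal (if x \<in> {0..c} then x powr e else 0))"
      by (auto simp: indicator_def fun_eq_iff)
    ultimately show ?thesis by simp
  qed
  finally show ?thesis .
qed

text \<open>Hardy's inequality after the substitution of \<open>1/t\<close> for the length of the interval of
  integration; the weight \<open>r powr ((q - 1) / 2)\<close> replaces Hoelder's inequality.\<close>

lemma Hardy_inequality:
  fixes \<gamma> k :: "real \<Rightarrow> real"
  assumes q: "1 < q" and \<gamma>[measurable]: "\<gamma> \<in> borel_measurable borel" and \<gamma>0: "\<And>r. 0 \<le> \<gamma> r"
    and k: "\<And>t. 0 < t \<Longrightarrow> 0 \<le> k t"
      "\<And>t. 0 < t \<Longrightarrow> ennreal (k t) \<le> (\<integral>\<^sup>+ r. ennreal (\<gamma> r) * indicator {0<..<1 / t} r \<partial>lborel)"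
  shows "(\<integral>\<^sup>+ t. ennreal (t powr (q - 2) * k t powr q) * indicator {0<..} t \<partial>lborel)
    \<le> ennreal (3 powr q * (2 / (q - 1))) * (\<integral>\<^sup>+ r. ennreal (\<gamma> r powr q) * indicator {0<..} r \<partial>lborel)"
proof -
  define d where "d = (q - 1) / 2"
  have d: "0 < d" using q by (simp add: d_def)
  define P where "P t = (\<integral>\<^sup>+ r. ennreal (r powr d * \<gamma> r powr q) * indicator {0<..<1 / t} r \<partial>lborel)" for t
  \<comment> \<open>The weight \<open>l * r powr (- 1 / 2)\<close> is integrable at 0, with integral
    \<open>2 * l * (1 / t) powr (1 / 2)\<close> over \<open>(0, 1/t)\<close>; the parameter
    \<open>l\<close> is optimised in \<open>point\<close>.\<close>
  have young: "k t \<le> 2 * l * (1 / t) powr (1 / 2) + l powr (1 - q) * p"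
    if t: "0 < t" and p: "0 \<le> p" "P t = ennreal p" and l: "0 < l" for t l p
  proof -
    let ?i = "indicator {0<..<1 / t} :: real \<Rightarrow> ennreal"
    have "ennreal (k t) \<le> (\<integral>\<^sup>+ r. ennreal (\<gamma> r) * ?i r \<partial>lborel)" by (rule k(2)[OF t])
    also have "\<dots> \<le> (\<integral>\<^sup>+ r. ennreal l * (ennreal (r powr (- 1 / 2)) * ?i r) +
        ennreal (l powr (1 - q)) * (ennreal (r powr d * \<gamma> r powr q) * ?i r) \<partial>lborel)"
    proof (rule nn_integral_mono)
      fix r :: real
      show "ennreal (\<gamma> r) * ?i r \<le> ennreal l * (ennreal (r powr (- 1 / 2)) * ?i r) +
        ennreal (l powr (1 - q)) * (ennreal (r powr d * \<gamma> r powr q) * ?i r)"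
      proof (cases "0 < r \<and> r < 1 / t")
        case True
        then have "\<gamma> r \<le> l * r powr (- 1 / 2) + (l * r powr (- 1 / 2)) powr (1 - q) * \<gamma> r powr q"
          using q l \<gamma>0 by (intro le_power_weighted) auto
        also have "(l * r powr (- 1 / 2)) powr (1 - q) = l powr (1 - q) * r powr d"
          using True l by (simp add: powr_mult powr_powr d_def) (simp add: algebra_simps diff_divide_distrib)
        finally have "ennreal (\<gamma> r) \<le> ennreal (l * r powr (- 1 / 2) + l powr (1 - q) * (r powr d * \<gamma> r powr q))"
          by (intro ennreal_leI) (simp add: mult.assoc)
        then show ?thesis using True l by (simp add: ennreal_mult[symmetric] flip: ennreal_plus)
      qed (auto simp: indicator_def)
    qed
    also have "\<dots> = ennreal l * ennreal ((1 / t) powr (1 / 2) / (1 / 2)) + ennreal (l powr (1 - q)) * P t"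
      unfolding P_def using nn_integral_powr_Ioo[of "- 1 / 2" "1 / t"] t
      by (simp add: nn_integral_add nn_integral_cmult)
    also have "\<dots> = ennreal (2 * l * (1 / t) powr (1 / 2) + l powr (1 - q) * p)"
      unfolding p(2) using l p(1) by (simp add: ennreal_mult[symmetric] mult_ac flip: ennreal_plus)
    finally have "ennreal (k t) \<le> ennreal (2 * l * (1 / t) powr (1 / 2) + l powr (1 - q) * p)" .
    then show ?thesis by (rule ennreal_le_iff[THEN iffD1, rotated]) (use l p(1) t in \<open>simp add: add_nonneg_nonneg\<close>)
  qed
  have point: "k t powr q \<le> 3 powr q * (p * (1 / t) powr d)"
    if t: "0 < t" and p: "0 \<le> p" "P t = ennreal p" for t p
  proof (rule field_le_epsilon)
    fix e :: real assume e: "0 < e"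
    define s where "s = (1 / t) powr (1 / 2)"
    have s: "0 < s" using t by (simp add: s_def)
    have sd: "s powr (q - 1) = (1 / t) powr d" using t by (simp add: s_def powr_powr d_def)
    \<comment> \<open>Slightly above \<open>p\<close>, to be positive; the increment is scaled to
      become \<open>e\<close> in the final bound.\<close>
    define p' where "p' = p + e / (3 powr q * s powr (q - 1))"
    have p': "0 < p'" "p \<le> p'" using p e s by (auto simp: p'_def add_nonneg_pos)
    \<comment> \<open>Balances the two terms: \<open>l powr (1 - q) * p'\<close> becomes
      \<open>l * s\<close>, so their sum is \<open>3 * l * s\<close>.\<close>
    define l where "l = (p' / s) powr (1 / q)"
    have l: "0 < l" "l powr q = p' / s" using p' s q by (simp_all add: l_def powr_powr)
    have "l powr (1 - q) * p' = l * s"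
    proof -
      have "l powr (1 - q) = l / l powr q" using l(1) by (simp add: powr_diff)
      then show ?thesis using l p' s by simp
    qed
    then have "k t \<le> 2 * l * s + l * s"
      using young[OF t p l(1)] mult_left_mono[OF p'(2), of "l powr (1 - q)"] by (simp add: s_def)
    then have "k t powr q \<le> (3 * l * s) powr q" using k(1)[OF t] q by (intro powr_mono2) auto
    also have "\<dots> = 3 powr q * (p' * s powr (q - 1))"
      using l s p' by (simp add: powr_mult l(2) powr_diff)
    also have "\<dots> = 3 powr q * (p * s powr (q - 1)) + e"
      using s by (simp add: p'_def field_simps)
    finally show "k t powr q \<le> 3 powr q * (p * (1 / t) powr d) + e" by (simp add: sd)
  qed
  have "(\<integral>\<^sup>+ t. ennreal (t powr (q - 2) * k t powr q) * indicator {0<..} t \<partial>lborel)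
      \<le> (\<integral>\<^sup>+ t. ennreal (3 powr q) * (\<integral>\<^sup>+ r. ennreal (t powr (d - 1)) * ennreal (r powr d * \<gamma> r powr q) *
          (if 0 < t \<and> 0 < r \<and> r * t < 1 then 1 else 0) \<partial>lborel) \<partial>lborel)"
  proof (rule nn_integral_mono)
    fix t :: real
    show "ennreal (t powr (q - 2) * k t powr q) * indicator {0<..} t \<le>
      ennreal (3 powr q) * (\<integral>\<^sup>+ r. ennreal (t powr (d - 1)) * ennreal (r powr d * \<gamma> r powr q) *
          (if 0 < t \<and> 0 < r \<and> r * t < 1 then 1 else 0) \<partial>lborel)"
    proof (cases "0 < t")
      case t: True
      have "(\<integral>\<^sup>+ r. ennreal (t powr (d - 1)) * ennreal (r powr d * \<gamma> r powr q) *
          (if 0 < t \<and> 0 < r \<and> r * t < 1 then 1 else 0) \<partial>lborel) =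
          (\<integral>\<^sup>+ r. ennreal (t powr (d - 1)) * (ennreal (r powr d * \<gamma> r powr q) * indicator {0<..<1 / t} r) \<partial>lborel)"
        by (rule nn_integral_cong) (use t in \<open>auto simp: indicator_def pos_less_divide_eq\<close>)
      also have "\<dots> = ennreal (t powr (d - 1)) * P t" unfolding P_def by (rule nn_integral_cmult) measurable
      finally have eq: "(\<integral>\<^sup>+ r. ennreal (t powr (d - 1)) * ennreal (r powr d * \<gamma> r powr q) *
          (if 0 < t \<and> 0 < r \<and> r * t < 1 then 1 else 0) \<partial>lborel) = ennreal (t powr (d - 1)) * P t" .
      show ?thesis
      proof (cases "P t")
        case (real p)
        have "t powr (q - 2) * k t powr q \<le> t powr (q - 2) * (3 powr q * (p * (1 / t) powr d))"
          by (rule mult_left_mono[OF point[OF t real]]) simp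
        also have "\<dots> = 3 powr q * ((t powr (q - 2) * t powr - d) * p)"
          using t by (simp add: powr_divide powr_minus_divide)
        \<comment> \<open>Here q - 2 - d = d - 1, because d is half of q - 1.\<close>
        also have "t powr (q - 2) * t powr - d = t powr (d - 1)"
          by (simp add: powr_add[symmetric] d_def) (simp add: field_simps)
        finally have "ennreal (t powr (q - 2) * k t powr q) \<le> ennreal (3 powr q * (t powr (d - 1) * p))"
          by (rule ennreal_leI)
        then show ?thesis unfolding eq real(2) using t real(1) by (simp add: ennreal_mult)
      next
        case top
        then show ?thesis unfolding eq using t by (simp add: ennreal_mult_top)
      qed
    qed simp
  qed
  also have "\<dots> = ennreal (3 powr q) * (\<integral>\<^sup>+ t. \<integral>\<^sup>+ r. ennreal (t powr (d - 1)) * ennreal (r powr d * \<gamma> r powr q) *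
          (if 0 < t \<and> 0 < r \<and> r * t < 1 then 1 else 0) \<partial>lborel \<partial>lborel)"
    by (rule nn_integral_cmult) measurable
  also have "(\<integral>\<^sup>+ t. \<integral>\<^sup>+ r. ennreal (t powr (d - 1)) * ennreal (r powr d * \<gamma> r powr q) *
          (if 0 < t \<and> 0 < r \<and> r * t < 1 then 1 else 0) \<partial>lborel \<partial>lborel) =
      (\<integral>\<^sup>+ r. \<integral>\<^sup>+ t. ennreal (t powr (d - 1)) * ennreal (r powr d * \<gamma> r powr q) *
          (if 0 < t \<and> 0 < r \<and> r * t < 1 then 1 else 0) \<partial>lborel \<partial>lborel)"
    \<comment> \<open>After the exchange the integral of \<open>t powr (d - 1)\<close> over
      \<open>(0, 1/r)\<close> is \<open>(1 / r) powr d / d\<close>; it cancels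
      \<open>r powr d\<close> and leaves the constant 1/d = 2/(q - 1).\<close>
    by (rule lborel_pair.Fubini'[symmetric]) measurable
  also have "\<dots> = (\<integral>\<^sup>+ r. ennreal (2 / (q - 1)) * (ennreal (\<gamma> r powr q) * indicator {0<..} r) \<partial>lborel)"
  proof (rule nn_integral_cong)
    fix r :: real
    show "(\<integral>\<^sup>+ t. ennreal (t powr (d - 1)) * ennreal (r powr d * \<gamma> r powr q) *
          (if 0 < t \<and> 0 < r \<and> r * t < 1 then 1 else 0) \<partial>lborel)
        = ennreal (2 / (q - 1)) * (ennreal (\<gamma> r powr q) * indicator {0<..} r)"
    proof (cases "0 < r")
      case r: True
      have "(\<integral>\<^sup>+ t. ennreal (t powr (d - 1)) * ennreal (r powr d * \<gamma> r powr q) *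
          (if 0 < t \<and> 0 < r \<and> r * t < 1 then 1 else 0) \<partial>lborel) =
        (\<integral>\<^sup>+ t. ennreal (r powr d * \<gamma> r powr q) * (ennreal (t powr (d - 1)) * indicator {0<..<1 / r} t) \<partial>lborel)"
        by (rule nn_integral_cong) (use r in \<open>auto simp: indicator_def pos_less_divide_eq mult.commute\<close>)
      also have "\<dots> = ennreal (r powr d * \<gamma> r powr q) * ennreal ((1 / r) powr (d - 1 + 1) / (d - 1 + 1))"
        using nn_integral_powr_Ioo[of "d - 1" "1 / r"] r d by (simp add: nn_integral_cmult)
      also have "\<dots> = ennreal (r powr d * \<gamma> r powr q * ((1 / r) powr d / d))"
        using d by (simp add: ennreal_mult[symmetric])
      also have "r powr d * \<gamma> r powr q * ((1 / r) powr d / d) = 2 / (q - 1) * \<gamma> r powr q"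
        using r by (simp add: powr_divide d_def)
      also have "ennreal (2 / (q - 1) * \<gamma> r powr q) = ennreal (2 / (q - 1)) * ennreal (\<gamma> r powr q)"
        using q by (intro ennreal_mult) auto
      finally show ?thesis using r by (simp only: greaterThan_iff indicator_simps mult_1_right)
    qed simp
  qed
  also have "\<dots> = ennreal (2 / (q - 1)) * (\<integral>\<^sup>+ r. ennreal (\<gamma> r powr q) * indicator {0<..} r \<partial>lborel)"
    by (rule nn_integral_cmult) measurable
  moreover have "ennreal (3 powr q * (2 / (q - 1))) = ennreal (3 powr q) * ennreal (2 / (q - 1))"
    using q by (intro ennreal_mult) auto
  ultimately show ?thesis by (simp only: mult.assoc)
qed

text \<open>The sum of the two norms is only Lebesgue measurable, while Hardy's inequality uses
  Fubini and substitution for Borel functions; a Borel version equal almost everywhere has the same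
  integrals.\<close>

lemma Lq_borel_majorant:
  fixes f :: "real \<Rightarrow> 'b::real_normed_vector" and g :: "real \<Rightarrow> 'c::real_normed_vector"
  assumes f: "smeas (leb_Ioo a b) f" "qint (leb_Ioo a b) q f < \<infinity>"
    and g: "smeas (leb_Ioo a b) g" "qint (leb_Ioo a b) q g < \<infinity>" and q: "1 \<le> q"
  obtains \<gamma> :: "real \<Rightarrow> real" where "\<gamma> \<in> borel_measurable borel" "\<And>r. 0 \<le> \<gamma> r"
    "(\<integral>\<^sup>+ r. ennreal (\<gamma> r powr q) \<partial>lborel) < \<infinity>"
    "\<And>c d. a \<le> c \<Longrightarrow> d \<le> b \<Longrightarrow> qint (leb_Ioo c d) 1 f + qint (leb_Ioo c d) 1 g =
      (\<integral>\<^sup>+ r. ennreal (\<gamma> r) * indicator {c<..<d} r \<partial>lborel)"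
proof -
  let ?f = "\<lambda>r. indicator {a<..<b} r *\<^sub>R f r" and ?g = "\<lambda>r. indicator {a<..<b} r *\<^sub>R g r"
  have fg: "smeas lebesgue ?f" "smeas lebesgue ?g" using f g by (simp_all add: smeas_leb_Ioo_iff)
  note [measurable] = completion.smeas_norm_measurable[OF fg(1)] completion.smeas_norm_measurable[OF fg(2)]
  have "(\<lambda>r. norm (?f r) + norm (?g r)) \<in> borel_measurable lebesgue" by measurable
  then obtain h where [measurable]: "h \<in> borel_measurable lborel" and h: "AE r in lborel. norm (?f r) + norm (?g r) = h r"
    using completion_ex_borel_measurable_real by blast
  define \<gamma> where "\<gamma> r = max 0 (h r)" for r
  have \<gamma>m [measurable]: "\<gamma> \<in> borel_measurable borel" unfolding \<gamma>_def by measurable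
  have ae: "AE r in lebesgue. \<gamma> r = norm (?f r) + norm (?g r)"
  proof (rule AE_completion, use h in eventually_elim)
    fix r assume e: "norm (?f r) + norm (?g r) = h r"
    have "0 \<le> h r" unfolding e[symmetric] by (intro add_nonneg_nonneg norm_ge_zero)
    then show "\<gamma> r = norm (?f r) + norm (?g r)" unfolding e by (simp add: \<gamma>_def)
  qed
  show ?thesis
  proof (rule that[OF \<gamma>m])
    show "0 \<le> \<gamma> r" for r by (simp add: \<gamma>_def)
    have "(\<integral>\<^sup>+ r. ennreal (\<gamma> r powr q) \<partial>lborel) = (\<integral>\<^sup>+ r. ennreal (\<gamma> r powr q) \<partial>lebesgue)"
      by (rule nn_integral_completion[symmetric]) measurable
    also have "\<dots> \<le> (\<integral>\<^sup>+ r. ennreal (2 powr q) * (ennreal (norm (?f r) powr q) + ennreal (norm (?g r) powr q)) \<partial>lebesgue)"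
    proof (rule nn_integral_mono_AE, use ae in eventually_elim)
      fix r assume r: "\<gamma> r = norm (?f r) + norm (?g r)"
      have "\<gamma> r powr q \<le> (1 + 1) powr (q - 1) * (1 powr (1 - q) * norm (?f r) powr q + 1 powr (1 - q) * norm (?g r) powr q)"
        unfolding r using q by (intro powr_add_weighted) auto
      also have "\<dots> \<le> 2 powr q * (norm (?f r) powr q + norm (?g r) powr q)"
        using q by (auto intro!: mult_right_mono powr_mono)
      finally show "ennreal (\<gamma> r powr q) \<le> ennreal (2 powr q) * (ennreal (norm (?f r) powr q) + ennreal (norm (?g r) powr q))"
        by (simp add: ennreal_mult[symmetric] ennreal_leI flip: ennreal_plus)
    qed
    also have "\<dots> = ennreal (2 powr q) * (qint (leb_Ioo a b) q f + qint (leb_Ioo a b) q g)"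
      unfolding qint_leb_Ioo_eq unfolding qint_def by (simp add: nn_integral_cmult nn_integral_add del: norm_scaleR)
    also have "\<dots> < \<infinity>" using f(2) g(2) by (simp add: ennreal_mult_less_top)
    finally show "(\<integral>\<^sup>+ r. ennreal (\<gamma> r powr q) \<partial>lborel) < \<infinity>" .
    fix c d assume cd: "a \<le> c" "d \<le> b"
    have sub: "smeas lebesgue (\<lambda>r. indicator {c<..<d} r *\<^sub>R f r)" "smeas lebesgue (\<lambda>r. indicator {c<..<d} r *\<^sub>R g r)"
      using smeas_leb_Ioo_subset[OF f(1) cd] smeas_leb_Ioo_subset[OF g(1) cd] by (simp_all add: smeas_leb_Ioo_iff)
    note [measurable] = completion.smeas_norm_measurable[OF sub(1)] completion.smeas_norm_measurable[OF sub(2)]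
    have "qint (leb_Ioo c d) 1 f + qint (leb_Ioo c d) 1 g =
        (\<integral>\<^sup>+ r. ennreal (norm (indicator {c<..<d} r *\<^sub>R f r)) + ennreal (norm (indicator {c<..<d} r *\<^sub>R g r)) \<partial>lebesgue)"
      unfolding qint_leb_Ioo_eq unfolding qint_1 by (subst nn_integral_add) (auto simp del: norm_scaleR)
    also have "\<dots> = (\<integral>\<^sup>+ r. ennreal (\<gamma> r) * indicator {c<..<d} r \<partial>lebesgue)"
      by (rule nn_integral_cong_AE, use ae in eventually_elim) (use cd in \<open>auto simp: indicator_def ennreal_plus\<close>)
    also have "\<dots> = (\<integral>\<^sup>+ r. ennreal (\<gamma> r) * indicator {c<..<d} r \<partial>lborel)"
      by (rule nn_integral_completion) measurable
    finally show "qint (leb_Ioo c d) 1 f + qint (leb_Ioo c d) 1 g = \<dots>" .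
  qed
qed

text \<open>Absolute continuity of the integral: the part of \<open>g\<close> above a high level
  \<open>n\<close> has small integral, and the rest contributes at most \<open>n\<close> times the
  length, wherever the interval lies.\<close>

lemma nn_integral_Ioo_uniformly_small:
  fixes g :: "real \<Rightarrow> real"
  assumes g[measurable]: "g \<in> borel_measurable borel" and g0: "\<And>r. 0 \<le> g r"
    and fin: "(\<integral>\<^sup>+ r. ennreal (g r) \<partial>lborel) < \<infinity>" and e: "0 < e"
  obtains \<eta>0 where "0 < \<eta>0"
    "\<And>p \<eta>. 0 < \<eta> \<Longrightarrow> \<eta> \<le> \<eta>0 \<Longrightarrow> (\<integral>\<^sup>+ r. ennreal (g r) * indicator {p - \<eta><..<p + \<eta>} r \<partial>lborel) \<le> ennreal e"
proof -
  have "(\<lambda>n. \<integral>\<^sup>+ r. ennreal (g r) * indicator {r. real n < g r} r \<partial>lborel) \<longlonglongrightarrow> (\<integral>\<^sup>+ r. 0 \<partial>(lborel :: real measure))"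
  proof (rule nn_integral_dominated_convergence[where w = "\<lambda>r. ennreal (g r)"])
    show "AE r in lborel. (\<lambda>n. ennreal (g r) * indicator {r. real n < g r} r) \<longlonglongrightarrow> 0"
    proof (rule AE_I2)
      fix r
      obtain N where "g r \<le> real N" using real_arch_simple by blast
      then have "\<forall>\<^sub>F n in sequentially. ennreal (g r) * indicator {r. real n < g r} r = 0"
        by (intro eventually_sequentiallyI[of N]) (auto simp: indicator_def)
      then show "(\<lambda>n. ennreal (g r) * indicator {r. real n < g r} r) \<longlonglongrightarrow> 0"
        by (rule tendsto_eventually)
    qed
  qed (use fin in \<open>auto simp: indicator_def\<close>)
  then have "\<forall>\<^sub>F n in sequentially. (\<integral>\<^sup>+ r. ennreal (g r) * indicator {r. real n < g r} r \<partial>lborel) < ennreal (e / 2)"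
    using e by (intro order_tendstoD(2)) auto
  then obtain n where n: "(\<integral>\<^sup>+ r. ennreal (g r) * indicator {r. real n < g r} r \<partial>lborel) < ennreal (e / 2)"
    by (auto simp: eventually_sequentially)
  \<comment> \<open>Chosen so that \<open>(n + 1) * (2 * \<eta>0)\<close> is \<open>e / 2\<close>;
    the summand 1 covers n = 0.\<close>
  define \<eta>0 where "\<eta>0 = e / (4 * (real n + 1))"
  show ?thesis
  proof (rule that)
    show "0 < \<eta>0" using e by (simp add: \<eta>0_def)
    fix p \<eta> :: real assume \<eta>: "0 < \<eta>" "\<eta> \<le> \<eta>0"
    have "(\<integral>\<^sup>+ r. ennreal (g r) * indicator {p - \<eta><..<p + \<eta>} r \<partial>lborel) \<le>
        (\<integral>\<^sup>+ r. ennreal (g r) * indicator {r. real n < g r} r + ennreal (real n) * indicator {p - \<eta><..<p + \<eta>} r \<partial>lborel)"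
      by (rule nn_integral_mono) (auto simp: indicator_def ennreal_leI not_less simp del: ennreal_of_nat_eq_real_of_nat)
    also have "\<dots> = (\<integral>\<^sup>+ r. ennreal (g r) * indicator {r. real n < g r} r \<partial>lborel) + ennreal (real n) * ennreal (2 * \<eta>)"
      using \<eta> by (subst nn_integral_add) (auto simp: nn_integral_cmult_indicator)
    also have "\<dots> \<le> ennreal (e / 2) + ennreal (e / 2)"
    proof (rule add_mono[OF less_imp_le[OF n]])
      have "real n * (2 * \<eta>) \<le> (real n + 1) * (2 * \<eta>0)" using \<eta> by (intro mult_mono) auto
      also have "\<dots> = e / 2" by (simp add: \<eta>0_def divide_simps)
      finally show "ennreal (real n) * ennreal (2 * \<eta>) \<le> ennreal (e / 2)"
        by (simp add: ennreal_mult[symmetric] ennreal_leI del: ennreal_of_nat_eq_real_of_nat) (use \<eta> in \<open>simp add: ennreal_mult[symmetric] ennreal_leI\<close>)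
    qed
    also have "\<dots> = ennreal e" using e by (simp flip: ennreal_plus)
    finally show "(\<integral>\<^sup>+ r. ennreal (g r) * indicator {p - \<eta><..<p + \<eta>} r \<partial>lborel) \<le> ennreal e" .
  qed
qed

section \<open>Head and tail of the trace norm, and the trace embedding\<close>

context
  fixes X1 X0 :: "'a::complex_vector nspace" and C :: real
  assumes X: "complex_banach X0" "complex_banach X1" and \<iota>: "bnd_lin X1 X0 C (\<lambda>x. x)" "0 \<le> C"
begin

lemma trint_split:
  assumes x: "x \<in> carr X0" and s: "0 < s"
  shows "trint X1 X0 q {0<..} x = trint X1 X0 q {0<..<s} x + trint X1 X0 q {s..} x"
proof -
  note [measurable] = trint_measurable[OF X \<iota> x]
  show ?thesis
    unfolding trint_def[OF X \<iota>]
    by (subst nn_integral_add[symmetric], simp, simp, rule nn_integral_cong) (use s in \<open>auto simp: indicator_def\<close>)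
qed

text \<open>The trivial decomposition bounds the functional by \<open>t * nrm X0 x\<close>; the
  remaining weight \<open>t powr (q - 2)\<close> is integrable at 0 because
  \<open>1 < q\<close>.\<close>

lemma trint_head:
  assumes x: "x \<in> carr X0" and q: "1 < q" and s: "0 \<le> s"
  shows "trint X1 X0 q {0<..<s} x \<le> ennreal (nrm X0 x powr q * (s powr (q - 1) / (q - 1)))"
proof -
  have "trint X1 X0 q {0<..<s} x \<le> (\<integral>\<^sup>+ t. ennreal (nrm X0 x powr q) * (ennreal (t powr (q - 2)) * indicator {0<..<s} t) \<partial>lborel)"
    unfolding trint_def[OF X \<iota>]
  proof (rule nn_integral_mono)
    fix t :: real
    show "ennreal (t powr - 2 * (if 0 < t then K_functional X1 X0 t x else 0) powr q) * indicator {0<..<s} t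
      \<le> ennreal (nrm X0 x powr q) * (ennreal (t powr (q - 2)) * indicator {0<..<s} t)"
    proof (cases "0 < t \<and> t < s")
      case True
      have "K_functional X1 X0 t x powr q \<le> (t * nrm X0 x) powr q"
        using True q by (intro powr_mono2 K_le_X0[OF X \<iota>] K_nonneg[OF X \<iota>] x) auto
      then have "t powr - 2 * K_functional X1 X0 t x powr q \<le> t powr - 2 * (t powr q * nrm X0 x powr q)"
        using True nrm_nonneg[OF X(1) x] by (intro mult_left_mono) (auto simp: powr_mult)
      also have "\<dots> = nrm X0 x powr q * t powr (q - 2)" by (simp add: powr_add[symmetric] mult.assoc[symmetric])
      finally show ?thesis using True by (simp add: ennreal_mult[symmetric] ennreal_leI)
    qed (auto simp: indicator_def)
  qed
  also have "\<dots> = ennreal (nrm X0 x powr q) * ennreal (s powr (q - 1) / (q - 1))"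
    using nn_integral_powr_Ioo[of "q - 2" s] q s by (simp add: nn_integral_cmult)
  also have "\<dots> = ennreal (nrm X0 x powr q * (s powr (q - 1) / (q - 1)))"
    by (subst ennreal_mult[symmetric]) (use q s in auto)
  finally show ?thesis .
qed

text \<open>The decomposition takes the mean of \<open>u\<close> over \<open>(c, d)\<close> as the part in \<open>X1\<close>.\<close>

lemma K_le_mean:
  assumes u: "u \<in> Lq q a b X1" and v: "v \<in> Lq q a b X0" and p: "primitive X0 a b u v" and q: "1 \<le> q"
    and cd: "a \<le> c" "c < d" "d \<le> b" and t: "t = c \<or> t = d"
  shows "ennreal ((d - c) * K_functional X1 X0 (1 / (d - c)) (u t)) \<le>
    qint (leb_Ioo c d) 1 (\<lambda>r. binj X1 (u r)) + qint (leb_Ioo c d) 1 (\<lambda>r. binj X0 (v r))"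
proof -
  let ?L = "d - c"
  have L: "0 < ?L" using cd by simp
  note u' = Lq_subinterval[OF X(2) u cd(1,3)] and v' = Lq_subinterval[OF X(1) v cd(1,3)]
  note ui = Lq_integrable_on[OF X(2) u' q] and vi = Lq_integrable_on[OF X(1) v' q]
  have uc: "u r \<in> carr X0" if "r \<in> {c..d}" for r using primitive_carr[OF p] that cd by auto
  have ut: "u t \<in> carr X0" using uc t cd by auto
  obtain x where x: "x \<in> carr X1" "((\<lambda>r. binj X1 (u r)) has_integral binj X1 x) {c..d}"
    using integral_in_carr[OF X(2) ui(3)] by blast
  have x0: "x \<in> carr X0" by (rule incl_carr[OF X \<iota> x(1)])
  have N1: "ennreal (nrm X1 x) \<le> qint (leb_Ioo c d) 1 (\<lambda>r. binj X1 (u r))"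
    using L1_norm_integral_le[OF ui(1,2) order_refl] integral_unique[OF x(2)] norm_binj[OF X(2) x(1)] by simp
  define e where "e = enn2real (qint (leb_Ioo c d) 1 (\<lambda>r. binj X0 (v r)))"
  have e: "0 \<le> e" "ennreal e = qint (leb_Ioo c d) 1 (\<lambda>r. binj X0 (v r))"
    using vi(2) by (auto simp: e_def)
  have "((\<lambda>r. lift_op X1 X0 (\<lambda>x. x) (binj X1 (u r))) has_integral lift_op X1 X0 (\<lambda>x. x) (binj X1 x)) {c..d}"
    using has_integral_linear[OF x(2) lift_op_bounded(3)[OF X(2,1) \<iota>]] by (simp add: o_def)
  then have "((\<lambda>r. binj X0 (u r)) has_integral lift_op X1 X0 (\<lambda>x. x) (binj X1 x)) {c..d}"
  proof (rule has_integral_cong_AE)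
    have "AE r in leb_Ioo c d. u r \<in> carr X1" using u' by (simp add: Lq_iff[OF X(2)])
    then show "AE r in leb_Ioo c d. lift_op X1 X0 (\<lambda>x. x) (binj X1 (u r)) = binj X0 (u r)"
      by eventually_elim (simp add: lift_op_binj X)
  qed
  then have "((\<lambda>r. binj X0 (u r)) has_integral binj X0 x) (cbox c d)"
    by (simp add: lift_op_binj X x(1))
  \<comment> \<open>The remainder \<open>u t\<close> minus the mean, times \<open>d - c\<close>, is
    the integral of the increments \<open>u t - u r\<close>, each bounded by the L^1 norm of
    \<open>v\<close> over \<open>(c, d)\<close>.\<close>
  from has_integral_diff[OF has_integral_const this, of "binj X0 (u t)"]
  have I: "((\<lambda>r. binj X0 (u t) - binj X0 (u r)) has_integral ?L *\<^sub>R binj X0 (u t) - binj X0 x) (cbox c d)"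
    using cd by simp
  have bound: "norm (binj X0 (u t) - binj X0 (u r)) \<le> e" if r: "r \<in> cbox c d" for r
  proof -
    have *: "norm (binj X0 (u r2) - binj X0 (u r1)) \<le> e" if "c \<le> r1" "r1 \<le> r2" "r2 \<le> d" for r1 r2
    proof -
      have "((\<lambda>r. binj X0 (v r)) has_integral binj X0 (u r2) - binj X0 (u r1)) {r1..r2}"
        by (rule primitive_has_integral[OF p]) (use that cd in auto)
      then have "ennreal (norm (binj X0 (u r2) - binj X0 (u r1))) \<le> ennreal e"
        using L1_norm_integral_le[OF vi(1,2), of r1 r2] that unfolding e(2) by (simp add: integral_unique)
      then show ?thesis using e(1) by simp
    qed
    show ?thesis using t *[of c r] *[of r d] r by (auto simp: norm_minus_commute)
  qed
  let ?y = "u t - (1 / ?L) *\<^sub>R x"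
  have y: "?y \<in> carr X0" using ut x0 by (simp add: banach_diff banach_scaleR X)
  have "norm (?L *\<^sub>R binj X0 (u t) - binj X0 x) \<le> e * ?L"
    using has_integral_bound[OF e(1) I bound] cd by simp
  moreover have "?L *\<^sub>R binj X0 (u t) - binj X0 x = ?L *\<^sub>R binj X0 ?y"
    using L ut x0 by (simp add: binj_diff binj_scaleR banach_scaleR X scaleR_diff_right)
  ultimately have "?L * nrm X0 ?y \<le> ?L * e" using L y by (simp add: norm_binj X mult.commute)
  then have ny: "nrm X0 ?y \<le> e" using L by simp
  have "K_functional X1 X0 (1 / ?L) (u t) \<le> nrm X1 ((1 / ?L) *\<^sub>R x) + 1 / ?L * nrm X0 ?y"
    by (rule K_le[OF X \<iota>]) (use L x y in \<open>auto simp: banach_scaleR X\<close>)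
  also have "\<dots> = (nrm X1 x + nrm X0 ?y) / ?L" using L x by (simp add: nrm_scaleR X add_divide_distrib)
  finally have "?L * K_functional X1 X0 (1 / ?L) (u t) \<le> nrm X1 x + nrm X0 ?y"
    using L by (simp add: pos_le_divide_eq mult.commute)
  also have "\<dots> \<le> nrm X1 x + e" using ny by simp
  finally have "ennreal (?L * K_functional X1 X0 (1 / ?L) (u t)) \<le> ennreal (nrm X1 x + e)" by (rule ennreal_leI)
  also have "\<dots> = ennreal (nrm X1 x) + ennreal e" using e(1) nrm_nonneg[OF X(2) x(1)] by (rule ennreal_plus[rotated])
  finally show ?thesis using add_mono[OF N1 order_refl[of "ennreal e"]] unfolding e(2) by (rule order_trans)
qed

end

context
  fixes X1 X0 :: "'a::complex_vector nspace" and C :: real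
  assumes X: "complex_banach X0" "complex_banach X1" and \<iota>: "bnd_lin X1 X0 C (\<lambda>x. x)" "0 \<le> C"
begin

text \<open>The sign \<open>\<sigma>\<close> tells whether the intervals start or end at
  \<open>p\<close>. The substitution \<open>p + \<sigma> * r\<close> turns both cases into intervals
  \<open>(0, h)\<close>, and \<open>h = 1 / t\<close> brings the tail into the form of Hardy's
  inequality.\<close>

lemma trint_tail_oriented:
  assumes q: "1 < q" and \<eta>: "0 < \<eta>" and x: "x \<in> carr X0" and \<sigma>: "\<sigma> = 1 \<or> \<sigma> = - 1"
    and \<gamma>[measurable]: "\<gamma> \<in> borel_measurable borel" and \<gamma>0: "\<And>r. 0 \<le> \<gamma> r"
    and K: "\<And>h. 0 < h \<Longrightarrow> h \<le> \<eta> \<Longrightarrow> ennreal (h * K_functional X1 X0 (1 / h) x) \<le>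
      (\<integral>\<^sup>+ r. ennreal (\<gamma> r) * indicator {min p (p + \<sigma> * h)<..<max p (p + \<sigma> * h)} r \<partial>lborel)"
  shows "trint X1 X0 q {1 / \<eta>..} x \<le> ennreal (3 powr q * (2 / (q - 1))) *
    (\<integral>\<^sup>+ r. ennreal (\<gamma> r powr q) * indicator {p - \<eta><..<p + \<eta>} r \<partial>lborel)"
proof -
  have \<sigma>1: "\<sigma> \<noteq> 0" "\<bar>\<sigma>\<bar> = 1" using \<sigma> by auto
  have subst: "(\<integral>\<^sup>+ r. f r \<partial>lborel) = (\<integral>\<^sup>+ r. f (p + \<sigma> * r) \<partial>lborel)"
    if "f \<in> borel_measurable borel" for f :: "real \<Rightarrow> ennreal"
    using nn_integral_real_affine[of f \<sigma> p] that \<sigma>1 by simp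
  \<comment> \<open>The majorant is cut off at distance \<open>\<eta>\<close> and the functional
    below \<open>1 / \<eta>\<close>: the decomposition is only available for lengths up to
    \<open>\<eta>\<close>.\<close>
  define g where "g r = \<gamma> (p + \<sigma> * r) * indicator {0<..<\<eta>} r" for r
  define k where "k t = (if 1 / \<eta> \<le> t then K_functional X1 X0 t x / t else 0)" for t
  have gm: "g \<in> borel_measurable borel" unfolding g_def by measurable
  have g0: "0 \<le> g r" for r unfolding g_def using \<gamma>0 by simp
  have k0: "0 \<le> k t" if "0 < t" for t using that K_nonneg[OF X \<iota> _ x, of t] by (simp add: k_def)
  have kg: "ennreal (k t) \<le> (\<integral>\<^sup>+ r. ennreal (g r) * indicator {0<..<1 / t} r \<partial>lborel)" if t: "0 < t" for t
  proof (cases "1 / \<eta> \<le> t")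
    case True
    define h where "h = 1 / t"
    have h: "0 < h" "h \<le> \<eta>" unfolding h_def using True t \<eta> by (auto simp: field_simps)
    have "ennreal (k t) \<le> (\<integral>\<^sup>+ r. ennreal (\<gamma> r) * indicator {min p (p + \<sigma> * h)<..<max p (p + \<sigma> * h)} r \<partial>lborel)"
      using K[OF h] True by (simp add: k_def h_def)
    also have "\<dots> = (\<integral>\<^sup>+ r. ennreal (\<gamma> (p + \<sigma> * r)) *
        indicator {min p (p + \<sigma> * h)<..<max p (p + \<sigma> * h)} (p + \<sigma> * r) \<partial>lborel)"
      by (rule subst) measurable
    also have "\<dots> = (\<integral>\<^sup>+ r. ennreal (g r) * indicator {0<..<h} r \<partial>lborel)"
      by (rule nn_integral_cong) (use \<sigma> h in \<open>auto simp: g_def indicator_def min_def max_def\<close>)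
    finally show ?thesis unfolding h_def .
  qed (simp add: k_def)
  have "trint X1 X0 q {1 / \<eta>..} x \<le> (\<integral>\<^sup>+ t. ennreal (t powr (q - 2) * k t powr q) * indicator {0<..} t \<partial>lborel)"
    unfolding trint_def[OF X \<iota>]
  proof (rule nn_integral_mono)
    fix t :: real
    show "ennreal (t powr - 2 * (if 0 < t then K_functional X1 X0 t x else 0) powr q) * indicator {1 / \<eta>..} t
      \<le> ennreal (t powr (q - 2) * k t powr q) * indicator {0<..} t"
    proof (cases "1 / \<eta> \<le> t")
      case True
      then have t: "0 < t" using \<eta> by (meson divide_pos_pos less_le_trans zero_less_one)
      have "t powr (q - 2) * (K_functional X1 X0 t x / t) powr q = t powr - 2 * K_functional X1 X0 t x powr q"
        using t K_nonneg[OF X \<iota> _ x, of t] by (simp add: powr_divide powr_diff powr_minus divide_simps)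
      then show ?thesis using True t by (simp add: k_def)
    qed simp
  qed
  also have "\<dots> \<le> ennreal (3 powr q * (2 / (q - 1))) * (\<integral>\<^sup>+ r. ennreal (g r powr q) * indicator {0<..} r \<partial>lborel)"
    by (rule Hardy_inequality[OF q gm g0 k0 kg])
  also have "(\<integral>\<^sup>+ r. ennreal (g r powr q) * indicator {0<..} r \<partial>lborel) \<le>
      (\<integral>\<^sup>+ r. ennreal (\<gamma> (p + \<sigma> * r) powr q) * indicator {p - \<eta><..<p + \<eta>} (p + \<sigma> * r) \<partial>lborel)"
    by (rule nn_integral_mono) (use \<sigma> q in \<open>auto simp: g_def indicator_def\<close>)
  also have "\<dots> = (\<integral>\<^sup>+ r. ennreal (\<gamma> r powr q) * indicator {p - \<eta><..<p + \<eta>} r \<partial>lborel)"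
    by (rule subst[symmetric]) measurable
  finally show ?thesis by (simp add: mult_left_mono)
qed

text \<open>Uniformity in \<open>t\<close> is what continuity needs. It holds because the tail at
  \<open>t\<close> is controlled by the integral of one fixed function over a window around
  \<open>t\<close>.\<close>

lemma trint_tail_uniform:
  assumes u: "u \<in> Lq q a b X1" and v: "v \<in> Lq q a b X0" and p: "primitive X0 a b u v"
    and q: "1 < q" and ab: "a < b" and e: "0 < e"
  obtains \<eta> where "0 < \<eta>" "\<And>t. t \<in> {a..b} \<Longrightarrow> trint X1 X0 q {1 / \<eta>..} (u t) \<le> ennreal e"
proof -
  have q1: "1 \<le> q" using q by simp
  obtain \<gamma> where \<gamma>: "\<gamma> \<in> borel_measurable borel" "\<And>r. 0 \<le> \<gamma> r" "(\<integral>\<^sup>+ r. ennreal (\<gamma> r powr q) \<partial>lborel) < \<infinity>"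
    and maj: "\<And>c d. a \<le> c \<Longrightarrow> d \<le> b \<Longrightarrow> qint (leb_Ioo c d) 1 (\<lambda>r. binj X1 (u r)) + qint (leb_Ioo c d) 1 (\<lambda>r. binj X0 (v r)) =
      (\<integral>\<^sup>+ r. ennreal (\<gamma> r) * indicator {c<..<d} r \<partial>lborel)"
    using Lq_borel_majorant[of a b "\<lambda>r. binj X1 (u r)" q "\<lambda>r. binj X0 (v r)"] u v q1 X by (auto simp: Lq_iff)
  define H where "H = 3 powr q * (2 / (q - 1))"
  have H: "0 < H" using q by (simp add: H_def)
  have \<gamma>q: "(\<lambda>r. \<gamma> r powr q) \<in> borel_measurable borel" using \<gamma>(1) by measurable
  obtain \<eta>0 where \<eta>0: "0 < \<eta>0" "\<And>p \<eta>. 0 < \<eta> \<Longrightarrow> \<eta> \<le> \<eta>0 \<Longrightarrow>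
      (\<integral>\<^sup>+ r. ennreal (\<gamma> r powr q) * indicator {p - \<eta><..<p + \<eta>} r \<partial>lborel) \<le> ennreal (e / H)"
    using nn_integral_Ioo_uniformly_small[OF \<gamma>q _ \<gamma>(3), of "e / H"] e H by auto
  \<comment> \<open>At most half the length of \<open>{a..b}\<close>, so that at each
    \<open>t\<close> an interval of length \<open>\<eta>\<close> fits on at least one side.\<close>
  define \<eta> where "\<eta> = min \<eta>0 ((b - a) / 2)"
  have \<eta>: "0 < \<eta>" "\<eta> \<le> \<eta>0" "\<eta> \<le> (b - a) / 2"
    unfolding \<eta>_def using \<eta>0(1) ab by (simp_all only: min.cobounded1 min.cobounded2 min_less_iff_conj) simp
  show ?thesis
  proof (rule that[OF \<eta>(1)])
    fix t assume t: "t \<in> {a..b}"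
    have ut: "u t \<in> carr X0" using p t by (rule primitive_carr)
    define \<sigma> :: real where "\<sigma> = (if t + \<eta> \<le> b then 1 else - 1)"
    have \<sigma>: "\<sigma> = 1 \<or> \<sigma> = - 1" by (simp add: \<sigma>_def)
    have "trint X1 X0 q {1 / \<eta>..} (u t) \<le> ennreal H *
        (\<integral>\<^sup>+ r. ennreal (\<gamma> r powr q) * indicator {t - \<eta><..<t + \<eta>} r \<partial>lborel)"
      unfolding H_def
    proof (rule trint_tail_oriented[OF q \<eta>(1) ut \<sigma> \<gamma>(1,2)])
      fix h assume h: "0 < h" "h \<le> \<eta>"
      let ?c = "min t (t + \<sigma> * h)" and ?d = "max t (t + \<sigma> * h)"
      have cd: "a \<le> ?c" "?c < ?d" "?d \<le> b" "t = ?c \<or> t = ?d" and dc: "?d - ?c = h"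
        using h \<eta>(3) t by (auto simp: \<sigma>_def)
      show "ennreal (h * K_functional X1 X0 (1 / h) (u t)) \<le> (\<integral>\<^sup>+ r. ennreal (\<gamma> r) * indicator {?c<..<?d} r \<partial>lborel)"
        using K_le_mean[OF X \<iota> u v p q1 cd] unfolding dc maj[OF cd(1,3)] .
    qed
    also have "\<dots> \<le> ennreal H * ennreal (e / H)" by (intro mult_left_mono \<eta>0(2) \<eta>) auto
    also have "\<dots> = ennreal e" using H e by (simp add: ennreal_mult[symmetric])
    finally show "trint X1 X0 q {1 / \<eta>..} (u t) \<le> ennreal e" .
  qed
qed

text \<open>The head of the norm of \<open>u s - u t\<close> is small by continuity in
  \<open>X0\<close>, the tail uniformly by \<open>trint_tail_uniform\<close>; \<open>\<eta>\<close>
  is fixed first, then \<open>s\<close> is brought close to \<open>t\<close>.\<close>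

theorem trace_embedding:
  assumes u: "u \<in> Lq q a b X1" and v: "v \<in> Lq q a b X0" and p: "primitive X0 a b u v"
    and q: "1 < q" and ab: "a < b"
  shows "continuous_map (top_of_set {a..b}) (ntop (trace_space q X1 X0)) u"
proof -
  let ?T = "trace_space q X1 X0"
  interpret M: Metric_space "carr ?T" "ndist ?T" by (rule trace_Metric_space[OF X \<iota> q])
  have u0: "u t \<in> carr X0" if "t \<in> {a..b}" for t using p that by (rule primitive_carr)
  have uT: "u t \<in> carr ?T" if t: "t \<in> {a..b}" for t
  proof -
    obtain \<eta> where \<eta>: "0 < \<eta>" "trint X1 X0 q {1 / \<eta>..} (u t) \<le> ennreal 1"
      using trint_tail_uniform[OF u v p q ab zero_less_one] t by metis
    have "trint X1 X0 q {0<..} (u t) \<le> ennreal (nrm X0 (u t) powr q * ((1 / \<eta>) powr (q - 1) / (q - 1))) + ennreal 1"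
      unfolding trint_split[OF X \<iota> u0[OF t], of "1 / \<eta>"]
    proof (subst trint_split[OF X \<iota> u0[OF t], of "1 / \<eta>"])
    qed (use \<eta> trint_head[OF X \<iota> u0[OF t] q, of "1 / \<eta>"] in \<open>auto intro!: add_mono\<close>)
    also have "\<dots> < \<infinity>" by simp
    finally show ?thesis using u0[OF t] by (simp add: trace_carr[OF X \<iota> q])
  qed
  have "limitin M.mtopology u (u t) (at t within {a..b})" if t: "t \<in> {a..b}" for t
    unfolding M.limitin_metric
  proof (intro conjI allI impI uT t)
    fix e :: real assume e: "0 < e"
    \<comment> \<open>The tails of \<open>u s\<close> and \<open>u t\<close> together give
      \<open>2 powr (q - 1) * (2 * e')\<close>, which is \<open>e powr q / 3\<close>; with the head,
      two thirds of \<open>e powr q\<close> are spent.\<close>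
    define e' where "e' = e powr q / 3 / 2 powr (q - 1) / 2"
    have e': "0 < e'" using e by (simp add: e'_def)
    obtain \<eta> where \<eta>: "0 < \<eta>" "\<And>t. t \<in> {a..b} \<Longrightarrow> trint X1 X0 q {1 / \<eta>..} (u t) \<le> ennreal e'"
      using trint_tail_uniform[OF u v p q ab e'] by blast
    let ?h = "\<lambda>s. norm (binj X0 (u s) - binj X0 (u t)) powr q * ((1 / \<eta>) powr (q - 1) / (q - 1))"
    have cont: "((\<lambda>s. binj X0 (u s)) \<longlongrightarrow> binj X0 (u t)) (at t within {a..b})"
      using primitive_continuous_on[OF p] t by (simp add: continuous_on_def)
    have "((\<lambda>s. norm (binj X0 (u s) - binj X0 (u t))) \<longlongrightarrow> 0) (at t within {a..b})"
      by (rule tendsto_norm_zero[OF LIM_zero[OF cont]])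
    then have "((\<lambda>s. norm (binj X0 (u s) - binj X0 (u t)) powr q) \<longlongrightarrow> 0) (at t within {a..b})"
      using q by (intro tendsto_zero_powrI[OF _ tendsto_const]) auto
    then have "(?h \<longlongrightarrow> 0) (at t within {a..b})" by (rule tendsto_mult_left_zero)
    then have "\<forall>\<^sub>F s in at t within {a..b}. ?h s < e powr q / 3"
      using e by (intro order_tendstoD(2)) auto
    moreover have "\<forall>\<^sub>F s in at t within {a..b}. s \<in> {a..b}" by (simp add: eventually_at_filter)
    ultimately show "\<forall>\<^sub>F s in at t within {a..b}. u s \<in> carr ?T \<and> ndist ?T (u s) (u t) < e"
    proof eventually_elim
      case (elim s)
      let ?x = "u s - u t"
      have us: "u s \<in> carr ?T" "u s \<in> carr X0" and ut: "u t \<in> carr ?T" "u t \<in> carr X0" using uT u0 elim(2) t by auto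
      have x: "?x \<in> carr X0" "?x \<in> carr ?T" using us ut by (simp_all add: banach_diff X trace_diff[OF X \<iota> q])
      have n: "norm (binj X0 (u s) - binj X0 (u t)) = nrm X0 ?x"
        using us ut x by (simp add: binj_diff[symmetric] norm_binj X)
      have "trint X1 X0 q {1 / \<eta>..} (u s + - u t) \<le> ennreal ((1 + 1) powr (q - 1)) *
          (ennreal (1 powr (1 - q)) * trint X1 X0 q {1 / \<eta>..} (u s) + ennreal (1 powr (1 - q)) * trint X1 X0 q {1 / \<eta>..} (- u t))"
        by (rule trint_add[OF X \<iota>]) (use us ut q in \<open>auto simp: banach_minus X\<close>)
      also have "\<dots> \<le> ennreal (2 powr (q - 1)) * (ennreal e' + ennreal e')"
        using \<eta>(2)[OF elim(2)] \<eta>(2)[OF t] by (auto simp: trint_minus[OF X \<iota> ut(2)] intro!: mult_left_mono add_mono)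
      also have "\<dots> = ennreal (e powr q / 3)"
        using e' by (simp add: ennreal_mult[symmetric] flip: ennreal_plus) (simp add: e'_def)
      finally have tail: "trint X1 X0 q {1 / \<eta>..} ?x \<le> ennreal (e powr q / 3)" by simp
      have head: "trint X1 X0 q {0<..<1 / \<eta>} ?x \<le> ennreal (e powr q / 3)"
        using order_trans[OF trint_head[OF X \<iota> x(1) q, of "1 / \<eta>"] ennreal_leI[OF less_imp_le[OF elim(1)[unfolded n]]]] \<eta>(1) by simp
      have "ennreal (nrm ?T ?x powr q) = trint X1 X0 q {0<..<1 / \<eta>} ?x + trint X1 X0 q {1 / \<eta>..} ?x"
        using trint_split[OF X \<iota> x(1), of "1 / \<eta>" q] \<eta>(1) trint_eq_nrm(1)[OF X \<iota> q x(2)] by simp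
      also have "\<dots> \<le> ennreal (e powr q / 3) + ennreal (e powr q / 3)" by (rule add_mono[OF head tail])
      also have "\<dots> < ennreal (e powr q)" using e by (simp add: ennreal_less_iff flip: ennreal_plus)
      finally have "nrm ?T ?x powr q < e powr q" by (simp add: ennreal_less_iff)
      then have "nrm ?T ?x < e" using e q powr_mono2[of q e "nrm ?T ?x"] by fastforce
      then show ?case using us ut by (simp add: ndist_def)
    qed
  qed
  then show ?thesis
    unfolding ntop_def continuous_map_atin using uT
    by (auto simp: limitin_def atin_subtopology_within atin_within_euclidean)
qed

end

subsection \<open>Gain of regularity\<close>

lemma op_continuous_onD:
  assumes X: "complex_banach X" and Y: "complex_banach Y" and B: "op_continuous_on a b X Y B"
    and t: "t \<in> {a..b}" and e: "0 < e"
  obtains \<delta> where "0 < \<delta>" "\<And>r. r \<in> {a..b} \<Longrightarrow> \<bar>r - t\<bar> < \<delta> \<Longrightarrow> opnorm X Y (\<lambda>x. B r x - B t x) < e"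
proof -
  have "\<forall>\<^sub>F r in at t within {a..b}. opnorm X Y (\<lambda>x. B r x - B t x) < e"
    using B t e unfolding op_continuous_on_def by (intro order_tendstoD(2)[of _ 0]) auto
  then obtain \<delta> where \<delta>: "0 < \<delta>"
    "\<And>r. r \<in> {a..b} \<Longrightarrow> r \<noteq> t \<Longrightarrow> dist r t < \<delta> \<Longrightarrow> opnorm X Y (\<lambda>x. B r x - B t x) < e"
    unfolding eventually_at by blast
  \<comment> \<open>The limit says nothing about the point \<open>t\<close> itself; there the
    difference is zero and its operator norm an infimum over all nonnegative constants.\<close>
  have "opnorm X Y (\<lambda>x. B t x - B t x) = Inf {0..}"
    unfolding opnorm_def by (rule arg_cong[where f = Inf]) (auto simp: nrm_zero Y nrm_nonneg X)
  then have "opnorm X Y (\<lambda>x. B t x - B t x) < e" using e by simp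
  with \<delta> show ?thesis by (intro that[of \<delta>]) (metis dist_real_def)+
qed

lemma op_continuous_on_compose:
  assumes X: "complex_banach X" and Y: "complex_banach Y" and B: "op_continuous_on a b X Y B"
    and \<phi>: "continuous_on {c..d} \<phi>" "\<And>t. t \<in> {c..d} \<Longrightarrow> \<phi> t \<in> {a..b}"
  shows "op_continuous_on c d X Y (\<lambda>t. B (\<phi> t))"
  unfolding op_continuous_on_def
proof (intro conjI ballI)
  fix t assume t: "t \<in> {c..d}"
  show "bounded_op X Y (B (\<phi> t))" using B \<phi>(2)[OF t] unfolding op_continuous_on_def by blast
  show "((\<lambda>r. opnorm X Y (\<lambda>x. B (\<phi> r) x - B (\<phi> t) x)) \<longlongrightarrow> 0) (at t within {c..d})"
    unfolding tendsto_iff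
  proof (intro allI impI)
    fix e :: real assume e: "0 < e"
    obtain \<delta> where \<delta>: "0 < \<delta>"
      "\<And>r. r \<in> {a..b} \<Longrightarrow> \<bar>r - \<phi> t\<bar> < \<delta> \<Longrightarrow> opnorm X Y (\<lambda>x. B r x - B (\<phi> t) x) < e"
      by (rule op_continuous_onD[OF X Y B \<phi>(2)[OF t] e]) blast
    have "\<forall>\<^sub>F r in at t within {c..d}. dist (\<phi> r) (\<phi> t) < \<delta>"
      using \<phi>(1) t \<delta>(1) unfolding continuous_on_def by (blast intro: tendstoD)
    moreover have "\<forall>\<^sub>F r in at t within {c..d}. r \<in> {c..d}" by (simp add: eventually_at_filter)
    ultimately show "\<forall>\<^sub>F r in at t within {c..d}. dist (opnorm X Y (\<lambda>x. B (\<phi> r) x - B (\<phi> t) x)) 0 < e"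
    proof eventually_elim
      case (elim r)
      obtain C D where "0 \<le> C" "0 \<le> D" "bnd_lin X Y C (B (\<phi> r))" "bnd_lin X Y D (B (\<phi> t))"
        using op_continuous_bnd_lin[OF X B \<phi>(2)[OF t]] op_continuous_bnd_lin[OF X B \<phi>(2)[OF elim(2)]] by blast
      then have "0 \<le> opnorm X Y (\<lambda>x. B (\<phi> r) x - B (\<phi> t) x)"
        by (intro opnorm_nonneg[OF bnd_lin_diff[OF Y]]) auto
      then show ?case using \<delta>(2)[OF \<phi>(2)[OF elim(2)]] elim(1) by (simp add: dist_real_def)
    qed
  qed
qed

text \<open>The time change \<open>\<phi>\<close> allows shifted and clamped times: all that matters
  is that the operators used stay close to the one at \<open>s\<close>.\<close>

lemma max_reg_near:
  fixes X1 X0 :: "'a::complex_vector nspace"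
  assumes X: "complex_banach X0" "complex_banach X1" and q: "1 \<le> q"
    and \<iota>: "bnd_lin X1 X0 C (\<lambda>x. x)" "0 \<le> C" and \<tau>: "0 < \<tau>"
    and B: "op_continuous_on a b X1 X0 B" and s: "s \<in> {a..b}" and mr: "max_reg_on q \<tau> X1 X0 (B s)"
  obtains \<delta> where "0 < \<delta>"
    "\<And>\<phi> f. continuous_on {0..\<tau>} \<phi> \<Longrightarrow> (\<And>t. t \<in> {0..\<tau>} \<Longrightarrow> \<phi> t \<in> {a..b} \<and> \<bar>\<phi> t - s\<bar> < \<delta>) \<Longrightarrow>
      f \<in> Lq q 0 \<tau> X0 \<Longrightarrow> \<exists>w v. solves q \<tau> X1 X0 (\<lambda>t. B (\<phi> t)) f w v"
    "\<And>\<phi> w v t. continuous_on {0..\<tau>} \<phi> \<Longrightarrow> (\<And>t. t \<in> {0..\<tau>} \<Longrightarrow> \<phi> t \<in> {a..b} \<and> \<bar>\<phi> t - s\<bar> < \<delta>) \<Longrightarrow>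
      solves q \<tau> X1 X0 (\<lambda>t. B (\<phi> t)) (\<lambda>_. 0) w v \<Longrightarrow> t \<in> {0..\<tau>} \<Longrightarrow> w t = 0"
proof -
  obtain D where D: "0 \<le> D" "bnd_lin X1 X0 D (B s)" using op_continuous_bnd_lin[OF X(2) B s] by blast
  obtain \<kappa> where \<kappa>: "0 < \<kappa>"
    and ex: "\<And>B' f. op_continuous_on 0 \<tau> X1 X0 B' \<Longrightarrow>
      (\<And>t x. t \<in> {0..\<tau>} \<Longrightarrow> x \<in> carr X1 \<Longrightarrow> nrm X0 (B s x - B' t x) \<le> \<kappa> * nrm X1 x) \<Longrightarrow>
      f \<in> Lq q 0 \<tau> X0 \<Longrightarrow> \<exists>w v. solves q \<tau> X1 X0 B' f w v"
    and un: "\<And>B' w v t. op_continuous_on 0 \<tau> X1 X0 B' \<Longrightarrow>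
      (\<And>t x. t \<in> {0..\<tau>} \<Longrightarrow> x \<in> carr X1 \<Longrightarrow> nrm X0 (B s x - B' t x) \<le> \<kappa> * nrm X1 x) \<Longrightarrow>
      solves q \<tau> X1 X0 B' (\<lambda>_. 0) w v \<Longrightarrow> t \<in> {0..\<tau>} \<Longrightarrow> w t = 0"
    by (rule max_reg_perturbation[OF X q \<iota> \<tau> D(2,1) mr]) blast
  obtain \<delta> where \<delta>: "0 < \<delta>"
    "\<And>r. r \<in> {a..b} \<Longrightarrow> \<bar>r - s\<bar> < \<delta> \<Longrightarrow> opnorm X1 X0 (\<lambda>x. B r x - B s x) < \<kappa>"
    by (rule op_continuous_onD[OF X(2,1) B s \<kappa>]) blast
  have near: "nrm X0 (B s x - B r x) \<le> \<kappa> * nrm X1 x" if r: "r \<in> {a..b}" "\<bar>r - s\<bar> < \<delta>" and x: "x \<in> carr X1" for r x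
  proof -
    obtain E where E: "0 \<le> E" "bnd_lin X1 X0 E (B r)" using op_continuous_bnd_lin[OF X(2) B r(1)] by blast
    have "nrm X0 (B s x - B r x) = nrm X0 (B r x - B s x)"
      using bnd_linD(1)[OF E(2) x] bnd_linD(1)[OF D(2) x] by (simp add: nrm_diff_commute X)
    also have "\<dots> \<le> opnorm X1 X0 (\<lambda>x. B r x - B s x) * nrm X1 x"
      using opnorm_bound[OF X(2,1) bnd_lin_diff[OF X(1) E(2) D(2)] _ x] E D by simp
    also have "\<dots> \<le> \<kappa> * nrm X1 x"
      using \<delta>(2)[OF r] by (intro mult_right_mono nrm_nonneg[OF X(2) x]) auto
    finally show ?thesis .
  qed
  show ?thesis
  proof (rule that[OF \<delta>(1)])
    fix \<phi> f assume \<phi>: "continuous_on {0..\<tau>} \<phi>" "\<And>t. t \<in> {0..\<tau>} \<Longrightarrow> \<phi> t \<in> {a..b} \<and> \<bar>\<phi> t - s\<bar> < \<delta>"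
      and f: "f \<in> Lq q 0 \<tau> X0"
    show "\<exists>w v. solves q \<tau> X1 X0 (\<lambda>t. B (\<phi> t)) f w v"
      by (rule ex[OF op_continuous_on_compose[OF X(2,1) B] near f]) (use \<phi> in auto)
  next
    fix \<phi> w v t assume \<phi>: "continuous_on {0..\<tau>} \<phi>" "\<And>t. t \<in> {0..\<tau>} \<Longrightarrow> \<phi> t \<in> {a..b} \<and> \<bar>\<phi> t - s\<bar> < \<delta>"
      and w: "solves q \<tau> X1 X0 (\<lambda>t. B (\<phi> t)) (\<lambda>_. 0) w v" and t: "t \<in> {0..\<tau>}"
    show "w t = 0"
      by (rule un[OF op_continuous_on_compose[OF X(2,1) B] near w t]) (use \<phi> in auto)
  qed
qed

lemma primitive_diff:
  assumes X: "complex_banach X" and p: "primitive X a b u v" and p': "primitive X a b u' v'"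
    and v: "AE t in leb_Ioo a b. v t \<in> carr X" "AE t in leb_Ioo a b. v' t \<in> carr X"
  shows "primitive X a b (\<lambda>t. u t - u' t) (\<lambda>t. v t - v' t)"
  unfolding primitive_def
proof (intro ballI conjI)
  fix t assume t: "t \<in> {a..b}"
  then have c: "u t \<in> carr X" "u' t \<in> carr X" "u a \<in> carr X" "u' a \<in> carr X"
    using primitive_carr[OF p] primitive_carr[OF p'] by auto
  show "u t - u' t \<in> carr X" using c by (simp add: banach_diff X)
  have I: "((\<lambda>r. binj X (v r) - binj X (v' r)) has_integral
      (binj X (u t) - binj X (u a)) - (binj X (u' t) - binj X (u' a))) {a..t}"
    by (intro has_integral_diff primitive_has_integral[OF p] primitive_has_integral[OF p']) (use t in auto)
  have "AE r in leb_Ioo a b. binj X (v r) - binj X (v' r) = binj X (v r - v' r)"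
    using v by eventually_elim (simp add: binj_diff X)
  then have "AE r in leb_Ioo a t. binj X (v r) - binj X (v' r) = binj X (v r - v' r)"
    by (rule AE_leb_Ioo_subset) (use t in auto)
  from has_integral_cong_AE[OF I this]
  show "((\<lambda>r. binj X (v r - v' r)) has_integral binj X (u t - u' t) - binj X (u a - u' a)) {a..t}"
    using c by (simp add: binj_diff X algebra_simps)
qed

text \<open>Existence in the smaller couple and uniqueness in the larger one: both solutions, extended
  by zero to the left, solve the same problem on \<open>(0, \<tau>)\<close>.\<close>

lemma local_regularity:
  fixes X1 X0 Y1 Y0 :: "'a::complex_vector nspace"
  assumes X: "complex_banach X0" "complex_banach X1" and Y: "complex_banach Y0" "complex_banach Y1"
    and q: "1 \<le> q" and \<iota>X: "bnd_lin X1 X0 CX (\<lambda>x. x)" "0 \<le> CX" and \<iota>Y: "bnd_lin Y1 Y0 CY (\<lambda>x. x)" "0 \<le> CY"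
    and \<iota>0: "bnd_lin Y0 X0 C0 (\<lambda>x. x)" "0 \<le> C0" and \<iota>1: "bnd_lin Y1 X1 C1 (\<lambda>x. x)" "0 \<le> C1"
    and BX: "op_continuous_on a b X1 X0 B" and BY: "op_continuous_on a b Y1 Y0 B" and s: "s \<in> {a..b}"
    and mX: "maximal_regularity q X1 X0 (B s)" and mY: "maximal_regularity q Y1 Y0 (B s)"
  obtains \<delta> where "0 < \<delta>"
    "\<And>c d w v f. a \<le> c \<Longrightarrow> s - \<delta> \<le> c \<Longrightarrow> c < d \<Longrightarrow> d \<le> b \<Longrightarrow> d \<le> s + \<delta> \<Longrightarrow>
      w \<in> Lq q c d X1 \<Longrightarrow> v \<in> Lq q c d X0 \<Longrightarrow> primitive X0 c d w v \<Longrightarrow> w c = 0 \<Longrightarrow>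
      AE t in leb_Ioo c d. v t + B t (w t) = f t \<Longrightarrow> f \<in> Lq q c d Y0 \<Longrightarrow>
      w \<in> Lq q c d Y1 \<and> v \<in> Lq q c d Y0"
proof -
  have q0: "0 \<le> q" "0 < q" using q by auto
  have lin: "linear_op X1 X0 (B s)" "linear_op Y1 Y0 (B s)"
    using mX mY by (auto simp: maximal_regularity_def bounded_op_def)
  obtain \<tau>0 \<tau>1 where \<tau>01: "0 < \<tau>0" "max_reg_on q \<tau>0 X1 X0 (B s)" "0 < \<tau>1" "max_reg_on q \<tau>1 Y1 Y0 (B s)"
    using maximal_regularity_max_reg_on[OF X q mX] maximal_regularity_max_reg_on[OF Y q mY] by blast
  \<comment> \<open>Existence and uniqueness belong to different couples and come with different
    lengths; both are shrunk to a common one.\<close>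
  define \<tau> where "\<tau> = min \<tau>0 \<tau>1"
  have \<tau>: "0 < \<tau>" using \<tau>01 by (simp add: \<tau>_def)
  have mr: "max_reg_on q \<tau> X1 X0 (B s)" "max_reg_on q \<tau> Y1 Y0 (B s)"
    by (rule max_reg_on_shrink[OF X q lin(1) \<tau>01(2) \<tau>], simp add: \<tau>_def)
       (rule max_reg_on_shrink[OF Y q lin(2) \<tau>01(4) \<tau>], simp add: \<tau>_def)
  obtain \<delta>X where \<delta>X: "0 < \<delta>X"
    and unX: "\<And>\<phi> w v t. continuous_on {0..\<tau>} \<phi> \<Longrightarrow> (\<And>t. t \<in> {0..\<tau>} \<Longrightarrow> \<phi> t \<in> {a..b} \<and> \<bar>\<phi> t - s\<bar> < \<delta>X) \<Longrightarrow>
      solves q \<tau> X1 X0 (\<lambda>t. B (\<phi> t)) (\<lambda>_. 0) w v \<Longrightarrow> t \<in> {0..\<tau>} \<Longrightarrow> w t = 0"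
    by (rule max_reg_near[OF X q \<iota>X \<tau> BX s mr(1)]) blast
  obtain \<delta>Y where \<delta>Y: "0 < \<delta>Y"
    and exY: "\<And>\<phi> f. continuous_on {0..\<tau>} \<phi> \<Longrightarrow> (\<And>t. t \<in> {0..\<tau>} \<Longrightarrow> \<phi> t \<in> {a..b} \<and> \<bar>\<phi> t - s\<bar> < \<delta>Y) \<Longrightarrow>
      f \<in> Lq q 0 \<tau> Y0 \<Longrightarrow> \<exists>w v. solves q \<tau> Y1 Y0 (\<lambda>t. B (\<phi> t)) f w v"
    by (rule max_reg_near[OF Y q \<iota>Y \<tau> BY s mr(2)]) blast
  \<comment> \<open>An interval within \<open>\<delta>\<close> of \<open>s\<close> has length at
    most \<open>2 * \<delta>\<close>, hence fits into \<open>(0, \<tau>)\<close> after a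
    delay.\<close>
  define \<delta> where "\<delta> = min (min \<delta>X \<delta>Y) \<tau> / 2"
  have \<delta>: "0 < \<delta>" "\<delta> < \<delta>X" "\<delta> < \<delta>Y" "2 * \<delta> \<le> \<tau>" using \<delta>X \<delta>Y \<tau> by (auto simp: \<delta>_def)
  show ?thesis
  proof (rule that[OF \<delta>(1)])
    fix c d w v f
    assume cd: "a \<le> c" "s - \<delta> \<le> c" "c < d" "d \<le> b" "d \<le> s + \<delta>"
      and w: "w \<in> Lq q c d X1" and v: "v \<in> Lq q c d X0" and p: "primitive X0 c d w v" and wc: "w c = 0"
      and eq: "AE t in leb_Ioo c d. v t + B t (w t) = f t" and f: "f \<in> Lq q c d Y0"
    define h where "h = \<tau> - (d - c)"
    have h: "0 \<le> h" "h + d - c = \<tau>" using cd \<delta> by (auto simp: h_def)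
    have cd': "c \<le> d" using cd by simp
    \<comment> \<open>During the waiting time before \<open>h\<close> the operator is frozen at time
      \<open>c\<close>; the delayed \<open>w\<close> is zero there, so the equation is
      unaffected.\<close>
    define \<phi> where "\<phi> t = max c (min d (c - h + t))" for t
    have \<phi>: "continuous_on {0..\<tau>} \<phi>" unfolding \<phi>_def by (intro continuous_intros)
    have \<phi>r: "\<phi> t \<in> {a..b}" "\<bar>\<phi> t - s\<bar> \<le> \<delta>" for t using cd by (auto simp: \<phi>_def)
    let ?w = "delay h c w" and ?v = "delay h c v" and ?f = "delay h c f"
    note D = Lq_delay[OF _ _ h(1) cd' q0(2), unfolded h(2)]
    have W: "?w \<in> Lq q 0 \<tau> X1" "?v \<in> Lq q 0 \<tau> X0" "?f \<in> Lq q 0 \<tau> Y0"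
      by (rule D[OF X(2) w], rule D[OF X(1) v], rule D[OF Y(1) f])
    have pW: "primitive X0 0 \<tau> ?w ?v" using primitive_delay[OF X(1) p h(1) wc cd'] unfolding h(2) .
    have "AE t in leb_Ioo c d. v t + B t (w t) - f t = 0" using eq by eventually_elim simp
    then have "AE t in leb_Ioo 0 (h + d - c). delay h c (\<lambda>t. v t + B t (w t) - f t) t = 0"
      by (rule AE_delay) simp
    moreover have "AE t in leb_Ioo 0 \<tau>. t \<in> {0<..<\<tau>}" by (rule AE_leb_Ioo_I) simp
    ultimately have eqW: "AE t in leb_Ioo 0 \<tau>. ?v t + B (\<phi> t) (?w t) = ?f t"
      unfolding h(2)
    proof eventually_elim
      case (elim t)
      have "B (\<phi> t) 0 = 0"
        using BX \<phi>r(1)[of t] linear_op_0[OF X(2)] unfolding op_continuous_on_def bounded_op_def by blast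
      moreover have "\<phi> t = c - h + t" if "h < t" using that elim(2) h cd by (auto simp: \<phi>_def)
      ultimately show ?case using elim(1) by (auto simp: delay_def split: if_splits)
    qed
    obtain w1 v1 where s1: "solves q \<tau> Y1 Y0 (\<lambda>t. B (\<phi> t)) ?f w1 v1"
      using exY[OF \<phi> _ W(3)] \<phi>r \<delta>(3) order_le_less_trans by blast
    have w1: "w1 \<in> Lq q 0 \<tau> Y1" and v1: "v1 \<in> Lq q 0 \<tau> Y0" and p1: "primitive Y0 0 \<tau> w1 v1" and w10: "w1 0 = 0"
      and eq1: "AE t in leb_Ioo 0 \<tau>. v1 t + B (\<phi> t) (w1 t) = ?f t"
      using s1 unfolding solves_def by auto
    have w1X: "w1 \<in> Lq q 0 \<tau> X1" and v1X: "v1 \<in> Lq q 0 \<tau> X0"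
      using Lq_bnd_lin[OF Y(2) w1 X(2) q0(1) \<iota>1] Lq_bnd_lin[OF Y(1) v1 X(1) q0(1) \<iota>0] by simp_all
    have carr: "AE t in leb_Ioo 0 \<tau>. ?w t \<in> carr X1" "AE t in leb_Ioo 0 \<tau>. w1 t \<in> carr X1"
      "AE t in leb_Ioo 0 \<tau>. ?v t \<in> carr X0" "AE t in leb_Ioo 0 \<tau>. v1 t \<in> carr X0" "AE t in leb_Ioo 0 \<tau>. v1 t \<in> carr Y0"
      using W w1X v1X v1 by (simp_all add: Lq_iff X Y)
    have "primitive X0 0 \<tau> (\<lambda>t. ?w t - w1 t) (\<lambda>t. ?v t - v1 t)"
      by (rule primitive_diff[OF X(1) pW primitive_bnd_lin[OF Y(1) X(1) \<iota>0 p1 carr(5)] carr(3,4)])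
    moreover have "AE t in leb_Ioo 0 \<tau>. ?v t - v1 t + B (\<phi> t) (?w t - w1 t) = 0"
      using eqW eq1 carr(1,2)
    proof eventually_elim
      case (elim t)
      obtain E where "bnd_lin X1 X0 E (B (\<phi> t))" using op_continuous_bnd_lin[OF X(2) BX \<phi>r(1)[of t]] by blast
      then have add: "B (\<phi> t) (x + y) = B (\<phi> t) x + B (\<phi> t) y" if "x \<in> carr X1" "y \<in> carr X1" for x y
        using that unfolding bnd_lin_def by blast
      have "B (\<phi> t) (?w t) = B (\<phi> t) (?w t - w1 t) + B (\<phi> t) (w1 t)"
        using add[of "?w t - w1 t" "w1 t"] elim(3,4) by (simp add: banach_diff X)
      then have "(?v t + B (\<phi> t) (?w t - w1 t)) + B (\<phi> t) (w1 t) = v1 t + B (\<phi> t) (w1 t)"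
        using elim(1,2) by (simp add: add.assoc)
      then show ?case by (simp add: algebra_simps)
    qed
    ultimately have "solves q \<tau> X1 X0 (\<lambda>t. B (\<phi> t)) (\<lambda>_. 0) (\<lambda>t. ?w t - w1 t) (\<lambda>t. ?v t - v1 t)"
      unfolding solves_def using Lq_diff[OF X(2) W(1) w1X q0(1)] Lq_diff[OF X(1) W(2) v1X q0(1)] h(1) w10
      by (simp add: delay_def)
    from unX[OF \<phi> _ this] have ww: "?w t = w1 t" if "t \<in> {0..\<tau>}" for t
      using that \<phi>r \<delta>(2) order_le_less_trans by (metis eq_iff_diff_eq_0)
    have ww': "AE t in leb_Ioo 0 \<tau>. w1 t = ?w t" by (rule AE_leb_Ioo_I) (simp add: ww)
    then have vv': "AE t in leb_Ioo 0 \<tau>. v1 t = ?v t"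
      using eqW eq1 by eventually_elim (metis add_right_cancel)
    \<comment> \<open>Undoing the delay returns regularity on \<open>(0, \<tau>)\<close> to the
      original interval.\<close>
    have unshift: "g \<in> Lq q c d Z" if Z: "complex_banach Z" and g: "delay h c g \<in> Lq q 0 \<tau> Z" for g Z
    proof -
      have "(\<lambda>t. delay h c g (h - c + t)) \<in> Lq q (0 - (h - c)) (\<tau> - (h - c)) Z" by (rule Lq_shift[OF Z g])
      then have "(\<lambda>t. delay h c g (h - c + t)) \<in> Lq q c d Z"
        by (rule Lq_subinterval[OF Z]) (use h in auto)
      then show ?thesis by (rule Lq_cong_AE[OF Z], intro AE_leb_Ioo_I) (simp add: delay_def)
    qed
    show "w \<in> Lq q c d Y1 \<and> v \<in> Lq q c d Y0"
      using unshift[OF Y(2) Lq_cong_AE[OF Y(2) w1 ww']] unshift[OF Y(1) Lq_cong_AE[OF Y(1) v1 vv']] by blast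
  qed
qed

text \<open>The factor \<open>t - l\<close> with \<open>l\<close> to the left of \<open>s\<close> produces the zero initial value required by
  \<open>local_regularity\<close>.\<close>

theorem regularity_gain:
  fixes X1 X0 Y1 Y0 :: "'a::complex_vector nspace"
  assumes X: "complex_banach X0" "complex_banach X1" and Y: "complex_banach Y0" "complex_banach Y1"
    and q: "1 \<le> q" and \<iota>X: "bnd_lin X1 X0 CX (\<lambda>x. x)" "0 \<le> CX" and \<iota>Y: "bnd_lin Y1 Y0 CY (\<lambda>x. x)" "0 \<le> CY"
    and \<iota>0: "bnd_lin Y0 X0 C0 (\<lambda>x. x)" "0 \<le> C0" and \<iota>1: "bnd_lin Y1 X1 C1 (\<lambda>x. x)" "0 \<le> C1"
    and BX: "op_continuous_on a b X1 X0 B" and BY: "op_continuous_on a b Y1 Y0 B"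
    and mX: "\<And>s. s \<in> {a..b} \<Longrightarrow> maximal_regularity q X1 X0 (B s)"
    and mY: "\<And>s. s \<in> {a..b} \<Longrightarrow> maximal_regularity q Y1 Y0 (B s)"
    and u: "u \<in> Lq q a b X1" and uY: "u \<in> Lq q a b Y0" and v: "v \<in> Lq q a b X0" and p: "primitive X0 a b u v"
    and eq: "AE t in leb_Ioo a b. v t + B t (u t) = f t" and f: "f \<in> Lq q a b Y0"
    and c: "a < c" "c \<le> b"
  shows "u \<in> Lq q c b Y1" "v \<in> Lq q c b Y0"
proof -
  have q0: "0 \<le> q" "0 < q" using q by auto
  \<comment> \<open>Vacuous for intervals that leave \<open>{c..b}\<close>: the local condition of
    the bisection principle also asks about those.\<close>
  define P where "P s t \<longleftrightarrow> (c \<le> s \<longrightarrow> t \<le> b \<longrightarrow> u \<in> Lq q s t Y1 \<and> v \<in> Lq q s t Y0)" for s t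
  have "P c b"
  proof (rule Bolzano[OF c(2)])
    fix r s t assume "P r s" "P s t" "r \<le> s" "s \<le> t"
    then show "P r t"
      unfolding P_def using Lq_join[OF Y(2) _ _ q0(2), of u r s t] Lq_join[OF Y(1) _ _ q0(2), of v r s t] by auto
  next
    fix s assume s: "c \<le> s" "s \<le> b"
    then have s': "s \<in> {a..b}" using c by auto
    obtain \<delta>0 where \<delta>0: "0 < \<delta>0"
      and reg: "\<And>c d w v f. a \<le> c \<Longrightarrow> s - \<delta>0 \<le> c \<Longrightarrow> c < d \<Longrightarrow> d \<le> b \<Longrightarrow> d \<le> s + \<delta>0 \<Longrightarrow>
      w \<in> Lq q c d X1 \<Longrightarrow> v \<in> Lq q c d X0 \<Longrightarrow> primitive X0 c d w v \<Longrightarrow> w c = 0 \<Longrightarrow>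
      AE t in leb_Ioo c d. v t + B t (w t) = f t \<Longrightarrow> f \<in> Lq q c d Y0 \<Longrightarrow>
      w \<in> Lq q c d Y1 \<and> v \<in> Lq q c d Y0"
      by (rule local_regularity[OF X Y q \<iota>X \<iota>Y \<iota>0 \<iota>1 BX BY s' mX[OF s'] mY[OF s']]) blast
    \<comment> \<open>The bound \<open>c - a\<close> leaves room for the starting point
      \<open>l\<close> to the left of \<open>s\<close>, even when \<open>s = c\<close>.\<close>
    define \<delta> where "\<delta> = min \<delta>0 (c - a)"
    have \<delta>: "0 < \<delta>" "\<delta> \<le> \<delta>0" "\<delta> \<le> c - a" using \<delta>0 c by (auto simp: \<delta>_def)
    define l where "l = s - \<delta>"
    \<comment> \<open>Strictly between \<open>l\<close> and \<open>s\<close>: on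
      \<open>{m..d}\<close> the factor \<open>t - l\<close> can be divided out again.\<close>
    define m where "m = s - \<delta> / 2"
    define d where "d = min (s + \<delta>) b"
    have ord: "a \<le> l" "s - \<delta>0 \<le> l" "l < d" "d \<le> b" "d \<le> s + \<delta>0" "l < m" "m \<le> d"
      using \<delta> s by (auto simp: l_def m_def d_def)
    let ?w = "\<lambda>t. (t - l) *\<^sub>R u t" and ?w' = "\<lambda>t. 1 *\<^sub>R u t + (t - l) *\<^sub>R v t" and ?f = "\<lambda>t. (t - l) *\<^sub>R f t + u t"
    note sub = Lq_subinterval[OF _ _ ord(1,4)]
    have ul: "u \<in> Lq q l d X1" "u \<in> Lq q l d Y0" and vl: "v \<in> Lq q l d X0" and fl: "f \<in> Lq q l d Y0"
      using sub[OF X(2) u] sub[OF Y(1) uY] sub[OF X(1) v] sub[OF Y(1) f] by auto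
    have pl: "primitive X0 l d u v" by (rule primitive_subinterval[OF p ord(1,4)])
    have cont: "continuous_on {l..d} (\<lambda>t. t - l)" by (intro continuous_intros)
    have w: "?w \<in> Lq q l d X1" by (rule Lq_scaleR[OF X(2) ul(1) q0(1) cont])
    have pw: "primitive X0 l d ?w ?w'"
      by (rule primitive_scaleR[OF X(1) q pl vl]) (auto intro!: derivative_eq_intros)
    have w': "?w' \<in> Lq q l d X0"
      by (intro Lq_add Lq_scaleR X(1) vl q0 cont primitive_Lq[OF X(1) pl] continuous_on_const)
    have fw: "?f \<in> Lq q l d Y0" by (intro Lq_add Lq_scaleR Y(1) fl ul q0 cont)
    have uc: "AE t in leb_Ioo l d. u t \<in> carr X1" using ul by (simp add: Lq_iff X)
    have eql: "AE t in leb_Ioo l d. v t + B t (u t) = f t" by (rule AE_leb_Ioo_subset[OF eq ord(1,4)])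
    have "AE t in leb_Ioo l d. t \<in> {a..b}" by (rule AE_leb_Ioo_I) (use ord in auto)
    then have "AE t in leb_Ioo l d. ?w' t + B t (?w t) = ?f t" using uc eql
    proof eventually_elim
      case (elim t)
      obtain E where "bnd_lin X1 X0 E (B t)" using op_continuous_bnd_lin[OF X(2) BX elim(1)] by blast
      then have "B t (?w t) = (t - l) *\<^sub>R B t (u t)" using elim(2) unfolding bnd_lin_def by blast
      then show ?case by (simp add: elim(3)[symmetric] scaleR_add_right)
    qed
    then have R: "?w \<in> Lq q l d Y1" "?w' \<in> Lq q l d Y0"
      using reg[OF ord(1-5) w w' pw _ _ fw] by simp_all
    note subm = Lq_subinterval[OF _ _ less_imp_le[OF ord(6)] order_refl]
    have contm: "continuous_on {m..d} (\<lambda>t. 1 / (t - l))"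
      by (intro continuous_intros) (use ord in auto)
    have um: "u \<in> Lq q m d Y1"
      by (rule Lq_cong_AE[OF Y(2) Lq_scaleR[OF Y(2) subm[OF Y(2) R(1)] q0(1) contm]], rule AE_leb_Ioo_I)
         (use ord in simp)
    \<comment> \<open>Removing the term from the product rule leaves
      \<open>(t - l) *\<^sub>R v t\<close>, from which \<open>v\<close> is recovered.\<close>
    have "(\<lambda>t. ?w' t - u t) \<in> Lq q m d Y0"
      by (intro Lq_diff subm Y(1) R(2) ul(2) q0)
    from Lq_scaleR[OF Y(1) this q0(1) contm] have vm: "v \<in> Lq q m d Y0"
      by (rule Lq_cong_AE[OF Y(1)], intro AE_leb_Ioo_I) (use ord in simp)
    show "\<exists>e>0. \<forall>r t. r \<le> s \<and> s \<le> t \<and> t - r < e \<longrightarrow> P r t"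
    proof (intro exI[of _ "\<delta> / 2"] conjI allI impI)
      show "0 < \<delta> / 2" using \<delta> by simp
      fix r t assume rt: "r \<le> s \<and> s \<le> t \<and> t - r < \<delta> / 2"
      show "P r t"
        unfolding P_def using Lq_subinterval[OF Y(2) um, of r t] Lq_subinterval[OF Y(1) vm, of r t] rt \<delta>
        by (auto simp: m_def d_def)
    qed
  qed
  then show "u \<in> Lq q c b Y1" "v \<in> Lq q c b Y0" by (auto simp: P_def)
qed

section \<open>The inclusions of the scale and the induction over its levels\<close>

lemma bnd_lin_incl_trans:
  assumes "bnd_lin X Y C (\<lambda>x. x)" "bnd_lin Y Z D (\<lambda>x. x)" "0 \<le> D"
  shows "bnd_lin X Z (D * C) (\<lambda>x. x)"
proof -
  have "nrm Z x \<le> D * C * nrm X x" if x: "x \<in> carr X" for x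
  proof -
    have "nrm Z x \<le> D * nrm Y x" by (rule bnd_linD(2)[OF assms(2) bnd_linD(1)[OF assms(1) x]])
    also have "\<dots> \<le> D * (C * nrm X x)" by (intro mult_left_mono bnd_linD(2)[OF assms(1) x] assms(3))
    finally show ?thesis by (simp add: mult.assoc)
  qed
  then show ?thesis using bnd_linD(1)[OF assms(1)] bnd_linD(1)[OF assms(2)] by (simp add: bnd_lin_def)
qed

lemma scale_bnd_lin:
  assumes "\<And>i. complex_banach (Y i)" "\<And>i. dense_inj (Y (Suc i)) (Y i)"
  shows "\<exists>C\<ge>0. bnd_lin (Y i) (Y 0) C (\<lambda>x. x)"
proof (induction i)
  case 0
  have "bnd_lin (Y 0) (Y 0) 1 (\<lambda>x. x)" by (simp add: bnd_lin_def)
  then show ?case by (intro exI[of _ 1]) simp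
next
  case (Suc i)
  then obtain C D where "0 \<le> C" "bnd_lin (Y i) (Y 0) C (\<lambda>x. x)" "0 \<le> D" "bnd_lin (Y (Suc i)) (Y i) D (\<lambda>x. x)"
    using dense_inj_bnd_lin[OF assms(1) assms(2)[of i]] by blast
  then show ?case using bnd_lin_incl_trans[of "Y (Suc i)" "Y i" D "Y 0" C] by (intro exI[of _ "C * D"]) simp
qed

text \<open>Applied at the next level, this places \<open>Y1 i\<close> in \<open>Y0 (Suc i)\<close>,
  so that \<open>u\<close> itself may stand on the right-hand side there.\<close>

lemma dense_inj_trace_bnd_lin:
  assumes X: "complex_banach X0" "complex_banach X1" and \<iota>: "bnd_lin X1 X0 C (\<lambda>x. x)" "0 \<le> C"
    and q: "1 < q" and W: "complex_banach W" and inj: "dense_inj W (trace_space q X1 X0)"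
  shows "\<exists>D\<ge>0. bnd_lin W X0 D (\<lambda>x. x)"
proof -
  obtain E where E: "0 \<le> E" "bnd_lin W (trace_space q X1 X0) E (\<lambda>x. x)" using dense_inj_bnd_lin[OF W inj] by blast
  have "bnd_lin (trace_space q X1 X0) X0 ((C + 1) * 4 powr (1 / q)) (\<lambda>x. x)"
    using trace_lower[OF X \<iota> q] by (simp add: bnd_lin_def trace_carr[OF X \<iota> q])
  from bnd_lin_incl_trans[OF E(2) this] show ?thesis using E(1) \<iota>(2) by (intro exI[of _ "(C + 1) * 4 powr (1 / q) * E"]) simp
qed

theorem theorem3p1:
  fixes q T :: real
    and Y0 Y1 :: "nat \<Rightarrow> 'a::complex_vector nspace"
    and Z :: "'a set"
    and A :: "'a \<Rightarrow> 'a \<Rightarrow> 'a"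
    and F :: "'a \<Rightarrow> real \<Rightarrow> 'a"
    and u0 :: 'a
    and u :: "real \<Rightarrow> 'a"
  assumes q: "1 < q"
    and banach: "\<And>i. complex_banach (Y0 i)" "\<And>i. complex_banach (Y1 i)"
    and couple: "\<And>i. dense_inj (Y1 i) (Y0 i)"
    and scale: "\<And>i. dense_inj (Y0 (Suc i)) (Y0 i)" "\<And>i. dense_inj (Y1 (Suc i)) (Y1 i)"
      "\<And>i. dense_inj (Y1 i) (trace_space q (Y1 (Suc i)) (Y0 (Suc i)))"
    and Z: "Z \<subseteq> carr (trace_space q (Y1 0) (Y0 0))" "u0 \<in> Z"
    and A_linear: "\<And>v. v \<in> Z \<Longrightarrow> linear_op (Y1 0) (Y0 0) (A v)"
    \<comment> \<open>(i)\<close>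
    and T: "0 < T"
    and solution: "strong_solution q T (Y1 0) (Y0 0) (\<lambda>t. A (u t)) (\<lambda>t. F (u t) t) u0 u"
      "u ` {0..T} \<subseteq> Z"
    and unique: "\<And>w. strong_solution q T (Y1 0) (Y0 0) (\<lambda>t. A (w t)) (\<lambda>t. F (w t) t) u0 w \<Longrightarrow>
      w ` {0..T} \<subseteq> Z \<Longrightarrow> \<forall>t\<in>{0..T}. w t = u t"
    and regularity_u: "\<And>t. t \<in> {0..T} \<Longrightarrow> maximal_regularity q (Y1 0) (Y0 0) (A (u t))"
    and continuity_u: "op_continuous_on 0 T (Y1 0) (Y0 0) (\<lambda>t. A (u t))"
    \<comment> \<open>(ii)\<close>
    and regularity: "\<And>i v. v \<in> Z \<inter> carr (trace_space q (Y1 i) (Y0 i)) \<Longrightarrow>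
      maximal_regularity q (Y1 (Suc i)) (Y0 (Suc i)) (A v)"
    and continuity: "\<And>i v. v \<in> cont_into 0 T Z (trace_space q (Y1 i) (Y0 i)) \<Longrightarrow>
      op_continuous_on 0 T (Y1 (Suc i)) (Y0 (Suc i)) (\<lambda>t. A (v t))"
    \<comment> \<open>(iii)\<close>
    and forcing: "\<And>i v. v \<in> cont_into 0 T Z (trace_space q (Y1 i) (Y0 i)) \<Longrightarrow>
      (\<lambda>t. F (v t) t) \<in> Lq q 0 T (Y0 (Suc i))"
  shows "\<forall>\<epsilon>\<in>{0<..<T}. u \<in> (\<Inter>i. W1q q \<epsilon> T (Y0 i) \<inter> Lq q \<epsilon> T (Y1 i))"
proof -
  have q1: "1 \<le> q" and q0: "0 \<le> q" using q by auto
  have "\<exists>C\<ge>0. bnd_lin (Y1 i) (Y0 i) C (\<lambda>x. x)" for i by (rule dense_inj_bnd_lin[OF banach(2) couple])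
  then obtain Ci where \<iota>: "\<And>i. bnd_lin (Y1 i) (Y0 i) (Ci i) (\<lambda>x. x)" "\<And>i. 0 \<le> Ci i" by metis
  obtain C0 where \<iota>0: "\<And>i. bnd_lin (Y0 i) (Y0 0) (C0 i) (\<lambda>x. x)" "\<And>i. 0 \<le> C0 i"
    using scale_bnd_lin[of Y0, OF banach(1) scale(1)] by metis
  obtain C1 where \<iota>1: "\<And>i. bnd_lin (Y1 i) (Y1 0) (C1 i) (\<lambda>x. x)" "\<And>i. 0 \<le> C1 i"
    using scale_bnd_lin[of Y1, OF banach(2) scale(2)] by metis
  obtain v where u: "u \<in> Lq q 0 T (Y1 0)" "continuous_map (top_of_set {0..T}) (ntop (Y0 0)) u"
    and v: "v \<in> Lq q 0 T (Y0 0)" "weak_deriv 0 T (Y0 0) u v"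
    and eq: "AE t in leb_Ioo 0 T. v t + A (u t) (u t) = F (u t) t"
    using solution(1) unfolding strong_solution_def by blast
  have p: "primitive (Y0 0) 0 T u v" by (rule weak_deriv_primitive[OF banach(1) T q1 u(2) v])
  \<comment> \<open>Turns L^q information at level \<open>i\<close> into the integral relation
    there, on which both the trace embedding and the final Sobolev membership rest.\<close>
  have up: "primitive (Y0 i) a T u v"
    if a: "0 \<le> a" "a < T" and u': "u \<in> Lq q a T (Y1 i)" and v': "v \<in> Lq q a T (Y0 i)" for a i
  proof (rule primitive_upgrade[OF banach(1) banach(1) \<iota>0 q1 a(2) primitive_subinterval[OF p a(1) order_refl] v'])
    have "AE t in leb_Ioo a T. u t \<in> carr (Y1 i)" using u' by (simp add: Lq_iff[OF banach(2)])
    then show "AE t in leb_Ioo a T. u t \<in> carr (Y0 i)" by eventually_elim (rule bnd_linD(1)[OF \<iota>(1)])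
  qed
  \<comment> \<open>Stated for every left end point, since each level consumes part of the interval:
    the induction hypothesis is used at \<open>\<epsilon> / 2\<close>.\<close>
  have reg: "u \<in> Lq q \<epsilon> T (Y1 i) \<and> v \<in> Lq q \<epsilon> T (Y0 i)" if "0 < \<epsilon>" "\<epsilon> < T" for \<epsilon> i
    using that
  proof (induction i arbitrary: \<epsilon>)
    case 0
    then show ?case using Lq_subinterval[OF banach(2) u(1)] Lq_subinterval[OF banach(1) v(1)] by simp
  next
    case (Suc i)
    define a where "a = \<epsilon> / 2"
    have a: "0 < a" "0 \<le> a" "a < T" "a < \<epsilon>" using Suc.prems by (auto simp: a_def)
    have ui: "u \<in> Lq q a T (Y1 i)" and vi: "v \<in> Lq q a T (Y0 i)" using Suc.IH[OF a(1,3)] by auto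
    let ?T = "trace_space q (Y1 i) (Y0 i)"
    have cT: "continuous_map (top_of_set {a..T}) (ntop ?T) u"
      by (rule trace_embedding[OF banach \<iota> ui vi up[OF a(2,3) ui vi] q a(3)])
    have uT: "u t \<in> carr ?T" if "t \<in> {a..T}" for t
    proof -
      interpret Metric_space "carr ?T" "ndist ?T" by (rule trace_Metric_space[OF banach \<iota> q])
      show ?thesis using continuous_map_image_subset_topspace[OF cT] that by (auto simp: ntop_def)
    qed
    have cm: "continuous_on {b..T} (max a)" "max a t \<in> {a..T}" if "t \<in> {b..T}" for b t
      using that a by (auto intro!: continuous_intros)
    have "continuous_map (top_of_set {0..T}) (top_of_set {a..T}) (max a)"
      using cm[of _ 0] a T by (auto simp: continuous_map_in_subtopology intro!: continuous_intros)
    from continuous_map_compose[OF this cT]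
    have w: "(\<lambda>t. u (max a t)) \<in> cont_into 0 T Z ?T"
      using solution(2) a by (auto simp: cont_into_def o_def)
    obtain D where D: "0 \<le> D" "bnd_lin (Y1 i) (Y0 (Suc i)) D (\<lambda>x. x)"
      using dense_inj_trace_bnd_lin[OF banach \<iota> q banach(2) scale(3)] by blast
    have ae: "AE t in leb_Ioo a T. v t + A (u (max a t)) (u t) = F (u (max a t)) t"
    proof -
      have "AE t in leb_Ioo a T. t \<in> {a<..<T}" by (rule AE_leb_Ioo_I) simp
      moreover have "AE t in leb_Ioo a T. v t + A (u t) (u t) = F (u t) t"
        using eq by (rule AE_leb_Ioo_subset) (use a in auto)
      ultimately show ?thesis by eventually_elim simp
    qed
    let ?B = "\<lambda>t. A (u (max a t))" and ?f = "\<lambda>t. F (u (max a t)) t"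
    \<comment> \<open>At level 0 the operators come from (i): on \<open>{a..T}\<close> the clamped
      path is \<open>u\<close> itself.\<close>
    have B0: "op_continuous_on a T (Y1 0) (Y0 0) ?B"
      by (rule op_continuous_on_compose[OF banach(2,1) continuity_u]) (use a in \<open>auto intro!: continuous_intros\<close>)
    have B1: "op_continuous_on a T (Y1 (Suc i)) (Y0 (Suc i)) ?B"
      using op_continuous_on_compose[OF banach(2,1) continuity[OF w], of a T "\<lambda>t. t"] a by simp
    have m0: "maximal_regularity q (Y1 0) (Y0 0) (?B s)" if "s \<in> {a..T}" for s
      using regularity_u[of s] that a by (simp add: max_def)
    have m1: "maximal_regularity q (Y1 (Suc i)) (Y0 (Suc i)) (?B s)" if "s \<in> {a..T}" for s
      by (rule regularity) (use that a uT[of s] solution(2) in \<open>auto simp: max_def\<close>)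
    have f: "?f \<in> Lq q a T (Y0 (Suc i))"
      by (rule Lq_subinterval[OF banach(1) forcing[OF w] a(2) order_refl])
    have u0: "u \<in> Lq q a T (Y1 0)" and v0: "v \<in> Lq q a T (Y0 0)"
      by (rule Lq_subinterval[OF banach(2) u(1) a(2) order_refl], rule Lq_subinterval[OF banach(1) v(1) a(2) order_refl])
    \<comment> \<open>This is the requirement on \<open>u\<close> as a summand of the right-hand
      side; it uses the third injection of the scale.\<close>
    have uS: "u \<in> Lq q a T (Y0 (Suc i))" by (rule Lq_bnd_lin[OF banach(2) ui banach(1) q0 D(2,1)])
    note gain = regularity_gain[OF banach banach q1 \<iota> \<iota> \<iota>0 \<iota>1 B0 B1 m0 m1 u0 uS v0
        primitive_subinterval[OF p a(2) order_refl] ae f a(4) less_imp_le[OF Suc.prems(2)]]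
    have "u \<in> Lq q \<epsilon> T (Y1 (Suc i))" "v \<in> Lq q \<epsilon> T (Y0 (Suc i))" by (rule gain; assumption)+
    then show ?case by blast
  qed
  show ?thesis
  proof (intro ballI INT_I IntI)
    fix \<epsilon> i assume "\<epsilon> \<in> {0<..<T}"
    then have \<epsilon>: "0 \<le> \<epsilon>" "\<epsilon> < T" and ui: "u \<in> Lq q \<epsilon> T (Y1 i)" and vi: "v \<in> Lq q \<epsilon> T (Y0 i)"
      using reg[of \<epsilon> i] by auto
    note pi = up[OF \<epsilon> ui vi]
    show "u \<in> Lq q \<epsilon> T (Y1 i)" by (rule ui)
    show "u \<in> W1q q \<epsilon> T (Y0 i)"
      unfolding W1q_def using primitive_Lq[OF banach(1) pi q0] primitive_weak_deriv[OF banach(1) \<epsilon>(2) q1 pi vi] vi by blast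
  qed
qed

end
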